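(* Let $T>0$. Let $u_0\in H^{1,e}(\mathbb{R})$ or $u_0\in H^{1,\alpha}(\mathbb{R})$ (for a given $\alpha>1$), let $Y_0$ be the Lagrangian element associated with $u_0$, let $Y(t)=S_t(Y_0)=(y,U,H,q,w,h)(t)$ and let $u$ be the corresponding global conservative solution, whose graph at time $t$ is $\{(y(t,\xi),U(t,\xi)):\xi\in\mathbb{R}\}$. For $n$ let $\Delta\xi$, $R=N\Delta\xi$, $\Delta t=T/N_T$ be such that $\frac1n=\Delta\xi+\frac1R+\Delta t$, and let $Y_{0,n}\in F_{\{\Delta\xi,R\}}$ be such that $\lim_{n\to\infty}\|Y_{0,n}-Y_0\|_F=0$ and $\|Y_{0,n}\|_{F^e}\le C_0\|Y_0\|_{F^e}$ (respectively $\|Y_{0,n}\|_{F^\alpha}\le C_0\|Y_0\|_{F^\alpha}$) with $C_0$ independent of $Y_0$ and $n$. Let $Y_n(t_j)=\Phi_{j\Delta t}(Y_{0,n})=(y_n,U_n,H_n,q_n,w_n,h_n)(t_j)$, where $t_j=j\Delta t$. Then the fully discretised (Lie--Trotter splitting) scheme provides points which converge to the graph of the exact conservative solution $u(t,x)$: for all sufficiently large $n$, if $u_0\in H^{1,e}(\mathbb{R})$, $$\max_{\substack{i=-N,\dots,N-1\\ j=0,\dots,N_T}}\left|(y_n(t_j,\xi_i),U_n(t_j,\xi_i))-(y(t_j,\xi_i),U(t_j,\xi_i))\right|\le C\left(\|Y_0-Y_{0,n}\|_F+\sqrt{\Delta\xi}+e^{-R}+\Delta t\right),$$ where $C$ depends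 only on $\|u_0\|_{H^{1,e}}$ (and the fixed $T$), and, if $u_0\in H^{1,\alpha}(\mathbb{R})$, $$\max_{\substack{i=-N,\dots,N-1\\ j=0,\dots,N_T}}\left|(y_n(t_j,\xi_i),U_n(t_j,\xi_i))-(y(t_j,\xi_i),U(t_j,\xi_i))\right|\le C\left(\|Y_0-Y_{0,n}\|_F+\sqrt{\Delta\xi}+\frac1{R^{\alpha/2}}+\Delta t\right),$$ where $C$ depends only on $\|u_0\|_{H^{1,\alpha}}$ (and the fixed $T$).
   Context: Fix $\gamma\in\mathbb{R}$. All function spaces are over $\mathbb{R}$. $H^{1,e}$ and $H^{1,\alpha}$ ($\alpha>1$) are the subspaces of $H^1(\mathbb{R})$ with finite norms $\|u\|_{H^{1,e}}^2=\|e^{|x|/2}u\|_{L^2}^2+\|e^{|x|/2}u_x\|_{L^2}^2$ and $\|u\|_{H^{1,\alpha}}^2=\|(1+|x|)^{\alpha/2}u\|_{L^2}^2+\|(1+|x|)^{\alpha/2}u_x\|_{L^2}^2$. $F=L^\infty\times(L^\infty\cap L^2)\times L^\infty\times L^2\times L^2\times L^2$ is the Banach space of elements $Y=(\zeta,U,H,v,w,h)$ with norm $\|Y\|_F=\|\zeta\|_{L^\infty}+\|U\|_{L^2}+\|U\|_{L^\infty}+\|H\|_{L^\infty}+\|v\|_{L^2}+\|w\|_{L^2}+\|h\|_{L^2}$. One writes $y(\xi)=\xi+\zeta(\xi)$, $q=1+v$, and also $Y=(y,U,H,q,w,h)$. For $Y\in F$, $P(Y)(\xi)=\frac12\int_{\mathbb{R}}e^{-\mathrm{sgn}(\xi-\eta)(y(\xi)-y(\eta))}\left(\frac{3-2\gamma}{2}U^2q+\frac{\gamma}{2}h\right)(\eta)\,d\eta$,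 $Q(Y)(\xi)=-\frac12\int_{\mathbb{R}}\mathrm{sgn}(\xi-\eta)e^{-\mathrm{sgn}(\xi-\eta)(y(\xi)-y(\eta))}\left(\frac{3-2\gamma}{2}U^2q+\frac{\gamma}{2}h\right)(\eta)\,d\eta$. The system $Y_t=G(Y)$ is: $\zeta_t=\gamma U$, $U_t=-Q$, $H_t=U^3-2PU$, $v_t=q_t=\gamma w$, $w_t=\frac{\gamma}{2}h+\left(\frac{3-2\gamma}{2}U^2-P\right)q$, $h_t=-2QUq+(3U^2-2P)w$. $\mathcal{G}$ is the set of $Y\in F$ such that: $q,w,h\in L^\infty$; $qh=U^2q^2+w^2$, $q\ge0$, $h\ge0$, $q+h\ge c$ a.e. for some $c>0$; and $y_\xi=q$, $U_\xi=w$, $H_\xi=h$. For initial data in $\mathcal{G}$ the system has a global solution (known), staying in $\mathcal{G}$; $S_t$ denotes the resulting semigroup. Lagrangian element associated with $u_0$: $y_0(\xi)+\int_{-\infty}^{y_0(\xi)}(u_0^2+u_{0,x}^2)\,dx=\xi$, $U_0=u_0\circ y_0$, $H_0(\xi)=\xi-y_0(\xi)$, $q_0=y_{0,\xi}$, $w_0=U_{0,\xi}$, $h_0=H_{0,\xi}$; it belongs to $\mathcal{G}$. The global conservative solution of the hyperelastic rod wave equation $u_t-u_{xxt}+3uu_x-\gamma(2u_xu_{xx}+uu_{xxx})=0$ with initial data $u_0$ is $u(t,x)=U(t,\xi)$ for any $\xi$ with $y(t,\xi)=x$ (well defined; known). $F^e=\{Y\in F: q,w,h\in L^\infty,\ e^{|\xi|/2}U\in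 L^2,\ e^{|\xi|/2}w\in L^2,\ e^{|\xi|}h\in L^1\}$ with norm $\|Y\|_{F^e}=\|Y\|_F+\|q\|_{L^\infty}+\|w\|_{L^\infty}+\|h\|_{L^\infty}+\|e^{|\xi|/2}U\|_{L^2}+\|e^{|\xi|/2}w\|_{L^2}+\|e^{|\xi|}h\|_{L^1}$. $F^\alpha$ is defined in the same way with $e^{|\xi|/2}$ replaced by $(1+|\xi|)^{\alpha/2}$ and $e^{|\xi|}$ by $(1+|\xi|)^\alpha$. For $\Delta\xi>0$, $N\in\mathbb{N}$, $R=N\Delta\xi$, $\xi_i=i\Delta\xi$: $F_{\{\Delta\xi,R\}}$ is the space of $Y=(\zeta,U,H,v,w,h)\in F$ all of whose components are constant on each $[\xi_i,\xi_{i+1})$ and such that $U=v=w=h=0$ on $(-\infty,-R)\cup[R,\infty)$, $\zeta$ and $H$ are constant on $[R,\infty)$, $\zeta$ is constant on $(-\infty,-R)$ and $H=0$ on $(-\infty,-R)$. Put $P_\ast=\sum_{i=-N}^{N-1}P(Y)(\xi_i)\chi_{[\xi_i,\xi_{i+1})}$, $Q_\ast=\sum_{i=-N}^{N-1}Q(Y)(\xi_i)\chi_{[\xi_i,\xi_{i+1})}$ and, on $F_{\{\Delta\xi,R\}}$, in the components $(\zeta,U,H,v,w,h)$, $\bar G_1(Y)=\left(0,0,0,\gamma w,\frac{\gamma}{2}h+\left(\frac{3-2\gamma}{2}U^2-P_\ast\right)q,(3U^2-2P_\ast)w\right)$, $\bar G_2(Y)=\left(\gamma U,-Q_\ast,U^3-2P_\ast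 U,0,0,-2Q_\ast Uq\right)$. For $k=1,2$, $\Phi^k_{\Delta t}(Y)=Z$ where $Z=Y+\Delta t\,\bar G_k\left(\frac{Y+Z}2\right)$ (implicit midpoint rule; for $\Delta t$ small, $Z$ is the solution close to $Y$ given by the implicit function theorem). $\Phi_{\Delta t}=\Phi^2_{\Delta t}\circ\Phi^1_{\Delta t}$ and $\Phi_{j\Delta t}$ is its $j$-fold composition. *)

theory Defs
  imports "HOL-Analysis.Analysis" "HOL-Probability.Essential_Supremum"
begin

text \<open>Elements of Lebesgue spaces are represented by Borel functions, so the norms below are
  seminorms on representatives.  Where point values matter (\<open>y\<close>, \<open>U\<close>, \<open>H\<close> on the set \<open>GG\<close>,
  initial data in \<open>H\<^sup>1\<close>, grid functions) the definitions themselves single out the continuous,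
  respectively the piecewise constant, representative.\<close>

definition Linf :: "(real \<Rightarrow> real) set" where
  "Linf = {f \<in> borel_measurable lborel. esssup lborel (\<lambda>x. ereal \<bar>f x\<bar>) < \<infinity>}"

definition Linf_norm :: "(real \<Rightarrow> real) \<Rightarrow> real" where
  "Linf_norm f = real_of_ereal (esssup lborel (\<lambda>x. ereal \<bar>f x\<bar>))"

definition L2 :: "(real \<Rightarrow> real) set" where
  "L2 = {f \<in> borel_measurable lborel. integrable lborel (\<lambda>x. (f x)\<^sup>2)}"

definition L2_norm :: "(real \<Rightarrow> real) \<Rightarrow> real" where
  "L2_norm f = sqrt (LINT x|lborel. (f x)\<^sup>2)"

definition L1 :: "(real \<Rightarrow> real) set" where
  "L1 = {f. integrable lborel f}"

definition L1_norm :: "(real \<Rightarrow> real) \<Rightarrow> real" where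
  "L1_norm f = (LINT x|lborel. \<bar>f x\<bar>)"

text \<open>\<open>f\<close> is locally absolutely continuous with (weak) derivative \<open>g\<close>; in particular \<open>f\<close> is the
  continuous representative of its class, while \<open>g\<close> is determined only almost everywhere.\<close>

definition has_wderiv :: "(real \<Rightarrow> real) \<Rightarrow> (real \<Rightarrow> real) \<Rightarrow> bool" where
  "has_wderiv f g \<longleftrightarrow>
     (\<forall>a b. a \<le> b \<longrightarrow> set_integrable lborel {a..b} g \<and> (LBINT x:{a..b}. g x) = f b - f a)"

definition wderiv :: "(real \<Rightarrow> real) \<Rightarrow> real \<Rightarrow> real" where
  "wderiv f = (SOME g. has_wderiv f g)"

definition H1 :: "(real \<Rightarrow> real) set" where
  "H1 = {u. (\<exists>g. has_wderiv u g) \<and> u \<in> L2 \<and> wderiv u \<in> L2}"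

text \<open>The exponential and the algebraic case differ only in the weight \<open>\<omega>\<close>; the \<open>L\<^sup>1\<close> weights
  \<open>e\<^bsup>\<bar>x\<bar>\<^esup>\<close> and \<open>(1 + \<bar>x\<bar>)\<^bsup>\<alpha>\<^esup>\<close> are \<open>\<omega>\<^sup>2\<close>.\<close>

definition exp_weight :: "real \<Rightarrow> real" where
  "exp_weight x = exp (\<bar>x\<bar> / 2)"

definition pow_weight :: "real \<Rightarrow> real \<Rightarrow> real" where
  "pow_weight \<alpha> x = (1 + \<bar>x\<bar>) powr (\<alpha> / 2)"

definition H1w :: "(real \<Rightarrow> real) \<Rightarrow> (real \<Rightarrow> real) set" where
  "H1w \<omega> = {u \<in> H1. (\<lambda>x. \<omega> x * u x) \<in> L2 \<and> (\<lambda>x. \<omega> x * wderiv u x) \<in> L2}"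

definition H1w_norm :: "(real \<Rightarrow> real) \<Rightarrow> (real \<Rightarrow> real) \<Rightarrow> real" where
  "H1w_norm \<omega> u =
     sqrt ((L2_norm (\<lambda>x. \<omega> x * u x))\<^sup>2 + (L2_norm (\<lambda>x. \<omega> x * wderiv u x))\<^sup>2)"

datatype lag = Lag
  (l_zeta: "real \<Rightarrow> real") (l_U: "real \<Rightarrow> real") (l_H: "real \<Rightarrow> real")
  (l_v: "real \<Rightarrow> real") (l_w: "real \<Rightarrow> real") (l_h: "real \<Rightarrow> real")

instantiation lag :: real_vector
begin

definition zero_lag :: lag where
  "0 = Lag (\<lambda>_. 0) (\<lambda>_. 0) (\<lambda>_. 0) (\<lambda>_. 0) (\<lambda>_. 0) (\<lambda>_. 0)"

definition plus_lag :: "lag \<Rightarrow> lag \<Rightarrow> lag" where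
  "X + Y = Lag (\<lambda>x. l_zeta X x + l_zeta Y x) (\<lambda>x. l_U X x + l_U Y x) (\<lambda>x. l_H X x + l_H Y x)
               (\<lambda>x. l_v X x + l_v Y x) (\<lambda>x. l_w X x + l_w Y x) (\<lambda>x. l_h X x + l_h Y x)"

definition minus_lag :: "lag \<Rightarrow> lag \<Rightarrow> lag" where
  "X - Y = Lag (\<lambda>x. l_zeta X x - l_zeta Y x) (\<lambda>x. l_U X x - l_U Y x) (\<lambda>x. l_H X x - l_H Y x)
               (\<lambda>x. l_v X x - l_v Y x) (\<lambda>x. l_w X x - l_w Y x) (\<lambda>x. l_h X x - l_h Y x)"

definition uminus_lag :: "lag \<Rightarrow> lag" where
  "- X = Lag (\<lambda>x. - l_zeta X x) (\<lambda>x. - l_U X x) (\<lambda>x. - l_H X x)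
             (\<lambda>x. - l_v X x) (\<lambda>x. - l_w X x) (\<lambda>x. - l_h X x)"

definition scaleR_lag :: "real \<Rightarrow> lag \<Rightarrow> lag" where
  "c *\<^sub>R X = Lag (\<lambda>x. c * l_zeta X x) (\<lambda>x. c * l_U X x) (\<lambda>x. c * l_H X x)
                (\<lambda>x. c * l_v X x) (\<lambda>x. c * l_w X x) (\<lambda>x. c * l_h X x)"

instance
  by standard
    (auto simp: zero_lag_def plus_lag_def minus_lag_def uminus_lag_def scaleR_lag_def
        algebra_simps)

end

definition l_y :: "lag \<Rightarrow> real \<Rightarrow> real" where
  "l_y Y \<xi> = \<xi> + l_zeta Y \<xi>"

definition l_q :: "lag \<Rightarrow> real \<Rightarrow> real" where
  "l_q Y \<xi> = 1 + l_v Y \<xi>"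

definition FF :: "lag set" where
  "FF = {Y. l_zeta Y \<in> Linf \<and> l_U Y \<in> Linf \<and> l_U Y \<in> L2 \<and> l_H Y \<in> Linf \<and>
            l_v Y \<in> L2 \<and> l_w Y \<in> L2 \<and> l_h Y \<in> L2}"

definition F_norm :: "lag \<Rightarrow> real" where
  "F_norm Y = Linf_norm (l_zeta Y) + L2_norm (l_U Y) + Linf_norm (l_U Y) + Linf_norm (l_H Y)
              + L2_norm (l_v Y) + L2_norm (l_w Y) + L2_norm (l_h Y)"

definition Fw :: "(real \<Rightarrow> real) \<Rightarrow> lag set" where
  "Fw \<omega> = {Y \<in> FF. l_q Y \<in> Linf \<and> l_w Y \<in> Linf \<and> l_h Y \<in> Linf \<and>
            (\<lambda>\<xi>. \<omega> \<xi> * l_U Y \<xi>) \<in> L2 \<and> (\<lambda>\<xi>. \<omega> \<xi> * l_w Y \<xi>) \<in> L2 \<and>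
            (\<lambda>\<xi>. (\<omega> \<xi>)\<^sup>2 * l_h Y \<xi>) \<in> L1}"

definition Fw_norm :: "(real \<Rightarrow> real) \<Rightarrow> lag \<Rightarrow> real" where
  "Fw_norm \<omega> Y = F_norm Y + Linf_norm (l_q Y) + Linf_norm (l_w Y) + Linf_norm (l_h Y)
     + L2_norm (\<lambda>\<xi>. \<omega> \<xi> * l_U Y \<xi>) + L2_norm (\<lambda>\<xi>. \<omega> \<xi> * l_w Y \<xi>)
     + L1_norm (\<lambda>\<xi>. (\<omega> \<xi>)\<^sup>2 * l_h Y \<xi>)"

definition PP :: "real \<Rightarrow> lag \<Rightarrow> real \<Rightarrow> real" where
  "PP \<gamma> Y \<xi> = 1/2 * (LINT \<eta>|lborel. exp (- sgn (\<xi> - \<eta>) * (l_y Y \<xi> - l_y Y \<eta>)) *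
      ((3 - 2 * \<gamma>) / 2 * (l_U Y \<eta>)\<^sup>2 * l_q Y \<eta> + \<gamma> / 2 * l_h Y \<eta>))"

definition QQ :: "real \<Rightarrow> lag \<Rightarrow> real \<Rightarrow> real" where
  "QQ \<gamma> Y \<xi> = - 1/2 * (LINT \<eta>|lborel. sgn (\<xi> - \<eta>) *
      exp (- sgn (\<xi> - \<eta>) * (l_y Y \<xi> - l_y Y \<eta>)) *
      ((3 - 2 * \<gamma>) / 2 * (l_U Y \<eta>)\<^sup>2 * l_q Y \<eta> + \<gamma> / 2 * l_h Y \<eta>))"

definition G_rhs :: "real \<Rightarrow> lag \<Rightarrow> lag" where
  "G_rhs \<gamma> Y = Lag
     (\<lambda>\<xi>. \<gamma> * l_U Y \<xi>)
     (\<lambda>\<xi>. - QQ \<gamma> Y \<xi>)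
     (\<lambda>\<xi>. (l_U Y \<xi>)^3 - 2 * PP \<gamma> Y \<xi> * l_U Y \<xi>)
     (\<lambda>\<xi>. \<gamma> * l_w Y \<xi>)
     (\<lambda>\<xi>. \<gamma> / 2 * l_h Y \<xi> + ((3 - 2 * \<gamma>) / 2 * (l_U Y \<xi>)\<^sup>2 - PP \<gamma> Y \<xi>) * l_q Y \<xi>)
     (\<lambda>\<xi>. - 2 * QQ \<gamma> Y \<xi> * l_U Y \<xi> * l_q Y \<xi> + (3 * (l_U Y \<xi>)\<^sup>2 - 2 * PP \<gamma> Y \<xi>) * l_w Y \<xi>)"

definition GG :: "lag set" where
  "GG = {Y \<in> FF. l_q Y \<in> Linf \<and> l_w Y \<in> Linf \<and> l_h Y \<in> Linf \<and>
     (AE \<xi> in lborel. l_q Y \<xi> * l_h Y \<xi> = (l_U Y \<xi>)\<^sup>2 * (l_q Y \<xi>)\<^sup>2 + (l_w Y \<xi>)\<^sup>2) \<and>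
     (AE \<xi> in lborel. l_q Y \<xi> \<ge> 0) \<and> (AE \<xi> in lborel. l_h Y \<xi> \<ge> 0) \<and>
     (\<exists>c>0. AE \<xi> in lborel. l_q Y \<xi> + l_h Y \<xi> \<ge> c) \<and>
     has_wderiv (l_y Y) (l_q Y) \<and> has_wderiv (l_U Y) (l_w Y) \<and> has_wderiv (l_H Y) (l_h Y)}"

text \<open>\<open>Y(t) = S\<^sub>t(Y\<^sub>0)\<close>: the global solution in \<open>GG\<close>, with time derivative taken in the Banach
  space \<open>F\<close> (one-sided at \<open>t = 0\<close>).\<close>

definition is_flow :: "real \<Rightarrow> lag \<Rightarrow> (real \<Rightarrow> lag) \<Rightarrow> bool" where
  "is_flow \<gamma> Y\<^sub>0 Y \<longleftrightarrow> Y 0 = Y\<^sub>0 \<and>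
     (\<forall>t\<ge>0. Y t \<in> GG \<and>
        ((\<lambda>s. F_norm ((1 / (s - t)) *\<^sub>R (Y s - Y t) - G_rhs \<gamma> (Y t))) \<longlongrightarrow> 0) (at t within {0..}))"

definition lagrangian_of :: "(real \<Rightarrow> real) \<Rightarrow> lag \<Rightarrow> bool" where
  "lagrangian_of u\<^sub>0 Y \<longleftrightarrow>
     (\<forall>\<xi>. l_y Y \<xi> + (LBINT x:{..l_y Y \<xi>}. (u\<^sub>0 x)\<^sup>2 + (wderiv u\<^sub>0 x)\<^sup>2) = \<xi>) \<and>
     l_U Y = u\<^sub>0 \<circ> l_y Y \<and>
     (\<forall>\<xi>. l_H Y \<xi> = \<xi> - l_y Y \<xi>) \<and>
     has_wderiv (l_y Y) (l_q Y) \<and> has_wderiv (l_U Y) (l_w Y) \<and> has_wderiv (l_H Y) (l_h Y)"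

definition conservative_solution :: "(real \<Rightarrow> lag) \<Rightarrow> (real \<Rightarrow> real \<Rightarrow> real) \<Rightarrow> bool" where
  "conservative_solution Y u \<longleftrightarrow> (\<forall>t\<ge>0. \<forall>x \<xi>. l_y (Y t) \<xi> = x \<longrightarrow> u t x = l_U (Y t) \<xi>)"

definition grid :: "real \<Rightarrow> int \<Rightarrow> real" where
  "grid \<delta> i = of_int i * \<delta>"

definition cellwise_const :: "real \<Rightarrow> (real \<Rightarrow> real) \<Rightarrow> bool" where
  "cellwise_const \<delta> f \<longleftrightarrow> (\<forall>i. f constant_on {grid \<delta> i..<grid \<delta> (i + 1)})"

definition F_grid :: "real \<Rightarrow> nat \<Rightarrow> lag set" where
  "F_grid \<delta> N = (let R = real N * \<delta> in
     {Y \<in> FF.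
        (\<forall>f \<in> {l_zeta Y, l_U Y, l_H Y, l_v Y, l_w Y, l_h Y}. cellwise_const \<delta> f) \<and>
        (\<forall>f \<in> {l_U Y, l_v Y, l_w Y, l_h Y}. \<forall>\<xi> \<in> {..<-R} \<union> {R..}. f \<xi> = 0) \<and>
        l_zeta Y constant_on {R..} \<and> l_H Y constant_on {R..} \<and>
        l_zeta Y constant_on {..<-R} \<and> (\<forall>\<xi> < -R. l_H Y \<xi> = 0)})"

definition sample :: "real \<Rightarrow> nat \<Rightarrow> (real \<Rightarrow> real) \<Rightarrow> real \<Rightarrow> real" where
  "sample \<delta> N f \<xi> =
     (\<Sum>i = - int N..int N - 1. f (grid \<delta> i) * indicator {grid \<delta> i..<grid \<delta> (i + 1)} \<xi>)"

definition G_bar1 :: "real \<Rightarrow> real \<Rightarrow> nat \<Rightarrow> lag \<Rightarrow> lag" where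
  "G_bar1 \<gamma> \<delta> N Y = (let P = sample \<delta> N (PP \<gamma> Y) in Lag
     (\<lambda>\<xi>. 0)
     (\<lambda>\<xi>. 0)
     (\<lambda>\<xi>. 0)
     (\<lambda>\<xi>. \<gamma> * l_w Y \<xi>)
     (\<lambda>\<xi>. \<gamma> / 2 * l_h Y \<xi> + ((3 - 2 * \<gamma>) / 2 * (l_U Y \<xi>)\<^sup>2 - P \<xi>) * l_q Y \<xi>)
     (\<lambda>\<xi>. (3 * (l_U Y \<xi>)\<^sup>2 - 2 * P \<xi>) * l_w Y \<xi>))"

definition G_bar2 :: "real \<Rightarrow> real \<Rightarrow> nat \<Rightarrow> lag \<Rightarrow> lag" where
  "G_bar2 \<gamma> \<delta> N Y = (let P = sample \<delta> N (PP \<gamma> Y); Q = sample \<delta> N (QQ \<gamma> Y) in Lag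
     (\<lambda>\<xi>. \<gamma> * l_U Y \<xi>)
     (\<lambda>\<xi>. - Q \<xi>)
     (\<lambda>\<xi>. (l_U Y \<xi>)^3 - 2 * P \<xi> * l_U Y \<xi>)
     (\<lambda>\<xi>. 0)
     (\<lambda>\<xi>. 0)
     (\<lambda>\<xi>. - 2 * Q \<xi> * l_U Y \<xi> * l_q Y \<xi>))"

text \<open>The implicit midpoint equation may have several solutions; the step is the one closest to
  \<open>Y\<close>, which for small \<open>\<tau>\<close> is the branch given by the implicit function theorem at \<open>\<tau> = 0\<close>.
  For \<open>\<tau>\<close> so large that there is no solution the value is unspecified.\<close>

definition midpoint_step :: "lag set \<Rightarrow> (lag \<Rightarrow> lag) \<Rightarrow> real \<Rightarrow> lag \<Rightarrow> lag" where
  "midpoint_step S g \<tau> Y =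
     arg_min (\<lambda>Z. F_norm (Z - Y)) (\<lambda>Z. Z \<in> S \<and> Z = Y + \<tau> *\<^sub>R g ((1/2) *\<^sub>R (Y + Z)))"

definition lie_trotter :: "real \<Rightarrow> real \<Rightarrow> nat \<Rightarrow> real \<Rightarrow> lag \<Rightarrow> lag" where
  "lie_trotter \<gamma> \<delta> N \<tau> =
     midpoint_step (F_grid \<delta> N) (G_bar2 \<gamma> \<delta> N) \<tau> \<circ> midpoint_step (F_grid \<delta> N) (G_bar1 \<gamma> \<delta> N) \<tau>"

definition discretisation ::
  "(real \<Rightarrow> real) \<Rightarrow> real \<Rightarrow> real \<Rightarrow> lag \<Rightarrow> (nat \<Rightarrow> real) \<Rightarrow> (nat \<Rightarrow> nat) \<Rightarrow> (nat \<Rightarrow> nat)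
     \<Rightarrow> (nat \<Rightarrow> lag) \<Rightarrow> bool" where
  "discretisation \<omega> T C\<^sub>0 Y\<^sub>0 \<delta> N N\<^sub>T Z \<longleftrightarrow>
     (\<forall>n\<ge>1. \<delta> n > 0 \<and> N n \<ge> 1 \<and> N\<^sub>T n \<ge> 1 \<and>
        1 / real n = \<delta> n + 1 / (real (N n) * \<delta> n) + T / real (N\<^sub>T n) \<and>
        Z n \<in> F_grid (\<delta> n) (N n) \<and> Z n \<in> Fw \<omega> \<and>
        Fw_norm \<omega> (Z n) \<le> C\<^sub>0 * Fw_norm \<omega> Y\<^sub>0) \<and>
     (\<lambda>n. F_norm (Z n - Y\<^sub>0)) \<longlonglongrightarrow> 0"

definition graph_error ::
  "real \<Rightarrow> real \<Rightarrow> nat \<Rightarrow> nat \<Rightarrow> real \<Rightarrow> lag \<Rightarrow> (real \<Rightarrow> lag) \<Rightarrow> real" where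
  "graph_error \<gamma> \<delta> N N\<^sub>T \<tau> Z Y =
     (MAX (i, j) \<in> {- int N..int N - 1} \<times> {0..N\<^sub>T}.
        let Z\<^sub>j = (lie_trotter \<gamma> \<delta> N \<tau> ^^ j) Z; Y\<^sub>j = Y (real j * \<tau>); \<xi> = grid \<delta> i
        in norm ((l_y Z\<^sub>j \<xi>, l_U Z\<^sub>j \<xi>) - (l_y Y\<^sub>j \<xi>, l_U Y\<^sub>j \<xi>)))"

end

theory Submission
  imports Defs
begin

text \<open>
  The right-hand side of the system is locally Lipschitz in the norm of \<open>F\<close>: the nonlocal terms
  are dominated by convolutions of \<open>e\<^bsup>-\<bar>x\<bar>\<^esup>\<close> with functions in \<open>L\<^sup>2\<close>, and sampling such a
  convolution on a grid of width at most one costs only a factor \<open>e\<close>.  Hence, uniformly in the grid,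
  the midpoint equations are contractions and one splitting step is an explicit Euler step up to
  \<open>O(\<Delta>t\<^sup>2)\<close>, and the error follows from a discrete Gronwall argument as soon as the exact
  solution is bounded in \<open>F\<close> and the nonlocal terms are well approximated by their samples.

  The exact solution is bounded because the energy \<open>\<integral>h\<close> does not increase.  Within a cell the nonlocal
  terms oscillate by \<open>O(\<surd>\<Delta>\<xi>)\<close>, since \<open>y\<^sub>\<xi> - 1\<close> and the source are in \<open>L\<^sup>2\<close>; outside
  \<open>[-R, R)\<close> their decay follows from that of the weighted energy \<open>\<integral>\<omega>\<^sup>2h\<close>, which satisfies a linear
  Gronwall inequality.
\<close>

section \<open>Bounds in \<open>L\<^sup>2\<close> and \<open>L\<^sup>\<infinity>\<close>\<close>

text \<open>The numerical states need not satisfy qh = U^2 q^2 + w^2 or have a monotone y, so no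
  energy estimate is available for them. The structure of \<open>GG\<close> is used on the exact
  solution alone; the scheme stays bounded because it stays within distance 1 of that solution,
  which is part of the induction and the reason for taking n large. Estimates comparing the two
  therefore rest on the norm of F only. The exact flow is differentiable only in that norm. The
  energy is read off from H, whose rate of change U^3 - 2PU is controlled in L^1 but not at a given
  point far out, so averages of H over long intervals replace its limits. The weighted energy is not
  continuous on F and is reached through truncated weights, with bounds uniform in the truncation.
  The constant may depend on u_0 only through its norm \<nu>, so every bound is fixed before the
  data: the energy is at most \<nu>^2; it bounds U; this bounds zeta on [0, T]; these bound P and Q;
  and then F_norm obeys a linear Gronwall inequality.\<close>

definition Linf_le :: "(real \<Rightarrow> real) \<Rightarrow> real \<Rightarrow> bool" where
  "Linf_le f a \<longleftrightarrow> f \<in> borel_measurable borel \<and> (AE x in lborel. \<bar>f x\<bar> \<le> a)"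

text \<open>\<open>Linf_norm\<close> and \<open>L2_norm\<close> may return 0 outside their spaces,
  by the default values of \<open>real_of_ereal\<close> and of the integral. A bound is meaningful
  only together with membership, so \<open>Linf_le\<close> and \<open>L2_le\<close> carry
  both.\<close>

definition L2_le :: "(real \<Rightarrow> real) \<Rightarrow> real \<Rightarrow> bool" where
  "L2_le f a \<longleftrightarrow> f \<in> L2 \<and> L2_norm f \<le> a"

lemma AE_lborel_nonneg_bound:
  assumes "AE x in (lborel :: real measure). \<bar>f x :: real\<bar> \<le> a"
  shows "0 \<le> a"
proof (rule ccontr)
  assume a: "\<not> 0 \<le> a"
  have "AE x in (lborel :: real measure). False"
    using assms by (rule eventually_mono) (use a in linarith)
  then show False by (simp add: eventually_False ae_filter_eq_bot_iff)
qed

lemma Linf_le_nonneg: "Linf_le f a \<Longrightarrow> 0 \<le> a"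
  unfolding Linf_le_def using AE_lborel_nonneg_bound by blast

lemma esssup_abs_nonneg: "0 \<le> esssup lborel (\<lambda>x :: real. ereal \<bar>f x\<bar>)"
proof (rule ccontr)
  let ?s = "esssup lborel (\<lambda>x :: real. ereal \<bar>f x\<bar>)"
  assume "\<not> 0 \<le> ?s"
  then have neg: "?s < 0" by simp
  have ae: "AE x in lborel. ereal \<bar>f x\<bar> \<le> ?s" by (rule esssup_AE)
  have "AE x in (lborel :: real measure). \<bar>0 :: real\<bar> \<le> - 1"
    using ae
  proof (rule eventually_mono)
    fix x assume "ereal \<bar>f x\<bar> \<le> ?s"
    from le_less_trans[OF this neg] have "ereal \<bar>f x\<bar> < 0" .
    then show "\<bar>0 :: real\<bar> \<le> - 1" by (simp add: zero_ereal_def)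
  qed
  from AE_lborel_nonneg_bound[OF this] show False by simp
qed

lemma Linf_norm_nonneg [simp]: "0 \<le> Linf_norm f"
  unfolding Linf_norm_def by (rule real_of_ereal_pos[OF esssup_abs_nonneg])

lemma Linf_le_iff: "Linf_le f a \<longleftrightarrow> f \<in> Linf \<and> Linf_norm f \<le> a"
proof
  assume f: "Linf_le f a"
  then have m[measurable]: "f \<in> borel_measurable borel" and ae: "AE x in lborel. \<bar>f x\<bar> \<le> a"
    by (auto simp: Linf_le_def)
  have "esssup lborel (\<lambda>x. ereal \<bar>f x\<bar>) \<le> ereal a"
    using ae by (intro esssup_I) auto
  moreover have "0 \<le> esssup lborel (\<lambda>x. ereal \<bar>f x\<bar>)" by (rule esssup_abs_nonneg)
  ultimately show "f \<in> Linf \<and> Linf_norm f \<le> a"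
    unfolding Linf_def Linf_norm_def
    by (cases "esssup lborel (\<lambda>x. ereal \<bar>f x\<bar>)") auto
next
  assume f: "f \<in> Linf \<and> Linf_norm f \<le> a"
  then have m[measurable]: "f \<in> borel_measurable borel" by (auto simp: Linf_def)
  have "0 \<le> esssup lborel (\<lambda>x. ereal \<bar>f x\<bar>)" by (rule esssup_abs_nonneg)
  then obtain r where r: "esssup lborel (\<lambda>x. ereal \<bar>f x\<bar>) = ereal r"
    using f by (cases "esssup lborel (\<lambda>x. ereal \<bar>f x\<bar>)") (auto simp: Linf_def)
  then have "r \<le> a" using f by (auto simp: Linf_norm_def)
  moreover have "AE x in lborel. ereal \<bar>f x\<bar> \<le> ereal r" using esssup_AE r by metis
  ultimately show "Linf_le f a" unfolding Linf_le_def using m by (auto elim!: eventually_mono)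
qed

lemma Linf_le_norm: "f \<in> Linf \<Longrightarrow> Linf_le f (Linf_norm f)"
  by (simp add: Linf_le_iff)

lemma Linf_leI: "f \<in> borel_measurable borel \<Longrightarrow> (\<And>x. \<bar>f x\<bar> \<le> a) \<Longrightarrow> Linf_le f a"
  by (simp add: Linf_le_def)

lemma L2_le_measurable: "L2_le f a \<Longrightarrow> f \<in> borel_measurable borel"
  by (simp add: L2_le_def L2_def)

lemma Linf_le_weaken: "Linf_le f a \<Longrightarrow> a \<le> b \<Longrightarrow> Linf_le f b"
  by (auto simp: Linf_le_def elim!: eventually_mono)

lemma L2_le_weaken: "L2_le f a \<Longrightarrow> a \<le> b \<Longrightarrow> L2_le f b"
  by (auto simp: L2_le_def)

lemma Linf_le_mono:
  assumes "Linf_le g a" "f \<in> borel_measurable borel" "AE x in lborel. \<bar>f x\<bar> \<le> \<bar>g x\<bar>"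
  shows "Linf_le f a"
proof -
  have "AE x in lborel. \<bar>g x\<bar> \<le> a" using assms(1) by (auto simp: Linf_le_def)
  with assms(3) have "AE x in lborel. \<bar>f x\<bar> \<le> a" by eventually_elim auto
  with assms(2) show ?thesis by (simp add: Linf_le_def)
qed

lemma Linf_le_add:
  assumes "Linf_le f a" "Linf_le g b" shows "Linf_le (\<lambda>x. f x + g x) (a + b)"
proof -
  have [measurable]: "f \<in> borel_measurable borel" "g \<in> borel_measurable borel"
    using assms by (auto simp: Linf_le_def)
  have "AE x in lborel. \<bar>f x\<bar> \<le> a" "AE x in lborel. \<bar>g x\<bar> \<le> b"
    using assms by (auto simp: Linf_le_def)
  then have "AE x in lborel. \<bar>f x + g x\<bar> \<le> a + b" by eventually_elim linarith
  then show ?thesis by (simp add: Linf_le_def)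
qed

lemma Linf_le_mult:
  assumes "Linf_le f a" "Linf_le g b" shows "Linf_le (\<lambda>x. f x * g x) (a * b)"
proof -
  have [measurable]: "f \<in> borel_measurable borel" "g \<in> borel_measurable borel"
    using assms by (auto simp: Linf_le_def)
  have "AE x in lborel. \<bar>f x\<bar> \<le> a" "AE x in lborel. \<bar>g x\<bar> \<le> b"
    using assms by (auto simp: Linf_le_def)
  then have "AE x in lborel. \<bar>f x * g x\<bar> \<le> a * b"
    by eventually_elim (auto simp: abs_mult intro!: mult_mono)
  then show ?thesis by (simp add: Linf_le_def)
qed

lemma Linf_le_const: "Linf_le (\<lambda>x. c) \<bar>c\<bar>"
  by (simp add: Linf_le_def)

lemma Linf_le_cmult: "Linf_le f a \<Longrightarrow> Linf_le (\<lambda>x. c * f x) (\<bar>c\<bar> * a)"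
  by (rule Linf_le_mult[OF Linf_le_const])

lemma Linf_le_minus: "Linf_le f a \<Longrightarrow> Linf_le (\<lambda>x. - f x) a"
  by (simp add: Linf_le_def)

lemma Linf_le_diff:
  "Linf_le f a \<Longrightarrow> Linf_le g b \<Longrightarrow> Linf_le (\<lambda>x. f x - g x) (a + b)"
  using Linf_le_add[of f a "\<lambda>x. - g x" b] Linf_le_minus[of g b] by simp

lemma Linf_le_power2: "Linf_le f a \<Longrightarrow> Linf_le (\<lambda>x. (f x)\<^sup>2) (a\<^sup>2)"
  using Linf_le_mult[of f a f a] by (simp add: power2_eq_square)

text \<open>If |f x| > a, then |f| > a on some interval (x, b), which is not a null set. Continuous
  functions and step functions on half-open cells are both right continuous, so the norm of F
  controls the point values of exact and numerical states alike.\<close>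

lemma Linf_le_right_cont:
  assumes f: "Linf_le f a" and rc: "continuous (at_right x) f"
  shows "\<bar>f x\<bar> \<le> a"
proof (rule ccontr)
  assume "\<not> \<bar>f x\<bar> \<le> a"
  then have "a < \<bar>f x\<bar>" by simp
  moreover have "((\<lambda>y. \<bar>f y\<bar>) \<longlongrightarrow> \<bar>f x\<bar>) (at_right x)"
    using rc by (intro tendsto_intros) (simp add: continuous_within)
  ultimately have "eventually (\<lambda>y. a < \<bar>f y\<bar>) (at_right x)"
    by (rule order_tendstoD(1)[rotated])
  then obtain b where b: "b > x" "\<And>y. y > x \<Longrightarrow> y < b \<Longrightarrow> a < \<bar>f y\<bar>"
    by (auto simp: eventually_at_right_field)
  have "AE y in lborel. y \<notin> {x<..<b}"
  proof -
    have "AE y in lborel. \<bar>f y\<bar> \<le> a" using f by (simp add: Linf_le_def)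
    then show ?thesis
    proof (rule eventually_mono)
      fix y assume "\<bar>f y\<bar> \<le> a" then show "y \<notin> {x<..<b}" using b(2)[of y] by auto
    qed
  qed
  then have "emeasure lborel {x<..<b} = 0"
    by (subst (asm) AE_iff_measurable[OF _ refl]) (auto simp: greaterThanLessThan_def greaterThan_def lessThan_def Collect_conj_eq[symmetric])
  then show False using b(1) by simp
qed

lemma L2_norm_nonneg [simp]: "0 \<le> L2_norm f"
  by (simp add: L2_norm_def)

lemma L2_norm_power2: "(L2_norm f)\<^sup>2 = (LINT x|lborel. (f x)\<^sup>2)"
  by (simp add: L2_norm_def)

lemma L2_le_nonneg: "L2_le f a \<Longrightarrow> 0 \<le> a"
  using L2_norm_nonneg order_trans unfolding L2_le_def by blast

lemma L2_le_norm: "f \<in> L2 \<Longrightarrow> L2_le f (L2_norm f)"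
  by (simp add: L2_le_def)

lemma L2_le_iff:
  "L2_le f a \<longleftrightarrow> 0 \<le> a \<and> f \<in> borel_measurable borel \<and> integrable lborel (\<lambda>x. (f x)\<^sup>2) \<and>
     (LINT x|lborel. (f x)\<^sup>2) \<le> a\<^sup>2"
proof -
  have "L2_norm f \<le> a \<longleftrightarrow> 0 \<le> a \<and> (LINT x|lborel. (f x)\<^sup>2) \<le> a\<^sup>2"
    unfolding L2_norm_power2[symmetric]
    by (metis L2_norm_nonneg order_trans power2_le_imp_le power_mono)
  then show ?thesis by (auto simp: L2_le_def L2_def)
qed

lemma L2_le_mono:
  assumes "L2_le g a" "f \<in> borel_measurable borel" "AE x in lborel. \<bar>f x\<bar> \<le> \<bar>g x\<bar>"
  shows "L2_le f a"
proof -
  have [measurable]: "f \<in> borel_measurable borel" by fact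
  have g: "integrable lborel (\<lambda>x. (g x)\<^sup>2)" "(LINT x|lborel. (g x)\<^sup>2) \<le> a\<^sup>2" "0 \<le> a"
    using assms(1) by (auto simp: L2_le_iff)
  have le: "AE x in lborel. (f x)\<^sup>2 \<le> (g x)\<^sup>2"
    using assms(3) by eventually_elim (simp add: abs_le_square_iff)
  have i: "integrable lborel (\<lambda>x. (f x)\<^sup>2)"
    by (rule Bochner_Integration.integrable_bound[OF g(1)]) (use le in auto)
  have "(LINT x|lborel. (f x)\<^sup>2) \<le> (LINT x|lborel. (g x)\<^sup>2)"
    by (rule integral_mono_AE[OF i g(1) le])
  then show ?thesis using g i by (auto simp: L2_le_iff)
qed

lemma L2_le_cmult:
  assumes "L2_le f a" shows "L2_le (\<lambda>x. c * f x) (\<bar>c\<bar> * a)"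
proof -
  have "(LINT x|lborel. (c * f x)\<^sup>2) = c\<^sup>2 * (LINT x|lborel. (f x)\<^sup>2)"
    by (simp add: power_mult_distrib)
  also have "\<dots> \<le> c\<^sup>2 * a\<^sup>2"
    using assms by (intro mult_left_mono) (auto simp: L2_le_iff)
  finally show ?thesis
    using assms by (auto simp: L2_le_iff power_mult_distrib)
qed

lemma L2_le_minus: "L2_le f a \<Longrightarrow> L2_le (\<lambda>x. - f x) a"
  by (simp add: L2_le_iff)

lemma L2_le_abs: "L2_le f a \<Longrightarrow> L2_le (\<lambda>x. \<bar>f x\<bar>) a"
  by (auto simp: L2_le_iff)

lemma L2_le_mult_integrable:
  assumes "L2_le f a" "L2_le g b"
  shows "integrable lborel (\<lambda>x. f x * g x)"
proof -
  have [measurable]: "f \<in> borel_measurable borel" "g \<in> borel_measurable borel"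
    using assms by (auto simp: L2_le_iff)
  have i: "integrable lborel (\<lambda>x. (f x)\<^sup>2 + (g x)\<^sup>2)"
    using assms by (auto simp: L2_le_iff)
  show ?thesis
  proof (rule Bochner_Integration.integrable_bound[OF i], simp, intro AE_I2)
    fix x
    have "2 * \<bar>f x\<bar> * \<bar>g x\<bar> \<le> \<bar>f x\<bar>\<^sup>2 + \<bar>g x\<bar>\<^sup>2" by (rule sum_squares_bound)
    moreover have "0 \<le> \<bar>f x\<bar> * \<bar>g x\<bar>" by simp
    moreover have "(f x)\<^sup>2 + (g x)\<^sup>2 = \<bar>f x\<bar>\<^sup>2 + \<bar>g x\<bar>\<^sup>2" by simp
    ultimately have "\<bar>f x\<bar> * \<bar>g x\<bar> \<le> (f x)\<^sup>2 + (g x)\<^sup>2" by linarith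
    then show "norm (f x * g x) \<le> norm ((f x)\<^sup>2 + (g x)\<^sup>2)" by (simp add: abs_mult)
  qed
qed

lemma L2_le_Cauchy_Schwarz:
  assumes "L2_le f a" "L2_le g b"
  shows "(LINT x|lborel. \<bar>f x * g x\<bar>) \<le> a * b"
proof -
  have fi: "integrable lborel (\<lambda>x. (f x)\<^sup>2)" "(LINT x|lborel. (f x)\<^sup>2) \<le> a\<^sup>2"
    and gi: "integrable lborel (\<lambda>x. (g x)\<^sup>2)" "(LINT x|lborel. (g x)\<^sup>2) \<le> b\<^sup>2"
    and nn: "0 \<le> a" "0 \<le> b"
    using assms by (auto simp: L2_le_iff)
  have fg: "integrable lborel (\<lambda>x. \<bar>f x * g x\<bar>)"
    using L2_le_mult_integrable[OF assms] by simp
  \<comment> \<open>Young's inequality is applied with weight b/a, so both bounds are first enlarged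
    to positive numbers; the limit below removes the enlargement.\<close>
  have main: "(LINT x|lborel. \<bar>f x * g x\<bar>) \<le> a' * b'" if "a < a'" "b < b'" for a' b'
  proof -
    have pos: "a' > 0" "b' > 0" using that nn by auto
    define l where "l = b' / a'"
    have l: "l > 0" using pos by (simp add: l_def)
    have pt: "\<bar>f x * g x\<bar> \<le> (l * (f x)\<^sup>2 + (g x)\<^sup>2 / l) / 2" for x
    proof -
      have "2 * (sqrt l * \<bar>f x\<bar>) * (\<bar>g x\<bar> / sqrt l) \<le> (sqrt l * \<bar>f x\<bar>)\<^sup>2 + (\<bar>g x\<bar> / sqrt l)\<^sup>2"
        by (rule sum_squares_bound)
      then show ?thesis using l by (simp add: power_mult_distrib power_divide abs_mult)
    qed
    have "(LINT x|lborel. \<bar>f x * g x\<bar>) \<le> (LINT x|lborel. (l * (f x)\<^sup>2 + (g x)\<^sup>2 / l) / 2)"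
      using fi gi fg by (intro integral_mono pt) auto
    also have "\<dots> = (l * (LINT x|lborel. (f x)\<^sup>2) + (LINT x|lborel. (g x)\<^sup>2) / l) / 2"
      using fi gi by simp
    also have "\<dots> \<le> (l * a'\<^sup>2 + b'\<^sup>2 / l) / 2"
      using fi(2) gi(2) l that nn
      by (intro divide_right_mono add_mono mult_left_mono order_trans[OF fi(2)] order_trans[OF gi(2)] power_mono) auto
    also have "\<dots> = a' * b'" using pos by (simp add: l_def power2_eq_square)
    finally show ?thesis .
  qed
  have lim: "((\<lambda>e. (a + e) * (b + e)) \<longlongrightarrow> (a + 0) * (b + 0)) (at_right 0)"
    by (intro tendsto_intros)
  have "(LINT x|lborel. \<bar>f x * g x\<bar>) \<le> (a + 0) * (b + 0)"
    by (rule tendsto_lowerbound[OF lim]) (auto intro!: main eventually_at_rightI[of 0 1])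
  then show ?thesis by simp
qed

lemma L2_le_add:
  assumes "L2_le f a" "L2_le g b" shows "L2_le (\<lambda>x. f x + g x) (a + b)"
proof -
  have [measurable]: "f \<in> borel_measurable borel" "g \<in> borel_measurable borel"
    using assms by (auto simp: L2_le_iff)
  have fi: "integrable lborel (\<lambda>x. (f x)\<^sup>2)" "(LINT x|lborel. (f x)\<^sup>2) \<le> a\<^sup>2"
    and gi: "integrable lborel (\<lambda>x. (g x)\<^sup>2)" "(LINT x|lborel. (g x)\<^sup>2) \<le> b\<^sup>2"
    and nn: "0 \<le> a" "0 \<le> b"
    using assms by (auto simp: L2_le_iff)
  have fg: "integrable lborel (\<lambda>x. f x * g x)" by (rule L2_le_mult_integrable[OF assms])
  have eq: "(f x + g x)\<^sup>2 = (f x)\<^sup>2 + (g x)\<^sup>2 + 2 * (f x * g x)" for x by (simp add: power2_sum)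
  have i: "integrable lborel (\<lambda>x. (f x + g x)\<^sup>2)"
    unfolding eq using fi gi fg by simp
  have "(LINT x|lborel. f x * g x) \<le> (LINT x|lborel. \<bar>f x * g x\<bar>)"
    using fg by (intro integral_mono) auto
  also have "\<dots> \<le> a * b" by (rule L2_le_Cauchy_Schwarz[OF assms])
  finally have "(LINT x|lborel. (f x + g x)\<^sup>2) \<le> a\<^sup>2 + b\<^sup>2 + 2 * (a * b)"
    unfolding eq using fi gi fg by simp
  then show ?thesis using nn i by (simp add: L2_le_iff power2_sum)
qed

lemma L2_le_diff:
  "L2_le f a \<Longrightarrow> L2_le g b \<Longrightarrow> L2_le (\<lambda>x. f x - g x) (a + b)"
  using L2_le_add[of f a "\<lambda>x. - g x" b] L2_le_minus[of g b] by simp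

lemma L2_le_mult:
  assumes "Linf_le f a" "L2_le g b" shows "L2_le (\<lambda>x. f x * g x) (a * b)"
proof -
  have [measurable]: "f \<in> borel_measurable borel" "g \<in> borel_measurable borel"
    using assms by (auto simp: Linf_le_def L2_le_iff)
  have a: "0 \<le> a" by (rule Linf_le_nonneg[OF assms(1)])
  have "L2_le (\<lambda>x. a * g x) (\<bar>a\<bar> * b)" by (rule L2_le_cmult[OF assms(2)])
  moreover have "AE x in lborel. \<bar>f x\<bar> \<le> a" using assms(1) by (simp add: Linf_le_def)
  then have "AE x in lborel. \<bar>f x * g x\<bar> \<le> \<bar>a * g x\<bar>"
    by eventually_elim (use a in \<open>auto simp: abs_mult intro!: mult_right_mono\<close>)
  ultimately show ?thesis using L2_le_mono[of "\<lambda>x. a * g x" "\<bar>a\<bar> * b" "\<lambda>x. f x * g x"] a by simp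
qed

lemma L2_le_0: "L2_le (\<lambda>x. 0) 0" by (simp add: L2_le_iff)
lemma Linf_le_0: "Linf_le (\<lambda>x. 0) 0" by (simp add: Linf_le_def)

section \<open>Convolution with integrable kernels\<close>

text \<open>The bound k <= 1 gives k^2 <= k, so the single number c controls the L^1 norm and sqrt c
  the L^2 norm.\<close>

definition kernel :: "(real \<Rightarrow> real) \<Rightarrow> real \<Rightarrow> bool" where
  "kernel k c \<longleftrightarrow> k \<in> borel_measurable borel \<and> (\<forall>x. 0 \<le> k x \<and> k x \<le> 1) \<and>
     integrable lborel k \<and> (LINT x|lborel. k x) = c"

definition conv :: "(real \<Rightarrow> real) \<Rightarrow> (real \<Rightarrow> real) \<Rightarrow> real \<Rightarrow> real" where
  "conv k g \<xi> = (LINT \<eta>|lborel. k (\<xi> - \<eta>) * g \<eta>)"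

lemma kernelD:
  assumes "kernel k c"
  shows "k \<in> borel_measurable borel" "0 \<le> k x" "k x \<le> 1" "integrable lborel k"
    "(LINT x|lborel. k x) = c" "0 \<le> c"
  using assms by (auto simp: kernel_def intro!: integral_nonneg_AE)

lemma kernel_reflect:
  assumes "kernel k c"
  shows "kernel (\<lambda>\<eta>. k (\<xi> - \<eta>)) c" "kernel (\<lambda>\<eta>. k (\<eta> - \<xi>)) c"
proof -
  note k = kernelD[OF assms]
  have [measurable]: "k \<in> borel_measurable borel" by (rule k)
  have "integrable lborel (\<lambda>\<eta>. k (\<xi> + (- 1) * \<eta>))" "integrable lborel (\<lambda>\<eta>. k (- \<xi> + 1 * \<eta>))"
    using k(4) by (intro lborel_integrable_real_affine; simp)+
  moreover have "(LINT \<eta>|lborel. k (\<xi> + (- 1) * \<eta>)) = c" "(LINT \<eta>|lborel. k (- \<xi> + 1 * \<eta>)) = c"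
    using lborel_integral_real_affine[of "-1" k \<xi>] lborel_integral_real_affine[of "1" k "-\<xi>"] k(5)
    by simp_all
  ultimately show "kernel (\<lambda>\<eta>. k (\<xi> - \<eta>)) c" "kernel (\<lambda>\<eta>. k (\<eta> - \<xi>)) c"
    using k(2,3) unfolding kernel_def by simp_all
qed

lemma kernel_L2_le:
  assumes "kernel k c" shows "L2_le k (sqrt c)"
proof -
  note k = kernelD[OF assms]
  have [measurable]: "k \<in> borel_measurable borel" by (rule k)
  have le: "(k x)\<^sup>2 \<le> k x" for x
    using k(2,3)[of x] by (simp add: power2_eq_square mult_left_le)
  have i: "integrable lborel (\<lambda>x. (k x)\<^sup>2)"
    by (rule Bochner_Integration.integrable_bound[OF k(4)]) (use le k(2) in auto)
  have "(LINT x|lborel. (k x)\<^sup>2) \<le> (LINT x|lborel. k x)"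
    by (intro integral_mono i k(4) le)
  then show ?thesis using i k(5,6) by (auto simp: L2_le_iff)
qed

lemma conv_integrable_L2:
  assumes "kernel k c" "L2_le g b"
  shows "integrable lborel (\<lambda>\<eta>. k (\<xi> - \<eta>) * g \<eta>)"
  by (rule L2_le_mult_integrable[OF kernel_L2_le[OF kernel_reflect(1)[OF assms(1)]] assms(2)])

lemma conv_bound_L2:
  assumes "kernel k c" "L2_le g b"
  shows "\<bar>conv k g \<xi>\<bar> \<le> sqrt c * b"
proof -
  have "\<bar>conv k g \<xi>\<bar> \<le> (LINT \<eta>|lborel. \<bar>k (\<xi> - \<eta>) * g \<eta>\<bar>)"
    unfolding conv_def by (rule integral_abs_bound)
  also have "\<dots> \<le> sqrt c * b"
    by (rule L2_le_Cauchy_Schwarz[OF kernel_L2_le[OF kernel_reflect(1)[OF assms(1)]] assms(2)])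
  finally show ?thesis .
qed

lemma conv_integrable_L1:
  assumes "kernel k c" "integrable lborel g"
  shows "integrable lborel (\<lambda>\<eta>. k (\<xi> - \<eta>) * g \<eta>)"
proof -
  note k = kernelD[OF assms(1)]
  have [measurable]: "k \<in> borel_measurable borel" "g \<in> borel_measurable borel"
    using k(1) assms(2) by auto
  show ?thesis
    by (rule Bochner_Integration.integrable_bound[OF assms(2)])
      (use k(2,3) in \<open>auto simp: abs_mult intro!: mult_left_le_one_le\<close>)
qed

lemma conv_bound_L1:
  assumes "kernel k c" "integrable lborel g"
  shows "\<bar>conv k g \<xi>\<bar> \<le> (LINT x|lborel. \<bar>g x\<bar>)"
proof -
  note k = kernelD[OF assms(1)]
  have "\<bar>conv k g \<xi>\<bar> \<le> (LINT \<eta>|lborel. \<bar>k (\<xi> - \<eta>) * g \<eta>\<bar>)"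
    unfolding conv_def by (rule integral_abs_bound)
  also have "\<dots> \<le> (LINT x|lborel. \<bar>g x\<bar>)"
    using integrable_abs[OF conv_integrable_L1[OF assms]] assms(2) k(2,3)
    by (intro integral_mono) (auto simp: abs_mult intro!: mult_left_le_one_le)
  finally show ?thesis .
qed

lemma conv_measurable [measurable]:
  assumes [measurable]: "k \<in> borel_measurable borel" "g \<in> borel_measurable borel"
  shows "conv k g \<in> borel_measurable borel"
  unfolding conv_def by measurable

lemma conv_L1:
  assumes "kernel k c" "integrable lborel g"
  shows "integrable lborel (conv k g)"
    and "(LINT \<xi>|lborel. conv k g \<xi>) = c * (LINT x|lborel. g x)"
proof -
  note k = kernelD[OF assms(1)]
  have [measurable]: "k \<in> borel_measurable borel" "g \<in> borel_measurable borel"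
    using k(1) assms(2) by auto
  have ck: "integrable lborel (\<lambda>\<xi>. k (\<xi> - \<eta>))" "(LINT \<xi>|lborel. k (\<xi> - \<eta>)) = c" for \<eta>
    using kernelD(4,5)[OF kernel_reflect(2)[OF assms(1), of \<eta>]] .
  have F: "integrable (lborel \<Otimes>\<^sub>M lborel) (\<lambda>(\<eta>, \<xi>). k (\<xi> - \<eta>) * g \<eta>)"
  proof (rule lborel_pair.Fubini_integrable)
    have "(\<lambda>\<eta>. LINT \<xi>|lborel. norm (case (\<eta>, \<xi>) of (\<eta>, \<xi>) \<Rightarrow> k (\<xi> - \<eta>) * g \<eta>)) = (\<lambda>\<eta>. c * \<bar>g \<eta>\<bar>)"
      using k(2) ck by (simp add: abs_mult)
    then show "integrable lborel (\<lambda>\<eta>. LINT \<xi>|lborel. norm (case (\<eta>, \<xi>) of (\<eta>, \<xi>) \<Rightarrow> k (\<xi> - \<eta>) * g \<eta>))"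
      using assms(2) by simp
    show "AE \<eta> in lborel. integrable lborel (\<lambda>\<xi>. case (\<eta>, \<xi>) of (\<eta>, \<xi>) \<Rightarrow> k (\<xi> - \<eta>) * g \<eta>)"
      using ck by simp
  qed measurable
  show "integrable lborel (conv k g)"
    unfolding conv_def by (rule lborel_pair.integrable_snd[OF F])
  have "(LINT \<xi>|lborel. conv k g \<xi>) = (LINT \<eta>|lborel. (LINT \<xi>|lborel. k (\<xi> - \<eta>) * g \<eta>))"
    unfolding conv_def by (rule lborel_pair.Fubini_integral[OF F])
  also have "\<dots> = c * (LINT x|lborel. g x)" using ck by simp
  finally show "(LINT \<xi>|lborel. conv k g \<xi>) = c * (LINT x|lborel. g x)" .
qed

text \<open>Young's inequality. Writing k g = sqrt k (sqrt k g), Cauchy--Schwarz bounds the square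
  of the convolution by c times the convolution of k with g^2, which is then integrated by
  Fubini.\<close>

lemma conv_L2_le:
  assumes "kernel k c" "L2_le g b"
  shows "L2_le (conv k g) (c * b)"
proof -
  note k = kernelD[OF assms(1)]
  have g: "integrable lborel (\<lambda>x. (g x)\<^sup>2)" "(LINT x|lborel. (g x)\<^sup>2) \<le> b\<^sup>2" "0 \<le> b"
    using assms(2) by (auto simp: L2_le_iff)
  have [measurable]: "k \<in> borel_measurable borel" "g \<in> borel_measurable borel"
    using k(1) assms(2) by (auto simp: L2_le_iff)
  let ?G = "\<lambda>x. (g x)\<^sup>2"
  have le: "(conv k g \<xi>)\<^sup>2 \<le> c * conv k ?G \<xi>" for \<xi>
  proof -
    have kr: "kernel (\<lambda>\<eta>. k (\<xi> - \<eta>)) c" by (rule kernel_reflect(1)[OF assms(1)])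
    have i1: "integrable lborel (\<lambda>\<eta>. k (\<xi> - \<eta>) * ?G \<eta>)" by (rule conv_integrable_L1[OF assms(1) g(1)])
    have n1: "0 \<le> conv k ?G \<xi>" unfolding conv_def using k(2) by (intro integral_nonneg_AE) auto
    have "L2_le (\<lambda>\<eta>. sqrt (k (\<xi> - \<eta>))) (sqrt c)"
      using kernelD(4-6)[OF kr] k(2) by (auto simp: L2_le_iff)
    moreover have "L2_le (\<lambda>\<eta>. sqrt (k (\<xi> - \<eta>)) * g \<eta>) (sqrt (conv k ?G \<xi>))"
      using k(2) i1 n1 by (auto simp: L2_le_iff power_mult_distrib conv_def)
    ultimately have "(LINT \<eta>|lborel. \<bar>sqrt (k (\<xi> - \<eta>)) * (sqrt (k (\<xi> - \<eta>)) * g \<eta>)\<bar>)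
        \<le> sqrt c * sqrt (conv k ?G \<xi>)" by (rule L2_le_Cauchy_Schwarz)
    then have "(LINT \<eta>|lborel. \<bar>k (\<xi> - \<eta>) * g \<eta>\<bar>) \<le> sqrt c * sqrt (conv k ?G \<xi>)"
      using k(2) by (simp add: mult.assoc[symmetric])
    moreover have "\<bar>conv k g \<xi>\<bar> \<le> (LINT \<eta>|lborel. \<bar>k (\<xi> - \<eta>) * g \<eta>\<bar>)"
      unfolding conv_def by (rule integral_abs_bound)
    ultimately have "\<bar>conv k g \<xi>\<bar> \<le> sqrt (c * conv k ?G \<xi>)" by (simp add: real_sqrt_mult)
    then have "\<bar>conv k g \<xi>\<bar>\<^sup>2 \<le> (sqrt (c * conv k ?G \<xi>))\<^sup>2" by (rule power_mono) simp
    then show ?thesis using n1 k(6) by simp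
  qed
  have i: "integrable lborel (\<lambda>\<xi>. c * conv k ?G \<xi>)"
    using conv_L1(1)[OF assms(1) g(1)] by simp
  have i2: "integrable lborel (\<lambda>\<xi>. (conv k g \<xi>)\<^sup>2)"
  proof (rule Bochner_Integration.integrable_bound[OF i])
    show "AE x in lborel. norm ((conv k g x)\<^sup>2) \<le> norm (c * conv k ?G x)"
      using le by (auto intro!: AE_I2 intro: order_trans[OF _ abs_ge_self])
  qed measurable
  have "(LINT \<xi>|lborel. (conv k g \<xi>)\<^sup>2) \<le> (LINT \<xi>|lborel. c * conv k ?G \<xi>)"
    by (intro integral_mono i2 i le)
  also have "\<dots> = c * (c * (LINT x|lborel. ?G x))" using conv_L1(2)[OF assms(1) g(1)] by simp
  also have "\<dots> \<le> c * (c * b\<^sup>2)" using g(2) k(6) by (intro mult_left_mono) auto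
  finally show ?thesis using g(3) k(6) i2
    by (simp add: L2_le_iff power_mult_distrib power2_eq_square mult_ac)
qed

section \<open>The exponential kernel\<close>

definition exp_kernel :: "real \<Rightarrow> real" where "exp_kernel x = exp (- \<bar>x\<bar>)"

lemma exp_kernel_measurable [measurable]: "exp_kernel \<in> borel_measurable borel"
  unfolding exp_kernel_def by measurable

lemma exp_kernel_pos: "0 < exp_kernel x" and exp_kernel_nonneg [simp]: "0 \<le> exp_kernel x" by (simp_all add: exp_kernel_def)

lemma nn_integral_exp_tail:
  fixes a c :: real
  assumes "c > 0"
  shows "(\<integral>\<^sup>+x. ennreal (exp (- (c * x))) * indicator {a..} x \<partial>lborel) = ennreal (exp (- (c * a)) / c)"
proof -
  have t: "((\<lambda>x. - exp (- (c * x)) / c) \<longlongrightarrow> - 0 / c) at_top"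
    using assms
    by (intro tendsto_intros filterlim_compose[OF exp_at_bot] filterlim_uminus_at_bot_at_top[THEN filterlim_compose]
        filterlim_tendsto_pos_mult_at_top[OF tendsto_const] filterlim_ident) auto
  have "(\<integral>\<^sup>+x. ennreal (exp (- (c * x))) * indicator {a..} x \<partial>lborel) = ennreal (0 - (- exp (- (c * a)) / c))"
    by (rule nn_integral_FTC_atLeast)
      (use t assms in \<open>auto intro!: derivative_eq_intros simp: field_simps\<close>)
  then show ?thesis by simp
qed

lemma exp_abs_tail:
  fixes c R :: real
  assumes c: "c > 0" and R: "R \<ge> 0"
  shows "integrable lborel (\<lambda>x. exp (- (c * \<bar>x\<bar>)) * indicator ({..- R} \<union> {R..}) x)" (is ?A)
    and "(LINT x|lborel. exp (- (c * \<bar>x\<bar>)) * indicator ({..- R} \<union> {R..}) x) \<le> 2 * exp (- (c * R)) / c" (is ?B)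
proof -
  let ?f = "\<lambda>x. exp (- (c * \<bar>x\<bar>)) * indicator ({..- R} \<union> {R..}) x"
  have refl: "(\<integral>\<^sup>+x. ennreal (exp (c * x)) * indicator {..- R} x \<partial>lborel)
      = (\<integral>\<^sup>+x. ennreal (exp (- (c * x))) * indicator {R..} x \<partial>lborel)"
    by (subst nn_integral_real_affine[of _ "-1" 0]) (auto intro!: nn_integral_cong simp: indicator_def)
  have "(\<integral>\<^sup>+x. ennreal (?f x) \<partial>lborel) \<le>
      (\<integral>\<^sup>+x. ennreal (exp (c * x)) * indicator {..- R} x + ennreal (exp (- (c * x))) * indicator {R..} x \<partial>lborel)"
    using R by (intro nn_integral_mono) (auto simp: indicator_def)
  also have "\<dots> = ennreal (exp (- (c * R)) / c) + ennreal (exp (- (c * R)) / c)"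
    by (subst nn_integral_add) (auto simp: refl nn_integral_exp_tail[OF c])
  also have "\<dots> = ennreal (2 * exp (- (c * R)) / c)"
    using c by (subst ennreal_plus[symmetric]) auto
  finally have le: "(\<integral>\<^sup>+x. ennreal (?f x) \<partial>lborel) \<le> ennreal (2 * exp (- (c * R)) / c)" .
  show ?A
    by (rule integrableI_bounded) (use le in \<open>auto simp: top_unique less_top[symmetric] intro: le_less_trans\<close>)
  show ?B
    using le c by (intro integral_real_bounded) auto
qed

lemma exp_kernel_kernel: "\<exists>c. kernel exp_kernel c"
proof -
  have "(\<lambda>x :: real. exp (- (1 * \<bar>x\<bar>)) * indicator ({..- 0} \<union> {0..}) x) = exp_kernel"
    by (auto simp: exp_kernel_def fun_eq_iff indicator_def)
  then have "integrable lborel exp_kernel" using exp_abs_tail(1)[of 1 0] by simp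
  then show ?thesis by (auto simp: kernel_def exp_kernel_def)
qed

text \<open>This is the number 2; it enters constants only and is kept as a symbol.\<close>

definition exp_mass :: real where "exp_mass = (LINT x|lborel. exp_kernel x)"

lemma kernel_exp_kernel: "kernel exp_kernel exp_mass"
  using exp_kernel_kernel by (auto simp: exp_mass_def kernel_def)

lemma kernel_indicator:
  assumes "0 \<le> d" shows "kernel (indicator {0..d}) d"
  using assms by (simp add: kernel_def indicator_le_1)

lemma exp_kernel_shift: "exp_kernel (x - a) \<le> exp \<bar>x - y\<bar> * exp_kernel (y - a)"
  unfolding exp_kernel_def exp_add[symmetric] by (simp add: exp_add[symmetric])

text \<open>A Harnack inequality: by the triangle inequality the kernel seen from x is at most
  e^{|x-y|} times the kernel seen from y, and g has a sign.\<close>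

lemma conv_exp_kernel_shift:
  assumes "L2_le g b" "\<And>x. 0 \<le> g x"
  shows "conv exp_kernel g x \<le> exp \<bar>x - y\<bar> * conv exp_kernel g y"
proof -
  have "conv exp_kernel g x \<le> (LINT \<eta>|lborel. exp \<bar>x - y\<bar> * (exp_kernel (y - \<eta>) * g \<eta>))"
    unfolding conv_def
  proof (rule integral_mono)
    show "integrable lborel (\<lambda>\<eta>. exp_kernel (x - \<eta>) * g \<eta>)" "integrable lborel (\<lambda>\<eta>. exp \<bar>x - y\<bar> * (exp_kernel (y - \<eta>) * g \<eta>))"
      using conv_integrable_L2[OF kernel_exp_kernel assms(1)] by auto
    fix \<eta>
    show "exp_kernel (x - \<eta>) * g \<eta> \<le> exp \<bar>x - y\<bar> * (exp_kernel (y - \<eta>) * g \<eta>)"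
      using mult_right_mono[OF exp_kernel_shift[of x \<eta> y] assms(2)[of \<eta>]] by (simp add: mult.assoc)
  qed
  then show ?thesis by (simp add: conv_def)
qed

lemma conv_nonneg: "kernel k c \<Longrightarrow> (\<And>x. 0 \<le> g x) \<Longrightarrow> 0 \<le> conv k g \<xi>"
  unfolding conv_def by (intro integral_nonneg_AE AE_I2 mult_nonneg_nonneg) (auto simp: kernel_def)

section \<open>The space \<open>F\<close> and the nonlocal terms\<close>

text \<open>In products one factor is estimated in L^\<infinity> and the other in L^2; U, P and Q
  have to serve in both roles.\<close>

definition L2_Linf_le :: "(real \<Rightarrow> real) \<Rightarrow> real \<Rightarrow> bool" where
  "L2_Linf_le f a \<longleftrightarrow> L2_le f a \<and> Linf_le f a"

lemma L2_Linf_leD: "L2_Linf_le f a \<Longrightarrow> L2_le f a" "L2_Linf_le f a \<Longrightarrow> Linf_le f a"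
  by (auto simp: L2_Linf_le_def)

lemma L2_Linf_le_add: "L2_Linf_le f a \<Longrightarrow> L2_Linf_le g b \<Longrightarrow> L2_Linf_le (\<lambda>x. f x + g x) (a + b)"
  by (simp add: L2_Linf_le_def L2_le_add Linf_le_add)
lemma L2_Linf_le_diff: "L2_Linf_le f a \<Longrightarrow> L2_Linf_le g b \<Longrightarrow> L2_Linf_le (\<lambda>x. f x - g x) (a + b)"
  by (simp add: L2_Linf_le_def L2_le_diff Linf_le_diff)
lemma L2_Linf_le_cmult: "L2_Linf_le f a \<Longrightarrow> L2_Linf_le (\<lambda>x. c * f x) (\<bar>c\<bar> * a)"
  by (simp add: L2_Linf_le_def L2_le_cmult Linf_le_cmult)
lemma L2_Linf_le_mult: "Linf_le f a \<Longrightarrow> L2_Linf_le g b \<Longrightarrow> L2_Linf_le (\<lambda>x. f x * g x) (a * b)"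
  by (simp add: L2_Linf_le_def L2_le_mult Linf_le_mult)
lemma L2_Linf_le_weaken: "L2_Linf_le f a \<Longrightarrow> a \<le> b \<Longrightarrow> L2_Linf_le f b"
  using L2_le_weaken Linf_le_weaken by (auto simp: L2_Linf_le_def)
lemma L2_Linf_le_0: "L2_Linf_le (\<lambda>x. 0) 0"
  by (simp add: L2_Linf_le_def L2_le_0 Linf_le_0)
lemma L2_Linf_le_nonneg: "L2_Linf_le f a \<Longrightarrow> 0 \<le> a"
  using L2_le_nonneg by (auto simp: L2_Linf_le_def)

lemma lag_sel [simp]:
  "l_zeta (X + Y) = (\<lambda>x. l_zeta X x + l_zeta Y x)" "l_U (X + Y) = (\<lambda>x. l_U X x + l_U Y x)"
  "l_H (X + Y) = (\<lambda>x. l_H X x + l_H Y x)" "l_v (X + Y) = (\<lambda>x. l_v X x + l_v Y x)"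
  "l_w (X + Y) = (\<lambda>x. l_w X x + l_w Y x)" "l_h (X + Y) = (\<lambda>x. l_h X x + l_h Y x)"
  "l_zeta (X - Y) = (\<lambda>x. l_zeta X x - l_zeta Y x)" "l_U (X - Y) = (\<lambda>x. l_U X x - l_U Y x)"
  "l_H (X - Y) = (\<lambda>x. l_H X x - l_H Y x)" "l_v (X - Y) = (\<lambda>x. l_v X x - l_v Y x)"
  "l_w (X - Y) = (\<lambda>x. l_w X x - l_w Y x)" "l_h (X - Y) = (\<lambda>x. l_h X x - l_h Y x)"
  "l_zeta (- Y) = (\<lambda>x. - l_zeta Y x)" "l_U (- Y) = (\<lambda>x. - l_U Y x)"
  "l_H (- Y) = (\<lambda>x. - l_H Y x)" "l_v (- Y) = (\<lambda>x. - l_v Y x)"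
  "l_w (- Y) = (\<lambda>x. - l_w Y x)" "l_h (- Y) = (\<lambda>x. - l_h Y x)"
  "l_zeta (c *\<^sub>R Y) = (\<lambda>x. c * l_zeta Y x)" "l_U (c *\<^sub>R Y) = (\<lambda>x. c * l_U Y x)"
  "l_H (c *\<^sub>R Y) = (\<lambda>x. c * l_H Y x)" "l_v (c *\<^sub>R Y) = (\<lambda>x. c * l_v Y x)"
  "l_w (c *\<^sub>R Y) = (\<lambda>x. c * l_w Y x)" "l_h (c *\<^sub>R Y) = (\<lambda>x. c * l_h Y x)"
  "l_zeta 0 = (\<lambda>x. 0)" "l_U 0 = (\<lambda>x. 0)" "l_H 0 = (\<lambda>x. 0)" "l_v 0 = (\<lambda>x. 0)"
  "l_w 0 = (\<lambda>x. 0)" "l_h 0 = (\<lambda>x. 0)"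
  by (simp_all add: plus_lag_def minus_lag_def uminus_lag_def scaleR_lag_def zero_lag_def)

text \<open>A common bound for the seven seminorms that add up to \<open>F_norm\<close>; passing
  back to the sum is the origin of every factor 7 below.\<close>

definition comps_le :: "lag \<Rightarrow> real \<Rightarrow> bool" where
  "comps_le Y a \<longleftrightarrow> Linf_le (l_zeta Y) a \<and> L2_Linf_le (l_U Y) a \<and> Linf_le (l_H Y) a \<and>
     L2_le (l_v Y) a \<and> L2_le (l_w Y) a \<and> L2_le (l_h Y) a"

lemma comps_le_of_F_norm:
  assumes "Y \<in> FF" "F_norm Y \<le> a" shows "comps_le Y a"
proof -
  note nn = Linf_norm_nonneg[of "l_zeta Y"] Linf_norm_nonneg[of "l_U Y"] Linf_norm_nonneg[of "l_H Y"]
    L2_norm_nonneg[of "l_U Y"] L2_norm_nonneg[of "l_v Y"] L2_norm_nonneg[of "l_w Y"] L2_norm_nonneg[of "l_h Y"]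
  show ?thesis
    using assms nn unfolding comps_le_def L2_Linf_le_def Linf_le_iff L2_le_def FF_def F_norm_def mem_Collect_eq
    by linarith
qed

lemma comps_le_imp: "comps_le Y a \<Longrightarrow> Y \<in> FF" "comps_le Y a \<Longrightarrow> F_norm Y \<le> 7 * a"
  unfolding comps_le_def L2_Linf_le_def Linf_le_iff L2_le_def FF_def F_norm_def mem_Collect_eq by linarith+

lemma comps_le_nonneg: "comps_le Y a \<Longrightarrow> 0 \<le> a"
  using Linf_le_nonneg by (auto simp: comps_le_def)

lemma comps_le_measurable:
  assumes "comps_le Y a"
  shows "l_zeta Y \<in> borel_measurable borel" "l_U Y \<in> borel_measurable borel"
    "l_H Y \<in> borel_measurable borel" "l_v Y \<in> borel_measurable borel"
    "l_w Y \<in> borel_measurable borel" "l_h Y \<in> borel_measurable borel"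
  using assms by (auto simp: comps_le_def L2_Linf_le_def Linf_le_def L2_le_iff)

lemma FF_measurable:
  assumes "Y \<in> FF"
  shows "l_zeta Y \<in> borel_measurable borel" "l_U Y \<in> borel_measurable borel"
    "l_H Y \<in> borel_measurable borel" "l_v Y \<in> borel_measurable borel"
    "l_w Y \<in> borel_measurable borel" "l_h Y \<in> borel_measurable borel"
  using comps_le_measurable[OF comps_le_of_F_norm[OF assms order_refl]] .

lemma F_norm_nonneg [simp]: "0 \<le> F_norm Y"
  by (simp add: F_norm_def)

lemma FF_0: "0 \<in> FF" and F_norm_0 [simp]: "F_norm 0 = 0"
proof -
  have "comps_le 0 0" by (simp add: comps_le_def L2_Linf_le_0 Linf_le_0 L2_le_0)
  from comps_le_imp[OF this] show "0 \<in> FF" "F_norm 0 = 0" by (auto intro: antisym)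
qed

lemma F_norm_add:
  assumes "X \<in> FF" "Y \<in> FF" shows "X + Y \<in> FF" "F_norm (X + Y) \<le> F_norm X + F_norm Y"
proof -
  note X = assms(1)[unfolded FF_def mem_Collect_eq] and Y = assms(2)[unfolded FF_def mem_Collect_eq]
  note ii = Linf_le_add[OF Linf_le_norm Linf_le_norm, unfolded Linf_le_iff]
  note ll = L2_le_add[OF L2_le_norm L2_le_norm, unfolded L2_le_def]
  show "X + Y \<in> FF" using X Y ii ll by (simp add: FF_def)
  have "Linf_norm (l_zeta (X + Y)) \<le> Linf_norm (l_zeta X) + Linf_norm (l_zeta Y)"
    "Linf_norm (l_U (X + Y)) \<le> Linf_norm (l_U X) + Linf_norm (l_U Y)"
    "Linf_norm (l_H (X + Y)) \<le> Linf_norm (l_H X) + Linf_norm (l_H Y)"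
    "L2_norm (l_U (X + Y)) \<le> L2_norm (l_U X) + L2_norm (l_U Y)"
    "L2_norm (l_v (X + Y)) \<le> L2_norm (l_v X) + L2_norm (l_v Y)"
    "L2_norm (l_w (X + Y)) \<le> L2_norm (l_w X) + L2_norm (l_w Y)"
    "L2_norm (l_h (X + Y)) \<le> L2_norm (l_h X) + L2_norm (l_h Y)"
    using X Y ii ll by simp_all
  then show "F_norm (X + Y) \<le> F_norm X + F_norm Y" unfolding F_norm_def by linarith
qed

lemma F_norm_scaleR:
  assumes "X \<in> FF" shows "c *\<^sub>R X \<in> FF" "F_norm (c *\<^sub>R X) \<le> \<bar>c\<bar> * F_norm X"
proof -
  note X = assms[unfolded FF_def mem_Collect_eq]
  note ii = Linf_le_cmult[OF Linf_le_norm, unfolded Linf_le_iff]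
  note ll = L2_le_cmult[OF L2_le_norm, unfolded L2_le_def]
  show "c *\<^sub>R X \<in> FF" using X ii ll by (simp add: FF_def)
  have "Linf_norm (l_zeta (c *\<^sub>R X)) \<le> \<bar>c\<bar> * Linf_norm (l_zeta X)"
    "Linf_norm (l_U (c *\<^sub>R X)) \<le> \<bar>c\<bar> * Linf_norm (l_U X)"
    "Linf_norm (l_H (c *\<^sub>R X)) \<le> \<bar>c\<bar> * Linf_norm (l_H X)"
    "L2_norm (l_U (c *\<^sub>R X)) \<le> \<bar>c\<bar> * L2_norm (l_U X)"
    "L2_norm (l_v (c *\<^sub>R X)) \<le> \<bar>c\<bar> * L2_norm (l_v X)"
    "L2_norm (l_w (c *\<^sub>R X)) \<le> \<bar>c\<bar> * L2_norm (l_w X)"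
    "L2_norm (l_h (c *\<^sub>R X)) \<le> \<bar>c\<bar> * L2_norm (l_h X)"
    using X ii ll by simp_all
  then show "F_norm (c *\<^sub>R X) \<le> \<bar>c\<bar> * F_norm X"
    unfolding F_norm_def by (simp add: distrib_left)
qed

lemma F_norm_minus: "F_norm (- X) = F_norm X"
  by (simp add: F_norm_def Linf_norm_def L2_norm_def)

lemma FF_minus: "X \<in> FF \<Longrightarrow> - X \<in> FF"
  using F_norm_scaleR(1)[of X "-1"] by simp

lemma F_norm_diff:
  assumes "X \<in> FF" "Y \<in> FF" shows "X - Y \<in> FF" "F_norm (X - Y) \<le> F_norm X + F_norm Y"
  using F_norm_add[OF assms(1) FF_minus[OF assms(2)]] by (simp_all add: F_norm_minus)

lemma F_norm_commute: "F_norm (X - Y) = F_norm (Y - X)"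
  using F_norm_minus[of "X - Y"] by simp

lemma F_norm_triangle:
  assumes "X \<in> FF" "Y \<in> FF" "Z \<in> FF" shows "F_norm (X - Z) \<le> F_norm (X - Y) + F_norm (Y - Z)"
  using F_norm_add(2)[OF F_norm_diff(1)[OF assms(1,2)] F_norm_diff(1)[OF assms(2,3)]] by simp

lemma F_norm_triangle_sub:
  assumes "X \<in> FF" "Y \<in> FF" shows "F_norm X \<le> F_norm Y + F_norm (X - Y)"
  using F_norm_add(2)[OF assms(2) F_norm_diff(1)[OF assms]] by simp

section \<open>The source and the nonlocal integrals\<close>

definition source :: "real \<Rightarrow> lag \<Rightarrow> real \<Rightarrow> real" where
  "source \<gamma> Y \<eta> = (3 - 2 * \<gamma>) / 2 * (l_U Y \<eta>)\<^sup>2 * l_q Y \<eta> + \<gamma> / 2 * l_h Y \<eta>"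

definition source_const :: "real \<Rightarrow> real \<Rightarrow> real" where
  "source_const \<gamma> M = \<bar>(3 - 2 * \<gamma>) / 2\<bar> * (2 * M + M\<^sup>2 + 2 * M * M) + \<bar>\<gamma> / 2\<bar>"

text \<open>Since q = 1 + v with only v in L^2, the 1 is split off before telescoping: U1^2 q1 -
  U2^2 q2 = (U1+U2)(U1-U2) + U1^2 (v1-v2) + (U1+U2)(U1-U2) v2. Each summand has exactly one factor
  taken in L^2, and \<open>source_const\<close> collects the coefficients.\<close>

lemma source_diff_L2_le:
  assumes "comps_le Y1 M" "comps_le Y2 M" "comps_le (Y1 - Y2) d"
  shows "L2_le (\<lambda>x. source \<gamma> Y1 x - source \<gamma> Y2 x) (source_const \<gamma> M * d)"
proof -
  note f1 = assms(1)[unfolded comps_le_def L2_Linf_le_def] and f2 = assms(2)[unfolded comps_le_def L2_Linf_le_def]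
    and f3 = assms(3)[unfolded comps_le_def L2_Linf_le_def lag_sel]
  let ?dU = "\<lambda>x. l_U Y1 x - l_U Y2 x" and ?sU = "\<lambda>x. l_U Y1 x + l_U Y2 x"
  have s: "Linf_le ?sU (M + M)" using f1 f2 by (intro Linf_le_add) auto
  have a: "L2_le (\<lambda>x. ?sU x * ?dU x) ((M + M) * d)"
    using s f3 by (intro L2_le_mult) auto
  have b: "L2_le (\<lambda>x. (l_U Y1 x)\<^sup>2 * (l_v Y1 x - l_v Y2 x)) (M\<^sup>2 * d)"
    using f1 f3 by (intro L2_le_mult Linf_le_power2) auto
  have c: "L2_le (\<lambda>x. (?sU x * ?dU x) * l_v Y2 x) ((M + M) * d * M)"
    using s f2 f3 by (intro L2_le_mult Linf_le_mult) auto
  have dd: "L2_le (\<lambda>x. (3 - 2 * \<gamma>) / 2 * (?sU x * ?dU x + ((l_U Y1 x)\<^sup>2 * (l_v Y1 x - l_v Y2 x) + (?sU x * ?dU x) * l_v Y2 x))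
      + \<gamma> / 2 * (l_h Y1 x - l_h Y2 x))
      (\<bar>(3 - 2 * \<gamma>) / 2\<bar> * ((M + M) * d + (M\<^sup>2 * d + (M + M) * d * M)) + \<bar>\<gamma> / 2\<bar> * d)"
    using f3 by (intro L2_le_add L2_le_cmult a b c) auto
  have "(\<lambda>x. source \<gamma> Y1 x - source \<gamma> Y2 x) =
    (\<lambda>x. (3 - 2 * \<gamma>) / 2 * (?sU x * ?dU x + ((l_U Y1 x)\<^sup>2 * (l_v Y1 x - l_v Y2 x) + (?sU x * ?dU x) * l_v Y2 x))
      + \<gamma> / 2 * (l_h Y1 x - l_h Y2 x))"
    unfolding source_def l_q_def by (rule ext) algebra
  moreover have "source_const \<gamma> M * d = \<bar>(3 - 2 * \<gamma>) / 2\<bar> * ((M + M) * d + (M\<^sup>2 * d + (M + M) * d * M)) + \<bar>\<gamma> / 2\<bar> * d"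
    unfolding source_const_def by algebra
  ultimately show ?thesis using dd by simp
qed

lemma comps_le_0: "0 \<le> M \<Longrightarrow> comps_le 0 M"
  by (simp add: comps_le_def L2_Linf_le_def Linf_le_def L2_le_iff)

lemma source_L2_le:
  assumes "comps_le Y M" shows "L2_le (source \<gamma> Y) (source_const \<gamma> M * M)"
  using source_diff_L2_le[OF assms comps_le_0, of M \<gamma>] assms comps_le_nonneg[OF assms]
  by (simp add: source_def[of \<gamma> 0])

lemma source_const_nonneg: "0 \<le> M \<Longrightarrow> 0 \<le> source_const \<gamma> M"
  by (simp add: source_const_def)

definition expo :: "lag \<Rightarrow> real \<Rightarrow> real \<Rightarrow> real" where
  "expo Y \<xi> \<eta> = sgn (\<xi> - \<eta>) * (l_y Y \<xi> - l_y Y \<eta>)"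

text \<open>With s = 1 this is 2P and with s = \<open>sgn\<close> it is -2Q, so every estimate is
  proved once for both.\<close>

definition nonloc :: "(real \<Rightarrow> real) \<Rightarrow> real \<Rightarrow> lag \<Rightarrow> real \<Rightarrow> real" where
  "nonloc s \<gamma> Y \<xi> = (LINT \<eta>|lborel. s (\<xi> - \<eta>) * (exp (- expo Y \<xi> \<eta>) * source \<gamma> Y \<eta>))"

lemma PP_nonloc: "PP \<gamma> Y \<xi> = 1 / 2 * nonloc (\<lambda>_. 1) \<gamma> Y \<xi>"
  by (simp add: PP_def nonloc_def expo_def source_def)

lemma QQ_nonloc: "QQ \<gamma> Y \<xi> = - 1 / 2 * nonloc sgn \<gamma> Y \<xi>"
  by (simp add: QQ_def nonloc_def expo_def source_def mult.assoc)

definition sgn_or_one :: "(real \<Rightarrow> real) \<Rightarrow> bool" where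
  "sgn_or_one s \<longleftrightarrow> s = (\<lambda>_. 1) \<or> s = sgn"

lemma sgn_or_one:
  assumes "sgn_or_one s" shows "s \<in> borel_measurable borel" "\<bar>s x\<bar> \<le> 1"
  using assms by (auto simp: sgn_or_one_def sgn_if)

text \<open>Numerical states offer no monotonicity of y. Instead y differs from the identity by
  zeta, which occurs at two points, so the exponent differs from |\<xi> - \<eta>| by at most
  2M.\<close>

lemma expo_ge:
  assumes "\<And>x. \<bar>l_zeta Y x\<bar> \<le> M"
  shows "exp (- expo Y \<xi> \<eta>) \<le> exp (2 * M) * exp_kernel (\<xi> - \<eta>)"
  using assms[of \<xi>] assms[of \<eta>] unfolding expo_def exp_kernel_def l_y_def exp_add[symmetric] exp_le_cancel_iff
  by (auto simp: sgn_if abs_if split: if_splits)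

lemma expo_measurable:
  assumes [measurable]: "l_zeta Y \<in> borel_measurable borel"
  shows "(\<lambda>(\<xi>, \<eta>). expo Y \<xi> \<eta>) \<in> borel_measurable (borel \<Otimes>\<^sub>M borel)"
  unfolding expo_def l_y_def by measurable

text \<open>Mean value inequality for e^{-t}. The bound c is left free because it will depend on the
  point and carry the decay of the kernel into the difference.\<close>

lemma abs_exp_diff_le:
  fixes a b c :: real
  assumes "exp (- a) \<le> c" "exp (- b) \<le> c"
  shows "\<bar>exp (- a) - exp (- b)\<bar> \<le> \<bar>a - b\<bar> * c"
proof -
  have *: "exp (- y) - exp (- x) \<le> (x - y) * exp (- y)" for x y :: real
  proof -
    have "1 + (y - x) \<le> exp (y - x)" by (rule exp_ge_add_one_self)
    then have "(1 + (y - x)) * exp (- y) \<le> exp (y - x) * exp (- y)"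
      by (intro mult_right_mono) auto
    also have "\<dots> = exp (- x)" by (simp add: exp_add[symmetric])
    finally show ?thesis by (simp add: algebra_simps)
  qed
  show ?thesis
  proof (cases "a \<le> b")
    case True
    then have "\<bar>exp (- a) - exp (- b)\<bar> = exp (- a) - exp (- b)" by simp
    also have "\<dots> \<le> (b - a) * exp (- a)" by (rule *)
    also have "\<dots> \<le> (b - a) * c" using True assms by (intro mult_left_mono) auto
    finally show ?thesis using True by simp
  next
    case False
    then have "\<bar>exp (- a) - exp (- b)\<bar> = exp (- b) - exp (- a)" by simp
    also have "\<dots> \<le> (a - b) * exp (- b)" by (rule *)
    also have "\<dots> \<le> (a - b) * c" using False assms by (intro mult_left_mono) auto
    finally show ?thesis using False by simp
  qed
qed

text \<open>The kernel is evaluated at individual points \<xi>, so zeta is bounded everywhere and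
  not merely almost everywhere.\<close>

locale nonloc_setting =
  fixes s :: "real \<Rightarrow> real" and \<gamma> :: real and Y :: lag and M :: real
  assumes s: "sgn_or_one s" and comps_le: "comps_le Y M" and zeta: "\<bar>l_zeta Y x\<bar> \<le> M"
begin

lemma M_nonneg: "0 \<le> M" by (rule comps_le_nonneg[OF comps_le])

lemma source_L2: "L2_le (source \<gamma> Y) (source_const \<gamma> M * M)"
  by (rule source_L2_le[OF comps_le])

lemma [measurable]: "l_zeta Y \<in> borel_measurable borel" "source \<gamma> Y \<in> borel_measurable borel"
  "s \<in> borel_measurable borel" "(\<lambda>(\<xi>, \<eta>). expo Y \<xi> \<eta>) \<in> borel_measurable (borel \<Otimes>\<^sub>M borel)"
  using comps_le_measurable[OF comps_le] L2_le_measurable[OF source_L2] sgn_or_one[OF s] expo_measurable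
  by auto

lemma integrand_bound:
  "\<bar>s (\<xi> - \<eta>) * (exp (- expo Y \<xi> \<eta>) * source \<gamma> Y \<eta>)\<bar> \<le> exp (2 * M) * (exp_kernel (\<xi> - \<eta>) * \<bar>source \<gamma> Y \<eta>\<bar>)"
proof -
  have "\<bar>s (\<xi> - \<eta>) * (exp (- expo Y \<xi> \<eta>) * source \<gamma> Y \<eta>)\<bar>
      = \<bar>s (\<xi> - \<eta>)\<bar> * (exp (- expo Y \<xi> \<eta>) * \<bar>source \<gamma> Y \<eta>\<bar>)" by (simp add: abs_mult)
  also have "\<dots> \<le> 1 * ((exp (2 * M) * exp_kernel (\<xi> - \<eta>)) * \<bar>source \<gamma> Y \<eta>\<bar>)"
    using sgn_or_one(2)[OF s] expo_ge[of Y M \<xi> \<eta>, OF zeta] by (intro mult_mono) auto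
  finally show ?thesis by (simp add: mult.assoc)
qed

lemma integrable_bnd:
  "integrable lborel (\<lambda>\<eta>. exp (2 * M) * (exp_kernel (\<xi> - \<eta>) * \<bar>source \<gamma> Y \<eta>\<bar>))"
  using conv_integrable_L2[OF kernel_exp_kernel L2_le_abs[OF source_L2]] by simp

lemma integrand_integrable:
  "integrable lborel (\<lambda>\<eta>. s (\<xi> - \<eta>) * (exp (- expo Y \<xi> \<eta>) * source \<gamma> Y \<eta>))"
  by (rule Bochner_Integration.integrable_bound[OF integrable_bnd[of \<xi>]])
    (use integrand_bound in \<open>auto intro!: AE_I2 intro: order_trans[OF _ abs_ge_self]\<close>)

lemma nonloc_measurable [measurable]: "nonloc s \<gamma> Y \<in> borel_measurable borel"
  unfolding nonloc_def by measurable

lemma nonloc_bound: "\<bar>nonloc s \<gamma> Y \<xi>\<bar> \<le> exp (2 * M) * conv exp_kernel (\<lambda>\<eta>. \<bar>source \<gamma> Y \<eta>\<bar>) \<xi>"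
proof -
  have "\<bar>nonloc s \<gamma> Y \<xi>\<bar> \<le> (LINT \<eta>|lborel. \<bar>s (\<xi> - \<eta>) * (exp (- expo Y \<xi> \<eta>) * source \<gamma> Y \<eta>)\<bar>)"
    unfolding nonloc_def by (rule integral_abs_bound)
  also have "\<dots> \<le> (LINT \<eta>|lborel. exp (2 * M) * (exp_kernel (\<xi> - \<eta>) * \<bar>source \<gamma> Y \<eta>\<bar>))"
    using integrable_abs[OF integrand_integrable] by (intro integral_mono integrable_bnd integrand_bound) auto
  finally show ?thesis by (simp add: conv_def)
qed

end

text \<open>The product of kernel and source is telescoped. The change of the kernel carries 2d
  because the exponent contains zeta at \<xi> and at \<eta>. The estimate stays pointwise, as a
  convolution, so that it survives sampling.\<close>

lemma nonloc_diff:
  assumes "nonloc_setting s Y1 M" "nonloc_setting s Y2 M" "comps_le (Y1 - Y2) d"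
    and z: "\<And>x. \<bar>l_zeta Y1 x - l_zeta Y2 x\<bar> \<le> d"
  shows "\<bar>nonloc s \<gamma> Y1 \<xi> - nonloc s \<gamma> Y2 \<xi>\<bar> \<le>
    exp (2 * M) * conv exp_kernel (\<lambda>\<eta>. 2 * d * \<bar>source \<gamma> Y1 \<eta>\<bar> + \<bar>source \<gamma> Y1 \<eta> - source \<gamma> Y2 \<eta>\<bar>) \<xi>"
proof -
  interpret A: nonloc_setting s \<gamma> Y1 M by fact
  interpret B: nonloc_setting s \<gamma> Y2 M by fact
  have d: "0 \<le> d" by (rule comps_le_nonneg[OF assms(3)])
  let ?g = "\<lambda>\<eta>. 2 * d * \<bar>source \<gamma> Y1 \<eta>\<bar> + \<bar>source \<gamma> Y1 \<eta> - source \<gamma> Y2 \<eta>\<bar>"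
  have g: "L2_le ?g (\<bar>2 * d\<bar> * (source_const \<gamma> M * M) + source_const \<gamma> M * d)"
    by (intro L2_le_add L2_le_cmult L2_le_abs A.source_L2 source_diff_L2_le[OF A.comps_le B.comps_le assms(3)])
  have gi: "integrable lborel (\<lambda>\<eta>. exp (2 * M) * (exp_kernel (\<xi> - \<eta>) * ?g \<eta>))"
    using conv_integrable_L2[OF kernel_exp_kernel g] by simp
  have pt: "\<bar>s (\<xi> - \<eta>) * (exp (- expo Y1 \<xi> \<eta>) * source \<gamma> Y1 \<eta>) - s (\<xi> - \<eta>) * (exp (- expo Y2 \<xi> \<eta>) * source \<gamma> Y2 \<eta>)\<bar>
    \<le> exp (2 * M) * (exp_kernel (\<xi> - \<eta>) * ?g \<eta>)" for \<eta>
  proof -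
    let ?e = "exp (2 * M) * exp_kernel (\<xi> - \<eta>)"
    have e: "exp (- expo Y1 \<xi> \<eta>) \<le> ?e" "exp (- expo Y2 \<xi> \<eta>) \<le> ?e"
      using expo_ge[of Y1 M] expo_ge[of Y2 M] A.zeta B.zeta by auto
    have "\<bar>exp (- expo Y1 \<xi> \<eta>) - exp (- expo Y2 \<xi> \<eta>)\<bar> \<le> \<bar>expo Y1 \<xi> \<eta> - expo Y2 \<xi> \<eta>\<bar> * ?e"
      by (rule abs_exp_diff_le[OF e])
    also have "\<dots> \<le> (2 * d) * ?e"
      using z[of \<xi>] z[of \<eta>] exp_kernel_pos[of "\<xi> - \<eta>"]
      by (intro mult_right_mono) (auto simp: expo_def l_y_def sgn_if abs_if split: if_splits)
    finally have de: "\<bar>exp (- expo Y1 \<xi> \<eta>) - exp (- expo Y2 \<xi> \<eta>)\<bar> \<le> (2 * d) * ?e" .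
    have "\<bar>s (\<xi> - \<eta>) * (exp (- expo Y1 \<xi> \<eta>) * source \<gamma> Y1 \<eta>) - s (\<xi> - \<eta>) * (exp (- expo Y2 \<xi> \<eta>) * source \<gamma> Y2 \<eta>)\<bar>
      = \<bar>s (\<xi> - \<eta>)\<bar> * \<bar>(exp (- expo Y1 \<xi> \<eta>) - exp (- expo Y2 \<xi> \<eta>)) * source \<gamma> Y1 \<eta>
          + exp (- expo Y2 \<xi> \<eta>) * (source \<gamma> Y1 \<eta> - source \<gamma> Y2 \<eta>)\<bar>"
      unfolding abs_mult[symmetric] by (simp add: algebra_simps)
    also have "\<dots> \<le> 1 * (\<bar>(exp (- expo Y1 \<xi> \<eta>) - exp (- expo Y2 \<xi> \<eta>)) * source \<gamma> Y1 \<eta>\<bar>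
          + \<bar>exp (- expo Y2 \<xi> \<eta>) * (source \<gamma> Y1 \<eta> - source \<gamma> Y2 \<eta>)\<bar>)"
      using sgn_or_one(2)[OF A.s] by (intro mult_mono abs_triangle_ineq) auto
    also have "\<dots> \<le> 1 * (((2 * d) * ?e) * \<bar>source \<gamma> Y1 \<eta>\<bar> + ?e * \<bar>source \<gamma> Y1 \<eta> - source \<gamma> Y2 \<eta>\<bar>)"
      unfolding abs_mult using de e d by (intro mult_mono add_mono) auto
    also have "\<dots> = exp (2 * M) * (exp_kernel (\<xi> - \<eta>) * ?g \<eta>)" by (simp add: algebra_simps)
    finally show ?thesis .
  qed
  have "\<bar>nonloc s \<gamma> Y1 \<xi> - nonloc s \<gamma> Y2 \<xi>\<bar> = \<bar>LINT \<eta>|lborel. s (\<xi> - \<eta>) * (exp (- expo Y1 \<xi> \<eta>) * source \<gamma> Y1 \<eta>) - s (\<xi> - \<eta>) * (exp (- expo Y2 \<xi> \<eta>) * source \<gamma> Y2 \<eta>)\<bar>"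
    unfolding nonloc_def by (subst Bochner_Integration.integral_diff[OF A.integrand_integrable B.integrand_integrable]) simp
  also have "\<dots> \<le> (LINT \<eta>|lborel. \<bar>s (\<xi> - \<eta>) * (exp (- expo Y1 \<xi> \<eta>) * source \<gamma> Y1 \<eta>) - s (\<xi> - \<eta>) * (exp (- expo Y2 \<xi> \<eta>) * source \<gamma> Y2 \<eta>)\<bar>)"
    by (rule integral_abs_bound)
  also have "\<dots> \<le> (LINT \<eta>|lborel. exp (2 * M) * (exp_kernel (\<xi> - \<eta>) * ?g \<eta>))"
    using A.integrand_integrable B.integrand_integrable by (intro integral_mono gi pt) auto
  finally show ?thesis by (simp add: conv_def)
qed

text \<open>The kernel is compared at two points \<open>x \<le> \<xi>\<close> of one cell; the sign jumps only for \<open>\<eta>\<close>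
  between them, which contributes the integral of the source over the cell.\<close>

lemma nonloc_shift:
  assumes "nonloc_setting s Y M" and x: "x \<le> \<xi>" "\<xi> \<le> x + d" and d: "d \<le> 1"
    and osc: "\<And>a. a \<in> {x..\<xi>} \<Longrightarrow> \<bar>l_y Y a - l_y Y x\<bar> \<le> \<rho>" "\<And>a. a \<in> {x..\<xi>} \<Longrightarrow> \<bar>l_y Y \<xi> - l_y Y a\<bar> \<le> \<rho>"
  shows "\<bar>nonloc s \<gamma> Y \<xi> - nonloc s \<gamma> Y x\<bar> \<le>
    exp (2 * M + 1) * (2 * \<rho> * conv exp_kernel (\<lambda>\<eta>. \<bar>source \<gamma> Y \<eta>\<bar>) \<xi> + 2 * conv (indicator {0..d}) (\<lambda>\<eta>. \<bar>source \<gamma> Y \<eta>\<bar>) \<xi>)"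
proof -
  interpret nonloc_setting s \<gamma> Y M by fact
  have rho: "0 \<le> \<rho>" using osc(1)[of x] x by auto
  have dn: "0 \<le> d" using x by simp
  let ?f = "\<lambda>\<eta>. \<bar>source \<gamma> Y \<eta>\<bar>"
  let ?g = "\<lambda>\<eta>. exp (2 * M + 1) * (2 * \<rho> * (exp_kernel (\<xi> - \<eta>) * ?f \<eta>) + 2 * (indicator {0..d} (\<xi> - \<eta>) * ?f \<eta>))"
  have i1: "integrable lborel (\<lambda>\<eta>. exp_kernel (\<xi> - \<eta>) * ?f \<eta>)"
    by (rule conv_integrable_L2[OF kernel_exp_kernel L2_le_abs[OF source_L2]])
  have i2: "integrable lborel (\<lambda>\<eta>. indicator {0..d} (\<xi> - \<eta>) * ?f \<eta>)"
    by (rule conv_integrable_L2[OF kernel_indicator[OF dn] L2_le_abs[OF source_L2]])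
  have gi: "integrable lborel ?g" using i1 i2 by simp
  have pt: "\<bar>s (\<xi> - \<eta>) * (exp (- expo Y \<xi> \<eta>) * source \<gamma> Y \<eta>) - s (x - \<eta>) * (exp (- expo Y x \<eta>) * source \<gamma> Y \<eta>)\<bar> \<le> ?g \<eta>" for \<eta>
  proof -
    \<comment> \<open>The points x and \<xi> are at most 1 apart, so moving the kernel from x to
      \<xi> costs a factor e; this is the summand 1 in the exponent.\<close>
    let ?E = "exp (2 * M + 1) * exp_kernel (\<xi> - \<eta>)"
    have e1: "exp (- expo Y \<xi> \<eta>) \<le> exp (2 * M) * exp_kernel (\<xi> - \<eta>)" and e2: "exp (- expo Y x \<eta>) \<le> exp (2 * M) * exp_kernel (x - \<eta>)"
      using expo_ge[of Y M] zeta by auto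
    have ek1: "exp_kernel (x - \<eta>) \<le> exp 1 * exp_kernel (\<xi> - \<eta>)"
      using exp_kernel_shift[of x \<eta> \<xi>] x d exp_kernel_pos[of "\<xi> - \<eta>"]
      by (elim order_trans) (intro mult_right_mono, auto)
    have "exp (2 * M) * exp_kernel (x - \<eta>) \<le> exp (2 * M) * (exp 1 * exp_kernel (\<xi> - \<eta>))"
      by (intro mult_left_mono ek1) auto
    from order_trans[OF e2 this] have E2: "exp (- expo Y x \<eta>) \<le> ?E" by (simp add: exp_add mult.assoc)
    have "exp (2 * M) * exp_kernel (\<xi> - \<eta>) \<le> ?E"
      using exp_kernel_pos[of "\<xi> - \<eta>"] by (intro mult_right_mono) auto
    with e1 have E1: "exp (- expo Y \<xi> \<eta>) \<le> ?E" by simp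
    \<comment> \<open>For \<eta> outside [x, \<xi>] the two exponents differ by y \<xi> - y x up to
      sign; for \<eta> inside, they are increments of y to either side of \<eta>, each at most
      \<rho> in absolute value.\<close>
    have dd: "\<bar>expo Y \<xi> \<eta> - expo Y x \<eta>\<bar> \<le> 2 * \<rho>"
    proof -
      consider "\<eta> < x" | "\<eta> > \<xi>" | "\<eta> \<in> {x..\<xi>}" by fastforce
      then show ?thesis
        using osc(1)[of \<eta>] osc(2)[of \<eta>] osc(1)[of \<xi>] x rho
        by cases (auto simp: expo_def sgn_if abs_if split: if_splits)
    qed
    have "\<bar>exp (- expo Y \<xi> \<eta>) - exp (- expo Y x \<eta>)\<bar> \<le> \<bar>expo Y \<xi> \<eta> - expo Y x \<eta>\<bar> * ?E"
      by (rule abs_exp_diff_le[OF E1 E2])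
    also have "\<dots> \<le> (2 * \<rho>) * ?E"
      using dd exp_kernel_pos[of "\<xi> - \<eta>"] by (intro mult_right_mono) auto
    finally have de: "\<bar>exp (- expo Y \<xi> \<eta>) - exp (- expo Y x \<eta>)\<bar> \<le> (2 * \<rho>) * ?E" .
    have exp_kernel_le1: "exp_kernel (x - \<eta>) \<le> 1" by (simp add: exp_kernel_def)
    have js: "\<bar>s (\<xi> - \<eta>) - s (x - \<eta>)\<bar> * exp (- expo Y x \<eta>) \<le> (2 * indicator {0..d} (\<xi> - \<eta>)) * exp (2 * M + 1)"
    proof (rule mult_mono)
      show "\<bar>s (\<xi> - \<eta>) - s (x - \<eta>)\<bar> \<le> 2 * indicator {0..d} (\<xi> - \<eta>)"
        using s x unfolding sgn_or_one_def by (auto simp: sgn_if indicator_def)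
      have "exp (2 * M) * exp_kernel (x - \<eta>) \<le> exp (2 * M + 1) * 1"
        by (intro mult_mono exp_kernel_le1) (use exp_kernel_pos[of "x - \<eta>"] in auto)
      from order_trans[OF e2 this] show "exp (- expo Y x \<eta>) \<le> exp (2 * M + 1)" by (simp only: mult_1_right)
    qed auto
    have "\<bar>s (\<xi> - \<eta>) * (exp (- expo Y \<xi> \<eta>) * source \<gamma> Y \<eta>) - s (x - \<eta>) * (exp (- expo Y x \<eta>) * source \<gamma> Y \<eta>)\<bar>
      = \<bar>s (\<xi> - \<eta>) * (exp (- expo Y \<xi> \<eta>) - exp (- expo Y x \<eta>)) + (s (\<xi> - \<eta>) - s (x - \<eta>)) * exp (- expo Y x \<eta>)\<bar> * ?f \<eta>"
      unfolding abs_mult[symmetric] by (simp add: algebra_simps)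
    also have "\<dots> \<le> (\<bar>s (\<xi> - \<eta>)\<bar> * \<bar>exp (- expo Y \<xi> \<eta>) - exp (- expo Y x \<eta>)\<bar> + \<bar>s (\<xi> - \<eta>) - s (x - \<eta>)\<bar> * exp (- expo Y x \<eta>)) * ?f \<eta>"
      by (intro mult_right_mono order_trans[OF abs_triangle_ineq]) (auto simp: abs_mult)
    also have "\<dots> \<le> (1 * ((2 * \<rho>) * ?E) + (2 * indicator {0..d} (\<xi> - \<eta>)) * exp (2 * M + 1)) * ?f \<eta>"
      using sgn_or_one(2)[OF s] de by (intro mult_right_mono add_mono[OF _ js] mult_mono) auto
    also have "\<dots> = ?g \<eta>" by (simp add: algebra_simps)
    finally show ?thesis .
  qed
  have "\<bar>nonloc s \<gamma> Y \<xi> - nonloc s \<gamma> Y x\<bar> = \<bar>LINT \<eta>|lborel. s (\<xi> - \<eta>) * (exp (- expo Y \<xi> \<eta>) * source \<gamma> Y \<eta>) - s (x - \<eta>) * (exp (- expo Y x \<eta>) * source \<gamma> Y \<eta>)\<bar>"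
    unfolding nonloc_def by (subst Bochner_Integration.integral_diff[OF integrand_integrable integrand_integrable]) simp
  also have "\<dots> \<le> (LINT \<eta>|lborel. \<bar>s (\<xi> - \<eta>) * (exp (- expo Y \<xi> \<eta>) * source \<gamma> Y \<eta>) - s (x - \<eta>) * (exp (- expo Y x \<eta>) * source \<gamma> Y \<eta>)\<bar>)"
    by (rule integral_abs_bound)
  also have "\<dots> \<le> (LINT \<eta>|lborel. ?g \<eta>)"
    using integrand_integrable by (intro integral_mono gi pt) auto
  also have "\<dots> = exp (2 * M + 1) * (2 * \<rho> * conv exp_kernel ?f \<xi> + 2 * conv (indicator {0..d}) ?f \<xi>)"
    unfolding conv_def using i1 i2 by simp
  finally show ?thesis .
qed

section \<open>Local Lipschitz estimates\<close>

lemma cell_iff: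
  assumes "\<delta> > 0"
  shows "\<xi> \<in> {grid \<delta> i..<grid \<delta> (i + 1)} \<longleftrightarrow> i = \<lfloor>\<xi> / \<delta>\<rfloor>"
  using assms by (auto simp: grid_def floor_eq_iff field_simps eq_commute[of i])

lemma sample_eq:
  assumes "\<delta> > 0"
  shows "sample \<delta> N f \<xi> = (if - real N * \<delta> \<le> \<xi> \<and> \<xi> < real N * \<delta> then f (grid \<delta> \<lfloor>\<xi> / \<delta>\<rfloor>) else 0)"
proof -
  have "sample \<delta> N f \<xi> = (\<Sum>i = - int N..int N - 1. if i = \<lfloor>\<xi> / \<delta>\<rfloor> then f (grid \<delta> i) else 0)"
    unfolding sample_def by (intro sum.cong refl) (simp add: indicator_def cell_iff[OF assms] del: atLeastLessThan_iff)
  also have "\<dots> = (if \<lfloor>\<xi> / \<delta>\<rfloor> \<in> {- int N..int N - 1} then f (grid \<delta> \<lfloor>\<xi> / \<delta>\<rfloor>) else 0)"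
    by (subst sum.delta) auto
  also have "\<lfloor>\<xi> / \<delta>\<rfloor> \<in> {- int N..int N - 1} \<longleftrightarrow> - real N * \<delta> \<le> \<xi> \<and> \<xi> < real N * \<delta>"
  proof -
    have "\<lfloor>\<xi> / \<delta>\<rfloor> \<in> {- int N..int N - 1} \<longleftrightarrow> - int N \<le> \<lfloor>\<xi> / \<delta>\<rfloor> \<and> \<lfloor>\<xi> / \<delta>\<rfloor> < int N" by auto
    also have "\<dots> \<longleftrightarrow> - real N \<le> \<xi> / \<delta> \<and> \<xi> / \<delta> < real N"
      unfolding le_floor_iff floor_less_iff by simp
    also have "\<dots> \<longleftrightarrow> - real N * \<delta> \<le> \<xi> \<and> \<xi> < real N * \<delta>"
      using assms by (simp add: pos_le_divide_eq pos_divide_less_eq)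
    finally show ?thesis .
  qed
  finally show ?thesis .
qed

lemma grid_floor:
  assumes "\<delta> > 0" shows "grid \<delta> \<lfloor>\<xi> / \<delta>\<rfloor> \<le> \<xi>" "\<xi> < grid \<delta> \<lfloor>\<xi> / \<delta>\<rfloor> + \<delta>"
proof -
  have "\<xi> \<in> {grid \<delta> \<lfloor>\<xi> / \<delta>\<rfloor>..<grid \<delta> (\<lfloor>\<xi> / \<delta>\<rfloor> + 1)}" using cell_iff[OF assms] by blast
  then show "grid \<delta> \<lfloor>\<xi> / \<delta>\<rfloor> \<le> \<xi>" "\<xi> < grid \<delta> \<lfloor>\<xi> / \<delta>\<rfloor> + \<delta>" by (auto simp: grid_def distrib_right)
qed

lemma sample_measurable [measurable]: "sample \<delta> N f \<in> borel_measurable borel"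
  unfolding sample_def by measurable

lemma sample_diff: "sample \<delta> N f \<xi> - sample \<delta> N g \<xi> = sample \<delta> N (\<lambda>x. f x - g x) \<xi>"
  by (simp add: sample_def sum_subtractf left_diff_distrib)

lemma sample_cmult: "sample \<delta> N (\<lambda>x. c * f x) \<xi> = c * sample \<delta> N f \<xi>"
  unfolding sample_def sum_distrib_left by (simp only: mult.assoc)

lemma sample_bound:
  assumes \<delta>: "0 < \<delta>" "\<delta> \<le> 1" and g: "L2_le g b" "\<And>x. 0 \<le> g x"
    and f: "\<And>x. \<bar>f x\<bar> \<le> conv exp_kernel g x"
  shows "\<bar>sample \<delta> N f \<xi>\<bar> \<le> exp 1 * conv exp_kernel g \<xi>"
proof -
  note gf = grid_floor[OF \<delta>(1), of \<xi>]
  have n: "0 \<le> conv exp_kernel g \<xi>" by (rule conv_nonneg[OF kernel_exp_kernel g(2)])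
  have "\<bar>f (grid \<delta> \<lfloor>\<xi> / \<delta>\<rfloor>)\<bar> \<le> conv exp_kernel g (grid \<delta> \<lfloor>\<xi> / \<delta>\<rfloor>)" by (rule f)
  also have "\<dots> \<le> exp \<bar>grid \<delta> \<lfloor>\<xi> / \<delta>\<rfloor> - \<xi>\<bar> * conv exp_kernel g \<xi>" by (rule conv_exp_kernel_shift[OF g])
  also have "\<dots> \<le> exp 1 * conv exp_kernel g \<xi>"
    using gf \<delta> n by (intro mult_right_mono) auto
  finally show ?thesis unfolding sample_eq[OF \<delta>(1)] using n by auto
qed

text \<open>The identity yields the right-hand side of the system and \<open>sample\<close> those of
  the scheme. Treating both at once makes the constants independent of the grid.\<close>

definition samp_op :: "((real \<Rightarrow> real) \<Rightarrow> real \<Rightarrow> real) \<Rightarrow> bool" where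
  "samp_op A \<longleftrightarrow> A = (\<lambda>f. f) \<or> (\<exists>\<delta> N. 0 < \<delta> \<and> \<delta> \<le> 1 \<and> A = sample \<delta> N)"

lemma samp_op:
  assumes "samp_op A"
  shows "f \<in> borel_measurable borel \<Longrightarrow> A f \<in> borel_measurable borel"
    "A f \<xi> - A g \<xi> = A (\<lambda>x. f x - g x) \<xi>"
    "A (\<lambda>x. c * f x) \<xi> = c * A f \<xi>"
  using assms unfolding samp_op_def by (auto simp: sample_diff sample_cmult)

text \<open>Sampling is not bounded on L^2. It is bounded on functions dominated by a convolution
  with \<open>exp_kernel\<close>, because the dominating function changes by at most a factor e
  within a cell.\<close>

lemma samp_op_L2_Linf_le:
  assumes A: "samp_op A" and g: "L2_le g b" "\<And>x. 0 \<le> g x"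
    and fm: "f \<in> borel_measurable borel" and f: "\<And>x. \<bar>f x\<bar> \<le> conv exp_kernel g x"
  shows "L2_Linf_le (A f) (exp 1 * ((exp_mass + sqrt exp_mass) * b))"
proof -
  have n: "0 \<le> conv exp_kernel g \<xi>" for \<xi> by (rule conv_nonneg[OF kernel_exp_kernel g(2)])
  have exp_mass: "0 \<le> exp_mass" by (rule kernelD(6)[OF kernel_exp_kernel])
  have b: "0 \<le> b" by (rule L2_le_nonneg[OF g(1)])
  have le: "\<bar>A f \<xi>\<bar> \<le> exp 1 * conv exp_kernel g \<xi>" for \<xi>
  proof -
    have "conv exp_kernel g \<xi> \<le> exp 1 * conv exp_kernel g \<xi>"
      using n[of \<xi>] mult_right_mono[of 1 "exp 1" "conv exp_kernel g \<xi>"] by simp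
    then show ?thesis using A f[of \<xi>] sample_bound[OF _ _ g f] unfolding samp_op_def
      by (auto intro: order_trans)
  qed
  have c1: "L2_le (\<lambda>\<xi>. exp 1 * conv exp_kernel g \<xi>) (\<bar>exp 1\<bar> * (exp_mass * b))"
    by (intro L2_le_cmult conv_L2_le kernel_exp_kernel g)
  have m: "A f \<in> borel_measurable borel" by (rule samp_op(1)[OF A fm])
  have "L2_le (A f) (\<bar>exp 1\<bar> * (exp_mass * b))"
    using le n by (intro L2_le_mono[OF c1 m]) (auto intro!: AE_I2)
  moreover have "Linf_le (A f) (exp 1 * (sqrt exp_mass * b))"
  proof (rule Linf_leI[OF m])
    fix \<xi>
    have "conv exp_kernel g \<xi> \<le> sqrt exp_mass * b" using conv_bound_L2[OF kernel_exp_kernel g(1), of \<xi>] by simp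
    then have "exp 1 * conv exp_kernel g \<xi> \<le> exp 1 * (sqrt exp_mass * b)" by simp
    with le[of \<xi>] show "\<bar>A f \<xi>\<bar> \<le> exp 1 * (sqrt exp_mass * b)" by linarith
  qed
  ultimately show ?thesis
    using exp_mass b by (auto simp: L2_Linf_le_def distrib_right distrib_left elim!: L2_le_weaken Linf_le_weaken)
qed

definition nonloc_const :: "real \<Rightarrow> real \<Rightarrow> real" where
  "nonloc_const \<gamma> M = exp (2 * M) * (exp 1 * ((exp_mass + sqrt exp_mass) * (2 * source_const \<gamma> M * M + source_const \<gamma> M)))"

lemma samp_nonloc_L2_Linf_le:
  assumes "nonloc_setting s Y M" and A: "samp_op A"
  shows "L2_Linf_le (A (nonloc s \<gamma> Y)) (exp (2 * M) * (exp 1 * ((exp_mass + sqrt exp_mass) * (source_const \<gamma> M * M))))"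
proof -
  interpret nonloc_setting s \<gamma> Y M by fact
  \<comment> \<open>Scaling by e^{-2M} makes the domination hold with constant 1; the factor is
    restored afterwards by homogeneity of \<open>A\<close>.\<close>
  let ?f = "\<lambda>\<xi>. exp (- (2 * M)) * nonloc s \<gamma> Y \<xi>"
  have "L2_Linf_le (A ?f) (exp 1 * ((exp_mass + sqrt exp_mass) * (source_const \<gamma> M * M)))"
  proof (rule samp_op_L2_Linf_le[OF A L2_le_abs[OF source_L2]])
    fix \<xi>
    show "\<bar>?f \<xi>\<bar> \<le> conv exp_kernel (\<lambda>\<eta>. \<bar>source \<gamma> Y \<eta>\<bar>) \<xi>"
      using nonloc_bound[of \<xi>] by (simp add: abs_mult exp_minus field_simps)
  qed auto
  from L2_Linf_le_cmult[OF this, of "exp (2 * M)"]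
  show ?thesis
    unfolding samp_op(3)[OF A] by (simp add: mult.assoc[symmetric] exp_add[symmetric] mult_exp_exp)
qed

lemma samp_nonloc_diff_L2_Linf_le:
  assumes "nonloc_setting s Y1 M" "nonloc_setting s Y2 M" "comps_le (Y1 - Y2) d"
    and z: "\<And>x. \<bar>l_zeta Y1 x - l_zeta Y2 x\<bar> \<le> d" and A: "samp_op A"
  shows "L2_Linf_le (\<lambda>\<xi>. A (nonloc s \<gamma> Y1) \<xi> - A (nonloc s \<gamma> Y2) \<xi>) (nonloc_const \<gamma> M * d)"
proof -
  interpret A: nonloc_setting s \<gamma> Y1 M by fact
  interpret B: nonloc_setting s \<gamma> Y2 M by fact
  have d: "0 \<le> d" by (rule comps_le_nonneg[OF assms(3)])
  let ?g = "\<lambda>\<eta>. 2 * d * \<bar>source \<gamma> Y1 \<eta>\<bar> + \<bar>source \<gamma> Y1 \<eta> - source \<gamma> Y2 \<eta>\<bar>"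
  let ?b = "\<bar>2 * d\<bar> * (source_const \<gamma> M * M) + source_const \<gamma> M * d"
  have g: "L2_le ?g ?b"
    by (intro L2_le_add L2_le_cmult L2_le_abs A.source_L2 source_diff_L2_le[OF A.comps_le B.comps_le assms(3)])
  let ?f = "\<lambda>\<xi>. exp (- (2 * M)) * (nonloc s \<gamma> Y1 \<xi> - nonloc s \<gamma> Y2 \<xi>)"
  have "L2_Linf_le (A ?f) (exp 1 * ((exp_mass + sqrt exp_mass) * ?b))"
  proof (rule samp_op_L2_Linf_le[OF A g])
    fix \<xi>
    show "\<bar>?f \<xi>\<bar> \<le> conv exp_kernel ?g \<xi>"
      using nonloc_diff[OF assms(1-3) z, where \<xi> = \<xi>] by (simp add: abs_mult exp_minus field_simps)
  qed (use d in auto)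
  from L2_Linf_le_cmult[OF this, of "exp (2 * M)"]
  have "L2_Linf_le (A (\<lambda>\<xi>. nonloc s \<gamma> Y1 \<xi> - nonloc s \<gamma> Y2 \<xi>)) (exp (2 * M) * (exp 1 * ((exp_mass + sqrt exp_mass) * ?b)))"
    unfolding samp_op(3)[OF A] by (simp add: mult.assoc[symmetric] exp_add[symmetric] mult_exp_exp)
  moreover have "exp (2 * M) * (exp 1 * ((exp_mass + sqrt exp_mass) * ?b)) = nonloc_const \<gamma> M * d"
    using d by (simp add: nonloc_const_def algebra_simps)
  moreover have "A (\<lambda>\<xi>. nonloc s \<gamma> Y1 \<xi> - nonloc s \<gamma> Y2 \<xi>) = (\<lambda>\<xi>. A (nonloc s \<gamma> Y1) \<xi> - A (nonloc s \<gamma> Y2) \<xi>)"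
    by (rule ext) (simp add: samp_op(2)[OF A])
  ultimately show ?thesis by simp
qed

text \<open>The switches a and b select the two parts of the splitting: (1, 0) and (0, 1) are the
  subfields, (1, 1) is the full field. P and Q are separate arguments, so exact and sampled values
  can be compared at the same or at different states.\<close>

definition lag_field :: "real \<Rightarrow> real \<Rightarrow> real \<Rightarrow> lag \<Rightarrow> (real \<Rightarrow> real) \<Rightarrow> (real \<Rightarrow> real) \<Rightarrow> lag" where
  "lag_field a b \<gamma> Y P Q = Lag
     (\<lambda>\<xi>. b * (\<gamma> * l_U Y \<xi>))
     (\<lambda>\<xi>. b * (- Q \<xi>))
     (\<lambda>\<xi>. b * ((l_U Y \<xi>)^3 - 2 * P \<xi> * l_U Y \<xi>))
     (\<lambda>\<xi>. a * (\<gamma> * l_w Y \<xi>))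
     (\<lambda>\<xi>. a * (\<gamma> / 2 * l_h Y \<xi> + ((3 - 2 * \<gamma>) / 2 * (l_U Y \<xi>)\<^sup>2 - P \<xi>) * l_q Y \<xi>))
     (\<lambda>\<xi>. b * (- 2 * Q \<xi> * l_U Y \<xi> * l_q Y \<xi>) + a * ((3 * (l_U Y \<xi>)\<^sup>2 - 2 * P \<xi>) * l_w Y \<xi>))"

lemma G_rhs_lag_field: "G_rhs \<gamma> Y = lag_field 1 1 \<gamma> Y (PP \<gamma> Y) (QQ \<gamma> Y)"
  by (simp add: G_rhs_def lag_field_def)

lemma G_bar1_lag_field: "G_bar1 \<gamma> \<delta> N Y = lag_field 1 0 \<gamma> Y (sample \<delta> N (PP \<gamma> Y)) (sample \<delta> N (QQ \<gamma> Y))"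
  by (simp add: G_bar1_def lag_field_def Let_def)

lemma G_bar2_lag_field: "G_bar2 \<gamma> \<delta> N Y = lag_field 0 1 \<gamma> Y (sample \<delta> N (PP \<gamma> Y)) (sample \<delta> N (QQ \<gamma> Y))"
  by (simp add: G_bar2_def lag_field_def Let_def)

lemma lag_field_add: "lag_field 1 0 \<gamma> Y P Q + lag_field 0 1 \<gamma> Y P Q = lag_field 1 1 \<gamma> Y P Q"
  by (simp add: lag_field_def plus_lag_def)

text \<open>The summands are the constants of the single components: 1 for U, |\<gamma>| for zeta
  and for v, then those of H, w and h. A sum keeps each of them visibly below the total.\<close>

definition lag_field_const :: "real \<Rightarrow> real \<Rightarrow> real" where
  "lag_field_const \<gamma> M = (let c = \<bar>(3 - 2 * \<gamma>) / 2\<bar>; k = c * (2 * M) + 1 in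
     1 + \<bar>\<gamma>\<bar> + (3 * M\<^sup>2 + 4 * M) + (\<bar>\<gamma> / 2\<bar> + k + k * M + (c * M\<^sup>2 + M)) +
     (2 * (2 * M + 2 * M * M + M\<^sup>2) + ((6 * M + 2) * M + (3 * M\<^sup>2 + 2 * M))))"

text \<open>The field is polynomial in the states and in P, Q. Telescoping leaves one difference in
  every term, and after splitting q = 1 + v every term of the components v, w and h contains a
  factor in L^2. Since P and Q come with both kinds of bounds, the terms produced by the 1 in q are
  covered as well.\<close>

lemma lag_field_diff_comps_le:
  assumes "comps_le Y1 M" "comps_le Y2 M" "comps_le (Y1 - Y2) d"
    and P: "L2_Linf_le P1 M" "L2_Linf_le P2 M" "L2_Linf_le (\<lambda>x. P1 x - P2 x) d"
    and Q: "L2_Linf_le Q1 M" "L2_Linf_le Q2 M" "L2_Linf_le (\<lambda>x. Q1 x - Q2 x) d"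
    and ab: "\<bar>a\<bar> \<le> 1" "\<bar>b\<bar> \<le> 1"
  shows "comps_le (lag_field a b \<gamma> Y1 P1 Q1 - lag_field a b \<gamma> Y2 P2 Q2) (lag_field_const \<gamma> M * d)"
proof -
  note f1 = assms(1)[unfolded comps_le_def] and f2 = assms(2)[unfolded comps_le_def]
    and f3 = assms(3)[unfolded comps_le_def lag_sel]
  note u1 = f1[unfolded L2_Linf_le_def] and u2 = f2[unfolded L2_Linf_le_def] and u3 = f3[unfolded L2_Linf_le_def]
  note PQ = P[unfolded L2_Linf_le_def] Q[unfolded L2_Linf_le_def]
  have M: "0 \<le> M" by (rule comps_le_nonneg[OF assms(1)])
  have d: "0 \<le> d" by (rule comps_le_nonneg[OF assms(3)])
  define c where "c = (3 - 2 * \<gamma>) / 2"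
  define k where "k = \<bar>c\<bar> * (2 * M) + 1"
  have k: "0 \<le> k" using M by (simp add: k_def)
  let ?K = "lag_field_const \<gamma> M"
  have K_eq: "?K = 1 + \<bar>\<gamma>\<bar> + (3 * M\<^sup>2 + 4 * M) + (\<bar>\<gamma> / 2\<bar> + k + k * M + (\<bar>c\<bar> * M\<^sup>2 + M)) +
     (2 * (2 * M + 2 * M * M + M\<^sup>2) + ((6 * M + 2) * M + (3 * M\<^sup>2 + 2 * M)))"
    by (simp add: lag_field_const_def Let_def k_def c_def)
  have nn: "0 \<le> \<bar>\<gamma>\<bar>" "0 \<le> 3 * M\<^sup>2 + 4 * M" "0 \<le> \<bar>\<gamma> / 2\<bar> + k + k * M + (\<bar>c\<bar> * M\<^sup>2 + M)"
    "0 \<le> 2 * (2 * M + 2 * M * M + M\<^sup>2) + ((6 * M + 2) * M + (3 * M\<^sup>2 + 2 * M))"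
    using M k by auto
  have Kge: "1 \<le> ?K" "\<bar>\<gamma>\<bar> \<le> ?K" "3 * M\<^sup>2 + 4 * M \<le> ?K" "\<bar>\<gamma> / 2\<bar> + k + k * M + (\<bar>c\<bar> * M\<^sup>2 + M) \<le> ?K"
    "2 * (2 * M + 2 * M * M + M\<^sup>2) + ((6 * M + 2) * M + (3 * M\<^sup>2 + 2 * M)) \<le> ?K"
    unfolding K_eq using nn by linarith+
  have cut: "\<bar>e\<bar> * r \<le> ?K * d" if "\<bar>e\<bar> \<le> 1" "r \<le> z * d" "z \<le> ?K" "0 \<le> r" for e r z
  proof -
    have "\<bar>e\<bar> * r \<le> 1 * r" using that by (intro mult_right_mono) auto
    also have "1 * r \<le> z * d" using that by simp
    also have "\<dots> \<le> ?K * d" using that d by (intro mult_right_mono)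
    finally show ?thesis .
  qed
  let ?U1 = "l_U Y1" and ?U2 = "l_U Y2" and ?v1 = "l_v Y1" and ?v2 = "l_v Y2"
    and ?w1 = "l_w Y1" and ?w2 = "l_w Y2" and ?h1 = "l_h Y1" and ?h2 = "l_h Y2"
  have sU: "Linf_le (\<lambda>x. ?U1 x + ?U2 x) (M + M)" using u1 u2 by (intro Linf_le_add) auto
  have dU2: "L2_Linf_le (\<lambda>x. (?U1 x + ?U2 x) * (?U1 x - ?U2 x)) ((M + M) * d)"
    using f3 by (intro L2_Linf_le_mult sU) auto
  have zeta: "Linf_le (\<lambda>x. b * (\<gamma> * (?U1 x - ?U2 x))) (?K * d)"
  proof (rule Linf_le_weaken)
    show "Linf_le (\<lambda>x. b * (\<gamma> * (?U1 x - ?U2 x))) (\<bar>b\<bar> * (\<bar>\<gamma>\<bar> * d))"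
      using u3 by (intro Linf_le_cmult) auto
    show "\<bar>b\<bar> * (\<bar>\<gamma>\<bar> * d) \<le> ?K * d"
      using ab d by (intro cut[OF _ _ Kge(2)]) auto
  qed
  have U: "L2_Linf_le (\<lambda>x. (- b) * (Q1 x - Q2 x)) (?K * d)"
  proof (rule L2_Linf_le_weaken)
    show "L2_Linf_le (\<lambda>x. (- b) * (Q1 x - Q2 x)) (\<bar>-b\<bar> * d)" by (intro L2_Linf_le_cmult Q)
    show "\<bar>-b\<bar> * d \<le> ?K * d"
      using ab d by (intro cut[OF _ _ Kge(1)]) auto
  qed
  have H: "Linf_le (\<lambda>x. b * (((?U1 x)\<^sup>2 + ?U1 x * ?U2 x + (?U2 x)\<^sup>2) * (?U1 x - ?U2 x)
      - ((2 * (P1 x - P2 x)) * ?U1 x + (2 * P2 x) * (?U1 x - ?U2 x)))) (?K * d)"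
  proof (rule Linf_le_weaken)
    show "Linf_le (\<lambda>x. b * (((?U1 x)\<^sup>2 + ?U1 x * ?U2 x + (?U2 x)\<^sup>2) * (?U1 x - ?U2 x)
      - ((2 * (P1 x - P2 x)) * ?U1 x + (2 * P2 x) * (?U1 x - ?U2 x))))
      (\<bar>b\<bar> * ((M\<^sup>2 + M * M + M\<^sup>2) * d + ((\<bar>2\<bar> * d) * M + (\<bar>2\<bar> * M) * d)))"
      using u1 u2 u3 PQ
      by (intro Linf_le_cmult Linf_le_diff Linf_le_add Linf_le_mult Linf_le_power2) auto
    show "\<bar>b\<bar> * ((M\<^sup>2 + M * M + M\<^sup>2) * d + ((\<bar>2\<bar> * d) * M + (\<bar>2\<bar> * M) * d)) \<le> ?K * d"
      using ab d M
      by (intro cut[OF _ _ Kge(3)]) (auto simp: algebra_simps power2_eq_square)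
  qed
  have v: "L2_le (\<lambda>x. a * (\<gamma> * (?w1 x - ?w2 x))) (?K * d)"
  proof (rule L2_le_weaken)
    show "L2_le (\<lambda>x. a * (\<gamma> * (?w1 x - ?w2 x))) (\<bar>a\<bar> * (\<bar>\<gamma>\<bar> * d))"
      using u3 by (intro L2_le_cmult) auto
    show "\<bar>a\<bar> * (\<bar>\<gamma>\<bar> * d) \<le> ?K * d"
      using ab d by (intro cut[OF _ _ Kge(2)]) auto
  qed
  have dK: "L2_Linf_le (\<lambda>x. c * ((?U1 x + ?U2 x) * (?U1 x - ?U2 x)) - (P1 x - P2 x)) (\<bar>c\<bar> * ((M + M) * d) + d)"
    by (intro L2_Linf_le_diff L2_Linf_le_cmult dU2 P)
  let ?dK = "\<lambda>x. c * ((?U1 x + ?U2 x) * (?U1 x - ?U2 x)) - (P1 x - P2 x)"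
  have kd: "\<bar>c\<bar> * ((M + M) * d) + d = k * d" by (simp add: k_def algebra_simps)
  have w: "L2_le (\<lambda>x. a * (\<gamma> / 2 * (?h1 x - ?h2 x) + ((?dK x + ?dK x * ?v1 x) + (c * (?U2 x)\<^sup>2 - P2 x) * (?v1 x - ?v2 x)))) (?K * d)"
  proof (rule L2_le_weaken)
    show "L2_le (\<lambda>x. a * (\<gamma> / 2 * (?h1 x - ?h2 x) + ((?dK x + ?dK x * ?v1 x) + (c * (?U2 x)\<^sup>2 - P2 x) * (?v1 x - ?v2 x))))
      (\<bar>a\<bar> * (\<bar>\<gamma> / 2\<bar> * d + ((k * d + k * d * M) + (\<bar>c\<bar> * M\<^sup>2 + M) * d)))"
      using u1 u2 u3 PQ dK[unfolded kd L2_Linf_le_def]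
      by (intro L2_le_cmult L2_le_add L2_le_mult Linf_le_diff Linf_le_cmult Linf_le_power2) auto
    show "\<bar>a\<bar> * (\<bar>\<gamma> / 2\<bar> * d + ((k * d + k * d * M) + (\<bar>c\<bar> * M\<^sup>2 + M) * d)) \<le> ?K * d"
      using ab d M k
      by (intro cut[OF _ _ Kge(4)]) (auto simp: algebra_simps)
  qed
  have dQU: "L2_Linf_le (\<lambda>x. ?U1 x * (Q1 x - Q2 x) + Q2 x * (?U1 x - ?U2 x)) (M * d + M * d)"
    using u1 f3 PQ Q by (intro L2_Linf_le_add L2_Linf_le_mult) auto
  let ?dQU = "\<lambda>x. ?U1 x * (Q1 x - Q2 x) + Q2 x * (?U1 x - ?U2 x)"
  have h: "L2_le (\<lambda>x. b * ((- 2) * ((?dQU x + ?dQU x * ?v1 x) + (Q2 x * ?U2 x) * (?v1 x - ?v2 x)))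
      + a * ((3 * ((?U1 x + ?U2 x) * (?U1 x - ?U2 x)) - 2 * (P1 x - P2 x)) * ?w1 x
          + (3 * (?U2 x)\<^sup>2 - 2 * P2 x) * (?w1 x - ?w2 x))) (?K * d)"
  proof (rule L2_le_weaken)
    show "L2_le (\<lambda>x. b * ((- 2) * ((?dQU x + ?dQU x * ?v1 x) + (Q2 x * ?U2 x) * (?v1 x - ?v2 x)))
      + a * ((3 * ((?U1 x + ?U2 x) * (?U1 x - ?U2 x)) - 2 * (P1 x - P2 x)) * ?w1 x
          + (3 * (?U2 x)\<^sup>2 - 2 * P2 x) * (?w1 x - ?w2 x)))
       (\<bar>b\<bar> * (\<bar>-2\<bar> * (((M * d + M * d) + (M * d + M * d) * M) + (M * M) * d))
        + \<bar>a\<bar> * ((\<bar>3\<bar> * ((M + M) * d) + \<bar>2\<bar> * d) * M + (\<bar>3\<bar> * M\<^sup>2 + \<bar>2\<bar> * M) * d))"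
      using u1 u2 u3 PQ dU2[unfolded L2_Linf_le_def] dQU[unfolded L2_Linf_le_def]
      by (intro L2_le_add[where a = "\<bar>b\<bar> * _"] L2_le_cmult L2_le_add L2_le_mult
          Linf_le_diff Linf_le_cmult Linf_le_power2 Linf_le_mult[of Q2]) auto
    let ?r1 = "\<bar>-2\<bar> * (((M * d + M * d) + (M * d + M * d) * M) + (M * M) * d)"
    let ?r2 = "(\<bar>3\<bar> * ((M + M) * d) + \<bar>2\<bar> * d) * M + (\<bar>3\<bar> * M\<^sup>2 + \<bar>2\<bar> * M) * d"
    have "\<bar>b\<bar> * ?r1 + \<bar>a\<bar> * ?r2 \<le> 1 * ?r1 + 1 * ?r2"
      using ab d M by (intro add_mono mult_right_mono) auto
    also have "\<dots> = (2 * (2 * M + 2 * M * M + M\<^sup>2) + ((6 * M + 2) * M + (3 * M\<^sup>2 + 2 * M))) * d"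
      by (simp add: algebra_simps power2_eq_square)
    also have "\<dots> \<le> ?K * d"
      using d Kge(5) by (intro mult_right_mono)
    finally show "\<bar>b\<bar> * ?r1 + \<bar>a\<bar> * ?r2 \<le> ?K * d" .
  qed
  show ?thesis
    unfolding comps_le_def lag_sel lag_field_def lag.sel
  proof (intro conjI)
    show "Linf_le (\<lambda>x. b * (\<gamma> * ?U1 x) - b * (\<gamma> * ?U2 x)) (?K * d)"
      using zeta by (simp add: right_diff_distrib)
    show "L2_Linf_le (\<lambda>x. b * - Q1 x - b * - Q2 x) (?K * d)"
      using U by (simp add: algebra_simps)
    have "(\<lambda>x. b * ((?U1 x)^3 - 2 * P1 x * ?U1 x) - b * ((?U2 x)^3 - 2 * P2 x * ?U2 x)) =
      (\<lambda>x. b * (((?U1 x)\<^sup>2 + ?U1 x * ?U2 x + (?U2 x)\<^sup>2) * (?U1 x - ?U2 x)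
      - ((2 * (P1 x - P2 x)) * ?U1 x + (2 * P2 x) * (?U1 x - ?U2 x))))"
      by (rule ext) algebra
    then show "Linf_le (\<lambda>x. b * ((?U1 x)^3 - 2 * P1 x * ?U1 x) - b * ((?U2 x)^3 - 2 * P2 x * ?U2 x)) (?K * d)"
      using H by simp
    show "L2_le (\<lambda>x. a * (\<gamma> * ?w1 x) - a * (\<gamma> * ?w2 x)) (?K * d)"
      using v by (simp add: right_diff_distrib)
    have "(\<lambda>x. a * (\<gamma> / 2 * ?h1 x + ((3 - 2 * \<gamma>) / 2 * (?U1 x)\<^sup>2 - P1 x) * l_q Y1 x)
        - a * (\<gamma> / 2 * ?h2 x + ((3 - 2 * \<gamma>) / 2 * (?U2 x)\<^sup>2 - P2 x) * l_q Y2 x)) =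
      (\<lambda>x. a * (\<gamma> / 2 * (?h1 x - ?h2 x) + ((?dK x + ?dK x * ?v1 x) + (c * (?U2 x)\<^sup>2 - P2 x) * (?v1 x - ?v2 x))))"
      unfolding c_def[symmetric] l_q_def by (rule ext) algebra
    then show "L2_le (\<lambda>x. a * (\<gamma> / 2 * ?h1 x + ((3 - 2 * \<gamma>) / 2 * (?U1 x)\<^sup>2 - P1 x) * l_q Y1 x)
        - a * (\<gamma> / 2 * ?h2 x + ((3 - 2 * \<gamma>) / 2 * (?U2 x)\<^sup>2 - P2 x) * l_q Y2 x)) (?K * d)"
      using w by simp
    have "(\<lambda>x. b * (- 2 * Q1 x * ?U1 x * l_q Y1 x) + a * ((3 * (?U1 x)\<^sup>2 - 2 * P1 x) * ?w1 x)
        - (b * (- 2 * Q2 x * ?U2 x * l_q Y2 x) + a * ((3 * (?U2 x)\<^sup>2 - 2 * P2 x) * ?w2 x))) =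
      (\<lambda>x. b * ((- 2) * ((?dQU x + ?dQU x * ?v1 x) + (Q2 x * ?U2 x) * (?v1 x - ?v2 x)))
      + a * ((3 * ((?U1 x + ?U2 x) * (?U1 x - ?U2 x)) - 2 * (P1 x - P2 x)) * ?w1 x
          + (3 * (?U2 x)\<^sup>2 - 2 * P2 x) * (?w1 x - ?w2 x)))"
      unfolding l_q_def by (rule ext) algebra
    then show "L2_le (\<lambda>x. b * (- 2 * Q1 x * ?U1 x * l_q Y1 x) + a * ((3 * (?U1 x)\<^sup>2 - 2 * P1 x) * ?w1 x)
        - (b * (- 2 * Q2 x * ?U2 x * l_q Y2 x) + a * ((3 * (?U2 x)\<^sup>2 - 2 * P2 x) * ?w2 x))) (?K * d)"
      using h by simp
  qed
qed

text \<open>The regularity shared by exact states (continuous zeta and U) and grid states (right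
  continuous steps). It turns the L^\<infinity> norms into bounds at every point, which the kernel
  and the final comparison of points require.\<close>

definition FF_rc :: "lag set" where
  "FF_rc = {Y \<in> FF. (\<forall>x. continuous (at_right x) (l_zeta Y)) \<and> (\<forall>x. continuous (at_right x) (l_U Y))}"

lemma FF_rc_FF: "Y \<in> FF_rc \<Longrightarrow> Y \<in> FF" by (simp add: FF_rc_def)

lemma FF_rc_diff: "X \<in> FF_rc \<Longrightarrow> Y \<in> FF_rc \<Longrightarrow> X - Y \<in> FF_rc"
  by (auto simp: FF_rc_def intro: F_norm_diff continuous_intros)

lemma FF_rc_pointwise:
  assumes "Y \<in> FF_rc" "F_norm Y \<le> M"
  shows "\<bar>l_zeta Y x\<bar> \<le> M" "\<bar>l_U Y x\<bar> \<le> M"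
proof -
  have "comps_le Y M" using assms by (intro comps_le_of_F_norm) (auto simp: FF_rc_def)
  then show "\<bar>l_zeta Y x\<bar> \<le> M" "\<bar>l_U Y x\<bar> \<le> M"
    using assms(1) by (auto simp: comps_le_def L2_Linf_le_def FF_rc_def intro: Linf_le_right_cont)
qed

lemma FF_rc_nonloc_setting:
  assumes "Y \<in> FF_rc" "F_norm Y \<le> M" "sgn_or_one s" shows "nonloc_setting s Y M"
  using assms FF_rc_pointwise comps_le_of_F_norm by unfold_locales (auto simp: FF_rc_def)

lemma samp_op_id: "samp_op (\<lambda>f. f)"
  by (simp add: samp_op_def)

lemma samp_op_sample: "0 < \<delta> \<Longrightarrow> \<delta> \<le> 1 \<Longrightarrow> samp_op (sample \<delta> N)"
  by (auto simp: samp_op_def)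

definition PQ_const :: "real \<Rightarrow> real \<Rightarrow> real" where
  "PQ_const \<gamma> M = exp (2 * M) * (exp 1 * ((exp_mass + sqrt exp_mass) * (source_const \<gamma> M * M)))"

lemma PQ_L2_Linf_le:
  assumes "Y \<in> FF_rc" "F_norm Y \<le> M" "samp_op A"
  shows "L2_Linf_le (A (PP \<gamma> Y)) (PQ_const \<gamma> M)" "L2_Linf_le (A (QQ \<gamma> Y)) (PQ_const \<gamma> M)"
proof -
  have s: "sgn_or_one (\<lambda>_. 1)" "sgn_or_one sgn" by (auto simp: sgn_or_one_def)
  note b = samp_nonloc_L2_Linf_le[OF FF_rc_nonloc_setting[OF assms(1,2)] assms(3), folded PQ_const_def]
  have n: "0 \<le> PQ_const \<gamma> M" using L2_Linf_le_nonneg[OF b[OF s(1)]] .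
  have "A (PP \<gamma> Y) = (\<lambda>\<xi>. 1 / 2 * A (nonloc (\<lambda>_. 1) \<gamma> Y) \<xi>)"
    "A (QQ \<gamma> Y) = (\<lambda>\<xi>. - 1 / 2 * A (nonloc sgn \<gamma> Y) \<xi>)"
    unfolding samp_op(3)[OF assms(3), symmetric] PP_nonloc[symmetric] QQ_nonloc[symmetric] by simp_all
  with L2_Linf_le_cmult[OF b[OF s(1)], of "1 / 2" \<gamma>] L2_Linf_le_cmult[OF b[OF s(2)], of "- 1 / 2" \<gamma>]
  show "L2_Linf_le (A (PP \<gamma> Y)) (PQ_const \<gamma> M)" "L2_Linf_le (A (QQ \<gamma> Y)) (PQ_const \<gamma> M)"
    using n by (auto elim: L2_Linf_le_weaken)
qed

lemma PQ_diff_L2_Linf_le: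
  assumes Y: "Y1 \<in> FF_rc" "F_norm Y1 \<le> M" "Y2 \<in> FF_rc" "F_norm Y2 \<le> M" and A: "samp_op A"
  shows "L2_Linf_le (\<lambda>x. A (PP \<gamma> Y1) x - A (PP \<gamma> Y2) x) (nonloc_const \<gamma> M * F_norm (Y1 - Y2))"
    "L2_Linf_le (\<lambda>x. A (QQ \<gamma> Y1) x - A (QQ \<gamma> Y2) x) (nonloc_const \<gamma> M * F_norm (Y1 - Y2))"
proof -
  have s: "sgn_or_one (\<lambda>_. 1)" "sgn_or_one sgn" by (auto simp: sgn_or_one_def)
  have d: "Y1 - Y2 \<in> FF_rc" by (rule FF_rc_diff[OF Y(1,3)])
  have "comps_le (Y1 - Y2) (F_norm (Y1 - Y2))" by (rule comps_le_of_F_norm[OF FF_rc_FF[OF d] order_refl])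
  moreover have "\<And>x. \<bar>l_zeta Y1 x - l_zeta Y2 x\<bar> \<le> F_norm (Y1 - Y2)"
    using FF_rc_pointwise(1)[OF d order_refl] by simp
  ultimately have b: "\<And>s. sgn_or_one s \<Longrightarrow> L2_Linf_le (\<lambda>\<xi>. A (nonloc s \<gamma> Y1) \<xi> - A (nonloc s \<gamma> Y2) \<xi>) (nonloc_const \<gamma> M * F_norm (Y1 - Y2))"
    using samp_nonloc_diff_L2_Linf_le[OF FF_rc_nonloc_setting[OF Y(1,2)] FF_rc_nonloc_setting[OF Y(3,4)] _ _ A] by blast
  have n: "0 \<le> nonloc_const \<gamma> M * F_norm (Y1 - Y2)" using L2_Linf_le_nonneg[OF b[OF s(1)]] .
  have eq: "A (PP \<gamma> Y) = (\<lambda>\<xi>. 1 / 2 * A (nonloc (\<lambda>_. 1) \<gamma> Y) \<xi>)"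
    "A (QQ \<gamma> Y) = (\<lambda>\<xi>. - 1 / 2 * A (nonloc sgn \<gamma> Y) \<xi>)" for Y
    unfolding samp_op(3)[OF A, symmetric] PP_nonloc[symmetric] QQ_nonloc[symmetric] by simp_all
  from L2_Linf_le_cmult[OF b[OF s(1)], of "1 / 2"] L2_Linf_le_cmult[OF b[OF s(2)], of "- 1 / 2"]
  have "L2_Linf_le (\<lambda>x. A (PP \<gamma> Y1) x - A (PP \<gamma> Y2) x) (\<bar>1 / 2\<bar> * (nonloc_const \<gamma> M * F_norm (Y1 - Y2)))"
    "L2_Linf_le (\<lambda>x. A (QQ \<gamma> Y1) x - A (QQ \<gamma> Y2) x) (\<bar>- 1 / 2\<bar> * (nonloc_const \<gamma> M * F_norm (Y1 - Y2)))"
    unfolding eq by (simp_all add: algebra_simps)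
  then show "L2_Linf_le (\<lambda>x. A (PP \<gamma> Y1) x - A (PP \<gamma> Y2) x) (nonloc_const \<gamma> M * F_norm (Y1 - Y2))"
    "L2_Linf_le (\<lambda>x. A (QQ \<gamma> Y1) x - A (QQ \<gamma> Y2) x) (nonloc_const \<gamma> M * F_norm (Y1 - Y2))"
    using n by (auto elim: L2_Linf_le_weaken)
qed

definition sampled_field :: "((real \<Rightarrow> real) \<Rightarrow> real \<Rightarrow> real) \<Rightarrow> real \<Rightarrow> real \<Rightarrow> real \<Rightarrow> lag \<Rightarrow> lag" where
  "sampled_field A a b \<gamma> Y = lag_field a b \<gamma> Y (A (PP \<gamma> Y)) (A (QQ \<gamma> Y))"

lemma lag_field_const_nonneg: "0 \<le> M \<Longrightarrow> 0 \<le> lag_field_const \<gamma> M"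
  by (simp add: lag_field_const_def Let_def)

lemma lag_field_diff_F_norm:
  assumes M: "0 \<le> M" "0 \<le> \<epsilon>"
  assumes Y: "Y1 \<in> FF" "F_norm Y1 \<le> M" "Y2 \<in> FF" "F_norm Y2 \<le> M"
    and PQ: "L2_Linf_le P1 M" "L2_Linf_le P2 M" "L2_Linf_le Q1 M" "L2_Linf_le Q2 M"
      "L2_Linf_le (\<lambda>x. P1 x - P2 x) \<epsilon>" "L2_Linf_le (\<lambda>x. Q1 x - Q2 x) \<epsilon>"
    and ab: "\<bar>a\<bar> \<le> 1" "\<bar>b\<bar> \<le> 1"
  shows "lag_field a b \<gamma> Y1 P1 Q1 - lag_field a b \<gamma> Y2 P2 Q2 \<in> FF"
    "F_norm (lag_field a b \<gamma> Y1 P1 Q1 - lag_field a b \<gamma> Y2 P2 Q2) \<le> 7 * lag_field_const \<gamma> M * (F_norm (Y1 - Y2) + \<epsilon>)"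
proof -
  let ?d = "F_norm (Y1 - Y2) + \<epsilon>"
  have "comps_le (lag_field a b \<gamma> Y1 P1 Q1 - lag_field a b \<gamma> Y2 P2 Q2) (lag_field_const \<gamma> M * ?d)"
  proof (rule lag_field_diff_comps_le)
    show "comps_le Y1 M" "comps_le Y2 M" using Y by (auto intro: comps_le_of_F_norm)
    show "comps_le (Y1 - Y2) ?d" using F_norm_diff(1)[OF Y(1,3)] M(2) by (intro comps_le_of_F_norm) auto
    show "L2_Linf_le (\<lambda>x. P1 x - P2 x) ?d" "L2_Linf_le (\<lambda>x. Q1 x - Q2 x) ?d"
      using PQ by (auto elim: L2_Linf_le_weaken)
  qed (use PQ ab in auto)
  from comps_le_imp[OF this] show "lag_field a b \<gamma> Y1 P1 Q1 - lag_field a b \<gamma> Y2 P2 Q2 \<in> FF"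
    "F_norm (lag_field a b \<gamma> Y1 P1 Q1 - lag_field a b \<gamma> Y2 P2 Q2) \<le> 7 * lag_field_const \<gamma> M * ?d" by (simp_all add: mult.assoc)
qed

lemma lag_field_0: "lag_field a b \<gamma> 0 (\<lambda>_. 0) (\<lambda>_. 0) = 0"
  by (simp add: lag_field_def zero_lag_def)

lemma lag_field_F_norm:
  assumes M: "0 \<le> M" and Y: "Y \<in> FF" "F_norm Y \<le> M"
    and PQ: "L2_Linf_le P M" "L2_Linf_le Q M" and ab: "\<bar>a\<bar> \<le> 1" "\<bar>b\<bar> \<le> 1"
  shows "lag_field a b \<gamma> Y P Q \<in> FF" "F_norm (lag_field a b \<gamma> Y P Q) \<le> 7 * lag_field_const \<gamma> M * (2 * M)"
proof -
  have 0: "L2_Linf_le (\<lambda>_. 0) M" using L2_Linf_le_0 M by (rule L2_Linf_le_weaken)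
  note * = lag_field_diff_F_norm[OF M M Y FF_0 _ PQ(1) 0 PQ(2) 0 _ _ ab, unfolded lag_field_0]
  show "lag_field a b \<gamma> Y P Q \<in> FF" using * M PQ by simp
  have "F_norm (lag_field a b \<gamma> Y P Q) \<le> 7 * lag_field_const \<gamma> M * (F_norm Y + M)" using * M PQ by simp
  also have "\<dots> \<le> 7 * lag_field_const \<gamma> M * (2 * M)"
    using Y(2) lag_field_const_nonneg[OF M] by (intro mult_left_mono) auto
  finally show "F_norm (lag_field a b \<gamma> Y P Q) \<le> 7 * lag_field_const \<gamma> M * (2 * M)" .
qed

text \<open>A bound and a Lipschitz constant in one number, for all fields on the ball of radius M.
  The inner radius \<open>K\<close> also accommodates the bounds on P and Q over that ball.\<close>

definition sampled_field_const :: "real \<Rightarrow> real \<Rightarrow> real" where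
  "sampled_field_const \<gamma> M = (let K = M + PQ_const \<gamma> M in 7 * lag_field_const \<gamma> K * (1 + nonloc_const \<gamma> M) + 7 * lag_field_const \<gamma> K * (2 * K))"

lemma PQ_const_nonneg: "0 \<le> M \<Longrightarrow> 0 \<le> PQ_const \<gamma> M" and nonloc_const_nonneg: "0 \<le> M \<Longrightarrow> 0 \<le> nonloc_const \<gamma> M"
  using kernelD(6)[OF kernel_exp_kernel] by (simp_all add: PQ_const_def nonloc_const_def source_const_nonneg)

lemma sampled_field_const_nonneg: "0 \<le> M \<Longrightarrow> 0 \<le> sampled_field_const \<gamma> M"
  by (simp add: sampled_field_const_def Let_def PQ_const_nonneg nonloc_const_nonneg lag_field_const_nonneg)

lemma sampled_field_lipschitz:
  assumes Y: "Y1 \<in> FF_rc" "F_norm Y1 \<le> M" "Y2 \<in> FF_rc" "F_norm Y2 \<le> M" and A: "samp_op A"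
    and ab: "\<bar>a\<bar> \<le> 1" "\<bar>b\<bar> \<le> 1"
  shows "F_norm (sampled_field A a b \<gamma> Y1 - sampled_field A a b \<gamma> Y2) \<le> sampled_field_const \<gamma> M * F_norm (Y1 - Y2)"
proof -
  have M: "0 \<le> M" using Y(2) F_norm_nonneg order_trans by blast
  define K where "K = M + PQ_const \<gamma> M"
  have K: "0 \<le> K" "M \<le> K" "PQ_const \<gamma> M \<le> K" using M PQ_const_nonneg[OF M, of \<gamma>] by (auto simp: K_def)
  have n: "0 \<le> nonloc_const \<gamma> M * F_norm (Y1 - Y2)" using nonloc_const_nonneg[OF M] by simp
  have "F_norm (sampled_field A a b \<gamma> Y1 - sampled_field A a b \<gamma> Y2) \<le> 7 * lag_field_const \<gamma> K * (F_norm (Y1 - Y2) + nonloc_const \<gamma> M * F_norm (Y1 - Y2))"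
    unfolding sampled_field_def
    using Y K PQ_L2_Linf_le[OF Y(1,2) A, of \<gamma>] PQ_L2_Linf_le[OF Y(3,4) A, of \<gamma>] ab
    by (intro lag_field_diff_F_norm n PQ_diff_L2_Linf_le[OF Y A]) (auto elim: L2_Linf_le_weaken intro: FF_rc_FF)
  also have "\<dots> = 7 * lag_field_const \<gamma> K * (1 + nonloc_const \<gamma> M) * F_norm (Y1 - Y2)" by (simp add: algebra_simps)
  also have "\<dots> \<le> sampled_field_const \<gamma> M * F_norm (Y1 - Y2)"
    using K(1) lag_field_const_nonneg[OF K(1), of \<gamma>] by (intro mult_right_mono) (auto simp: sampled_field_const_def Let_def K_def[symmetric])
  finally show ?thesis .
qed

lemma sampled_field_bounded:
  assumes Y: "Y \<in> FF_rc" "F_norm Y \<le> M" and A: "samp_op A" and ab: "\<bar>a\<bar> \<le> 1" "\<bar>b\<bar> \<le> 1"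
  shows "sampled_field A a b \<gamma> Y \<in> FF" "F_norm (sampled_field A a b \<gamma> Y) \<le> sampled_field_const \<gamma> M"
proof -
  have M: "0 \<le> M" using Y(2) F_norm_nonneg order_trans by blast
  define K where "K = M + PQ_const \<gamma> M"
  have K: "0 \<le> K" "M \<le> K" "PQ_const \<gamma> M \<le> K" using M PQ_const_nonneg[OF M, of \<gamma>] by (auto simp: K_def)
  have *: "sampled_field A a b \<gamma> Y \<in> FF" "F_norm (sampled_field A a b \<gamma> Y) \<le> 7 * lag_field_const \<gamma> K * (2 * K)"
    unfolding sampled_field_def
    using lag_field_F_norm[OF K(1) FF_rc_FF[OF Y(1)] order_trans[OF Y(2) K(2)]
        L2_Linf_le_weaken[OF PQ_L2_Linf_le(1)[OF Y A] K(3)] L2_Linf_le_weaken[OF PQ_L2_Linf_le(2)[OF Y A] K(3)] ab] by auto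
  show "sampled_field A a b \<gamma> Y \<in> FF" by fact
  show "F_norm (sampled_field A a b \<gamma> Y) \<le> sampled_field_const \<gamma> M"
    using *(2) K(1) lag_field_const_nonneg[OF K(1), of \<gamma>] nonloc_const_nonneg[OF M, of \<gamma>]
    by (auto simp: sampled_field_const_def Let_def K_def[symmetric] intro: order_trans)
qed

lemma G_rhs_sampled_field: "G_rhs \<gamma> Y = sampled_field (\<lambda>f. f) 1 1 \<gamma> Y"
  by (simp add: sampled_field_def G_rhs_lag_field)

lemma G_bar_sampled_field: "G_bar1 \<gamma> \<delta> N = sampled_field (sample \<delta> N) 1 0 \<gamma>" "G_bar2 \<gamma> \<delta> N = sampled_field (sample \<delta> N) 0 1 \<gamma>"
  by (simp_all add: sampled_field_def G_bar1_lag_field G_bar2_lag_field fun_eq_iff)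

lemma sampled_field_add: "sampled_field A 1 0 \<gamma> Y + sampled_field A 0 1 \<gamma> Y = sampled_field A 1 1 \<gamma> Y"
  by (simp add: sampled_field_def lag_field_add)

section \<open>Grid functions and the implicit midpoint rule\<close>

definition comps :: "(lag \<Rightarrow> real \<Rightarrow> real) set" where
  "comps = {l_zeta, l_U, l_H, l_v, l_w, l_h}"

definition comps0 :: "(lag \<Rightarrow> real \<Rightarrow> real) set" where
  "comps0 = {l_U, l_v, l_w, l_h}"

lemma comps_linear:
  assumes "f \<in> comps"
  shows "f (X + Y) x = f X x + f Y x" "f (X - Y) x = f X x - f Y x" "f (c *\<^sub>R X) x = c * f X x"
  using assms by (auto simp: comps_def)

lemma comps_measurable: "Y \<in> FF \<Longrightarrow> f \<in> comps \<Longrightarrow> f Y \<in> borel_measurable borel"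
  by (auto simp: comps_def FF_measurable)

lemma lag_eqI: "(\<And>f x. f \<in> comps \<Longrightarrow> f X x = f Y x) \<Longrightarrow> X = Y"
  by (rule lag.expand) (auto simp: comps_def fun_eq_iff)

text \<open>Constancy is stated as equations between values at two points; such equations are
  inherited by linear combinations and by pointwise limits.\<close>

definition cell_const :: "real \<Rightarrow> (real \<Rightarrow> real) \<Rightarrow> bool" where
  "cell_const \<delta> f \<longleftrightarrow> (\<forall>x. f x = f (grid \<delta> \<lfloor>x / \<delta>\<rfloor>))"

text \<open>Unlike [R, \<infinity>), the left half-line has no first point, so
  \<open>left_const\<close> names a reference point b. It will be the vertex -(N+1)\<delta>, one
  cell to the left of -R.\<close>

definition right_const :: "real \<Rightarrow> (real \<Rightarrow> real) \<Rightarrow> bool" where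
  "right_const R f \<longleftrightarrow> (\<forall>x\<ge>R. f x = f R)"

definition left_const :: "real \<Rightarrow> real \<Rightarrow> (real \<Rightarrow> real) \<Rightarrow> bool" where
  "left_const R b f \<longleftrightarrow> (\<forall>x<R. f x = f b)"

definition zero_outside :: "real \<Rightarrow> (real \<Rightarrow> real) \<Rightarrow> bool" where
  "zero_outside R f \<longleftrightarrow> (\<forall>x. x < - R \<or> R \<le> x \<longrightarrow> f x = 0)"

definition piecewise :: "real \<Rightarrow> nat \<Rightarrow> lag \<Rightarrow> bool" where
  "piecewise \<delta> N Y \<longleftrightarrow>
     (\<forall>f\<in>comps. cell_const \<delta> (f Y)) \<and> (\<forall>f\<in>comps0. zero_outside (real N * \<delta>) (f Y)) \<and>
     right_const (real N * \<delta>) (l_zeta Y) \<and> right_const (real N * \<delta>) (l_H Y) \<and>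
     left_const (- (real N * \<delta>)) (- (real N + 1) * \<delta>) (l_zeta Y) \<and>
     (\<forall>x < - (real N * \<delta>). l_H Y x = 0)"

lemma piecewiseD:
  assumes "piecewise \<delta> N Y"
  shows "f \<in> comps \<Longrightarrow> f Y x = f Y (grid \<delta> \<lfloor>x / \<delta>\<rfloor>)"
    "f \<in> comps0 \<Longrightarrow> x < - (real N * \<delta>) \<or> real N * \<delta> \<le> x \<Longrightarrow> f Y x = 0"
    "real N * \<delta> \<le> x \<Longrightarrow> l_zeta Y x = l_zeta Y (real N * \<delta>)"
    "real N * \<delta> \<le> x \<Longrightarrow> l_H Y x = l_H Y (real N * \<delta>)"
    "x < - (real N * \<delta>) \<Longrightarrow> l_zeta Y x = l_zeta Y (- (real N + 1) * \<delta>)"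
    "x < - (real N * \<delta>) \<Longrightarrow> l_H Y x = 0"
  using assms unfolding piecewise_def cell_const_def right_const_def left_const_def zero_outside_def
  by blast+

lemma piecewise_linear:
  assumes "piecewise \<delta> N X" "piecewise \<delta> N Y"
  shows "piecewise \<delta> N (a *\<^sub>R X + b *\<^sub>R Y)"
proof -
  have *: "f (a *\<^sub>R X + b *\<^sub>R Y) x = a * f X x + b * f Y x" if "f \<in> comps" for f x
    using that by (simp add: comps_linear)
  have z: "f \<in> comps0 \<Longrightarrow> f \<in> comps" for f by (auto simp: comps_def comps0_def)
  have i: "l_zeta \<in> comps" "l_H \<in> comps" by (auto simp: comps_def)
  note pX = piecewiseD[OF assms(1)] and pY = piecewiseD[OF assms(2)]
  show ?thesis
    unfolding piecewise_def cell_const_def right_const_def left_const_def zero_outside_def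
  proof (intro conjI ballI allI impI)
    fix f :: "lag \<Rightarrow> real \<Rightarrow> real" and x assume f: "f \<in> comps"
    show "f (a *\<^sub>R X + b *\<^sub>R Y) x = f (a *\<^sub>R X + b *\<^sub>R Y) (grid \<delta> \<lfloor>x / \<delta>\<rfloor>)"
      unfolding *[OF f] using pX(1)[OF f, of x] pY(1)[OF f, of x] by metis
  next
    fix f :: "lag \<Rightarrow> real \<Rightarrow> real" and x
    assume f: "f \<in> comps0" and x: "x < - (real N * \<delta>) \<or> real N * \<delta> \<le> x"
    show "f (a *\<^sub>R X + b *\<^sub>R Y) x = 0" unfolding *[OF z[OF f]] using pX(2)[OF f x] pY(2)[OF f x] by simp
  next
    fix x assume x: "real N * \<delta> \<le> x"
    show "l_zeta (a *\<^sub>R X + b *\<^sub>R Y) x = l_zeta (a *\<^sub>R X + b *\<^sub>R Y) (real N * \<delta>)"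
      unfolding *[OF i(1)] using pX(3)[OF x] pY(3)[OF x] by metis
    show "l_H (a *\<^sub>R X + b *\<^sub>R Y) x = l_H (a *\<^sub>R X + b *\<^sub>R Y) (real N * \<delta>)"
      unfolding *[OF i(2)] using pX(4)[OF x] pY(4)[OF x] by metis
  next
    fix x assume x: "x < - (real N * \<delta>)"
    show "l_zeta (a *\<^sub>R X + b *\<^sub>R Y) x = l_zeta (a *\<^sub>R X + b *\<^sub>R Y) (- (real N + 1) * \<delta>)"
      unfolding *[OF i(1)] using pX(5)[OF x] pY(5)[OF x] by metis
    show "l_H (a *\<^sub>R X + b *\<^sub>R Y) x = 0"
      unfolding *[OF i(2)] using pX(6)[OF x] pY(6)[OF x] by simp
  qed
qed

lemma cellwise_const_iff:
  assumes "\<delta> > 0"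
  shows "cellwise_const \<delta> f \<longleftrightarrow> cell_const \<delta> f"
proof
  assume c: "cellwise_const \<delta> f"
  show "cell_const \<delta> f"
    unfolding cell_const_def
  proof
    fix x
    have "x \<in> {grid \<delta> \<lfloor>x / \<delta>\<rfloor>..<grid \<delta> (\<lfloor>x / \<delta>\<rfloor> + 1)}" using cell_iff[OF assms] by blast
    moreover have "grid \<delta> \<lfloor>x / \<delta>\<rfloor> \<in> {grid \<delta> \<lfloor>x / \<delta>\<rfloor>..<grid \<delta> (\<lfloor>x / \<delta>\<rfloor> + 1)}"
      using assms by (auto simp: grid_def)
    moreover obtain y where "\<And>x'. x' \<in> {grid \<delta> \<lfloor>x / \<delta>\<rfloor>..<grid \<delta> (\<lfloor>x / \<delta>\<rfloor> + 1)} \<Longrightarrow> f x' = y"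
      using c unfolding cellwise_const_def constant_on_def by blast
    ultimately show "f x = f (grid \<delta> \<lfloor>x / \<delta>\<rfloor>)" by metis
  qed
next
  assume c: "cell_const \<delta> f"
  show "cellwise_const \<delta> f"
    unfolding cellwise_const_def constant_on_def
  proof (intro allI exI ballI)
    fix i x assume "x \<in> {grid \<delta> i..<grid \<delta> (i + 1)}"
    then have "i = \<lfloor>x / \<delta>\<rfloor>" using cell_iff[OF assms] by blast
    then show "f x = f (grid \<delta> i)" using c unfolding cell_const_def by metis
  qed
qed

lemma constant_on_right: "f constant_on {R..} \<longleftrightarrow> right_const R f" for f :: "real \<Rightarrow> real"
  unfolding constant_on_def right_const_def by (metis atLeast_iff order_refl)

lemma constant_on_left: "b < a \<Longrightarrow> f constant_on {..<a} \<longleftrightarrow> left_const a b f" for f :: "real \<Rightarrow> real"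
  unfolding constant_on_def left_const_def by (metis lessThan_iff)

lemma zero_outside_iff: "(\<forall>x\<in>{..<- R} \<union> {R..}. f x = 0) \<longleftrightarrow> zero_outside R f"
  unfolding zero_outside_def by auto

lemma F_grid_iff:
  assumes \<delta>: "\<delta> > 0"
  shows "Y \<in> F_grid \<delta> N \<longleftrightarrow> Y \<in> FF \<and> piecewise \<delta> N Y"
proof -
  have lt: "- (real N + 1) * \<delta> < - (real N * \<delta>)" using \<delta> by (simp add: algebra_simps)
  show ?thesis
    unfolding F_grid_def Let_def piecewise_def comps_def comps0_def
    unfolding cellwise_const_iff[OF \<delta>] constant_on_right constant_on_left[OF lt] zero_outside_iff
    by (simp only: mem_Collect_eq ball_simps simp_thms conj_ac)
qed

lemma piecewise_right_cont:
  assumes \<delta>: "\<delta> > 0" and Y: "piecewise \<delta> N Y" and f: "f \<in> comps"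
  shows "continuous (at_right x) (f Y)"
proof -
  have x: "x \<in> {grid \<delta> \<lfloor>x / \<delta>\<rfloor>..<grid \<delta> (\<lfloor>x / \<delta>\<rfloor> + 1)}" using cell_iff[OF \<delta>] by blast
  have "eventually (\<lambda>y. y < grid \<delta> (\<lfloor>x / \<delta>\<rfloor> + 1)) (at_right x)"
    using x by (intro eventually_at_rightI[of x "grid \<delta> (\<lfloor>x / \<delta>\<rfloor> + 1)"]) auto
  moreover have "eventually (\<lambda>y. x < y) (at_right x)" by (rule eventually_at_right_less)
  ultimately have "eventually (\<lambda>y. f Y y = f Y x) (at_right x)"
  proof eventually_elim
    case (elim y)
    then have "\<lfloor>x / \<delta>\<rfloor> = \<lfloor>y / \<delta>\<rfloor>" using cell_iff[OF \<delta>, of y "\<lfloor>x / \<delta>\<rfloor>"] x by auto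
    then show ?case using piecewiseD(1)[OF Y f, of x] piecewiseD(1)[OF Y f, of y] by metis
  qed
  then show ?thesis unfolding continuous_within by (rule tendsto_eventually)
qed

lemma F_grid_FF_rc: "\<delta> > 0 \<Longrightarrow> Y \<in> F_grid \<delta> N \<Longrightarrow> Y \<in> FF_rc"
  using piecewise_right_cont[of \<delta> N Y l_zeta] piecewise_right_cont[of \<delta> N Y l_U]
  by (simp add: F_grid_iff FF_rc_def comps_def)

lemma F_grid_FF: "Y \<in> F_grid \<delta> N \<Longrightarrow> Y \<in> FF"
  by (simp add: F_grid_def Let_def)

lemma F_grid_linear:
  assumes "\<delta> > 0" "X \<in> F_grid \<delta> N" "Y \<in> F_grid \<delta> N"
  shows "a *\<^sub>R X + b *\<^sub>R Y \<in> F_grid \<delta> N"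
  using assms piecewise_linear[of \<delta> N X Y a b] F_norm_add(1) F_norm_scaleR(1)
  by (simp add: F_grid_iff)

lemma F_grid_add: "\<delta> > 0 \<Longrightarrow> X \<in> F_grid \<delta> N \<Longrightarrow> Y \<in> F_grid \<delta> N \<Longrightarrow> X + Y \<in> F_grid \<delta> N"
  using F_grid_linear[of \<delta> X N Y 1 1] by simp
lemma F_grid_diff: "\<delta> > 0 \<Longrightarrow> X \<in> F_grid \<delta> N \<Longrightarrow> Y \<in> F_grid \<delta> N \<Longrightarrow> X - Y \<in> F_grid \<delta> N"
  using F_grid_linear[of \<delta> X N Y 1 "- 1"] by simp
lemma F_grid_scaleR: "\<delta> > 0 \<Longrightarrow> X \<in> F_grid \<delta> N \<Longrightarrow> c *\<^sub>R X \<in> F_grid \<delta> N"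
  using F_grid_linear[of \<delta> X N X c 0] by simp

lemma sample_piecewise:
  assumes \<delta>: "\<delta> > 0"
  shows "sample \<delta> N f x = sample \<delta> N f (grid \<delta> \<lfloor>x / \<delta>\<rfloor>)"
    "x < - (real N * \<delta>) \<or> real N * \<delta> \<le> x \<Longrightarrow> sample \<delta> N f x = 0"
proof -
  have i: "grid \<delta> \<lfloor>x / \<delta>\<rfloor> / \<delta> = of_int \<lfloor>x / \<delta>\<rfloor>" using \<delta> by (simp add: grid_def)
  have r: "- real N * \<delta> \<le> y \<and> y < real N * \<delta> \<longleftrightarrow> - int N \<le> \<lfloor>y / \<delta>\<rfloor> \<and> \<lfloor>y / \<delta>\<rfloor> < int N" for y
    unfolding le_floor_iff floor_less_iff using \<delta> by (simp add: pos_le_divide_eq pos_divide_less_eq)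
  show "sample \<delta> N f x = sample \<delta> N f (grid \<delta> \<lfloor>x / \<delta>\<rfloor>)"
    unfolding sample_eq[OF \<delta>] r i by simp
  show "x < - (real N * \<delta>) \<or> real N * \<delta> \<le> x \<Longrightarrow> sample \<delta> N f x = 0"
    unfolding sample_eq[OF \<delta>] by auto
qed

text \<open>Outside [-R, R) both U and the sampled P and Q vanish, so zeta and H are not changed
  there and keep their constant ends. Inside, all ingredients are constant on cells.\<close>

lemma sampled_field_F_grid:
  assumes \<delta>: "0 < \<delta>" "\<delta> \<le> 1" and Y: "Y \<in> F_grid \<delta> N" and ab: "\<bar>a\<bar> \<le> 1" "\<bar>b\<bar> \<le> 1"
  shows "sampled_field (sample \<delta> N) a b \<gamma> Y \<in> F_grid \<delta> N"
proof -
  have FF: "sampled_field (sample \<delta> N) a b \<gamma> Y \<in> FF"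
    by (rule sampled_field_bounded(1)[OF F_grid_FF_rc[OF \<delta>(1) Y] order_refl samp_op_sample[OF \<delta>] ab])
  let ?P = "sample \<delta> N (PP \<gamma> Y)" and ?Q = "sample \<delta> N (QQ \<gamma> Y)"
  have pw: "piecewise \<delta> N Y" using Y F_grid_iff[OF \<delta>(1)] by simp
  note c = piecewiseD(1)[OF pw] and z = piecewiseD(2)[OF pw]
  note sp = sample_piecewise[OF \<delta>(1)]
  have ci: "l_U \<in> comps" "l_v \<in> comps" "l_w \<in> comps" "l_h \<in> comps" by (auto simp: comps_def)
  have ci0: "l_U \<in> comps0" "l_v \<in> comps0" "l_w \<in> comps0" "l_h \<in> comps0" by (auto simp: comps0_def)
  have "piecewise \<delta> N (lag_field a b \<gamma> Y ?P ?Q)"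
    unfolding piecewise_def cell_const_def right_const_def left_const_def zero_outside_def
  proof (intro conjI allI ballI impI)
    fix f :: "lag \<Rightarrow> real \<Rightarrow> real" and x assume f: "f \<in> comps"
    note e = sp(1)[of N "PP \<gamma> Y" x] sp(1)[of N "QQ \<gamma> Y" x] c[OF ci(1), of x] c[OF ci(2), of x] c[OF ci(3), of x] c[OF ci(4), of x]
    from f consider "f = l_zeta" | "f = l_U" | "f = l_H" | "f = l_v" | "f = l_w" | "f = l_h" by (auto simp: comps_def)
    then show "f (lag_field a b \<gamma> Y ?P ?Q) x = f (lag_field a b \<gamma> Y ?P ?Q) (grid \<delta> \<lfloor>x / \<delta>\<rfloor>)"
      by (cases; simp only: lag_field_def lag.sel l_q_def; metis e)
  next
    fix f :: "lag \<Rightarrow> real \<Rightarrow> real" and x assume f: "f \<in> comps0" and x: "x < - (real N * \<delta>) \<or> real N * \<delta> \<le> x"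
    show "f (lag_field a b \<gamma> Y ?P ?Q) x = 0"
      using f sp(2)[OF x] z[OF ci0(1) x] z[OF ci0(3) x] z[OF ci0(4) x] unfolding comps0_def lag_field_def l_q_def by auto
  next
    fix x assume x: "real N * \<delta> \<le> x"
    have U: "l_U Y x = 0" "l_U Y (real N * \<delta>) = 0" using z[OF ci0(1)] x by auto
    then show "l_zeta (lag_field a b \<gamma> Y ?P ?Q) x = l_zeta (lag_field a b \<gamma> Y ?P ?Q) (real N * \<delta>)"
      "l_H (lag_field a b \<gamma> Y ?P ?Q) x = l_H (lag_field a b \<gamma> Y ?P ?Q) (real N * \<delta>)"
      by (auto simp: lag_field_def)
  next
    have lt: "- (real N + 1) * \<delta> < - (real N * \<delta>)" using \<delta> by (simp add: algebra_simps)
    fix x assume x: "x < - (real N * \<delta>)"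
    have U: "l_U Y x = 0" "l_U Y (- (real N + 1) * \<delta>) = 0" using z[OF ci0(1)] x lt by auto
    then show "l_zeta (lag_field a b \<gamma> Y ?P ?Q) x = l_zeta (lag_field a b \<gamma> Y ?P ?Q) (- (real N + 1) * \<delta>)"
      "l_H (lag_field a b \<gamma> Y ?P ?Q) x = 0"
      by (auto simp: lag_field_def)
  qed
  then show ?thesis using FF F_grid_iff[OF \<delta>(1)] by (simp add: sampled_field_def)
qed

section \<open>The grid space as a finite-dimensional normed space\<close>

lemma L2_le_cell_value:
  assumes f: "L2_le f b" and \<delta>: "\<delta> > 0" and c: "\<And>x. x \<in> {p..<p + \<delta>} \<Longrightarrow> f x = a"
  shows "\<bar>a\<bar> \<le> b / sqrt \<delta>"
proof -
  have "(LINT x|lborel. a\<^sup>2 * indicator {p..<p + \<delta>} x) \<le> (LINT x|lborel. (f x)\<^sup>2)"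
  proof (rule integral_mono)
    show "integrable lborel (\<lambda>x. a\<^sup>2 * indicator {p..<p + \<delta>} x)" using \<delta> by simp
    show "integrable lborel (\<lambda>x. (f x)\<^sup>2)" using f by (simp add: L2_le_iff)
    show "a\<^sup>2 * indicator {p..<p + \<delta>} x \<le> (f x)\<^sup>2" for x
      using c by (cases "x \<in> {p..<p + \<delta>}") auto
  qed
  also have "\<dots> \<le> b\<^sup>2" using f by (simp add: L2_le_iff)
  finally have "a\<^sup>2 * \<delta> \<le> b\<^sup>2" using \<delta> by simp
  then have "sqrt (a\<^sup>2 * \<delta>) \<le> sqrt (b\<^sup>2)" by (rule real_sqrt_le_mono)
  then have "\<bar>a\<bar> * sqrt \<delta> \<le> b" using L2_le_nonneg[OF f] by (simp add: real_sqrt_mult)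
  then show ?thesis using \<delta> by (simp add: pos_le_divide_eq)
qed

text \<open>The factor 1/sqrt \<delta> degenerates under refinement. The bound serves a fixed grid
  only: to identify states at distance 0 and to find limits of Cauchy sequences.\<close>

lemma F_grid_pointwise:
  assumes \<delta>: "\<delta> > 0" and Y: "Y \<in> F_grid \<delta> N" and f: "f \<in> comps"
  shows "\<bar>f Y x\<bar> \<le> (1 + 1 / sqrt \<delta>) * F_norm Y"
proof -
  have comps_le: "comps_le Y (F_norm Y)" by (rule comps_le_of_F_norm[OF F_grid_FF[OF Y] order_refl])
  have pw: "piecewise \<delta> N Y" using Y F_grid_iff[OF \<delta>] by simp
  consider "Linf_le (f Y) (F_norm Y)" | "L2_le (f Y) (F_norm Y)"
    using comps_le f by (auto simp: comps_le_def comps_def L2_Linf_le_def)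
  then show ?thesis
  proof cases
    case 1
    then have "\<bar>f Y x\<bar> \<le> F_norm Y"
      by (rule Linf_le_right_cont) (rule piecewise_right_cont[OF \<delta> pw f])
    moreover have "0 \<le> 1 / sqrt \<delta> * F_norm Y" using \<delta> by simp
    ultimately show ?thesis by (simp add: distrib_right)
  next
    case 2
    have "f Y y = f Y x" if "y \<in> {grid \<delta> \<lfloor>x / \<delta>\<rfloor>..<grid \<delta> \<lfloor>x / \<delta>\<rfloor> + \<delta>}" for y
    proof -
      have "\<lfloor>x / \<delta>\<rfloor> = \<lfloor>y / \<delta>\<rfloor>" using cell_iff[OF \<delta>, of y "\<lfloor>x / \<delta>\<rfloor>"] that by (simp add: grid_def distrib_right)
      then show ?thesis using piecewiseD(1)[OF pw f, of x] piecewiseD(1)[OF pw f, of y] by metis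
    qed
    then have "\<bar>f Y x\<bar> \<le> F_norm Y / sqrt \<delta>" by (rule L2_le_cell_value[OF 2 \<delta>])
    then show ?thesis by (simp add: distrib_right add_increasing)
  qed
qed

text \<open>A grid state is determined by its values at 2N + 2 vertices: the vertex N represents the
  right end and -N - 1 the left end.\<close>

definition vertex_sum :: "real \<Rightarrow> nat \<Rightarrow> lag \<Rightarrow> real" where
  "vertex_sum \<delta> N Y = (\<Sum>i\<in>{- int N - 1..int N}. \<Sum>f\<in>comps. \<bar>f Y (grid \<delta> i)\<bar>)"

lemma finite_comps: "finite comps" by (simp add: comps_def)

lemma piecewise_vertex_sum:
  assumes \<delta>: "\<delta> > 0" and pw: "piecewise \<delta> N Y" and f: "f \<in> comps"
  shows "\<bar>f Y x\<bar> \<le> vertex_sum \<delta> N Y"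
proof -
  have v: "\<bar>f Y (grid \<delta> i)\<bar> \<le> vertex_sum \<delta> N Y" if "i \<in> {- int N - 1..int N}" for i
  proof -
    have "\<bar>f Y (grid \<delta> i)\<bar> \<le> (\<Sum>f\<in>comps. \<bar>f Y (grid \<delta> i)\<bar>)"
      by (rule member_le_sum) (use f finite_comps in auto)
    also have "\<dots> \<le> vertex_sum \<delta> N Y"
      unfolding vertex_sum_def by (rule member_le_sum) (use that in \<open>auto intro: sum_nonneg\<close>)
    finally show ?thesis .
  qed
  have nn: "0 \<le> vertex_sum \<delta> N Y" unfolding vertex_sum_def by (intro sum_nonneg) auto
  have c: "f Y x = f Y (grid \<delta> \<lfloor>x / \<delta>\<rfloor>)" by (rule piecewiseD(1)[OF pw f])
  have f3: "f \<in> comps0 \<or> f = l_zeta \<or> f = l_H" using f by (auto simp: comps_def comps0_def)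
  have g: "grid \<delta> (int N) = real N * \<delta>" "grid \<delta> (- int N - 1) = - (real N + 1) * \<delta>"
    by (simp_all add: grid_def algebra_simps)
  consider "x < - (real N * \<delta>)" | "real N * \<delta> \<le> x" | "- real N * \<delta> \<le> x \<and> x < real N * \<delta>" by (simp, linarith)
  then show ?thesis
  proof cases
    case 1
    then have "f Y x = 0 \<or> f Y x = f Y (grid \<delta> (- int N - 1))"
      using piecewiseD(2-)[OF pw] f3 unfolding g by blast
    then show ?thesis using v[of "- int N - 1"] nn by auto
  next
    case 2
    then have "f Y x = 0 \<or> f Y x = f Y (grid \<delta> (int N))"
      using piecewiseD(2-)[OF pw] f3 unfolding g by blast
    then show ?thesis using v[of "int N"] nn by auto
  next
    case 3
    then have "- int N \<le> \<lfloor>x / \<delta>\<rfloor> \<and> \<lfloor>x / \<delta>\<rfloor> < int N"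
      unfolding le_floor_iff floor_less_iff using \<delta> by (simp add: pos_le_divide_eq pos_divide_less_eq)
    then show ?thesis using v[of "\<lfloor>x / \<delta>\<rfloor>"] c by auto
  qed
qed

lemma piecewise_FF:
  assumes \<delta>: "\<delta> > 0" and pw: "piecewise \<delta> N Y"
    and m: "\<And>f. f \<in> comps \<Longrightarrow> f Y \<in> borel_measurable borel"
  shows "Y \<in> FF" "F_norm Y \<le> 7 * ((1 + sqrt (2 * (real N * \<delta>))) * vertex_sum \<delta> N Y)"
proof -
  let ?V = "vertex_sum \<delta> N Y" and ?R = "real N * \<delta>"
  have nn: "0 \<le> ?V" unfolding vertex_sum_def by (intro sum_nonneg) auto
  have i: "Linf_le (f Y) ((1 + sqrt (2 * ?R)) * ?V)" if "f \<in> comps" for f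
    using piecewise_vertex_sum[OF \<delta> pw that] m[OF that] \<delta> nn
    by (intro Linf_leI) (auto simp: distrib_right intro: add_increasing2)
  have l: "L2_le (f Y) ((1 + sqrt (2 * ?R)) * ?V)" if f: "f \<in> comps0" for f
  proof -
    have fc: "f \<in> comps" using f by (auto simp: comps_def comps0_def)
    have sq: "(?V * indicator {- ?R..?R} x)\<^sup>2 = ?V\<^sup>2 * indicator {- ?R..?R} x" for x :: real
      by (simp split: split_indicator)
    have k: "L2_le (\<lambda>x. ?V * indicator {- ?R..?R} x) (?V * sqrt (2 * ?R))"
      unfolding L2_le_iff sq using \<delta> nn by (auto simp: power_mult_distrib)
    have "L2_le (f Y) (?V * sqrt (2 * ?R))"
    proof (rule L2_le_mono[OF k m[OF fc]], rule AE_I2)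
      fix x
      show "\<bar>f Y x\<bar> \<le> \<bar>?V * indicator {- ?R..?R} x\<bar>"
      proof (cases "x \<in> {- ?R..<?R}")
        case True
        then show ?thesis using piecewise_vertex_sum[OF \<delta> pw fc, of x] nn by simp
      next
        case False
        then have "f Y x = 0" by (intro piecewiseD(2)[OF pw f]) auto
        then show ?thesis by simp
      qed
    qed
    then show ?thesis using nn by (elim L2_le_weaken) (simp add: distrib_right)
  qed
  have "comps_le Y ((1 + sqrt (2 * ?R)) * ?V)"
    using i l unfolding comps_le_def L2_Linf_le_def comps_def comps0_def by auto
  from comps_le_imp[OF this] show "Y \<in> FF" "F_norm Y \<le> 7 * ((1 + sqrt (2 * ?R)) * ?V)" by auto
qed

text \<open>Cauchy sequences converge at each point, the defining equations pass to the limit, and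
  the finite sum over vertices converts convergence at points into convergence in F.\<close>

lemma F_grid_complete:
  assumes \<delta>: "\<delta> > 0" and \<sigma>: "\<And>n. \<sigma> n \<in> F_grid \<delta> N"
    and Cauchy: "\<And>e. e > 0 \<Longrightarrow> \<exists>K. \<forall>m\<ge>K. \<forall>n\<ge>K. F_norm (\<sigma> m - \<sigma> n) < e"
  obtains Z where "Z \<in> F_grid \<delta> N" "(\<lambda>n. F_norm (\<sigma> n - Z)) \<longlonglongrightarrow> 0"
proof -
  let ?c = "1 + 1 / sqrt \<delta>"
  have c: "?c > 0" using \<delta> by (simp add: add_pos_nonneg)
  have conv: "convergent (\<lambda>n. f (\<sigma> n) x)" if f: "f \<in> comps" for f x
  proof (rule Cauchy_convergent, rule CauchyI)
    fix e :: real assume e: "e > 0"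
    from Cauchy[of "e / ?c"] e c obtain K where K: "\<And>m n. m \<ge> K \<Longrightarrow> n \<ge> K \<Longrightarrow> F_norm (\<sigma> m - \<sigma> n) < e / ?c"
      by (meson divide_pos_pos)
    show "\<exists>M. \<forall>m\<ge>M. \<forall>n\<ge>M. norm (f (\<sigma> m) x - f (\<sigma> n) x) < e"
    proof (intro exI allI impI)
      fix m n assume mn: "K \<le> m" "K \<le> n"
      have "\<bar>f (\<sigma> m - \<sigma> n) x\<bar> \<le> ?c * F_norm (\<sigma> m - \<sigma> n)"
        by (rule F_grid_pointwise[OF \<delta> F_grid_diff[OF \<delta> \<sigma> \<sigma>] f])
      also have "\<dots> < e" using K[OF mn] c by (simp add: pos_less_divide_eq mult.commute)
      finally show "norm (f (\<sigma> m) x - f (\<sigma> n) x) < e" by (simp add: comps_linear[OF f])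
    qed
  qed
  define L where "L f = (\<lambda>x. lim (\<lambda>n. f (\<sigma> n) x))" for f :: "lag \<Rightarrow> real \<Rightarrow> real"
  define Z where "Z = Lag (L l_zeta) (L l_U) (L l_H) (L l_v) (L l_w) (L l_h)"
  have ZL: "f Z = L f" if "f \<in> comps" for f using that by (auto simp: comps_def Z_def)
  have lim: "(\<lambda>n. f (\<sigma> n) x) \<longlonglongrightarrow> f Z x" if "f \<in> comps" for f x
    using conv[OF that, of x] ZL[OF that] by (simp add: L_def convergent_LIMSEQ_iff)
  have m: "f Z \<in> borel_measurable borel" if "f \<in> comps" for f
    by (rule borel_measurable_LIMSEQ_real[OF lim[OF that]])
      (rule comps_measurable[OF F_grid_FF[OF \<sigma>] that])
  have ps: "piecewise \<delta> N (\<sigma> n)" for n using \<sigma> F_grid_iff[OF \<delta>] by simp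
  have eq: "f Z x = f Z y" if "f \<in> comps" "\<And>n. f (\<sigma> n) x = f (\<sigma> n) y" for f x y
    using lim[OF that(1), of x] lim[OF that(1), of y] that(2) LIMSEQ_unique by simp
  have zero: "f Z x = 0" if "f \<in> comps" "\<And>n. f (\<sigma> n) x = 0" for f x
    using lim[OF that(1), of x] that(2) LIMSEQ_unique[of "\<lambda>_. 0" "f Z x" 0] by simp
  have z: "f \<in> comps0 \<Longrightarrow> f \<in> comps" for f by (auto simp: comps_def comps0_def)
  have i: "l_zeta \<in> comps" "l_H \<in> comps" by (auto simp: comps_def)
  have pZ: "piecewise \<delta> N Z"
    unfolding piecewise_def cell_const_def right_const_def left_const_def zero_outside_def
  proof (intro conjI allI ballI impI)
    fix f :: "lag \<Rightarrow> real \<Rightarrow> real" and x assume f: "f \<in> comps"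
    show "f Z x = f Z (grid \<delta> \<lfloor>x / \<delta>\<rfloor>)"
      using eq[of f x "grid \<delta> \<lfloor>x / \<delta>\<rfloor>"] f piecewiseD(1)[OF ps f, of _ x] by blast
  next
    fix f :: "lag \<Rightarrow> real \<Rightarrow> real" and x assume f: "f \<in> comps0" and x: "x < - (real N * \<delta>) \<or> real N * \<delta> \<le> x"
    show "f Z x = 0"
      using zero[of f x] z[OF f] piecewiseD(2)[OF ps f x] by blast
  next
    fix x assume x: "real N * \<delta> \<le> x"
    show "l_zeta Z x = l_zeta Z (real N * \<delta>)"
      using eq[of l_zeta x "real N * \<delta>"] i piecewiseD(3)[OF ps x] by blast
    show "l_H Z x = l_H Z (real N * \<delta>)"
      using eq[of l_H x "real N * \<delta>"] i piecewiseD(4)[OF ps x] by blast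
  next
    fix x assume x: "x < - (real N * \<delta>)"
    show "l_zeta Z x = l_zeta Z (- (real N + 1) * \<delta>)"
      using eq[of l_zeta x "- (real N + 1) * \<delta>"] i piecewiseD(5)[OF ps x] by blast
    show "l_H Z x = 0"
      using zero[of l_H x] i piecewiseD(6)[OF ps x] by blast
  qed
  have ZF: "Z \<in> F_grid \<delta> N" unfolding F_grid_iff[OF \<delta>] by (intro conjI piecewise_FF(1)[OF \<delta> pZ] pZ) (rule m)
  have "(\<lambda>n. vertex_sum \<delta> N (\<sigma> n - Z)) \<longlonglongrightarrow> (\<Sum>i\<in>{- int N - 1..int N}. \<Sum>f\<in>comps. \<bar>0\<bar>)"
    unfolding vertex_sum_def
  proof (intro tendsto_sum tendsto_rabs)
    fix i and f :: "lag \<Rightarrow> real \<Rightarrow> real" assume f: "f \<in> comps"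
    have "(\<lambda>n. f (\<sigma> n) (grid \<delta> i) - f Z (grid \<delta> i)) \<longlonglongrightarrow> f Z (grid \<delta> i) - f Z (grid \<delta> i)"
      by (intro tendsto_intros lim f)
    then show "(\<lambda>n. f (\<sigma> n - Z) (grid \<delta> i)) \<longlonglongrightarrow> 0" by (simp add: comps_linear[OF f])
  qed
  then have v: "(\<lambda>n. 7 * ((1 + sqrt (2 * (real N * \<delta>))) * vertex_sum \<delta> N (\<sigma> n - Z))) \<longlonglongrightarrow> 7 * ((1 + sqrt (2 * (real N * \<delta>))) * 0)"
    by (intro tendsto_intros) simp
  have "(\<lambda>n. F_norm (\<sigma> n - Z)) \<longlonglongrightarrow> 0"
  proof (rule tendsto_sandwich[OF _ _ tendsto_const])
    show "(\<lambda>n. 7 * ((1 + sqrt (2 * (real N * \<delta>))) * vertex_sum \<delta> N (\<sigma> n - Z))) \<longlonglongrightarrow> 0" using v by simp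
    show "\<forall>\<^sub>F n in sequentially. F_norm (\<sigma> n - Z) \<le> 7 * ((1 + sqrt (2 * (real N * \<delta>))) * vertex_sum \<delta> N (\<sigma> n - Z))"
    proof (intro always_eventually allI)
      fix n
      have d: "\<sigma> n - Z \<in> F_grid \<delta> N" by (rule F_grid_diff[OF \<delta> \<sigma> ZF])
      then have "piecewise \<delta> N (\<sigma> n - Z)" by (simp only: F_grid_iff[OF \<delta>])
      then show "F_norm (\<sigma> n - Z) \<le> 7 * ((1 + sqrt (2 * (real N * \<delta>))) * vertex_sum \<delta> N (\<sigma> n - Z))"
        by (rule piecewise_FF(2)[OF \<delta>]) (rule comps_measurable[OF F_grid_FF[OF d]])
    qed
  qed simp
  with ZF show ?thesis by (rule that)
qed

lemma F_grid_norm_0: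
  assumes \<delta>: "\<delta> > 0" and X: "X \<in> F_grid \<delta> N" and Y: "Y \<in> F_grid \<delta> N" and "F_norm (X - Y) = 0"
  shows "X = Y"
proof (rule lag_eqI)
  fix f :: "lag \<Rightarrow> real \<Rightarrow> real" and x assume f: "f \<in> comps"
  have "\<bar>f (X - Y) x\<bar> \<le> (1 + 1 / sqrt \<delta>) * F_norm (X - Y)"
    by (rule F_grid_pointwise[OF \<delta> F_grid_diff[OF \<delta> X Y] f])
  then show "f X x = f Y x" using assms(4) by (simp add: comps_linear[OF f])
qed

text \<open>By contraction, the midpoint equation has exactly one solution in the unit ball around \<open>Y\<close>;
  it is therefore the solution closest to \<open>Y\<close>.\<close>

lemma midpoint_step:
  assumes \<delta>: "\<delta> > 0" and Y: "Y \<in> F_grid \<delta> N" "F_norm Y \<le> M" and \<tau>: "0 \<le> \<tau>" "\<tau> * L \<le> 1"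
    and g: "\<And>Z. Z \<in> F_grid \<delta> N \<Longrightarrow> g Z \<in> F_grid \<delta> N"
      "\<And>Z. Z \<in> F_grid \<delta> N \<Longrightarrow> F_norm Z \<le> M + 1 \<Longrightarrow> F_norm (g Z) \<le> L"
      "\<And>X Z. X \<in> F_grid \<delta> N \<Longrightarrow> F_norm X \<le> M + 1 \<Longrightarrow> Z \<in> F_grid \<delta> N \<Longrightarrow> F_norm Z \<le> M + 1 \<Longrightarrow>
        F_norm (g X - g Z) \<le> L * F_norm (X - Z)"
  defines "Z \<equiv> midpoint_step (F_grid \<delta> N) g \<tau> Y"
  shows "Z \<in> F_grid \<delta> N" "Z = Y + \<tau> *\<^sub>R g ((1/2) *\<^sub>R (Y + Z))" "F_norm (Z - Y) \<le> \<tau> * L" "F_norm ((1/2) *\<^sub>R (Y + Z) - Y) \<le> \<tau> * L"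
proof -
  define S where "S = {Z \<in> F_grid \<delta> N. F_norm (Z - Y) \<le> 1}"
  let ?mid = "\<lambda>Z. (1/2) *\<^sub>R (Y + Z)"
  define \<Psi> where "\<Psi> = (\<lambda>Z. Y + \<tau> *\<^sub>R g (?mid Z))"
  have G: "X - Z \<in> F_grid \<delta> N" "X + Z \<in> F_grid \<delta> N" "c *\<^sub>R X \<in> F_grid \<delta> N" "X \<in> FF"
    if "X \<in> F_grid \<delta> N" "Z \<in> F_grid \<delta> N" for X Z c
    using that F_grid_diff[OF \<delta>] F_grid_add[OF \<delta>] F_grid_scaleR[OF \<delta>] F_grid_FF by auto
  have L: "0 \<le> L" using g(2)[OF Y(1)] Y(2) F_norm_nonneg[of "g Y"] by linarith
  have YF: "Y \<in> FF" using Y(1) by (rule F_grid_FF)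
  have midY: "F_norm (?mid Z - Y) \<le> F_norm (Z - Y) / 2" if "Z \<in> F_grid \<delta> N" for Z
  proof -
    have "?mid Z - Y = ?mid Z - (1/2) *\<^sub>R (Y + Y)" by (simp only: scaleR_half_double)
    also have "\<dots> = (1/2) *\<^sub>R ((Y + Z) - (Y + Y))" by (simp only: scaleR_diff_right)
    also have "(Y + Z) - (Y + Y) = Z - Y" by simp
    finally have "?mid Z - Y = (1/2) *\<^sub>R (Z - Y)" .
    then show ?thesis using F_norm_scaleR(2)[OF G(4)[OF G(1)[OF that Y(1)] Y(1)], of "1/2"] by simp
  qed
  have mid: "?mid Z \<in> F_grid \<delta> N" "F_norm (?mid Z) \<le> M + 1" if "Z \<in> S" for Z
  proof -
    have Z: "Z \<in> F_grid \<delta> N" "F_norm (Z - Y) \<le> 1" using that by (auto simp: S_def)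
    show m: "?mid Z \<in> F_grid \<delta> N" by (intro F_grid_scaleR F_grid_add \<delta> Y(1) Z(1))
    show "F_norm (?mid Z) \<le> M + 1"
      using F_norm_triangle_sub[OF F_grid_FF[OF m] YF] midY[OF Z(1)] Z(2) Y(2) by linarith
  qed
  have scal: "F_norm (\<tau> *\<^sub>R X) \<le> \<tau> * F_norm X" if "X \<in> FF" for X
    using F_norm_scaleR(2)[OF that, of \<tau>] \<tau> by simp
  have \<Psi>S: "\<Psi> Z \<in> F_grid \<delta> N" "F_norm (\<Psi> Z - Y) \<le> \<tau> * L" if "Z \<in> S" for Z
  proof -
    note m = mid[OF that]
    show "\<Psi> Z \<in> F_grid \<delta> N" unfolding \<Psi>_def by (intro F_grid_scaleR F_grid_add \<delta> Y(1) g(1) m(1))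
    have "F_norm (\<Psi> Z - Y) \<le> \<tau> * F_norm (g (?mid Z))"
      unfolding \<Psi>_def using scal[OF F_grid_FF[OF g(1)[OF m(1)]]] by simp
    also have "\<dots> \<le> \<tau> * L" using g(2)[OF m] \<tau> by (intro mult_left_mono)
    finally show "F_norm (\<Psi> Z - Y) \<le> \<tau> * L" .
  qed
  \<comment> \<open>The factor 1/2 comes from the rule itself: the midpoints of (Y, X) and (Y, Z)
    differ by (X - Z)/2, so \<tau> L <= 1 already makes the map a contraction.\<close>
  have con: "F_norm (\<Psi> X - \<Psi> Z) \<le> 1/2 * F_norm (X - Z)" if X: "X \<in> S" and Z: "Z \<in> S" for X Z
  proof -
    note mX = mid[OF X] and mZ = mid[OF Z]
    have XZ: "X \<in> F_grid \<delta> N" "Z \<in> F_grid \<delta> N" using X Z by (auto simp: S_def)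
    have "\<Psi> X - \<Psi> Z = \<tau> *\<^sub>R (g (?mid X) - g (?mid Z))" by (simp add: \<Psi>_def scaleR_diff_right)
    then have "F_norm (\<Psi> X - \<Psi> Z) \<le> \<tau> * F_norm (g (?mid X) - g (?mid Z))"
      using scal[OF F_grid_FF[OF G(1)[OF g(1)[OF mX(1)] g(1)[OF mZ(1)]]]] by simp
    also have "\<dots> \<le> \<tau> * (L * F_norm (?mid X - ?mid Z))"
      using g(3)[OF mX mZ] \<tau> by (intro mult_left_mono)
    also have "?mid X - ?mid Z = (1/2) *\<^sub>R (X - Z)"
      by (simp only: scaleR_diff_right[symmetric] add_diff_cancel_left)
    also have "\<tau> * (L * F_norm ((1/2) *\<^sub>R (X - Z))) \<le> \<tau> * (L * (1/2 * F_norm (X - Z)))"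
      using F_norm_scaleR(2)[OF F_grid_FF[OF G(1)[OF XZ]], of "1/2"] \<tau> L by (intro mult_left_mono) auto
    also have "\<dots> = (\<tau> * L) * (1/2 * F_norm (X - Z))" by simp
    also have "\<dots> \<le> 1 * (1/2 * F_norm (X - Z))" using \<tau> by (intro mult_right_mono) auto
    finally show ?thesis by simp
  qed
  \<comment> \<open>On functions \<open>F_norm\<close> is a seminorm; on piecewise constant
    representatives distance 0 forces equality, which makes it a metric.\<close>
  interpret MS: Metric_space S "\<lambda>X Z. F_norm (X - Z)"
  proof
    show "F_norm (X - Z) = F_norm (Z - X)" for X Z by (rule F_norm_commute)
    show "(F_norm (X - Z) = 0) = (X = Z)" if "X \<in> S" "Z \<in> S" for X Z
      using that F_grid_norm_0[OF \<delta>, of X N Z] by (auto simp: S_def)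
    show "F_norm (X - W) \<le> F_norm (X - Z) + F_norm (Z - W)" if "X \<in> S" "Z \<in> S" "W \<in> S" for X Z W
      using that by (intro F_norm_triangle) (auto simp: S_def F_grid_FF)
  qed auto
  have "MS.mcomplete"
    unfolding MS.mcomplete_def
  proof (intro allI impI)
    fix \<sigma> assume \<sigma>: "MS.MCauchy \<sigma>"
    have \<sigma>S: "\<sigma> n \<in> S" for n using \<sigma> by (auto simp: MS.MCauchy_def)
    then have \<sigma>F: "\<sigma> n \<in> F_grid \<delta> N" for n by (simp add: S_def)
    have C: "\<forall>\<epsilon>>0. \<exists>N. \<forall>n n'. N \<le> n \<longrightarrow> N \<le> n' \<longrightarrow> F_norm (\<sigma> n - \<sigma> n') < \<epsilon>"
      using \<sigma> unfolding MS.MCauchy_def by (rule conjunct2)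
    have "\<exists>K. \<forall>m\<ge>K. \<forall>n\<ge>K. F_norm (\<sigma> m - \<sigma> n) < e" if e: "e > 0" for e
    proof -
      obtain K where K: "\<forall>n n'. K \<le> n \<longrightarrow> K \<le> n' \<longrightarrow> F_norm (\<sigma> n - \<sigma> n') < e"
        using C[rule_format, OF e] by (elim exE)
      show ?thesis by (rule exI[of _ K]) (simp add: K)
    qed
    from F_grid_complete[of \<delta> \<sigma> N, OF \<delta> \<sigma>F this]
    obtain Z where Z: "Z \<in> F_grid \<delta> N" "(\<lambda>n. F_norm (\<sigma> n - Z)) \<longlonglongrightarrow> 0" .
    have "F_norm (Z - Y) \<le> 1"
    proof (rule tendsto_lowerbound)
      show "(\<lambda>n. F_norm (\<sigma> n - Z) + 1) \<longlonglongrightarrow> 1" using tendsto_add[OF Z(2) tendsto_const[of 1]] by simp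
      have "F_norm (Z - Y) \<le> F_norm (\<sigma> n - Z) + 1" for n
      proof -
        have "F_norm (Z - Y) \<le> F_norm (Z - \<sigma> n) + F_norm (\<sigma> n - Y)"
          by (intro F_norm_triangle F_grid_FF[OF Z(1)] F_grid_FF[OF \<sigma>F] YF)
        then show ?thesis using \<sigma>S[of n] by (simp add: S_def F_norm_commute[of Z])
      qed
      then show "\<forall>\<^sub>F n in sequentially. F_norm (Z - Y) \<le> F_norm (\<sigma> n - Z) + 1" by simp
    qed simp
    then have ZS: "Z \<in> S" using Z(1) by (simp add: S_def)
    have "limitin MS.mtopology \<sigma> Z sequentially"
      unfolding MS.limitin_metric using ZS \<sigma>S Z(2)
      by (auto simp: order_tendsto_iff elim!: eventually_mono)
    then show "\<exists>x. limitin MS.mtopology \<sigma> x sequentially" by blast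
  qed
  moreover have "S \<noteq> {}" using Y(1) by (auto simp: S_def intro!: exI[of _ Y])
  moreover have "\<Psi> \<in> S \<rightarrow> S" using \<Psi>S \<tau> by (force simp: S_def)
  ultimately obtain Z0 where Z0: "Z0 \<in> S" "\<Psi> Z0 = Z0"
    using MS.Banach_fixedpoint_thm[of \<Psi> "1/2"] con by auto
  have uniq: "Z' = Z0" if "Z' \<in> S" "\<Psi> Z' = Z'" for Z'
  proof -
    have "F_norm (Z' - Z0) = 0"
      using con[OF that(1) Z0(1)] that(2) Z0(2) F_norm_nonneg[of "Z' - Z0"] by simp
    then show ?thesis using that(1) Z0(1) F_grid_norm_0[OF \<delta>] by (auto simp: S_def)
  qed
  let ?P = "\<lambda>Z. Z \<in> F_grid \<delta> N \<and> Z = Y + \<tau> *\<^sub>R g (?mid Z)"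
  have P0: "?P Z0" using Z0 by (auto simp: S_def \<Psi>_def)
  have n0: "F_norm (Z0 - Y) \<le> 1" using Z0(1) by (simp add: S_def)
  \<comment> \<open>A solution closer to Y than the fixed point would lie in the unit ball as well,
    contradicting uniqueness there.\<close>
  have am: "is_arg_min (\<lambda>Z. F_norm (Z - Y)) ?P Z0"
    unfolding is_arg_min_def
  proof (intro conjI notI)
    assume "\<exists>y. ?P y \<and> F_norm (y - Y) < F_norm (Z0 - Y)"
    then obtain y where y: "?P y" "F_norm (y - Y) < F_norm (Z0 - Y)" by blast
    then have "y \<in> S" "\<Psi> y = y" using n0 by (auto simp: S_def \<Psi>_def)
    then show False using uniq y(2) by blast
  qed (use P0 in auto)
  \<comment> \<open>\<open>arg_min\<close> returns some minimiser, which exists by the previous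
    step. Being no farther from Y than \<open>Z0\<close>, it lies in the ball, where the bounds on g
    apply.\<close>
  then have amZ: "is_arg_min (\<lambda>Z. F_norm (Z - Y)) ?P Z"
    unfolding Z_def midpoint_step_def arg_min_def by (rule someI)
  then have PZ: "?P Z" by (simp add: is_arg_min_def)
  have "F_norm (Z - Y) \<le> F_norm (Z0 - Y)" using amZ P0 unfolding is_arg_min_def by (meson not_less)
  then have ZS: "Z \<in> S" using PZ n0 by (simp add: S_def)
  show "Z \<in> F_grid \<delta> N" "Z = Y + \<tau> *\<^sub>R g ((1/2) *\<^sub>R (Y + Z))" using PZ by blast+
  then have "\<Psi> Z = Z" by (simp add: \<Psi>_def)
  with \<Psi>S(2)[OF ZS] show le: "F_norm (Z - Y) \<le> \<tau> * L" by simp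
  show "F_norm (?mid Z - Y) \<le> \<tau> * L"
    using midY[of Z] PZ le F_norm_nonneg[of "Z - Y"] by linarith
qed

section \<open>Time steps of the scheme and of the flow\<close>

text \<open>Each half step moves by at most \<tau> L <= 1, so all intermediate states stay in the
  ball of radius M + 2. The fields are evaluated at distance at most \<tau> L from Y in the first
  half step and 2 \<tau> L in the second; the Lipschitz bound turns this into (1 + 2) L^2
  \<tau>^2.\<close>

lemma lie_trotter_step:
  fixes \<gamma> \<delta> \<tau> M :: real and N :: nat and Y :: lag
  assumes \<delta>: "0 < \<delta>" "\<delta> \<le> 1" and Y: "Y \<in> F_grid \<delta> N" "F_norm Y \<le> M" and \<tau>: "0 \<le> \<tau>"
  defines "L \<equiv> sampled_field_const \<gamma> (M + 2)" and "Z \<equiv> lie_trotter \<gamma> \<delta> N \<tau> Y"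
  assumes \<tau>L: "\<tau> * L \<le> 1"
  shows "Z \<in> F_grid \<delta> N" "F_norm (Z - Y - \<tau> *\<^sub>R sampled_field (sample \<delta> N) 1 1 \<gamma> Y) \<le> 3 * L\<^sup>2 * \<tau>\<^sup>2"
proof -
  let ?g1 = "sampled_field (sample \<delta> N) 1 0 \<gamma>" and ?g2 = "sampled_field (sample \<delta> N) 0 1 \<gamma>"
  note so = samp_op_sample[OF \<delta>, of N]
  note FF_rc = F_grid_FF_rc[OF \<delta>(1)]
  have M: "0 \<le> M" using Y(2) F_norm_nonneg order_trans by blast
  then have L: "0 \<le> L" unfolding L_def by (intro sampled_field_const_nonneg) simp
  have gF: "?g1 X \<in> F_grid \<delta> N" "?g2 X \<in> F_grid \<delta> N" if "X \<in> F_grid \<delta> N" for X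
    using sampled_field_F_grid[OF \<delta> that] by simp_all
  have gb: "F_norm (?g1 X) \<le> L" "F_norm (?g2 X) \<le> L" if "X \<in> F_grid \<delta> N" "F_norm X \<le> M + 2" for X
    unfolding L_def using sampled_field_bounded(2)[OF FF_rc[OF that(1)] that(2) so] by simp_all
  have gl: "F_norm (?g1 X - ?g1 W) \<le> L * F_norm (X - W)" "F_norm (?g2 X - ?g2 W) \<le> L * F_norm (X - W)"
    if "X \<in> F_grid \<delta> N" "F_norm X \<le> M + 2" "W \<in> F_grid \<delta> N" "F_norm W \<le> M + 2" for X W
    unfolding L_def using sampled_field_lipschitz[OF FF_rc[OF that(1)] that(2) FF_rc[OF that(3)] that(4) so] by simp_all
  define Z1 where "Z1 = midpoint_step (F_grid \<delta> N) ?g1 \<tau> Y"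
  define m1 where "m1 = (1/2) *\<^sub>R (Y + Z1)"
  have Z1: "Z1 \<in> F_grid \<delta> N" "Z1 = Y + \<tau> *\<^sub>R ?g1 m1" "F_norm (Z1 - Y) \<le> \<tau> * L" "F_norm (m1 - Y) \<le> \<tau> * L"
    unfolding m1_def Z1_def
    using midpoint_step[OF \<delta>(1) Y \<tau> \<tau>L, of ?g1] gF(1) gb(1) gl(1) by simp_all
  have Z1n: "F_norm Z1 \<le> M + 1"
    using F_norm_triangle_sub[OF F_grid_FF[OF Z1(1)] F_grid_FF[OF Y(1)]] Z1(3) Y(2) \<tau>L by linarith
  define m2 where "m2 = (1/2) *\<^sub>R (Z1 + Z)"
  have Zeq: "Z = midpoint_step (F_grid \<delta> N) ?g2 \<tau> Z1"
    by (simp add: Z_def Z1_def lie_trotter_def G_bar_sampled_field)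
  have Z2: "Z \<in> F_grid \<delta> N" "Z = Z1 + \<tau> *\<^sub>R ?g2 m2" "F_norm (Z - Z1) \<le> \<tau> * L" "F_norm (m2 - Z1) \<le> \<tau> * L"
    unfolding m2_def Zeq
    using midpoint_step[OF \<delta>(1) Z1(1) Z1n \<tau> \<tau>L, of ?g2] gF(2) gb(2) gl(2) by simp_all
  show "Z \<in> F_grid \<delta> N" by (rule Z2)
  have mF: "m1 \<in> F_grid \<delta> N" "m2 \<in> F_grid \<delta> N"
    unfolding m1_def m2_def by (intro F_grid_scaleR F_grid_add \<delta> Y(1) Z1(1) Z2(1))+
  have m1n: "F_norm m1 \<le> M + 2"
    using F_norm_triangle_sub[OF F_grid_FF[OF mF(1)] F_grid_FF[OF Y(1)]] Z1(4) Y(2) \<tau>L by linarith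
  have m2n: "F_norm m2 \<le> M + 2"
    using F_norm_triangle_sub[OF F_grid_FF[OF mF(2)] F_grid_FF[OF Z1(1)]] Z2(4) Z1n \<tau>L by linarith
  have m2Y: "F_norm (m2 - Y) \<le> 2 * (\<tau> * L)"
    using F_norm_triangle[OF F_grid_FF[OF mF(2)] F_grid_FF[OF Z1(1)] F_grid_FF[OF Y(1)]] Z2(4) Z1(3) by linarith
  have Yn: "F_norm Y \<le> M + 2" using Y(2) by simp
  have d1: "F_norm (?g1 m1 - ?g1 Y) \<le> L * (\<tau> * L)"
    using gl(1)[OF mF(1) m1n Y(1) Yn] mult_left_mono[OF Z1(4) L] by linarith
  have d2: "F_norm (?g2 m2 - ?g2 Y) \<le> L * (2 * (\<tau> * L))"
    using gl(2)[OF mF(2) m2n Y(1) Yn] mult_left_mono[OF m2Y L] by linarith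
  have e: "Z - Y - \<tau> *\<^sub>R sampled_field (sample \<delta> N) 1 1 \<gamma> Y = \<tau> *\<^sub>R ((?g1 m1 - ?g1 Y) + (?g2 m2 - ?g2 Y))"
  proof -
    have "Z - Y = \<tau> *\<^sub>R ?g1 m1 + \<tau> *\<^sub>R ?g2 m2" using Z1(2) Z2(2) by (metis add.assoc add_diff_cancel_left')
    then show ?thesis unfolding sampled_field_add[symmetric] by (simp add: scaleR_add_right scaleR_diff_right)
  qed
  have F: "?g1 m1 - ?g1 Y \<in> FF" "?g2 m2 - ?g2 Y \<in> FF"
    by (intro F_norm_diff F_grid_FF[of _ \<delta> N] gF mF Y)+
  have "F_norm (Z - Y - \<tau> *\<^sub>R sampled_field (sample \<delta> N) 1 1 \<gamma> Y) \<le> \<tau> * F_norm ((?g1 m1 - ?g1 Y) + (?g2 m2 - ?g2 Y))"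
    unfolding e using F_norm_scaleR(2)[OF F_norm_add(1)[OF F], of \<tau>] \<tau> by simp
  also have "\<dots> \<le> \<tau> * (L * (\<tau> * L) + L * (2 * (\<tau> * L)))"
    by (intro mult_left_mono order_trans[OF F_norm_add(2)[OF F] add_mono[OF d1 d2]] \<tau>)
  also have "\<dots> = 3 * L\<^sup>2 * \<tau>\<^sup>2" by (simp add: power2_eq_square algebra_simps)
  finally show "F_norm (Z - Y - \<tau> *\<^sub>R sampled_field (sample \<delta> N) 1 1 \<gamma> Y) \<le> 3 * L\<^sup>2 * \<tau>\<^sup>2" .
qed

text \<open>A barrier argument that asks only for right difference quotients. The barrier \<psi>
  grows with the extra rate \<epsilon>; at the last time with \<phi> <= \<psi>, the hypothesis on
  \<phi> carries the inequality a little further.\<close>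

lemma dini_gronwall:
  fixes \<phi> :: "real \<Rightarrow> real"
  assumes cont: "continuous_on {a..b} \<phi>" and nn: "0 \<le> \<alpha>" "0 \<le> \<beta>" "0 \<le> \<phi> a"
    and step: "\<And>t \<epsilon>. a \<le> t \<Longrightarrow> t < b \<Longrightarrow> 0 < \<epsilon> \<Longrightarrow>
      \<forall>\<^sub>F s in at_right t. \<phi> s \<le> \<phi> t + (s - t) * (\<alpha> * \<phi> t + \<beta> + \<epsilon>)"
    and t: "t \<in> {a..b}"
  shows "\<phi> t \<le> (\<phi> a + \<beta> * (t - a)) * exp (\<alpha> * (t - a))"
proof -
  have main: "\<phi> t \<le> (\<phi> a + (\<beta> + \<epsilon>) * (t - a)) * exp (\<alpha> * (t - a))" if \<epsilon>: "\<epsilon> > 0" for \<epsilon>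
  proof (rule ccontr)
    define \<psi> where "\<psi> = (\<lambda>t. (\<phi> a + (\<beta> + \<epsilon>) * (t - a)) * exp (\<alpha> * (t - a)))"
    assume "\<not> \<phi> t \<le> (\<phi> a + (\<beta> + \<epsilon>) * (t - a)) * exp (\<alpha> * (t - a))"
    then have bad: "\<psi> t < \<phi> t" by (simp add: \<psi>_def)
    \<comment> \<open>If the bound failed at t, this compact set would have a largest element below
      t. The step condition then produces a larger element.\<close>
    let ?T = "{s \<in> {a..t}. \<phi> s \<le> \<psi> s}"
    have c: "continuous_on {a..t} \<phi>" using cont by (rule continuous_on_subset) (use t in auto)
    have c2: "continuous_on {a..t} \<psi>" unfolding \<psi>_def by (intro continuous_intros)
    have "closed ?T" by (rule continuous_on_closed_Collect_le[OF c c2]) simp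
    then have comp: "compact ?T"
      by (auto simp: compact_eq_bounded_closed intro: bounded_subset[OF bounded_closed_interval])
    have "a \<in> ?T" using t by (auto simp: \<psi>_def)
    then have ne: "?T \<noteq> {}" by blast
    obtain t0 where t0: "t0 \<in> ?T" "\<And>s. s \<in> ?T \<Longrightarrow> s \<le> t0"
      using compact_attains_sup[OF comp ne] by blast
    have lt: "t0 < t" using t0(1) bad by (cases "t0 = t") auto
    have "\<forall>\<^sub>F s in at_right t0. \<phi> s \<le> \<phi> t0 + (s - t0) * (\<alpha> * \<phi> t0 + \<beta> + \<epsilon>)"
      using t0(1) lt t \<epsilon> by (intro step) auto
    moreover have "\<forall>\<^sub>F s in at_right t0. s < t" using lt by (rule eventually_at_right_real[THEN eventually_mono]) auto
    moreover have "\<forall>\<^sub>F s in at_right t0. t0 < s" by (rule eventually_at_right_less)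
    ultimately have "\<forall>\<^sub>F s in at_right t0. False"
    proof eventually_elim
      case (elim s)
      define d where "d = s - t0"
      define c0 where "c0 = \<phi> a + (\<beta> + \<epsilon>) * (t0 - a)"
      define e0 where "e0 = exp (\<alpha> * (t0 - a))"
      have d: "0 < d" using elim by (simp add: d_def)
      have c0: "0 \<le> c0" using nn \<epsilon> t0(1) by (simp add: c0_def)
      have e0: "1 \<le> e0" using nn t0(1) by (simp add: e0_def)
      have \<psi>0: "\<psi> t0 = c0 * e0" by (simp add: \<psi>_def c0_def e0_def)
      have \<psi>s: "\<psi> s = (c0 + (\<beta> + \<epsilon>) * d) * (e0 * exp (\<alpha> * d))"
        by (simp add: \<psi>_def c0_def e0_def d_def exp_add[symmetric] algebra_simps)
      have e1: "1 + \<alpha> * d \<le> exp (\<alpha> * d)" by (rule exp_ge_add_one_self)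
      have "c0 * (e0 * (1 + \<alpha> * d)) \<le> c0 * (e0 * exp (\<alpha> * d))"
        using c0 e0 e1 by (intro mult_left_mono) auto
      moreover have "((\<beta> + \<epsilon>) * d) * (1 * 1) \<le> ((\<beta> + \<epsilon>) * d) * (e0 * exp (\<alpha> * d))"
        using nn \<epsilon> d e0 e1 by (intro mult_left_mono mult_mono) auto
      ultimately have ge: "\<psi> t0 + d * (\<alpha> * \<psi> t0 + \<beta> + \<epsilon>) \<le> \<psi> s"
        unfolding \<psi>0 \<psi>s by (simp add: algebra_simps)
      have "\<phi> t0 \<le> \<psi> t0" using t0(1) by simp
      then have "\<phi> t0 + d * (\<alpha> * \<phi> t0 + \<beta> + \<epsilon>) \<le> \<psi> t0 + d * (\<alpha> * \<psi> t0 + \<beta> + \<epsilon>)"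
        using d nn by (intro add_mono mult_left_mono) auto
      with elim(1) ge have "\<phi> s \<le> \<psi> s" by (simp add: d_def)
      then have "s \<in> ?T" using elim t0(1) by auto
      from t0(2)[OF this] elim show False by simp
    qed
    then show False by simp
  qed
  have lim: "((\<lambda>\<epsilon>. (\<phi> a + (\<beta> + \<epsilon>) * (t - a)) * exp (\<alpha> * (t - a))) \<longlongrightarrow> (\<phi> a + (\<beta> + 0) * (t - a)) * exp (\<alpha> * (t - a))) (at_right 0)"
    by (intro tendsto_intros)
  have "\<phi> t \<le> (\<phi> a + (\<beta> + 0) * (t - a)) * exp (\<alpha> * (t - a))"
    by (rule tendsto_lowerbound[OF lim]) (auto intro!: main eventually_at_rightI[of 0 1])
  then show ?thesis by simp
qed

lemma has_wderiv_continuous: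
  assumes "has_wderiv f g" shows "continuous (at x) f" "continuous (at_right x) f" "f \<in> borel_measurable borel"
proof -
  have c: "continuous_on {a..b} f" if ab: "a \<le> b" for a b
  proof -
    have si: "set_integrable lborel {a..x} g" "(LBINT y:{a..x}. g y) = f x - f a" if "a \<le> x" for x
      using assms that by (auto simp: has_wderiv_def)
    have "g integrable_on {a..b}" using set_borel_integral_eq_integral(1)[OF si(1)[OF ab]] .
    then have "continuous_on {a..b} (\<lambda>x. f a + integral {a..x} g)"
      by (intro continuous_intros indefinite_integral_continuous_1)
    moreover have "f a + integral {a..x} g = f x" if "x \<in> {a..b}" for x
      using set_borel_integral_eq_integral(2)[OF si(1)[of x]] si(2)[of x] that by simp
    ultimately show ?thesis by (rule continuous_on_eq)
  qed
  have cx: "continuous (at x) f" for x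
    using continuous_on_interior[OF c[of "x - 1" "x + 1"], of x] by (simp add: interior_atLeastAtMost_real)
  then show "continuous (at x) f" .
  show "continuous (at_right x) f" using cx by (rule continuous_at_imp_continuous_within)
  show "f \<in> borel_measurable borel"
    using cx by (intro borel_measurable_continuous_onI continuous_at_imp_continuous_on) auto
qed

lemma GG_FF_rc: "Y \<in> GG \<Longrightarrow> Y \<in> FF_rc"
proof -
  assume Y: "Y \<in> GG"
  then have "has_wderiv (l_y Y) (l_q Y)" "has_wderiv (l_U Y) (l_w Y)" "Y \<in> FF" by (auto simp: GG_def)
  moreover have "l_zeta Y = (\<lambda>x. l_y Y x - x)" by (auto simp: l_y_def)
  moreover have "continuous (at_right x) (\<lambda>x. l_y Y x - x)" if "has_wderiv (l_y Y) (l_q Y)" for x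
    using has_wderiv_continuous(2)[OF that] by (intro continuous_intros)
  ultimately show "Y \<in> FF_rc" unfolding FF_rc_def by (simp add: has_wderiv_continuous(2))
qed

lemma G_rhs_FF: "Y \<in> FF_rc \<Longrightarrow> G_rhs \<gamma> Y \<in> FF"
  unfolding G_rhs_sampled_field by (rule sampled_field_bounded(1)[OF _ order_refl samp_op_id]) auto

section \<open>The flow as a curve in the space F\<close>

locale flow =
  fixes \<gamma> :: real and Y\<^sub>0 :: lag and Y :: "real \<Rightarrow> lag"
  assumes flow: "is_flow \<gamma> Y\<^sub>0 Y"
begin

lemma GG: "0 \<le> t \<Longrightarrow> Y t \<in> GG" and Y0: "Y 0 = Y\<^sub>0"
  using flow by (auto simp: is_flow_def)

lemma FF_rc: "0 \<le> t \<Longrightarrow> Y t \<in> FF_rc" by (rule GG_FF_rc[OF GG])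

lemma FF: "0 \<le> t \<Longrightarrow> Y t \<in> FF" by (rule FF_rc_FF[OF FF_rc])

lemma rhs_FF: "0 \<le> t \<Longrightarrow> G_rhs \<gamma> (Y t) \<in> FF"
  by (rule G_rhs_FF[OF FF_rc])

lemma deriv:
  "0 \<le> t \<Longrightarrow> ((\<lambda>s. F_norm ((1 / (s - t)) *\<^sub>R (Y s - Y t) - G_rhs \<gamma> (Y t))) \<longlongrightarrow> 0) (at t within {0..})"
  using flow by (auto simp: is_flow_def)

text \<open>Separates the error of the difference quotient, which tends to 0 in F, from the
  deviation of the velocity from a chosen constant velocity B.\<close>

lemma increment:
  assumes "0 \<le> s" "0 \<le> t" "s \<noteq> t" "B \<in> FF"
  shows "Y s - Y t - (s - t) *\<^sub>R B = (s - t) *\<^sub>R (((1 / (s - t)) *\<^sub>R (Y s - Y t) - G_rhs \<gamma> (Y t)) + (G_rhs \<gamma> (Y t) - B))"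
    "(1 / (s - t)) *\<^sub>R (Y s - Y t) - G_rhs \<gamma> (Y t) \<in> FF" "G_rhs \<gamma> (Y t) - B \<in> FF"
proof -
  have "((1 / (s - t)) *\<^sub>R (Y s - Y t) - G_rhs \<gamma> (Y t)) + (G_rhs \<gamma> (Y t) - B) = (1 / (s - t)) *\<^sub>R (Y s - Y t) - B"
    by simp
  moreover have "(s - t) *\<^sub>R ((1 / (s - t)) *\<^sub>R X - B) = X - (s - t) *\<^sub>R B" for X
    using assms(3) by (simp add: scaleR_diff_right[of "s - t"])
  ultimately show "Y s - Y t - (s - t) *\<^sub>R B = (s - t) *\<^sub>R (((1 / (s - t)) *\<^sub>R (Y s - Y t) - G_rhs \<gamma> (Y t)) + (G_rhs \<gamma> (Y t) - B))"
    by metis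
  show "(1 / (s - t)) *\<^sub>R (Y s - Y t) - G_rhs \<gamma> (Y t) \<in> FF" "G_rhs \<gamma> (Y t) - B \<in> FF"
    by (intro F_norm_diff(1) F_norm_scaleR(1) rhs_FF FF assms)+
qed

lemma continuous:
  assumes "0 \<le> t"
  shows "((\<lambda>s. F_norm (Y s - Y t)) \<longlongrightarrow> 0) (at t within {0..})"
proof (rule tendsto_sandwich[OF _ _ tendsto_const])
  let ?r = "\<lambda>s. F_norm ((1 / (s - t)) *\<^sub>R (Y s - Y t) - G_rhs \<gamma> (Y t))"
  have "((\<lambda>s. \<bar>s - t\<bar> * (?r s + F_norm (G_rhs \<gamma> (Y t)))) \<longlongrightarrow> \<bar>t - t\<bar> * (0 + F_norm (G_rhs \<gamma> (Y t)))) (at t within {0..})"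
    by (intro tendsto_mult tendsto_add tendsto_const tendsto_rabs tendsto_diff tendsto_ident_at deriv assms)
  then show "((\<lambda>s. \<bar>s - t\<bar> * (?r s + F_norm (G_rhs \<gamma> (Y t)))) \<longlongrightarrow> 0) (at t within {0..})" by simp
  show "\<forall>\<^sub>F s in at t within {0..}. F_norm (Y s - Y t) \<le> \<bar>s - t\<bar> * (?r s + F_norm (G_rhs \<gamma> (Y t)))"
    unfolding eventually_at_filter
  proof (intro always_eventually allI impI)
    fix s assume s: "s \<noteq> t" "s \<in> {0..}"
    then have s0: "0 \<le> s" by simp
    note inc = increment[OF s0 assms s(1) FF_0, unfolded scaleR_zero_right diff_zero]
    have "F_norm (Y s - Y t) \<le> \<bar>s - t\<bar> * F_norm ((1 / (s - t)) *\<^sub>R (Y s - Y t) - G_rhs \<gamma> (Y t) + G_rhs \<gamma> (Y t))"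
      using F_norm_scaleR(2)[OF F_norm_add(1)[OF inc(2,3)], of "s - t"] arg_cong[OF inc(1), of F_norm] by linarith
    also have "\<dots> \<le> \<bar>s - t\<bar> * (?r s + F_norm (G_rhs \<gamma> (Y t)))"
      by (intro mult_left_mono F_norm_add(2)[OF inc(2,3)]) simp
    finally show "F_norm (Y s - Y t) \<le> \<bar>s - t\<bar> * (?r s + F_norm (G_rhs \<gamma> (Y t)))" .
  qed
qed simp

text \<open>Differentiability in F passes to every seminorm dominated by \<open>F_norm\<close>, and
  this is the only way in which the equation is used. The comparison curve A + tB covers all
  applications: A = B = 0 for a priori bounds, a constant state A with B = 0 for increments from it,
  and a tangent line for the local error.\<close>

lemma seminorm_gronwall:
  assumes p: "\<And>X Z. X \<in> FF \<Longrightarrow> Z \<in> FF \<Longrightarrow> p (X + Z) \<le> p X + p Z"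
      "\<And>c X. X \<in> FF \<Longrightarrow> p (c *\<^sub>R X) \<le> \<bar>c\<bar> * p X"
      "\<And>X. X \<in> FF \<Longrightarrow> 0 \<le> p X" "\<And>X. X \<in> FF \<Longrightarrow> p X \<le> K * F_norm X"
    and AB: "A \<in> FF" "B \<in> FF" and nn: "0 \<le> \<alpha>" "0 \<le> \<beta>" "0 \<le> a"
    and growth: "\<And>t. a \<le> t \<Longrightarrow> t < b \<Longrightarrow> p (G_rhs \<gamma> (Y t) - B) \<le> \<alpha> * p (Y t - A - t *\<^sub>R B) + \<beta>"
    and t: "t \<in> {a..b}"
  shows "p (Y t - A - t *\<^sub>R B) \<le> (p (Y a - A - a *\<^sub>R B) + \<beta> * (t - a)) * exp (\<alpha> * (t - a))"
proof (rule dini_gronwall[OF _ nn(1,2) _ _ t, where \<phi> = "\<lambda>t. p (Y t - A - t *\<^sub>R B)"])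
  let ?\<phi> = "\<lambda>t. p (Y t - A - t *\<^sub>R B)"
  have \<phi>F: "Y t - A - t *\<^sub>R B \<in> FF" if "0 \<le> t" for t
    by (intro F_norm_diff(1) F_norm_scaleR(1) AB FF that)
  show "0 \<le> ?\<phi> a" by (rule p(3)[OF \<phi>F[OF nn(3)]])
  have iF: "Y s - Y t - (s - t) *\<^sub>R B \<in> FF" if "0 \<le> t" "0 \<le> s" for s t
    by (intro F_norm_diff(1) F_norm_scaleR(1) AB FF that)
  have incr: "?\<phi> s \<le> ?\<phi> t + p (Y s - Y t - (s - t) *\<^sub>R B)" if "0 \<le> t" "0 \<le> s" for s t
  proof -
    have eq: "Y s - A - s *\<^sub>R B = (Y t - A - t *\<^sub>R B) + (Y s - Y t - (s - t) *\<^sub>R B)"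
      by (simp add: scaleR_diff_left)
    show ?thesis by (subst eq) (rule p(1)[OF \<phi>F[OF that(1)] iF[OF that]])
  qed
  have K: "0 \<le> \<bar>K\<bar>" by simp
  have pK: "p X \<le> \<bar>K\<bar> * F_norm X" if "X \<in> FF" for X
    using p(4)[OF that] mult_right_mono[OF abs_ge_self[of K] F_norm_nonneg[of X]] by linarith
  show "continuous_on {a..b} ?\<phi>"
    unfolding continuous_on_def
  proof
    fix t assume "t \<in> {a..b}"
    then have t0: "0 \<le> t" using nn by simp
    let ?e = "\<lambda>s. \<bar>K\<bar> * (F_norm (Y s - Y t) + \<bar>s - t\<bar> * F_norm B)"
    have "((\<lambda>s. ?e s) \<longlongrightarrow> \<bar>K\<bar> * (0 + \<bar>t - t\<bar> * F_norm B)) (at t within {0..})"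
      by (intro tendsto_mult tendsto_add tendsto_const tendsto_rabs tendsto_diff tendsto_ident_at continuous t0)
    then have e1: "(?e \<longlongrightarrow> 0) (at t within {0..})" by simp
    have sub: "{a..b} \<subseteq> {0..}" using nn by auto
    have e0: "(?e \<longlongrightarrow> 0) (at t within {a..b})"
      by (rule tendsto_within_subset[OF e1 sub])
    have est: "\<bar>?\<phi> s - ?\<phi> t\<bar> \<le> ?e s" if s: "s \<in> {a..b}" for s
    proof -
      have s0: "0 \<le> s" using s nn by simp
      have b: "p (Y s - Y t - (s - t) *\<^sub>R B) \<le> ?e s" "p (Y t - Y s - (t - s) *\<^sub>R B) \<le> ?e s"
      proof -
        have tri: "F_norm (Y x - Y y - (x - y) *\<^sub>R B) \<le> F_norm (Y x - Y y) + \<bar>x - y\<bar> * F_norm B"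
          if "0 \<le> x" "0 \<le> y" for x y
          using F_norm_diff(2)[OF F_norm_diff(1)[OF FF[OF that(1)] FF[OF that(2)]] F_norm_scaleR(1)[OF AB(2), of "x - y"]]
            F_norm_scaleR(2)[OF AB(2), of "x - y"] by linarith
        note 1 = tri[OF s0 t0]
        note 2 = tri[OF t0 s0, unfolded F_norm_commute[of "Y t" "Y s"] abs_minus_commute[of t s]]
        show "p (Y s - Y t - (s - t) *\<^sub>R B) \<le> ?e s"
          by (rule order_trans[OF pK[OF iF[OF t0 s0]] mult_left_mono[OF 1 K]])
        show "p (Y t - Y s - (t - s) *\<^sub>R B) \<le> ?e s"
          by (rule order_trans[OF pK[OF iF[OF s0 t0]] mult_left_mono[OF 2 K]])
      qed
      show ?thesis using b incr[OF t0 s0] incr[OF s0 t0] by linarith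
    qed
    show "(?\<phi> \<longlongrightarrow> ?\<phi> t) (at t within {a..b})"
    proof (rule LIM_zero_cancel)
      have "\<forall>\<^sub>F s in at t within {a..b}. norm (?\<phi> s - ?\<phi> t) \<le> norm (?e s)"
        unfolding eventually_at_filter
      proof (intro always_eventually allI impI)
        fix s assume "s \<in> {a..b}"
        from est[OF this] show "norm (?\<phi> s - ?\<phi> t) \<le> norm (?e s)"
          unfolding real_norm_def by (rule order_trans[OF _ abs_ge_self])
      qed
      then show "((\<lambda>s. ?\<phi> s - ?\<phi> t) \<longlongrightarrow> 0) (at t within {a..b})"
        by (rule Lim_transform_bound) (rule e0)
    qed
  qed
  fix t \<epsilon> :: real assume t: "a \<le> t" "t < b" and \<epsilon>: "0 < \<epsilon>"
  then have t0: "0 \<le> t" using nn by simp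
  let ?r = "\<lambda>s. F_norm ((1 / (s - t)) *\<^sub>R (Y s - Y t) - G_rhs \<gamma> (Y t))"
  have sub: "{t<..} \<subseteq> {0..}" using t0 by auto
  have "(?r \<longlongrightarrow> 0) (at_right t)"
    by (rule tendsto_within_subset[OF deriv[OF t0] sub])
  then have lim: "((\<lambda>s. \<bar>K\<bar> * ?r s) \<longlongrightarrow> \<bar>K\<bar> * 0) (at_right t)" by (rule tendsto_mult[OF tendsto_const])
  have "\<bar>K\<bar> * 0 < \<epsilon>" using \<epsilon> by simp
  from order_tendstoD(2)[OF lim this] have "\<forall>\<^sub>F s in at_right t. \<bar>K\<bar> * ?r s < \<epsilon>" .
  moreover have "\<forall>\<^sub>F s in at_right t. t < s" by (rule eventually_at_right_less)
  ultimately show "\<forall>\<^sub>F s in at_right t. ?\<phi> s \<le> ?\<phi> t + (s - t) * (\<alpha> * ?\<phi> t + \<beta> + \<epsilon>)"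
  proof eventually_elim
    case (elim s)
    then have s: "0 \<le> s" "s \<noteq> t" "0 < s - t" using t0 by auto
    note inc = increment[OF s(1) t0 s(2) AB(2)]
    have "p (Y s - Y t - (s - t) *\<^sub>R B) \<le> \<bar>s - t\<bar> * p (((1 / (s - t)) *\<^sub>R (Y s - Y t) - G_rhs \<gamma> (Y t)) + (G_rhs \<gamma> (Y t) - B))"
      unfolding inc(1) by (rule p(2)[OF F_norm_add(1)[OF inc(2,3)]])
    also have "\<dots> \<le> \<bar>s - t\<bar> * (\<alpha> * ?\<phi> t + \<beta> + \<epsilon>)"
    proof (rule mult_left_mono)
      show "p (((1 / (s - t)) *\<^sub>R (Y s - Y t) - G_rhs \<gamma> (Y t)) + (G_rhs \<gamma> (Y t) - B)) \<le> \<alpha> * ?\<phi> t + \<beta> + \<epsilon>"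
        using p(1)[OF inc(2,3)] pK[OF inc(2)] growth[OF t] elim(1) by linarith
    qed simp
    also have "\<bar>s - t\<bar> = s - t" using s(3) by simp
    finally show ?case using incr[OF t0 s(1)] by linarith
  qed
qed

end

section \<open>Energy and a priori bounds for the flow\<close>

text \<open>Monotone convergence with integrability as part of the conclusion, so that uniform
  bounds on bounded intervals produce energies on the whole line.\<close>

lemma integrable_of_intervals:
  fixes h :: "real \<Rightarrow> real"
  assumes h: "h \<in> borel_measurable borel" "AE x in lborel. 0 \<le> h x"
    and i: "\<And>n::nat. integrable lborel (\<lambda>x. indicator {- real n..real n} x * h x)"
    and le: "\<And>n::nat. (LINT x|lborel. indicator {- real n..real n} x * h x) \<le> E"
  shows "integrable lborel h" "(LINT x|lborel. h x) \<le> E"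
proof -
  let ?f = "\<lambda>n x. indicator {- real n..real n} x * h x"
  have m: "AE x in lborel. mono (\<lambda>n. ?f n x)"
    using h(2) by eventually_elim (auto simp: mono_def intro!: mult_right_mono split: split_indicator)
  have l: "AE x in lborel. (\<lambda>n. ?f n x) \<longlonglongrightarrow> h x"
  proof (rule AE_I2)
    fix x
    obtain n0 :: nat where n0: "\<bar>x\<bar> \<le> real n0" using real_arch_simple by blast
    have "\<forall>\<^sub>F n in sequentially. ?f n x = h x"
      using eventually_ge_at_top[of n0] by eventually_elim (use n0 in \<open>auto simp: indicator_def abs_le_iff\<close>)
    then show "(\<lambda>n. ?f n x) \<longlonglongrightarrow> h x" by (rule tendsto_eventually)
  qed
  have inc: "incseq (\<lambda>n. LINT x|lborel. ?f n x)"
    unfolding incseq_def using m i by (intro allI impI integral_mono_AE) (auto simp: mono_def)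
  obtain L where L: "(\<lambda>n. LINT x|lborel. ?f n x) \<longlonglongrightarrow> L" "\<And>n. (LINT x|lborel. ?f n x) \<le> L"
    using incseq_convergent[OF inc, of E] le by blast
  show "integrable lborel h"
    by (rule integrable_monotone_convergence[OF i m l L(1)]) (use h in auto)
  have "(LINT x|lborel. h x) = L"
    by (rule integral_monotone_convergence[OF i m l L(1)]) (use h in auto)
  also have "L \<le> E" by (rule LIMSEQ_le_const2[OF L(1)]) (use le in auto)
  finally show "(LINT x|lborel. h x) \<le> E" .
qed

section \<open>Weak derivatives and pointwise consequences of the relation in
  \<open>GG\<close>\<close>

lemma has_wderivD:
  assumes "has_wderiv f g" "a \<le> b"
  shows "integrable lborel (\<lambda>x. indicator {a..b} x * g x)" "(LINT x|lborel. indicator {a..b} x * g x) = f b - f a"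
  using assms unfolding has_wderiv_def set_integrable_def set_lebesgue_integral_def by auto

lemma has_wderivI:
  assumes "\<And>a b. a \<le> b \<Longrightarrow> integrable lborel (\<lambda>x. indicator {a..b} x * g x)"
    "\<And>a b. a \<le> b \<Longrightarrow> (LINT x|lborel. indicator {a..b} x * g x) = f b - f a"
  shows "has_wderiv f g"
  using assms unfolding has_wderiv_def set_integrable_def set_lebesgue_integral_def by auto

lemma has_wderiv_lincomb:
  assumes "has_wderiv f g" "has_wderiv F G"
  shows "has_wderiv (\<lambda>x. c * f x + d * F x) (\<lambda>x. c * g x + d * G x)"
proof (rule has_wderivI)
  fix a b :: real assume ab: "a \<le> b"
  note 1 = has_wderivD[OF assms(1) ab] and 2 = has_wderivD[OF assms(2) ab]
  have eq: "indicator {a..b} x * (c * g x + d * G x) = c * (indicator {a..b} x * g x) + d * (indicator {a..b} x * G x)" for x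
    by (simp add: algebra_simps)
  show "integrable lborel (\<lambda>x. indicator {a..b} x * (c * g x + d * G x))" unfolding eq using 1 2 by simp
  show "(LINT x|lborel. indicator {a..b} x * (c * g x + d * G x)) = c * f b + d * F b - (c * f a + d * F a)"
    unfolding eq Bochner_Integration.integral_add[OF integrable_mult_right[OF 1(1)] integrable_mult_right[OF 2(1)]]
      integral_mult_right_zero 1(2) 2(2) by (simp add: algebra_simps)
qed

lemma has_wderiv_mono:
  assumes "has_wderiv f g" "has_wderiv F G" "a \<le> b" "AE x in lborel. a \<le> x \<and> x \<le> b \<longrightarrow> g x \<le> G x"
  shows "f b - f a \<le> F b - F a"
proof -
  note 1 = has_wderivD[OF assms(1,3)] and 2 = has_wderivD[OF assms(2,3)]
  have "AE x in lborel. indicator {a..b} x * g x \<le> indicator {a..b} x * G x"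
    using assms(4) by eventually_elim (auto simp: indicator_def)
  from integral_mono_AE[OF 1(1) 2(1) this] show ?thesis using 1 2 by simp
qed

lemma has_wderiv_0: "has_wderiv (\<lambda>x. 0) (\<lambda>x. 0)"
  by (auto simp: has_wderiv_def set_integrable_def set_lebesgue_integral_def)

lemma has_wderiv_abs_le:
  assumes "has_wderiv f g" "has_wderiv F G" "a \<le> b" "AE x in lborel. \<bar>g x\<bar> \<le> G x"
  shows "\<bar>f b - f a\<bar> \<le> F b - F a"
proof -
  have "f b - f a \<le> F b - F a"
    using assms(4) by (intro has_wderiv_mono[OF assms(1,2,3)]) (auto elim!: eventually_mono)
  moreover have "(- 1 * f b + 0 * 0) - (- 1 * f a + 0 * 0) \<le> F b - F a"
    by (rule has_wderiv_mono[OF has_wderiv_lincomb[OF assms(1) has_wderiv_0, of "- 1" 0] assms(2,3)])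
      (use assms(4) in \<open>auto elim!: eventually_mono\<close>)
  ultimately show ?thesis by simp
qed

lemma has_wderiv_mono_on:
  assumes "has_wderiv f g" "AE x in lborel. 0 \<le> g x" "a \<le> b"
  shows "f a \<le> f b"
proof -
  have "AE x in lborel. a \<le> x \<and> x \<le> b \<longrightarrow> 0 \<le> g x" using assms(2) by eventually_elim simp
  from has_wderiv_mono[OF has_wderiv_0 assms(1,3) this] show ?thesis by simp
qed

text \<open>Dividing the relation by q gives U^2 q <= h (trivial when q = 0). The bound on w is the
  arithmetic-geometric mean inequality. For the product, (Uw)^2 = U^2 q (h - U^2 q) <= h^2, so U w
  is controlled by h alone, without the size of U.\<close>

lemma conservation_bounds:
  fixes q h U w :: real
  assumes eq: "q * h = U\<^sup>2 * q\<^sup>2 + w\<^sup>2" and nn: "0 \<le> q" "0 \<le> h"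
  shows "U\<^sup>2 * q \<le> h" "w\<^sup>2 \<le> q * h" "\<bar>w\<bar> \<le> (q + h) / 2" "\<bar>U * w\<bar> \<le> h" "(U * q)\<^sup>2 \<le> q * h"
proof -
  show s: "U\<^sup>2 * q \<le> h"
  proof (cases "q = 0")
    case False
    then have q: "q > 0" using nn by simp
    have "q * (U\<^sup>2 * q) \<le> q * h" using eq by (simp add: power2_eq_square algebra_simps)
    then show ?thesis using q by simp
  qed (use nn in simp)
  show w: "w\<^sup>2 \<le> q * h" using eq by simp
  have "w\<^sup>2 \<le> ((q + h) / 2)\<^sup>2"
    using w sum_squares_bound[of q h] by (simp add: power2_eq_square field_simps)
  then have "\<bar>w\<bar> \<le> \<bar>(q + h) / 2\<bar>" by (simp only: abs_le_square_iff)
  then show "\<bar>w\<bar> \<le> (q + h) / 2" using nn by simp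
  have "(U * w)\<^sup>2 = (U\<^sup>2 * q) * (h - U\<^sup>2 * q)"
  proof -
    have "w\<^sup>2 = q * h - U\<^sup>2 * q\<^sup>2" using eq by simp
    then show ?thesis by (simp add: power_mult_distrib) (simp add: algebra_simps power2_eq_square)
  qed
  also have "\<dots> \<le> h * h" using s nn by (intro mult_mono) auto
  finally have "(U * w)\<^sup>2 \<le> h\<^sup>2" by (simp add: power2_eq_square)
  then show "\<bar>U * w\<bar> \<le> h" using nn by (simp add: abs_le_square_iff[symmetric])
  show "(U * q)\<^sup>2 \<le> q * h" using eq by (simp add: power_mult_distrib)
qed

text \<open>Bounds \<integral>h over every bounded interval through increments of H. Stated this way
  it presupposes no integrability of h on the line; that follows in
  \<open>h_integrable\<close>.\<close>

definition energy_le :: "lag \<Rightarrow> real \<Rightarrow> bool" where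
  "energy_le Y E \<longleftrightarrow> (\<forall>a b. a \<le> b \<longrightarrow> l_H Y b - l_H Y a \<le> E)"

definition source_bd :: "real \<Rightarrow> real" where
  "source_bd \<gamma> = \<bar>(3 - 2 * \<gamma>) / 2\<bar> + \<bar>\<gamma> / 2\<bar>"

lemma source_bd_nonneg: "0 \<le> source_bd \<gamma>" by (simp add: source_bd_def)

locale GG_elem =
  fixes Y :: lag
  assumes GG: "Y \<in> GG"
begin

lemma AE_rel: "AE x in lborel. l_q Y x * l_h Y x = (l_U Y x)\<^sup>2 * (l_q Y x)\<^sup>2 + (l_w Y x)\<^sup>2"
  and AE_q: "AE x in lborel. 0 \<le> l_q Y x" and AE_h: "AE x in lborel. 0 \<le> l_h Y x"
  and dy: "has_wderiv (l_y Y) (l_q Y)" and dU: "has_wderiv (l_U Y) (l_w Y)" and dH: "has_wderiv (l_H Y) (l_h Y)"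
  and FF: "Y \<in> FF"
  using GG by (auto simp: GG_def)

lemma FF_rc: "Y \<in> FF_rc" by (rule GG_FF_rc[OF GG])

lemmas meas = FF_measurable[OF FF]

lemma q_meas: "l_q Y \<in> borel_measurable borel"
  using meas(4) unfolding l_q_def[abs_def] by simp

lemma AE_cons:
  "AE x in lborel. 0 \<le> l_q Y x \<and> 0 \<le> l_h Y x \<and> (l_U Y x)\<^sup>2 * l_q Y x \<le> l_h Y x \<and> (l_w Y x)\<^sup>2 \<le> l_q Y x * l_h Y x \<and>
     \<bar>l_w Y x\<bar> \<le> (l_q Y x + l_h Y x) / 2 \<and> \<bar>l_U Y x * l_w Y x\<bar> \<le> l_h Y x \<and> (l_U Y x * l_q Y x)\<^sup>2 \<le> l_q Y x * l_h Y x"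
  using AE_rel AE_q AE_h
proof eventually_elim
  case (elim x)
  from conservation_bounds[OF elim] elim show ?case by blast
qed

text \<open>Because U^2 q <= h, the source and hence P and Q are controlled linearly by the energy
  density; the general bound \<open>source_L2_le\<close> involves powers of the norm of F, too
  strong a growth for an a priori estimate.\<close>

lemma AE_source: "AE x in lborel. \<bar>source \<gamma> Y x\<bar> \<le> source_bd \<gamma> * l_h Y x"
  using AE_cons
proof eventually_elim
  case (elim x)
  then have 1: "0 \<le> (l_U Y x)\<^sup>2 * l_q Y x" "(l_U Y x)\<^sup>2 * l_q Y x \<le> l_h Y x" "0 \<le> l_h Y x" by auto
  have "\<bar>source \<gamma> Y x\<bar> \<le> \<bar>(3 - 2 * \<gamma>) / 2 * ((l_U Y x)\<^sup>2 * l_q Y x)\<bar> + \<bar>\<gamma> / 2 * l_h Y x\<bar>"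
    unfolding source_def mult.assoc by (rule abs_triangle_ineq)
  also have "\<dots> = \<bar>(3 - 2 * \<gamma>) / 2\<bar> * ((l_U Y x)\<^sup>2 * l_q Y x) + \<bar>\<gamma> / 2\<bar> * l_h Y x"
    by (simp only: abs_mult[of "(3 - 2 * \<gamma>) / 2"] abs_mult[of "\<gamma> / 2"] abs_of_nonneg[OF 1(1)] abs_of_nonneg[OF 1(3)])
  also have "\<dots> \<le> \<bar>(3 - 2 * \<gamma>) / 2\<bar> * l_h Y x + \<bar>\<gamma> / 2\<bar> * l_h Y x"
    using 1 by (intro add_mono mult_left_mono) auto
  finally show ?case by (simp add: source_bd_def distrib_right)
qed

lemma y_mono: "a \<le> b \<Longrightarrow> l_y Y a \<le> l_y Y b"
  by (rule has_wderiv_mono_on[OF dy AE_q])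

lemma H_mono: "a \<le> b \<Longrightarrow> l_H Y a \<le> l_H Y b"
  by (rule has_wderiv_mono_on[OF dH AE_h])

lemma y_surj: "\<exists>\<xi>. l_y Y \<xi> = x"
proof -
  obtain M where M: "\<And>x. \<bar>l_zeta Y x\<bar> \<le> M" using FF_rc_pointwise(1)[OF FF_rc order_refl] by blast
  then have M0: "0 \<le> M" using order_trans abs_ge_zero by blast
  have "\<exists>\<xi>. x - M \<le> \<xi> \<and> \<xi> \<le> x + M \<and> l_y Y \<xi> = x"
  proof (rule IVT)
    show "l_y Y (x - M) \<le> x" "x \<le> l_y Y (x + M)"
      using M[of "x - M"] M[of "x + M"] by (auto simp: l_y_def abs_le_iff)
  qed (use has_wderiv_continuous(1)[OF dy] M0 in auto)
  then show ?thesis by blast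
qed

lemma h_integrable:
  assumes "energy_le Y E"
  shows "integrable lborel (l_h Y)" "(LINT x|lborel. l_h Y x) \<le> E"
proof -
  have i: "integrable lborel (\<lambda>x. indicator {- real n..real n} x * l_h Y x)"
    and l: "(LINT x|lborel. indicator {- real n..real n} x * l_h Y x) \<le> E" for n
    using has_wderivD[OF dH, of "- real n" "real n"] assms by (auto simp: energy_le_def)
  show "integrable lborel (l_h Y)" "(LINT x|lborel. l_h Y x) \<le> E"
    using integrable_of_intervals[OF meas(6) AE_h i l] by auto
qed

text \<open>Go back from \<xi> to a point where y is smaller by 1. If U^2 exceeded E + 1 on all of
  this stretch, then h >= U^2 q would give it energy at least E + 1. So U^2 <= E + 1 at some c in
  between, and from c to \<xi> the function U changes by at most \<integral>(q + h)/2 <= (1 +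
  E)/2.\<close>

lemma U_bound:
  assumes E: "energy_le Y E"
  shows "\<bar>l_U Y \<xi>\<bar> \<le> sqrt (E + 1) + (1 + E) / 2"
proof -
  have E0: "0 \<le> E" using E[unfolded energy_le_def, rule_format, of 0 0] by simp
  obtain a' where a': "l_y Y a' = l_y Y \<xi> - 1" by (rule exE[OF y_surj])
  have a: "a' \<le> \<xi>"
  proof (rule ccontr)
    assume "\<not> a' \<le> \<xi>"
    then have "l_y Y \<xi> \<le> l_y Y a'" by (intro y_mono) simp
    then show False using a' by linarith
  qed
  have "\<exists>c\<in>{a'..\<xi>}. (l_U Y c)\<^sup>2 \<le> E + 1"
  proof (rule ccontr)
    assume none: "\<not> (\<exists>c\<in>{a'..\<xi>}. (l_U Y c)\<^sup>2 \<le> E + 1)"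
    have big: "E + 1 \<le> (l_U Y c)\<^sup>2" if "a' \<le> c" "c \<le> \<xi>" for c
    proof -
      have "c \<in> {a'..\<xi>}" using that by simp
      with none have "\<not> (l_U Y c)\<^sup>2 \<le> E + 1" by blast
      then show ?thesis by simp
    qed
    have "((E + 1) * l_y Y \<xi> + 0 * 0) - ((E + 1) * l_y Y a' + 0 * 0) \<le> l_H Y \<xi> - l_H Y a'"
    proof (rule has_wderiv_mono[OF has_wderiv_lincomb[OF dy has_wderiv_0] dH a])
      show "AE x in lborel. a' \<le> x \<and> x \<le> \<xi> \<longrightarrow> (E + 1) * l_q Y x + 0 * 0 \<le> l_h Y x"
        using AE_cons
      proof eventually_elim
        case (elim x)
        show ?case
        proof
          assume x: "a' \<le> x \<and> x \<le> \<xi>"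
          have "(E + 1) * l_q Y x \<le> (l_U Y x)\<^sup>2 * l_q Y x" using big[of x] x elim by (intro mult_right_mono) auto
          with elim show "(E + 1) * l_q Y x + 0 * 0 \<le> l_h Y x" by linarith
        qed
      qed
    qed
    also have "\<dots> \<le> E" using E[unfolded energy_le_def, rule_format, OF a] .
    finally have "(E + 1) * (l_y Y \<xi> - l_y Y a') \<le> E" by (simp add: algebra_simps)
    then show False using a' by simp
  qed
  then obtain c where c: "a' \<le> c" "c \<le> \<xi>" "(l_U Y c)\<^sup>2 \<le> E + 1" by auto
  have "\<bar>l_U Y \<xi> - l_U Y c\<bar> \<le> (1/2 * l_y Y \<xi> + 1/2 * l_H Y \<xi>) - (1/2 * l_y Y c + 1/2 * l_H Y c)"
  proof (rule has_wderiv_abs_le[OF dU has_wderiv_lincomb[OF dy dH] c(2)])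
    show "AE x in lborel. \<bar>l_w Y x\<bar> \<le> 1/2 * l_q Y x + 1/2 * l_h Y x"
      using AE_cons by eventually_elim auto
  qed
  also have "\<dots> = ((l_y Y \<xi> - l_y Y c) + (l_H Y \<xi> - l_H Y c)) / 2" by (simp add: field_simps)
  also have "\<dots> \<le> (1 + E) / 2"
  proof (intro divide_right_mono add_mono)
    show "l_y Y \<xi> - l_y Y c \<le> 1" using y_mono[OF c(1)] a' by simp
    show "l_H Y \<xi> - l_H Y c \<le> E" using E[unfolded energy_le_def, rule_format, OF c(2)] .
  qed simp
  finally have "\<bar>l_U Y \<xi> - l_U Y c\<bar> \<le> (1 + E) / 2" .
  moreover have "\<bar>l_U Y c\<bar> \<le> sqrt (E + 1)" using c(3) real_le_rsqrt[of "\<bar>l_U Y c\<bar>" "E + 1"] by simp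
  ultimately show ?thesis by linarith
qed

lemma setting: "sgn_or_one s \<Longrightarrow> nonloc_setting s Y (F_norm Y)"
  by (rule FF_rc_nonloc_setting[OF FF_rc order_refl])

text \<open>The constant involves the bound Z on zeta but not the norm of F, which keeps the a
  priori estimates free of circularity.\<close>

lemma nonloc_bound_conv:
  assumes s: "sgn_or_one s" and E: "energy_le Y E" and Z: "\<And>x. \<bar>l_zeta Y x\<bar> \<le> Z"
  shows "\<bar>nonloc s \<gamma> Y \<xi>\<bar> \<le> source_bd \<gamma> * exp (2 * Z) * conv exp_kernel (l_h Y) \<xi>"
proof -
  interpret nonloc_setting s \<gamma> Y "F_norm Y" by (rule setting[OF s])
  note hi = h_integrable[OF E]
  have "\<bar>nonloc s \<gamma> Y \<xi>\<bar> \<le> (LINT \<eta>|lborel. \<bar>s (\<xi> - \<eta>) * (exp (- expo Y \<xi> \<eta>) * source \<gamma> Y \<eta>)\<bar>)"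
    unfolding nonloc_def by (rule integral_abs_bound)
  also have "\<dots> \<le> (LINT \<eta>|lborel. source_bd \<gamma> * exp (2 * Z) * (exp_kernel (\<xi> - \<eta>) * l_h Y \<eta>))"
  proof (rule integral_mono_AE)
    show "integrable lborel (\<lambda>\<eta>. \<bar>s (\<xi> - \<eta>) * (exp (- expo Y \<xi> \<eta>) * source \<gamma> Y \<eta>)\<bar>)"
      by (rule integrable_abs[OF integrand_integrable])
    show "integrable lborel (\<lambda>\<eta>. source_bd \<gamma> * exp (2 * Z) * (exp_kernel (\<xi> - \<eta>) * l_h Y \<eta>))"
      using conv_integrable_L1[OF kernel_exp_kernel hi(1)] by simp
    show "AE \<eta> in lborel. \<bar>s (\<xi> - \<eta>) * (exp (- expo Y \<xi> \<eta>) * source \<gamma> Y \<eta>)\<bar> \<le> source_bd \<gamma> * exp (2 * Z) * (exp_kernel (\<xi> - \<eta>) * l_h Y \<eta>)"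
      using AE_source[of \<gamma>]
    proof eventually_elim
      case (elim \<eta>)
      have "\<bar>s (\<xi> - \<eta>) * (exp (- expo Y \<xi> \<eta>) * source \<gamma> Y \<eta>)\<bar> \<le> 1 * ((exp (2 * Z) * exp_kernel (\<xi> - \<eta>)) * (source_bd \<gamma> * l_h Y \<eta>))"
        unfolding abs_mult using sgn_or_one(2)[OF s] elim expo_ge[of Y Z \<xi> \<eta>, OF Z] by (intro mult_mono) auto
      then show ?case by (simp add: mult_ac)
    qed
  qed
  also have "\<dots> = source_bd \<gamma> * exp (2 * Z) * conv exp_kernel (l_h Y) \<xi>" by (simp add: conv_def)
  finally show ?thesis .
qed

end

text \<open>Tested against H, this is the mean over [L, 2L] minus the mean over [-2L, -L]. The rate
  of change of H is known to be integrable but not to decay at particular points; over an interval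
  of length L its mean is O(1/L).\<close>

definition end_means :: "real \<Rightarrow> real \<Rightarrow> real" where
  "end_means L x = (indicator {L..2 * L} x - indicator {- 2 * L..- L} x) / L"

lemma end_means:
  assumes "L > 0"
  shows "integrable lborel (end_means L)" "\<bar>end_means L x\<bar> \<le> 1 / L" "end_means L \<in> borel_measurable borel"
proof -
  show "integrable lborel (end_means L)" unfolding end_means_def[abs_def] using assms by simp
  show "\<bar>end_means L x\<bar> \<le> 1 / L" using assms by (auto simp: end_means_def indicator_def)
  show "end_means L \<in> borel_measurable borel" unfolding end_means_def[abs_def] by measurable
qed

lemma integrable_Linf_mult:
  assumes "integrable lborel g" "Linf_le f a"
  shows "integrable lborel (\<lambda>x. g x * f x)" "(LINT x|lborel. \<bar>g x * f x\<bar>) \<le> (LINT x|lborel. \<bar>g x\<bar>) * a"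
proof -
  have [measurable]: "f \<in> borel_measurable borel" "g \<in> borel_measurable borel" using assms by (auto simp: Linf_le_def)
  have b: "integrable lborel (\<lambda>x. \<bar>g x\<bar> * a)" using assms(1) by simp
  have ae: "AE x in lborel. \<bar>g x * f x\<bar> \<le> \<bar>g x\<bar> * a"
    using assms(2) unfolding Linf_le_def by (auto simp: abs_mult intro: mult_left_mono elim!: eventually_mono)
  show i: "integrable lborel (\<lambda>x. g x * f x)"
    by (rule Bochner_Integration.integrable_bound[OF b]) (use ae in \<open>auto elim!: eventually_mono\<close>)
  have "(LINT x|lborel. \<bar>g x * f x\<bar>) \<le> (LINT x|lborel. \<bar>g x\<bar> * a)"
    using i by (intro integral_mono_AE b ae) auto
  then show "(LINT x|lborel. \<bar>g x * f x\<bar>) \<le> (LINT x|lborel. \<bar>g x\<bar>) * a" by simp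
qed

text \<open>Monotonicity of H places each mean between the values at the ends of its
  interval.\<close>

lemma (in GG_elem) end_means_sandwich:
  assumes L: "L > 0"
  shows "l_H Y L - l_H Y (- L) \<le> (LINT x|lborel. end_means L x * l_H Y x)"
    "(LINT x|lborel. end_means L x * l_H Y x) \<le> l_H Y (2 * L) - l_H Y (- 2 * L)"
proof -
  have "Linf_le (l_H Y) (F_norm Y)" using comps_le_of_F_norm[OF FF order_refl] by (simp add: comps_le_def)
  note i = integrable_Linf_mult(1)[OF end_means(1)[OF L] this]
  have e: "(LINT x|lborel. (indicator {L..2 * L} x * a - indicator {- 2 * L..- L} x * b) / L) = a - b"
    and ei: "integrable lborel (\<lambda>x. (indicator {L..2 * L} x * a - indicator {- 2 * L..- L} x * b) / L)" for a b :: real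
    using L by (simp_all add: field_simps)
  have "(LINT x|lborel. (indicator {L..2 * L} x * l_H Y L - indicator {- 2 * L..- L} x * l_H Y (- L)) / L) \<le> (LINT x|lborel. end_means L x * l_H Y x)"
    using L by (intro integral_mono ei i) (auto simp: end_means_def indicator_def intro!: H_mono divide_right_mono)
  then show "l_H Y L - l_H Y (- L) \<le> (LINT x|lborel. end_means L x * l_H Y x)" unfolding e .
  have "(LINT x|lborel. end_means L x * l_H Y x) \<le> (LINT x|lborel. (indicator {L..2 * L} x * l_H Y (2 * L) - indicator {- 2 * L..- L} x * l_H Y (- 2 * L)) / L)"
    using L by (intro integral_mono ei i) (auto simp: end_means_def indicator_def intro!: H_mono divide_right_mono)
  then show "(LINT x|lborel. end_means L x * l_H Y x) \<le> l_H Y (2 * L) - l_H Y (- 2 * L)" unfolding e .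
qed

context flow
begin

lemma bounded_on: "\<exists>M. \<forall>t\<in>{0..T}. F_norm (Y t) \<le> M"
proof -
  have "continuous_on {0..T} (\<lambda>t. F_norm (Y t))"
    unfolding continuous_on_def
  proof
    fix t assume t: "t \<in> {0..T}"
    then have t0: "0 \<le> t" by simp
    have sub: "{0..T} \<subseteq> {0..}" by auto
    have "((\<lambda>s. F_norm (Y s - Y t)) \<longlongrightarrow> 0) (at t within {0..T})"
      by (rule tendsto_within_subset[OF continuous[OF t0] sub])
    moreover have "\<forall>\<^sub>F s in at t within {0..T}. norm (F_norm (Y s) - F_norm (Y t)) \<le> norm (F_norm (Y s - Y t))"
      unfolding eventually_at_filter
    proof (intro always_eventually allI impI)
      fix s assume "s \<in> {0..T}"
      then have s: "0 \<le> s" by simp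
      show "norm (F_norm (Y s) - F_norm (Y t)) \<le> norm (F_norm (Y s - Y t))"
        using F_norm_triangle_sub[OF FF[OF s] FF[OF t0]] F_norm_triangle_sub[OF FF[OF t0] FF[OF s]]
          F_norm_commute[of "Y s" "Y t"] by simp
    qed
    ultimately have "((\<lambda>s. F_norm (Y s) - F_norm (Y t)) \<longlongrightarrow> 0) (at t within {0..T})"
      by (rule Lim_transform_bound[rotated])
    then show "((\<lambda>s. F_norm (Y s)) \<longlongrightarrow> F_norm (Y t)) (at t within {0..T})" by (rule LIM_zero_cancel)
  qed
  then have "bounded ((\<lambda>t. F_norm (Y t)) ` {0..T})"
    by (intro compact_imp_bounded compact_continuous_image) auto
  then show ?thesis by (fastforce simp: bounded_iff)
qed

text \<open>U^2, U and P are in L^2, so U^3 - 2PU has a bounded L^1 norm, uniformly on [0, T]. The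
  bound on F_norm used here comes from mere compactness of [0, T]; its size is harmless because C
  disappears as L tends to infinity.\<close>

lemma energy_step:
  assumes T: "0 \<le> T"
  obtains C where "\<And>t L. t \<in> {0..T} \<Longrightarrow> L > 0 \<Longrightarrow>
    (LINT x|lborel. end_means L x * l_H (Y t) x) \<le> (LINT x|lborel. end_means L x * l_H (Y 0) x) + C / L"
proof -
  obtain M where M: "\<And>t. t \<in> {0..T} \<Longrightarrow> F_norm (Y t) \<le> M" using bounded_on by blast
  let ?C = "M\<^sup>2 * M + 2 * (PQ_const \<gamma> M * M)"
  have int: "(LINT x|lborel. \<bar>l_H (G_rhs \<gamma> (Y t)) x\<bar>) \<le> ?C" and inti: "integrable lborel (l_H (G_rhs \<gamma> (Y t)))" if t: "t \<in> {0..T}" for t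
  proof -
    have t0: "0 \<le> t" using t by simp
    have b: "L2_Linf_le (l_U (Y t)) M" using comps_le_of_F_norm[OF FF[OF t0] M[OF t]] by (simp add: comps_le_def)
    have P: "L2_Linf_le (PP \<gamma> (Y t)) (PQ_const \<gamma> M)" by (rule PQ_L2_Linf_le(1)[OF FF_rc[OF t0] M[OF t] samp_op_id])
    have U2: "L2_le (\<lambda>x. l_U (Y t) x * l_U (Y t) x) (M * M)" using b by (intro L2_le_mult) (auto simp: L2_Linf_le_def)
    note 1 = L2_le_mult_integrable[OF U2 L2_Linf_leD(1)[OF b]] L2_le_Cauchy_Schwarz[OF U2 L2_Linf_leD(1)[OF b]]
    note 2 = L2_le_mult_integrable[OF L2_Linf_leD(1)[OF P] L2_Linf_leD(1)[OF b]] L2_le_Cauchy_Schwarz[OF L2_Linf_leD(1)[OF P] L2_Linf_leD(1)[OF b]]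
    have eq: "l_H (G_rhs \<gamma> (Y t)) = (\<lambda>x. l_U (Y t) x * l_U (Y t) x * l_U (Y t) x - 2 * (PP \<gamma> (Y t) x * l_U (Y t) x))"
      by (simp add: G_rhs_def power3_eq_cube fun_eq_iff)
    show "integrable lborel (l_H (G_rhs \<gamma> (Y t)))" unfolding eq using 1 2 by simp
    have "(LINT x|lborel. \<bar>l_H (G_rhs \<gamma> (Y t)) x\<bar>) \<le> (LINT x|lborel. \<bar>l_U (Y t) x * l_U (Y t) x * l_U (Y t) x\<bar> + 2 * \<bar>PP \<gamma> (Y t) x * l_U (Y t) x\<bar>)"
      unfolding eq using integrable_abs[OF 1(1)] integrable_abs[OF 2(1)] 1(1) 2(1)
      by (intro integral_mono) (auto intro: order_trans[OF abs_triangle_ineq4])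
    also have "\<dots> \<le> ?C"
      using integrable_abs[OF 1(1)] integrable_abs[OF 2(1)] 1(2) 2(2) by (simp add: power2_eq_square)
    finally show "(LINT x|lborel. \<bar>l_H (G_rhs \<gamma> (Y t)) x\<bar>) \<le> ?C" .
  qed
  have C: "0 \<le> ?C" by (rule order_trans[OF _ int[of 0]]) (use T in auto)
  show thesis
  proof (rule that[of "?C * T"])
    fix t L :: real assume t: "t \<in> {0..T}" and L: "L > 0"
    let ?l = "\<lambda>X. LINT x|lborel. end_means L x * l_H X x"
    have HL: "Linf_le (l_H X) (F_norm X)" if "X \<in> FF" for X using comps_le_of_F_norm[OF that order_refl] by (simp add: comps_le_def)
    note i = integrable_Linf_mult[OF end_means(1)[OF L] HL]
    have "\<bar>?l (Y t - Y 0 - t *\<^sub>R 0)\<bar> \<le> (\<bar>?l (Y 0 - Y 0 - 0 *\<^sub>R 0)\<bar> + ?C / L * (t - 0)) * exp (0 * (t - 0))"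
    proof (rule seminorm_gronwall[where p = "\<lambda>X. \<bar>?l X\<bar>" and K = "LINT x|lborel. \<bar>end_means L x\<bar>" and b = T])
      fix X Z :: lag and c :: real assume X: "X \<in> FF"
      show "\<bar>?l (c *\<^sub>R X)\<bar> \<le> \<bar>c\<bar> * \<bar>?l X\<bar>"
      proof -
        have "?l (c *\<^sub>R X) = c * ?l X" by (simp add: mult.left_commute)
        then show ?thesis by (simp add: abs_mult)
      qed
      show "\<bar>?l X\<bar> \<le> (LINT x|lborel. \<bar>end_means L x\<bar>) * F_norm X"
        by (rule order_trans[OF integral_abs_bound i(2)[OF X]])
      assume Z: "Z \<in> FF"
      have "?l (X + Z) = ?l X + ?l Z" using i(1)[OF X] i(1)[OF Z] by (simp add: distrib_left)
      then show "\<bar>?l (X + Z)\<bar> \<le> \<bar>?l X\<bar> + \<bar>?l Z\<bar>" by simp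
    next
      fix s assume s: "0 \<le> s" "s < T"
      then have sT: "s \<in> {0..T}" by simp
      have "\<bar>?l (G_rhs \<gamma> (Y s) - 0)\<bar> \<le> (LINT x|lborel. \<bar>end_means L x * l_H (G_rhs \<gamma> (Y s)) x\<bar>)"
        unfolding diff_zero by (rule integral_abs_bound)
      also have "\<dots> \<le> (LINT x|lborel. 1 / L * \<bar>l_H (G_rhs \<gamma> (Y s)) x\<bar>)"
      proof (rule integral_mono)
        show "integrable lborel (\<lambda>x. \<bar>end_means L x * l_H (G_rhs \<gamma> (Y s)) x\<bar>)" using i(1)[OF rhs_FF[OF s(1)]] by (rule integrable_abs)
        show "integrable lborel (\<lambda>x. 1 / L * \<bar>l_H (G_rhs \<gamma> (Y s)) x\<bar>)" using inti[OF sT] by simp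
        show "\<bar>end_means L x * l_H (G_rhs \<gamma> (Y s)) x\<bar> \<le> 1 / L * \<bar>l_H (G_rhs \<gamma> (Y s)) x\<bar>" for x
          unfolding abs_mult by (intro mult_right_mono end_means L) simp
      qed
      also have "\<dots> \<le> 1 / L * ?C" using int[OF sT] L by (simp only: integral_mult_right_zero) (intro mult_left_mono, auto)
      finally show "\<bar>?l (G_rhs \<gamma> (Y s) - 0)\<bar> \<le> 0 * \<bar>?l (Y s - Y 0 - s *\<^sub>R 0)\<bar> + ?C / L" by simp
    qed (use t L C FF_0 FF[of 0] in auto)
    then have "?l (Y t - Y 0) \<le> ?C / L * t" by simp
    also have "\<dots> \<le> ?C / L * T" using t C L by (intro mult_left_mono) auto
    also have "?l (Y t - Y 0) = ?l (Y t) - ?l (Y 0)"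
      using i(1)[OF FF[of t]] i(1)[OF FF[of 0]] t by (simp add: right_diff_distrib)
    finally show "?l (Y t) \<le> ?l (Y 0) + ?C * T / L" by simp
  qed
qed

text \<open>For large L any increment of H at time t lies below the difference of end means at time
  t, which exceeds the initial one by at most C/L; the initial one is in turn an increment bounded
  by E. Then L tends to infinity.\<close>

lemma energy_le:
  assumes E: "energy_le (Y 0) E" and t: "0 \<le> t"
  shows "energy_le (Y t) E"
  unfolding energy_le_def
proof (intro allI impI)
  fix a b :: real assume ab: "a \<le> b"
  interpret Yt: GG_elem "Y t" by standard (rule GG[OF t])
  interpret Y0: GG_elem "Y 0" by standard (rule GG[OF order_refl])
  obtain C where C: "\<And>s L. s \<in> {0..t} \<Longrightarrow> L > 0 \<Longrightarrow>
    (LINT x|lborel. end_means L x * l_H (Y s) x) \<le> (LINT x|lborel. end_means L x * l_H (Y 0) x) + C / L"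
    using energy_step[OF t] by blast
  have le: "l_H (Y t) b - l_H (Y t) a \<le> E + C / L" if L: "L \<ge> max 1 (max \<bar>a\<bar> \<bar>b\<bar>)" for L
  proof -
    have L0: "L > 0" using L by simp
    have "l_H (Y t) b \<le> l_H (Y t) L" "l_H (Y t) (- L) \<le> l_H (Y t) a" using L by (auto intro!: Yt.H_mono)
    then have "l_H (Y t) b - l_H (Y t) a \<le> l_H (Y t) L - l_H (Y t) (- L)" by simp
    also have "\<dots> \<le> (LINT x|lborel. end_means L x * l_H (Y 0) x) + C / L"
      using Yt.end_means_sandwich(1)[OF L0] C[OF _ L0, of t] t by simp
    also have "(LINT x|lborel. end_means L x * l_H (Y 0) x) \<le> E"
      using Y0.end_means_sandwich(2)[OF L0] E[unfolded energy_le_def, rule_format, of "- 2 * L" "2 * L"] L0 by linarith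
    finally show ?thesis by simp
  qed
  have lim: "((\<lambda>L. E + C / L) \<longlongrightarrow> E + 0) at_top"
    by (intro tendsto_intros tendsto_divide_0[OF tendsto_const] filterlim_at_top_imp_at_infinity filterlim_ident)
  have "l_H (Y t) b - l_H (Y t) a \<le> E + 0"
    by (rule tendsto_lowerbound[OF lim]) (use le in \<open>auto intro!: eventually_at_top_linorderI[of "max 1 (max \<bar>a\<bar> \<bar>b\<bar>)"]\<close>)
  then show "l_H (Y t) b - l_H (Y t) a \<le> E" by simp
qed

end

lemma conv_nonneg_AE:
  assumes "kernel k c" "AE x in lborel. 0 \<le> g x" shows "0 \<le> conv k g \<xi>"
  unfolding conv_def using assms(2) kernelD(2)[OF assms(1)]
  by (intro integral_nonneg_AE) (auto elim!: eventually_mono)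

text \<open>Cauchy--Schwarz with respect to the measure \<open>h dx\<close>; squaring the kernel leaves one factor
  \<open>e\<^bsup>-\<bar>x - \<eta>\<bar>\<^esup>\<close> after the other has been spent on moving the weight inside.\<close>

lemma weighted_conv_exp_kernel:
  assumes h: "integrable lborel h" "AE x in lborel. 0 \<le> h x" "(LINT x|lborel. h x) \<le> E"
    and \<Omega>: "\<And>x. 0 \<le> \<Omega> x" "\<And>x y. \<Omega> x \<le> C * \<Omega> y * exp \<bar>x - y\<bar>" and C: "0 \<le> C"
    and \<Omega>h: "integrable lborel (\<lambda>x. \<Omega> x * h x)"
  shows "\<Omega> \<xi> * (conv exp_kernel h \<xi>)\<^sup>2 \<le> C * E * conv exp_kernel (\<lambda>x. \<Omega> x * h x) \<xi>"
proof -
  have [measurable]: "h \<in> borel_measurable borel" using h(1) by auto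
  have E: "0 \<le> (LINT x|lborel. h x)" using h(2) by (rule integral_nonneg_AE)
  have ih: "integrable lborel (\<lambda>x. \<bar>h x\<bar>)" using h(1) by simp
  have eh: "(LINT x|lborel. \<bar>h x\<bar>) = (LINT x|lborel. h x)"
    using h(2) by (intro integral_cong_AE) (auto elim!: eventually_mono)
  let ?k = "\<lambda>\<eta>. exp_kernel (\<xi> - \<eta>)"
  have k1: "?k \<eta> \<le> 1" for \<eta> by (simp add: exp_kernel_def)
  have i2: "integrable lborel (\<lambda>\<eta>. (?k \<eta>)\<^sup>2 * \<bar>h \<eta>\<bar>)"
    by (rule Bochner_Integration.integrable_bound[OF ih])
      (use k1 in \<open>auto simp: abs_mult power_le_one intro!: mult_left_le_one_le\<close>)
  let ?S = "LINT \<eta>|lborel. (?k \<eta>)\<^sup>2 * \<bar>h \<eta>\<bar>"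
  have S: "0 \<le> ?S" by (intro integral_nonneg_AE) auto
  have "L2_le (\<lambda>\<eta>. sqrt \<bar>h \<eta>\<bar>) (sqrt (LINT x|lborel. h x))"
    using E ih eh by (simp add: L2_le_iff)
  moreover have "L2_le (\<lambda>\<eta>. ?k \<eta> * sqrt \<bar>h \<eta>\<bar>) (sqrt ?S)"
    using S i2 by (simp add: L2_le_iff power_mult_distrib)
  ultimately have "(LINT \<eta>|lborel. \<bar>sqrt \<bar>h \<eta>\<bar> * (?k \<eta> * sqrt \<bar>h \<eta>\<bar>)\<bar>) \<le> sqrt (LINT x|lborel. h x) * sqrt ?S"
    by (rule L2_le_Cauchy_Schwarz)
  moreover have "\<bar>sqrt \<bar>h \<eta>\<bar> * (?k \<eta> * sqrt \<bar>h \<eta>\<bar>)\<bar> = \<bar>?k \<eta> * h \<eta>\<bar>" for \<eta>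
    by (simp add: abs_mult mult.left_commute)
  ultimately have "(LINT \<eta>|lborel. \<bar>?k \<eta> * h \<eta>\<bar>) \<le> sqrt ((LINT x|lborel. h x) * ?S)"
    by (simp add: real_sqrt_mult)
  moreover have "\<bar>conv exp_kernel h \<xi>\<bar> \<le> (LINT \<eta>|lborel. \<bar>?k \<eta> * h \<eta>\<bar>)"
    unfolding conv_def by (rule integral_abs_bound)
  ultimately have "\<bar>conv exp_kernel h \<xi>\<bar> \<le> sqrt ((LINT x|lborel. h x) * ?S)" by linarith
  then have "\<bar>conv exp_kernel h \<xi>\<bar>\<^sup>2 \<le> (sqrt ((LINT x|lborel. h x) * ?S))\<^sup>2" by (rule power_mono) simp
  then have "(conv exp_kernel h \<xi>)\<^sup>2 \<le> (LINT x|lborel. h x) * ?S" using E S by simp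
  also have "\<dots> \<le> E * ?S" using h(3) S by (rule mult_right_mono)
  finally have 1: "(conv exp_kernel h \<xi>)\<^sup>2 \<le> E * ?S" .
  have E0: "0 \<le> E" using E h(3) by linarith
  have "\<Omega> \<xi> * ?S = (LINT \<eta>|lborel. \<Omega> \<xi> * ((?k \<eta>)\<^sup>2 * \<bar>h \<eta>\<bar>))" by simp
  also have "\<dots> \<le> (LINT \<eta>|lborel. C * (?k \<eta> * (\<Omega> \<eta> * h \<eta>)))"
  proof (rule integral_mono_AE)
    show "integrable lborel (\<lambda>\<eta>. \<Omega> \<xi> * ((?k \<eta>)\<^sup>2 * \<bar>h \<eta>\<bar>))" using i2 by simp
    show "integrable lborel (\<lambda>\<eta>. C * (?k \<eta> * (\<Omega> \<eta> * h \<eta>)))"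
      using conv_integrable_L1[OF kernel_exp_kernel \<Omega>h] by simp
    show "AE \<eta> in lborel. \<Omega> \<xi> * ((?k \<eta>)\<^sup>2 * \<bar>h \<eta>\<bar>) \<le> C * (?k \<eta> * (\<Omega> \<eta> * h \<eta>))"
      using h(2)
    proof eventually_elim
      case (elim \<eta>)
      have "\<Omega> \<xi> * ?k \<eta> \<le> (C * \<Omega> \<eta> * exp \<bar>\<xi> - \<eta>\<bar>) * ?k \<eta>"
        by (intro mult_right_mono \<Omega>) simp
      also have "\<dots> = C * \<Omega> \<eta>" by (simp add: exp_kernel_def exp_minus)
      finally have "(\<Omega> \<xi> * ?k \<eta>) * (?k \<eta> * h \<eta>) \<le> (C * \<Omega> \<eta>) * (?k \<eta> * h \<eta>)"
        using elim by (intro mult_right_mono) auto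
      then show ?case using elim by (simp add: power2_eq_square mult_ac)
    qed
  qed
  also have "\<dots> = C * conv exp_kernel (\<lambda>x. \<Omega> x * h x) \<xi>" by (simp add: conv_def)
  finally have 2: "\<Omega> \<xi> * ?S \<le> C * conv exp_kernel (\<lambda>x. \<Omega> x * h x) \<xi>" .
  have "\<Omega> \<xi> * (conv exp_kernel h \<xi>)\<^sup>2 \<le> \<Omega> \<xi> * (E * ?S)" using 1 \<Omega>(1) by (rule mult_left_mono)
  also have "\<dots> = E * (\<Omega> \<xi> * ?S)" by simp
  also have "\<dots> \<le> E * (C * conv exp_kernel (\<lambda>x. \<Omega> x * h x) \<xi>)" using 2 E0 by (rule mult_left_mono)
  finally show ?thesis by (simp add: mult_ac)
qed

section \<open>Bounds in terms of the energy\<close>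

definition PQ_bd :: "real \<Rightarrow> real \<Rightarrow> real \<Rightarrow> real" where
  "PQ_bd \<gamma> Z E = source_bd \<gamma> * exp (2 * Z) * ((1 + sqrt exp_mass) * E)"

lemma PP_QQ_abs:
  "\<bar>PP \<gamma> Y \<xi>\<bar> \<le> \<bar>nonloc (\<lambda>_. 1) \<gamma> Y \<xi>\<bar>" "\<bar>QQ \<gamma> Y \<xi>\<bar> \<le> \<bar>nonloc sgn \<gamma> Y \<xi>\<bar>"
  by (simp_all add: PP_nonloc QQ_nonloc abs_mult)

lemma PQ_measurable:
  assumes "Y \<in> FF_rc" shows "PP \<gamma> Y \<in> borel_measurable borel" "QQ \<gamma> Y \<in> borel_measurable borel"
  using L2_le_measurable[OF L2_Linf_leD(1)[OF PQ_L2_Linf_le(1)[OF assms order_refl samp_op_id]]]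
    L2_le_measurable[OF L2_Linf_leD(1)[OF PQ_L2_Linf_le(2)[OF assms order_refl samp_op_id]]] .

context GG_elem
begin

lemma PQ_conv:
  assumes E: "energy_le Y E" and Z: "\<And>x. \<bar>l_zeta Y x\<bar> \<le> Z"
  shows "\<bar>PP \<gamma> Y \<xi>\<bar> \<le> source_bd \<gamma> * exp (2 * Z) * conv exp_kernel (l_h Y) \<xi>"
    "\<bar>QQ \<gamma> Y \<xi>\<bar> \<le> source_bd \<gamma> * exp (2 * Z) * conv exp_kernel (l_h Y) \<xi>"
  using PP_QQ_abs[of \<gamma> Y \<xi>] nonloc_bound_conv[OF _ E Z, of "\<lambda>_. 1" \<gamma> \<xi>] nonloc_bound_conv[OF _ E Z, of sgn \<gamma> \<xi>]
  by (auto simp: sgn_or_one_def)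

text \<open>The energy controls h in L^1 only. The convolution J satisfies J <= E and \<integral>J
  <= \<open>exp_mass\<close> E, so \<integral>J^2 <= E \<integral>J interpolates between L^1 and
  L^\<infinity>.\<close>

lemma conv_h_L2_Linf_le:
  assumes E: "energy_le Y E"
  shows "L2_Linf_le (conv exp_kernel (l_h Y)) ((1 + sqrt exp_mass) * E)"
proof -
  note hi = h_integrable[OF E]
  let ?J = "conv exp_kernel (l_h Y)"
  have exp_mass: "0 \<le> exp_mass" by (rule kernelD(6)[OF kernel_exp_kernel])
  have J0: "0 \<le> ?J \<xi>" for \<xi> by (rule conv_nonneg_AE[OF kernel_exp_kernel AE_h])
  have eh: "(LINT x|lborel. \<bar>l_h Y x\<bar>) = (LINT x|lborel. l_h Y x)"
    using AE_h meas by (intro integral_cong_AE) (auto elim!: eventually_mono)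
  have JE: "?J \<xi> \<le> E" for \<xi> using conv_bound_L1[OF kernel_exp_kernel hi(1), of \<xi>] hi(2) eh by linarith
  have E0: "0 \<le> E" using J0 JE order_trans by blast
  note Ji = conv_L1[OF kernel_exp_kernel hi(1)]
  have m: "?J \<in> borel_measurable borel" using Ji(1) by auto
  have le: "(?J \<xi>)\<^sup>2 \<le> E * ?J \<xi>" for \<xi>
    using mult_right_mono[OF JE J0, of \<xi> \<xi>] by (simp add: power2_eq_square)
  have Ei: "integrable lborel (\<lambda>\<xi>. E * ?J \<xi>)" using Ji(1) by simp
  have i: "integrable lborel (\<lambda>\<xi>. (?J \<xi>)\<^sup>2)"
  proof (rule Bochner_Integration.integrable_bound[OF Ei])
    show "(\<lambda>\<xi>. (?J \<xi>)\<^sup>2) \<in> borel_measurable lborel" using m by measurable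
    show "AE x in lborel. norm ((?J x)\<^sup>2) \<le> norm (E * ?J x)" using le J0 E0 by (intro AE_I2) simp
  qed
  have "(LINT \<xi>|lborel. (?J \<xi>)\<^sup>2) \<le> (LINT \<xi>|lborel. E * ?J \<xi>)"
    using le by (intro integral_mono i Ei)
  also have "\<dots> = E * (exp_mass * (LINT x|lborel. l_h Y x))" using Ji(2) by simp
  also have "\<dots> \<le> E * (exp_mass * E)" using hi(2) exp_mass E0 by (intro mult_left_mono) auto
  also have "\<dots> = (sqrt exp_mass * E)\<^sup>2" using exp_mass by (simp add: power_mult_distrib power2_eq_square)
  finally have "L2_le ?J (sqrt exp_mass * E)" using i m E0 exp_mass by (simp add: L2_le_iff)
  moreover have "Linf_le ?J E" using m J0 JE by (intro Linf_leI) auto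
  ultimately show ?thesis using E0 exp_mass
    by (auto simp: L2_Linf_le_def distrib_right elim!: L2_le_weaken Linf_le_weaken)
qed

lemma PQ_L2_Linf_energy:
  assumes E: "energy_le Y E" and Z: "\<And>x. \<bar>l_zeta Y x\<bar> \<le> Z"
  shows "L2_Linf_le (PP \<gamma> Y) (PQ_bd \<gamma> Z E)" "L2_Linf_le (QQ \<gamma> Y) (PQ_bd \<gamma> Z E)"
proof -
  let ?c = "source_bd \<gamma> * exp (2 * Z)"
  have c: "0 \<le> ?c" using source_bd_nonneg by simp
  have J0: "0 \<le> conv exp_kernel (l_h Y) \<xi>" for \<xi> by (rule conv_nonneg_AE[OF kernel_exp_kernel AE_h])
  have J: "L2_Linf_le (\<lambda>\<xi>. ?c * conv exp_kernel (l_h Y) \<xi>) (PQ_bd \<gamma> Z E)"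
    using L2_Linf_le_cmult[OF conv_h_L2_Linf_le[OF E], of ?c] c by (simp add: PQ_bd_def)
  have *: "L2_Linf_le f (PQ_bd \<gamma> Z E)" if "f \<in> borel_measurable borel" "\<And>\<xi>. \<bar>f \<xi>\<bar> \<le> ?c * conv exp_kernel (l_h Y) \<xi>" for f
  proof -
    have "AE x in lborel. \<bar>f x\<bar> \<le> \<bar>?c * conv exp_kernel (l_h Y) x\<bar>"
      using that(2) by (intro AE_I2) (rule order_trans[OF _ abs_ge_self])
    with J that(1) show ?thesis unfolding L2_Linf_le_def by (blast intro: L2_le_mono Linf_le_mono)
  qed
  show "L2_Linf_le (PP \<gamma> Y) (PQ_bd \<gamma> Z E)" "L2_Linf_le (QQ \<gamma> Y) (PQ_bd \<gamma> Z E)"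
    by (rule *[OF PQ_measurable(1)[OF FF_rc] PQ_conv(1)[OF E Z]], rule *[OF PQ_measurable(2)[OF FF_rc] PQ_conv(2)[OF E Z]])
qed

end

text \<open>Linear growth in \<open>F_norm X\<close>: in every product all factors but one are
  bounded by a (for U) or b (for P and Q), quantities that the energy controls. The Lipschitz
  estimates grow with powers of the norm and would give a bound for short times only.\<close>

lemma lag_field_growth:
  fixes \<gamma> a b :: real
  assumes X: "X \<in> FF" and a: "Linf_le (l_U X) a" and P: "L2_Linf_le P b" and Q: "L2_Linf_le Q b"
  defines "c \<equiv> \<bar>(3 - 2 * \<gamma>) / 2\<bar>"
  shows "F_norm (lag_field 1 1 \<gamma> X P Q) \<le>
    7 * (\<bar>\<gamma>\<bar> + \<bar>\<gamma> / 2\<bar> + c * a + c * a\<^sup>2 + 5 * b + 2 * a * b + 3 * a\<^sup>2) * F_norm X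
    + 7 * (\<bar>\<gamma>\<bar> * a + b + a^3 + 2 * b * a)"
proof -
  let ?N = "F_norm X"
  let ?A = "\<bar>\<gamma>\<bar> + \<bar>\<gamma> / 2\<bar> + c * a + c * a\<^sup>2 + 5 * b + 2 * a * b + 3 * a\<^sup>2"
  let ?B = "\<bar>\<gamma>\<bar> * a + b + a^3 + 2 * b * a"
  have N: "0 \<le> ?N" by simp
  have nn: "0 \<le> a" "0 \<le> b" "0 \<le> c" using Linf_le_nonneg[OF a] L2_Linf_le_nonneg[OF P] by (auto simp: c_def)
  note f = comps_le_of_F_norm[OF X order_refl, unfolded comps_le_def L2_Linf_le_def]
  note PQ = P[unfolded L2_Linf_le_def] Q[unfolded L2_Linf_le_def]
  let ?r = "?A * ?N + ?B"
  have p: "0 \<le> \<bar>\<gamma>\<bar> * ?N" "0 \<le> \<bar>\<gamma> / 2\<bar> * ?N" "0 \<le> c * a * ?N" "0 \<le> c * a\<^sup>2 * ?N" "0 \<le> b * ?N" "0 \<le> a * b * ?N" "0 \<le> a\<^sup>2 * ?N"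
    "0 \<le> \<bar>\<gamma>\<bar> * a" "0 \<le> a^3" "0 \<le> b * a" using nn N by auto
  have r: "?r = \<bar>\<gamma>\<bar> * ?N + \<bar>\<gamma> / 2\<bar> * ?N + c * a * ?N + c * a\<^sup>2 * ?N + 5 * (b * ?N) + 2 * (a * b * ?N) + 3 * (a\<^sup>2 * ?N)
     + (\<bar>\<gamma>\<bar> * a + b + a^3 + 2 * (b * a))" by (simp add: algebra_simps)
  define d where "d = (3 - 2 * \<gamma>) / 2"
  have dc: "\<bar>d\<bar> = c" by (simp add: d_def c_def)
  let ?U = "l_U X" and ?v = "l_v X" and ?w = "l_w X" and ?h = "l_h X"
  have z: "Linf_le (\<lambda>x. \<gamma> * ?U x) ?r"
    by (rule Linf_le_weaken[OF Linf_le_cmult[OF a]]) (use p nn in \<open>unfold r, linarith\<close>)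
  have u: "L2_Linf_le (\<lambda>x. (- 1) * Q x) ?r"
    by (rule L2_Linf_le_weaken[OF L2_Linf_le_cmult[OF Q]]) (use p nn in \<open>unfold r, simp\<close>)
  have H: "Linf_le (\<lambda>x. ?U x * (?U x)\<^sup>2 - 2 * (P x * ?U x)) ?r"
  proof (rule Linf_le_weaken)
    show "Linf_le (\<lambda>x. ?U x * (?U x)\<^sup>2 - 2 * (P x * ?U x)) (a * a\<^sup>2 + \<bar>2\<bar> * (b * a))"
      using PQ a by (intro Linf_le_diff Linf_le_mult Linf_le_cmult Linf_le_power2) auto
    show "a * a\<^sup>2 + \<bar>2\<bar> * (b * a) \<le> ?r" using p nn unfolding r by (simp add: power2_eq_square power3_eq_cube)
  qed
  have v: "L2_le (\<lambda>x. \<gamma> * ?w x) ?r"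
  proof (rule L2_le_weaken)
    show "L2_le (\<lambda>x. \<gamma> * ?w x) (\<bar>\<gamma>\<bar> * ?N)" using f by (intro L2_le_cmult) auto
    show "\<bar>\<gamma>\<bar> * ?N \<le> ?r" using p nn unfolding r by linarith
  qed
  have w: "L2_le (\<lambda>x. \<gamma> / 2 * ?h x + ((d * (?U x * ?U x) - P x) + (d * (?U x)\<^sup>2 - P x) * ?v x)) ?r"
  proof (rule L2_le_weaken)
    show "L2_le (\<lambda>x. \<gamma> / 2 * ?h x + ((d * (?U x * ?U x) - P x) + (d * (?U x)\<^sup>2 - P x) * ?v x))
      (\<bar>\<gamma> / 2\<bar> * ?N + ((\<bar>d\<bar> * (a * ?N) + b) + (\<bar>d\<bar> * a\<^sup>2 + b) * ?N))"
      using PQ a f by (intro L2_le_add L2_le_diff L2_le_cmult L2_le_mult Linf_le_diff Linf_le_cmult Linf_le_power2) auto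
    have "\<bar>\<gamma> / 2\<bar> * ?N + ((\<bar>d\<bar> * (a * ?N) + b) + (\<bar>d\<bar> * a\<^sup>2 + b) * ?N) =
      \<bar>\<gamma> / 2\<bar> * ?N + c * a * ?N + b + c * a\<^sup>2 * ?N + b * ?N" unfolding dc by (simp add: algebra_simps)
    then show "\<bar>\<gamma> / 2\<bar> * ?N + ((\<bar>d\<bar> * (a * ?N) + b) + (\<bar>d\<bar> * a\<^sup>2 + b) * ?N) \<le> ?r"
      using p nn unfolding r by linarith
  qed
  have h: "L2_le (\<lambda>x. (- 2) * (Q x * ?U x + (Q x * ?U x) * ?v x) + (3 * (?U x)\<^sup>2 - 2 * P x) * ?w x) ?r"
  proof (rule L2_le_weaken)
    show "L2_le (\<lambda>x. (- 2) * (Q x * ?U x + (Q x * ?U x) * ?v x) + (3 * (?U x)\<^sup>2 - 2 * P x) * ?w x)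
      (\<bar>- 2\<bar> * (b * ?N + (b * a) * ?N) + (\<bar>3\<bar> * a\<^sup>2 + \<bar>2\<bar> * b) * ?N)"
      using PQ a f
      by (intro L2_le_add L2_le_cmult L2_le_mult[of _ "\<bar>3\<bar> * a\<^sup>2 + \<bar>2\<bar> * b"] L2_le_mult[of _ b] L2_le_mult[of _ "b * a"]
          Linf_le_mult Linf_le_diff Linf_le_cmult Linf_le_power2) auto
    have "\<bar>- 2\<bar> * (b * ?N + (b * a) * ?N) + (\<bar>3\<bar> * a\<^sup>2 + \<bar>2\<bar> * b) * ?N =
       4 * (b * ?N) + 2 * (a * b * ?N) + 3 * (a\<^sup>2 * ?N)" by (simp add: algebra_simps)
    then show "\<bar>- 2\<bar> * (b * ?N + (b * a) * ?N) + (\<bar>3\<bar> * a\<^sup>2 + \<bar>2\<bar> * b) * ?N \<le> ?r"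
      using p nn unfolding r by linarith
  qed
  have "comps_le (lag_field 1 1 \<gamma> X P Q) ?r"
    unfolding comps_le_def lag_field_def lag.sel
  proof (intro conjI)
    show "Linf_le (\<lambda>x. 1 * (\<gamma> * ?U x)) ?r" using z by simp
    show "L2_Linf_le (\<lambda>x. 1 * - Q x) ?r" using u by simp
    show "Linf_le (\<lambda>x. 1 * ((?U x)^3 - 2 * P x * ?U x)) ?r"
      using H by (simp add: power3_eq_cube power2_eq_square mult.assoc)
    show "L2_le (\<lambda>x. 1 * (\<gamma> * ?w x)) ?r" using v by simp
    have "(\<lambda>x. 1 * (\<gamma> / 2 * ?h x + ((3 - 2 * \<gamma>) / 2 * (?U x)\<^sup>2 - P x) * l_q X x)) =
      (\<lambda>x. \<gamma> / 2 * ?h x + ((d * (?U x * ?U x) - P x) + (d * (?U x)\<^sup>2 - P x) * ?v x))"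
      unfolding d_def[symmetric] l_q_def by (rule ext) algebra
    then show "L2_le (\<lambda>x. 1 * (\<gamma> / 2 * ?h x + ((3 - 2 * \<gamma>) / 2 * (?U x)\<^sup>2 - P x) * l_q X x)) ?r" using w by simp
    have "(\<lambda>x. 1 * (- 2 * Q x * ?U x * l_q X x) + 1 * ((3 * (?U x)\<^sup>2 - 2 * P x) * ?w x)) =
      (\<lambda>x. (- 2) * (Q x * ?U x + (Q x * ?U x) * ?v x) + (3 * (?U x)\<^sup>2 - 2 * P x) * ?w x)"
      unfolding l_q_def by (rule ext) algebra
    then show "L2_le (\<lambda>x. 1 * (- 2 * Q x * ?U x * l_q X x) + 1 * ((3 * (?U x)\<^sup>2 - 2 * P x) * ?w x)) ?r" using h by simp
  qed
  from comps_le_imp(2)[OF this] show ?thesis by (simp add: algebra_simps)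
qed

definition U_bd :: "real \<Rightarrow> real" where "U_bd E = sqrt (E + 1) + (1 + E) / 2"

lemma (in GG_elem) U_Linf: "energy_le Y E \<Longrightarrow> Linf_le (l_U Y) (U_bd E)"
  using U_bound meas unfolding U_bd_def by (intro Linf_leI) auto

definition zeta_bd :: "real \<Rightarrow> real \<Rightarrow> real \<Rightarrow> real \<Rightarrow> real" where
  "zeta_bd \<gamma> T E F = F + \<bar>\<gamma>\<bar> * U_bd E * T"

context flow
begin

lemma elem: "0 \<le> t \<Longrightarrow> GG_elem (Y t)"
  by (simp add: GG_elem_def GG)

text \<open>The rate of change of zeta is \<gamma>U, bounded by the energy. This has to precede the
  bounds on P and Q, whose kernel contains zeta in the exponent.\<close>

lemma zeta_bound:
  assumes E: "energy_le (Y 0) E" and F: "F_norm (Y 0) \<le> F" and t: "t \<in> {0..T}"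
  shows "\<bar>l_zeta (Y t) x\<bar> \<le> zeta_bd \<gamma> T E F"
proof -
  let ?p = "\<lambda>X. Linf_norm (l_zeta X)"
  have zF: "l_zeta X \<in> Linf" if "X \<in> FF" for X using that by (simp add: FF_def)
  have a: "0 \<le> U_bd E" using Linf_le_nonneg[OF GG_elem.U_Linf[OF elem E]] by simp
  have "?p (Y t - 0 - t *\<^sub>R 0) \<le> (?p (Y 0 - 0 - 0 *\<^sub>R 0) + \<bar>\<gamma>\<bar> * U_bd E * (t - 0)) * exp (0 * (t - 0))"
  proof (rule seminorm_gronwall[where K = 1 and b = T])
    fix X Z :: lag and c :: real assume X: "X \<in> FF"
    show "?p (c *\<^sub>R X) \<le> \<bar>c\<bar> * ?p X"
      using Linf_le_cmult[OF Linf_le_norm[OF zF[OF X]], of c] by (simp add: Linf_le_iff)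
    show "?p X \<le> 1 * F_norm X" using comps_le_of_F_norm[OF X order_refl] by (simp add: comps_le_def Linf_le_iff)
    assume Z: "Z \<in> FF"
    show "?p (X + Z) \<le> ?p X + ?p Z"
      using Linf_le_add[OF Linf_le_norm[OF zF[OF X]] Linf_le_norm[OF zF[OF Z]]] by (simp add: Linf_le_iff)
  next
    fix s assume s: "0 \<le> s" "s < T"
    have "Linf_le (\<lambda>x. \<gamma> * l_U (Y s) x) (\<bar>\<gamma>\<bar> * U_bd E)"
      by (rule Linf_le_cmult[OF GG_elem.U_Linf[OF elem[OF s(1)] energy_le[OF E s(1)]]])
    then show "?p (G_rhs \<gamma> (Y s) - 0) \<le> 0 * ?p (Y s - 0 - s *\<^sub>R 0) + \<bar>\<gamma>\<bar> * U_bd E"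
      by (simp add: G_rhs_def Linf_le_iff)
  qed (use FF_0 a t in auto)
  then have "?p (Y t) \<le> ?p (Y 0) + \<bar>\<gamma>\<bar> * U_bd E * t" by simp
  also have "\<dots> \<le> F + \<bar>\<gamma>\<bar> * U_bd E * T"
  proof (intro add_mono mult_left_mono)
    show "?p (Y 0) \<le> F" using comps_le_of_F_norm[OF FF[OF order_refl] F] by (simp add: comps_le_def Linf_le_iff)
  qed (use a t in auto)
  finally have "Linf_le (l_zeta (Y t)) (zeta_bd \<gamma> T E F)"
    unfolding zeta_bd_def using zF[OF FF[of t]] t by (simp add: Linf_le_iff)
  then show ?thesis by (rule Linf_le_right_cont) (use FF_rc[of t] t in \<open>auto simp: FF_rc_def\<close>)
qed

end

text \<open>Energy, U, zeta, P and Q, and finally F_norm are bounded in this order. M is chosen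
  before the flow, so it depends on \<gamma>, T, E and F only.\<close>

lemma flow_F_bound:
  assumes T: "0 \<le> T"
  shows "\<exists>M\<ge>0. \<forall>Y\<^sub>0 Y. is_flow \<gamma> Y\<^sub>0 Y \<longrightarrow> energy_le (Y 0) E \<longrightarrow> F_norm (Y 0) \<le> F \<longrightarrow> (\<forall>t\<in>{0..T}. F_norm (Y t) \<le> M)"
proof -
  define a where "a = U_bd E"
  define b where "b = PQ_bd \<gamma> (zeta_bd \<gamma> T E F) E"
  define \<alpha> where "\<alpha> = 7 * (\<bar>\<gamma>\<bar> + \<bar>\<gamma> / 2\<bar> + \<bar>(3 - 2 * \<gamma>) / 2\<bar> * a + \<bar>(3 - 2 * \<gamma>) / 2\<bar> * a\<^sup>2 + 5 * b + 2 * a * b + 3 * a\<^sup>2)"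
  define \<beta> where "\<beta> = 7 * (\<bar>\<gamma>\<bar> * a + b + a^3 + 2 * b * a)"
  \<comment> \<open>The absolute value makes the candidate for M nonnegative even when no flow
    satisfies the hypotheses.\<close>
  have "F_norm (Y t) \<le> \<bar>(F + \<beta> * T) * exp (\<alpha> * T)\<bar>"
    if fl: "is_flow \<gamma> Y\<^sub>0 Y" and E: "energy_le (Y 0) E" and F: "F_norm (Y 0) \<le> F" and t: "t \<in> {0..T}" for Y\<^sub>0 Y t
  proof -
    interpret flow \<gamma> Y\<^sub>0 Y by standard (rule fl)
    have U: "Linf_le (l_U (Y s)) a" if "0 \<le> s" for s
      unfolding a_def by (rule GG_elem.U_Linf[OF elem[OF that] energy_le[OF E that]])
    have PQ: "L2_Linf_le (PP \<gamma> (Y s)) b" "L2_Linf_le (QQ \<gamma> (Y s)) b" if "s \<in> {0..T}" for s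
      unfolding b_def using that
      by (auto intro!: GG_elem.PQ_L2_Linf_energy elem energy_le E zeta_bound F)
    have a: "0 \<le> a" using Linf_le_nonneg[OF U[of 0]] by simp
    have b: "0 \<le> b" using L2_Linf_le_nonneg[OF PQ(1)[of 0]] T by simp
    have \<alpha>: "0 \<le> \<alpha>" and \<beta>: "0 \<le> \<beta>" using a b by (auto simp: \<alpha>_def \<beta>_def)
    have F0: "0 \<le> F" using F F_norm_nonneg order_trans by blast
    have "F_norm (Y t - 0 - t *\<^sub>R 0) \<le> (F_norm (Y 0 - 0 - 0 *\<^sub>R 0) + \<beta> * (t - 0)) * exp (\<alpha> * (t - 0))"
    proof (rule seminorm_gronwall[where K = 1 and b = T])
      fix s assume s: "0 \<le> s" "s < T"
      show "F_norm (G_rhs \<gamma> (Y s) - 0) \<le> \<alpha> * F_norm (Y s - 0 - s *\<^sub>R 0) + \<beta>"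
        using lag_field_growth[OF FF[OF s(1)] U[OF s(1)] PQ(1) PQ(2), of s s \<gamma>] s
        by (simp add: \<alpha>_def \<beta>_def G_rhs_lag_field)
    qed (use FF_0 \<alpha> \<beta> t F_norm_add(2) F_norm_scaleR(2) in auto)
    then have "F_norm (Y t) \<le> (F_norm (Y 0) + \<beta> * t) * exp (\<alpha> * t)" by simp
    also have "\<dots> \<le> (F + \<beta> * T) * exp (\<alpha> * T)"
      using t F F0 \<alpha> \<beta> by (intro mult_mono add_mono) (auto intro: mult_left_mono)
    finally show ?thesis by linarith
  qed
  then show ?thesis by (intro exI[of _ "\<bar>(F + \<beta> * T) * exp (\<alpha> * T)\<bar>"]) auto
qed

section \<open>Propagation of weights\<close>

text \<open>Used with r = Uq or r = w, whose squares \<open>AE_cons\<close> bounds by qh: a term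
  linear in P or Q becomes a multiple of q, quadratic in P or Q, plus h.\<close>

lemma amgm_square:
  fixes c r q h :: real
  assumes "0 \<le> q" "0 \<le> h" "r\<^sup>2 \<le> q * h" shows "2 * \<bar>c\<bar> * \<bar>r\<bar> \<le> c\<^sup>2 * q + h"
proof -
  have "(2 * \<bar>c\<bar> * \<bar>r\<bar>)\<^sup>2 = 4 * c\<^sup>2 * r\<^sup>2" by (simp add: power_mult_distrib)
  also have "\<dots> \<le> 4 * c\<^sup>2 * (q * h)" using assms(3) by (intro mult_left_mono) auto
  also have "\<dots> \<le> (c\<^sup>2 * q + h)\<^sup>2"
    using sum_squares_bound[of "c\<^sup>2 * q" h] by (simp add: power2_eq_square algebra_simps)
  finally show ?thesis by (rule power2_le_imp_le) (use assms in auto)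
qed

context GG_elem
begin

text \<open>In h_t = -2QUq + 3U^2 w - 2Pw the middle term is 3U (Uw), at most a multiple of h. The
  other two are at most Q^2 q + h and P^2 q + h, and P, Q are bounded by multiples of J, the
  convolution of h. The weight enters through V J^2 <= C E JV, where JV is the convolution of Vh.
  Thus everything is linear in \<integral>Vh, with a constant that sees V only through C.\<close>

lemma weighted_growth:
  assumes E: "energy_le Y E" and Z: "\<And>x. \<bar>l_zeta Y x\<bar> \<le> Z" and M: "F_norm Y \<le> M"
    and V: "\<And>x. 0 \<le> V x" "\<And>x y. V x \<le> C * V y * exp \<bar>x - y\<bar>" "0 \<le> C" "L2_le V k"
  shows "\<bar>LINT x|lborel. V x * l_h (G_rhs \<gamma> Y) x\<bar> \<le>
    (2 + 3 * U_bd E + 2 * (source_bd \<gamma> * exp (2 * Z))\<^sup>2 * (C * E) * (2 * exp_mass + M\<^sup>2)) * (LINT x|lborel. V x * l_h Y x)"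
proof -
  define a where "a = U_bd E"
  define \<kappa> where "\<kappa> = source_bd \<gamma> * exp (2 * Z)"
  define J where "J = conv exp_kernel (l_h Y)"
  define JV where "JV = conv exp_kernel (\<lambda>x. V x * l_h Y x)"
  define W where "W = (LINT x|lborel. V x * l_h Y x)"
  note hi = h_integrable[OF E]
  have comps_le: "comps_le Y M" by (rule comps_le_of_F_norm[OF FF M])
  have v: "L2_le (l_v Y) M" and hL: "L2_le (l_h Y) M" using comps_le by (auto simp: comps_le_def)
  have M0: "0 \<le> M" by (rule L2_le_nonneg[OF v])
  have exp_mass: "0 \<le> exp_mass" by (rule kernelD(6)[OF kernel_exp_kernel])
  have E0: "0 \<le> E" using hi(2) integral_nonneg_AE[OF AE_h] by linarith
  have \<kappa>: "0 \<le> \<kappa>" using source_bd_nonneg by (simp add: \<kappa>_def)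
  have a: "\<bar>l_U Y x\<bar> \<le> a" for x unfolding a_def U_bd_def by (rule U_bound[OF E])
  have a0: "0 \<le> a" using a order_trans abs_ge_zero by blast
  have [measurable]: "V \<in> borel_measurable borel" by (rule L2_le_measurable[OF V(4)])
  have Vh: "integrable lborel (\<lambda>x. V x * l_h Y x)" by (rule L2_le_mult_integrable[OF V(4) hL])
  have Vh0: "AE x in lborel. 0 \<le> V x * l_h Y x" using AE_h V(1) by (auto elim!: eventually_mono)
  have JV0: "0 \<le> JV x" for x unfolding JV_def by (rule conv_nonneg_AE[OF kernel_exp_kernel Vh0])
  have W_abs: "(LINT x|lborel. \<bar>V x * l_h Y x\<bar>) = W"
    unfolding W_def using Vh Vh0 by (intro integral_cong_AE) (auto elim!: eventually_mono)
  have JVW: "JV x \<le> W" for x using conv_bound_L1[OF kernel_exp_kernel Vh, of x] W_abs by (simp add: JV_def)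
  have W0: "0 \<le> W" using JV0 JVW order_trans by blast
  note JVi = conv_L1[OF kernel_exp_kernel Vh, folded JV_def W_def]
  have JVm[measurable]: "JV \<in> borel_measurable borel" using JVi(1) by auto
  have vm[measurable]: "l_v Y \<in> borel_measurable borel" "l_h (G_rhs \<gamma> Y) \<in> borel_measurable borel"
    using meas FF_measurable[OF G_rhs_FF[OF FF_rc]] by auto
  have vi: "integrable lborel (\<lambda>x. (l_v Y x)\<^sup>2)" "(LINT x|lborel. (l_v Y x)\<^sup>2) \<le> M\<^sup>2"
    using v by (auto simp: L2_le_iff)
  have Jv: "integrable lborel (\<lambda>x. JV x * (l_v Y x)\<^sup>2)"
  proof (rule Bochner_Integration.integrable_bound)
    show "integrable lborel (\<lambda>x. W * (l_v Y x)\<^sup>2)" using vi by simp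
    show "AE x in lborel. norm (JV x * (l_v Y x)\<^sup>2) \<le> norm (W * (l_v Y x)\<^sup>2)"
      using JV0 JVW W0 by (intro AE_I2) (auto simp: abs_mult intro!: mult_right_mono)
  qed measurable
  have Jv_le: "(LINT x|lborel. JV x * (l_v Y x)\<^sup>2) \<le> W * M\<^sup>2"
  proof -
    have "(LINT x|lborel. JV x * (l_v Y x)\<^sup>2) \<le> (LINT x|lborel. W * (l_v Y x)\<^sup>2)"
      using vi(1) by (intro integral_mono Jv mult_right_mono JVW) auto
    also have "\<dots> \<le> W * M\<^sup>2" using vi W0 by (auto intro: mult_left_mono)
    finally show ?thesis .
  qed
  let ?k = "2 * \<kappa>\<^sup>2 * (C * E)"
  have k0: "0 \<le> ?k" using E0 V(3) by simp
  let ?D = "\<lambda>x. (2 + 3 * a) * (V x * l_h Y x) + ?k * (2 * JV x + JV x * (l_v Y x)\<^sup>2)"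
  have Di: "integrable lborel ?D" using Vh JVi(1) Jv by simp
  have wc: "V x * (J x)\<^sup>2 \<le> C * E * JV x" for x
    unfolding J_def JV_def by (rule weighted_conv_exp_kernel[OF hi(1) AE_h hi(2) V(1,2,3) Vh])
  have dom: "AE x in lborel. \<bar>V x * l_h (G_rhs \<gamma> Y) x\<bar> \<le> ?D x"
    using AE_cons
  proof eventually_elim
    case (elim x)
    let ?P = "PP \<gamma> Y x" and ?Q = "QQ \<gamma> Y x" and ?U = "l_U Y x" and ?q = "l_q Y x" and ?w = "l_w Y x" and ?h = "l_h Y x"
    have J0: "0 \<le> J x" unfolding J_def by (rule conv_nonneg_AE[OF kernel_exp_kernel AE_h])
    have PQ: "\<bar>?P\<bar> \<le> \<kappa> * J x" "\<bar>?Q\<bar> \<le> \<kappa> * J x"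
      using PQ_conv[OF E Z] unfolding \<kappa>_def J_def by auto
    have PQ2: "?P\<^sup>2 \<le> \<kappa>\<^sup>2 * (J x)\<^sup>2" "?Q\<^sup>2 \<le> \<kappa>\<^sup>2 * (J x)\<^sup>2"
      using power_mono[OF PQ(1), of 2] power_mono[OF PQ(2), of 2] by (simp_all add: power_mult_distrib)
    have "\<bar>l_h (G_rhs \<gamma> Y) x\<bar> = \<bar>(- (2 * ?Q * (?U * ?q)) + 3 * ?U * (?U * ?w)) - 2 * ?P * ?w\<bar>"
      by (simp add: G_rhs_def algebra_simps power2_eq_square)
    also have "\<dots> \<le> 2 * \<bar>?Q\<bar> * \<bar>?U * ?q\<bar> + 3 * \<bar>?U\<bar> * \<bar>?U * ?w\<bar> + 2 * \<bar>?P\<bar> * \<bar>?w\<bar>"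
      using abs_triangle_ineq4[of "- (2 * ?Q * (?U * ?q)) + 3 * ?U * (?U * ?w)" "2 * ?P * ?w"]
        abs_triangle_ineq[of "- (2 * ?Q * (?U * ?q))" "3 * ?U * (?U * ?w)"]
      by (simp add: abs_mult)
    also have "\<dots> \<le> (?Q\<^sup>2 * ?q + ?h) + 3 * a * ?h + (?P\<^sup>2 * ?q + ?h)"
    proof (intro add_mono)
      show "2 * \<bar>?Q\<bar> * \<bar>?U * ?q\<bar> \<le> ?Q\<^sup>2 * ?q + ?h" "2 * \<bar>?P\<bar> * \<bar>?w\<bar> \<le> ?P\<^sup>2 * ?q + ?h"
        using elim by (intro amgm_square; simp)+
      show "3 * \<bar>?U\<bar> * \<bar>?U * ?w\<bar> \<le> 3 * a * ?h" using a[of x] a0 elim by (intro mult_mono) auto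
    qed
    also have "\<dots> \<le> (\<kappa>\<^sup>2 * (J x)\<^sup>2 * ?q + ?h) + 3 * a * ?h + (\<kappa>\<^sup>2 * (J x)\<^sup>2 * ?q + ?h)"
      using PQ2 elim by (intro add_mono mult_right_mono order_refl) auto
    finally have 1: "\<bar>l_h (G_rhs \<gamma> Y) x\<bar> \<le> (2 + 3 * a) * ?h + 2 * \<kappa>\<^sup>2 * ((J x)\<^sup>2 * ?q)" by (simp add: algebra_simps)
    \<comment> \<open>The norm of F does not bound q pointwise. The constant 2 is paired with JV in
      L^1, and v^2 in L^1 with JV in L^\<infinity>.\<close>
    have q2: "?q \<le> 2 + (l_v Y x)\<^sup>2"
      using sum_squares_bound[of "l_v Y x" 1] by (simp add: l_q_def power2_eq_square)
        (smt (verit) sum_squares_ge_zero zero_le_square)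
    have "V x * ((J x)\<^sup>2 * ?q) = (V x * (J x)\<^sup>2) * ?q" by simp
    also have "\<dots> \<le> (C * E * JV x) * ?q" using wc elim by (intro mult_right_mono) auto
    also have "\<dots> \<le> (C * E * JV x) * (2 + (l_v Y x)\<^sup>2)" using q2 V(3) E0 JV0 by (intro mult_left_mono) auto
    finally have 2: "V x * ((J x)\<^sup>2 * ?q) \<le> (C * E * JV x) * (2 + (l_v Y x)\<^sup>2)" .
    have "\<bar>V x * l_h (G_rhs \<gamma> Y) x\<bar> \<le> V x * ((2 + 3 * a) * ?h + 2 * \<kappa>\<^sup>2 * ((J x)\<^sup>2 * ?q))"
      using mult_left_mono[OF 1 V(1)[of x]] V(1)[of x] by (simp add: abs_mult)
    also have "\<dots> = (2 + 3 * a) * (V x * ?h) + 2 * \<kappa>\<^sup>2 * (V x * ((J x)\<^sup>2 * ?q))" by (simp add: algebra_simps)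
    also have "\<dots> \<le> (2 + 3 * a) * (V x * ?h) + 2 * \<kappa>\<^sup>2 * ((C * E * JV x) * (2 + (l_v Y x)\<^sup>2))"
      using 2 by (intro add_left_mono mult_left_mono) auto
    also have "\<dots> = ?D x" by (simp add: algebra_simps)
    finally show ?case .
  qed
  have "\<bar>LINT x|lborel. V x * l_h (G_rhs \<gamma> Y) x\<bar> \<le> (LINT x|lborel. \<bar>V x * l_h (G_rhs \<gamma> Y) x\<bar>)"
    by (rule integral_abs_bound)
  also have "\<dots> \<le> (LINT x|lborel. ?D x)"
  proof (rule integral_mono_AE[OF _ Di dom])
    have "integrable lborel (\<lambda>x. V x * l_h (G_rhs \<gamma> Y) x)"
      by (rule Bochner_Integration.integrable_bound[OF Di])
        (use dom in \<open>auto elim!: eventually_mono intro: order_trans[OF _ abs_ge_self]\<close>)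
    then show "integrable lborel (\<lambda>x. \<bar>V x * l_h (G_rhs \<gamma> Y) x\<bar>)" by (rule integrable_abs)
  qed
  also have "\<dots> = (2 + 3 * a) * W + ?k * (2 * (exp_mass * W) + (LINT x|lborel. JV x * (l_v Y x)\<^sup>2))"
    using Vh JVi Jv by (simp add: W_def)
  also have "\<dots> \<le> (2 + 3 * a) * W + ?k * (2 * (exp_mass * W) + W * M\<^sup>2)"
    using Jv_le k0 by (intro add_left_mono mult_left_mono)
  also have "\<dots> = (2 + 3 * a + ?k * (2 * exp_mass + M\<^sup>2)) * W" by (simp add: algebra_simps)
  finally show ?thesis by (simp add: a_def \<kappa>_def W_def)
qed

end

text \<open>The weight may grow at most as fast as the kernel decays; e^{|x|} is the borderline
  case, with C = 1.\<close>

definition weight :: "(real \<Rightarrow> real) \<Rightarrow> real \<Rightarrow> bool" where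
  "weight \<Omega> C \<longleftrightarrow> \<Omega> \<in> borel_measurable borel \<and> 1 \<le> C \<and> (\<forall>x. 1 \<le> \<Omega> x) \<and> (\<forall>x y. \<Omega> x \<le> C * \<Omega> y * exp \<bar>x - y\<bar>)"

text \<open>The decay of the truncated weight makes \<open>h \<mapsto> \<integral>\<Omega>\<^sub>Kh\<close> continuous on \<open>L\<^sup>2\<close>, in which
  \<open>h\<close> is differentiable in time.\<close>

definition cut_weight :: "(real \<Rightarrow> real) \<Rightarrow> real \<Rightarrow> real \<Rightarrow> real" where
  "cut_weight \<Omega> K x = min (\<Omega> x) (K * exp_kernel x)"

text \<open>Both \<Omega> and K \<open>exp_kernel\<close> satisfy the comparison inequality with
  constant C, and it passes to the minimum. Hence the estimates for the truncated weight do not see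
  K.\<close>

lemma cut_weight:
  assumes w: "weight \<Omega> C" and K: "0 \<le> K"
  shows "0 \<le> cut_weight \<Omega> K x" "cut_weight \<Omega> K x \<le> \<Omega> x"
    "cut_weight \<Omega> K x \<le> C * cut_weight \<Omega> K y * exp \<bar>x - y\<bar>"
    "L2_le (cut_weight \<Omega> K) (\<bar>K\<bar> * sqrt exp_mass)"
    "\<bar>x\<bar> \<le> r \<Longrightarrow> K = C * \<Omega> 0 * exp (2 * r) \<Longrightarrow> cut_weight \<Omega> K x = \<Omega> x"
proof -
  have \<Omega>: "\<Omega> \<in> borel_measurable borel" "1 \<le> C" "\<And>x. 1 \<le> \<Omega> x" "\<And>x y. \<Omega> x \<le> C * \<Omega> y * exp \<bar>x - y\<bar>"
    using w by (auto simp: weight_def)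
  have \<Omega>0: "0 \<le> \<Omega> x" for x using \<Omega>(3)[of x] by linarith
  show nn: "0 \<le> cut_weight \<Omega> K x" for x using \<Omega>0 K by (simp add: cut_weight_def)
  show "cut_weight \<Omega> K x \<le> \<Omega> x" by (simp add: cut_weight_def)
  show "cut_weight \<Omega> K x \<le> C * cut_weight \<Omega> K y * exp \<bar>x - y\<bar>"
  proof (cases "\<Omega> y \<le> K * exp_kernel y")
    case True
    then show ?thesis using \<Omega>(4)[of x y] by (auto simp: cut_weight_def)
  next
    case False
    have "K * exp_kernel x \<le> K * (exp \<bar>x - y\<bar> * exp_kernel y)"
      using exp_kernel_shift[of x 0 y] K by (intro mult_left_mono) auto
    also have "\<dots> \<le> C * (K * (exp \<bar>x - y\<bar> * exp_kernel y))"
      using mult_right_mono[OF \<Omega>(2), of "K * (exp \<bar>x - y\<bar> * exp_kernel y)"] K by simp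
    finally show ?thesis using False by (simp add: cut_weight_def mult_ac min_le_iff_disj)
  qed
  have m: "cut_weight \<Omega> K \<in> borel_measurable borel"
    unfolding cut_weight_def[abs_def] using \<Omega>(1) by measurable
  show "L2_le (cut_weight \<Omega> K) (\<bar>K\<bar> * sqrt exp_mass)"
    by (rule L2_le_mono[OF L2_le_cmult[OF kernel_L2_le[OF kernel_exp_kernel], of K] m])
      (use nn in \<open>auto simp: cut_weight_def min_le_iff_disj\<close>)
  assume x: "\<bar>x\<bar> \<le> r" "K = C * \<Omega> 0 * exp (2 * r)"
  \<comment> \<open>On [-r, r] the weight is at most C \<Omega>(0) e^{|x|}, and e^{|x|} <= e^{2r}
    e^{-|x|}; this determines the K that leaves the weight unchanged there.\<close>
  have "\<Omega> x \<le> C * \<Omega> 0 * exp \<bar>x\<bar>" using \<Omega>(4)[of x 0] by simp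
  also have "\<dots> \<le> C * \<Omega> 0 * (exp (2 * r) * exp_kernel x)"
    using x(1) \<Omega>(2) \<Omega>0[of 0] unfolding exp_kernel_def exp_add[symmetric] by (intro mult_left_mono) auto
  finally show "cut_weight \<Omega> K x = \<Omega> x" using x(2) by (simp add: cut_weight_def mult.assoc)
qed

context flow
begin

text \<open>Gronwall for the truncated weights, each giving a functional continuous on F. The rate
  depends on the weight only through C, so the truncation is removed by exhausting the line.\<close>

lemma weight_bound:
  assumes E: "energy_le (Y 0) E" and M: "\<And>t. t \<in> {0..T} \<Longrightarrow> F_norm (Y t) \<le> M"
    and w: "weight \<Omega> C" and W: "integrable lborel (\<lambda>x. \<Omega> x * l_h (Y 0) x)" "(LINT x|lborel. \<Omega> x * l_h (Y 0) x) \<le> W"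
    and t: "t \<in> {0..T}"
  defines "\<alpha> \<equiv> 2 + 3 * U_bd E + 2 * (source_bd \<gamma> * exp (2 * M))\<^sup>2 * (C * E) * (2 * exp_mass + M\<^sup>2)"
  shows "integrable lborel (\<lambda>x. \<Omega> x * l_h (Y t) x)" "(LINT x|lborel. \<Omega> x * l_h (Y t) x) \<le> W * exp (\<alpha> * T)"
proof -
  have \<Omega>: "\<Omega> \<in> borel_measurable borel" "1 \<le> C" "\<And>x. 1 \<le> \<Omega> x" using w by (auto simp: weight_def)
  have \<Omega>0: "0 \<le> \<Omega> x" for x using \<Omega>(3)[of x] by linarith
  have t0: "0 \<le> t" "0 \<le> T" using t by auto
  interpret Yt: GG_elem "Y t" by (rule elem[OF t0(1)])
  interpret Y0: GG_elem "Y 0" by (rule elem) simp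
  have E0: "0 \<le> E" using E[unfolded energy_le_def, rule_format, of 0 0] by simp
  have a0: "0 \<le> U_bd E" using Linf_le_nonneg[OF Y0.U_Linf[OF E]] .
  have exp_mass: "0 \<le> exp_mass" by (rule kernelD(6)[OF kernel_exp_kernel])
  have \<alpha>: "0 \<le> \<alpha>" using a0 E0 \<Omega>(2) exp_mass by (simp add: \<alpha>_def)
  have "AE x in lborel. 0 \<le> \<Omega> x * l_h (Y 0) x" using Y0.AE_h \<Omega>0 by (auto elim!: eventually_mono)
  from integral_nonneg_AE[OF this] have W0: "0 \<le> W" using W(2) by linarith
  have main: "(LINT x|lborel. cut_weight \<Omega> K x * l_h (Y t) x) \<le> W * exp (\<alpha> * T)" if K: "0 \<le> K" for K
  proof -
    let ?V = "cut_weight \<Omega> K"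
    note V = cut_weight[OF w K]
    let ?l = "\<lambda>X. LINT x|lborel. ?V x * l_h X x"
    have hL: "L2_le (l_h X) (F_norm X)" if "X \<in> FF" for X using comps_le_of_F_norm[OF that order_refl] by (simp add: comps_le_def)
    note i = L2_le_mult_integrable[OF V(4) hL] and cs = L2_le_Cauchy_Schwarz[OF V(4) hL]
    have lpos: "0 \<le> ?l (Y s)" if "0 \<le> s" for s
      using GG_elem.AE_h[OF elem[OF that]] V(1) by (intro integral_nonneg_AE) (auto elim!: eventually_mono)
    have "\<bar>?l (Y t - 0 - t *\<^sub>R 0)\<bar> \<le> (\<bar>?l (Y 0 - 0 - 0 *\<^sub>R 0)\<bar> + 0 * (t - 0)) * exp (\<alpha> * (t - 0))"
    proof (rule seminorm_gronwall[where p = "\<lambda>X. \<bar>?l X\<bar>" and K = "\<bar>K\<bar> * sqrt exp_mass" and b = T])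
      fix X Z :: lag and c :: real assume X: "X \<in> FF"
      have "?l (c *\<^sub>R X) = c * ?l X" by (simp add: mult.left_commute)
      then show "\<bar>?l (c *\<^sub>R X)\<bar> \<le> \<bar>c\<bar> * \<bar>?l X\<bar>" by (simp add: abs_mult)
      show "\<bar>?l X\<bar> \<le> \<bar>K\<bar> * sqrt exp_mass * F_norm X"
        by (rule order_trans[OF integral_abs_bound cs[OF X]])
      assume Z: "Z \<in> FF"
      have "?l (X + Z) = ?l X + ?l Z" using i[OF X] i[OF Z] by (simp add: distrib_left)
      then show "\<bar>?l (X + Z)\<bar> \<le> \<bar>?l X\<bar> + \<bar>?l Z\<bar>" by simp
    next
      fix s assume s: "0 \<le> s" "s < T"
      then have sT: "s \<in> {0..T}" by simp
      interpret Ys: GG_elem "Y s" by (rule elem[OF s(1)])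
      have "\<bar>?l (G_rhs \<gamma> (Y s))\<bar> \<le> \<alpha> * ?l (Y s)"
        unfolding \<alpha>_def
        by (rule Ys.weighted_growth[OF energy_le[OF E s(1)] FF_rc_pointwise(1)[OF FF_rc[OF s(1)] M[OF sT]] M[OF sT] V(1,3) _ V(4)])
          (use \<Omega>(2) in simp)
      then show "\<bar>?l (G_rhs \<gamma> (Y s) - 0)\<bar> \<le> \<alpha> * \<bar>?l (Y s - 0 - s *\<^sub>R 0)\<bar> + 0"
        using lpos[OF s(1)] by simp
    qed (use FF_0 \<alpha> t in auto)
    then have "?l (Y t) \<le> ?l (Y 0) * exp (\<alpha> * t)"
      using lpos[OF t0(1)] lpos[of 0] by simp
    also have "\<dots> \<le> W * exp (\<alpha> * T)"
    proof (intro mult_mono)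
      have "?l (Y 0) \<le> (LINT x|lborel. \<Omega> x * l_h (Y 0) x)"
        using Y0.AE_h V(2) by (intro integral_mono_AE i[OF Y0.FF] W(1)) (auto elim!: eventually_mono intro: mult_right_mono)
      with W(2) show "?l (Y 0) \<le> W" by linarith
    qed (use \<alpha> t W0 in \<open>auto intro: mult_left_mono\<close>)
    finally show ?thesis .
  qed
  have *: "integrable lborel (\<lambda>x. indicator {- real n..real n} x * (\<Omega> x * l_h (Y t) x))"
    "(LINT x|lborel. indicator {- real n..real n} x * (\<Omega> x * l_h (Y t) x)) \<le> W * exp (\<alpha> * T)" for n :: nat
  proof -
    define K where "K = C * \<Omega> 0 * exp (2 * real n)"
    have K: "0 \<le> K" using \<Omega>(2) \<Omega>0[of 0] by (simp add: K_def)
    note V = cut_weight[OF w K]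
    have eq: "indicator {- real n..real n} x * (\<Omega> x * l_h (Y t) x) = indicator {- real n..real n} x * (cut_weight \<Omega> K x * l_h (Y t) x)" for x
      using V(5)[of x "real n"] by (auto simp: K_def indicator_def abs_le_iff)
    have hL: "L2_le (l_h (Y t)) (F_norm (Y t))" using comps_le_of_F_norm[OF Yt.FF order_refl] by (simp add: comps_le_def)
    have i: "integrable lborel (\<lambda>x. cut_weight \<Omega> K x * l_h (Y t) x)" by (rule L2_le_mult_integrable[OF V(4) hL])
    show i2: "integrable lborel (\<lambda>x. indicator {- real n..real n} x * (\<Omega> x * l_h (Y t) x))"
      unfolding eq using integrable_real_mult_indicator[OF _ i, of "{- real n..real n}"] by (simp add: mult.commute)
    have "(LINT x|lborel. indicator {- real n..real n} x * (\<Omega> x * l_h (Y t) x)) \<le> (LINT x|lborel. cut_weight \<Omega> K x * l_h (Y t) x)"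
      unfolding eq using i2[unfolded eq] Yt.AE_h V(1)
      by (intro integral_mono_AE i) (auto elim!: eventually_mono simp: indicator_def)
    also have "\<dots> \<le> W * exp (\<alpha> * T)" by (rule main[OF K])
    finally show "(LINT x|lborel. indicator {- real n..real n} x * (\<Omega> x * l_h (Y t) x)) \<le> W * exp (\<alpha> * T)" .
  qed
  have m: "(\<lambda>x. \<Omega> x * l_h (Y t) x) \<in> borel_measurable borel" using \<Omega>(1) Yt.meas(6) by measurable
  have n: "AE x in lborel. 0 \<le> \<Omega> x * l_h (Y t) x" using Yt.AE_h \<Omega>0 by (auto elim!: eventually_mono)
  show "integrable lborel (\<lambda>x. \<Omega> x * l_h (Y t) x)" "(LINT x|lborel. \<Omega> x * l_h (Y t) x) \<le> W * exp (\<alpha> * T)"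
    using integrable_of_intervals[OF m n *] by auto
qed

end

text \<open>\<theta> R is the size of P and Q outside [-R, R), where the scheme replaces them by 0.
  The constant c is fixed before h and R, so it depends only on the energy E and the weighted energy
  W.\<close>

definition tail_rate :: "(real \<Rightarrow> real) \<Rightarrow> (real \<Rightarrow> real) \<Rightarrow> bool" where
  "tail_rate \<Omega> \<theta> \<longleftrightarrow> (\<forall>E W. \<exists>c\<ge>0. \<forall>h R. integrable lborel h \<longrightarrow> (AE x in lborel. 0 \<le> h x) \<longrightarrow>
     (LINT x|lborel. h x) \<le> E \<longrightarrow> integrable lborel (\<lambda>x. \<Omega> x * h x) \<longrightarrow> (LINT x|lborel. \<Omega> x * h x) \<le> W \<longrightarrow> 0 < R \<longrightarrow>
     L2_Linf_le (\<lambda>x. indicator (- {- R..<R}) x * conv exp_kernel h x) (c * \<theta> R))"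

section \<open>The exponential and the algebraic weight\<close>

lemma weight_exp: "weight (\<lambda>x. (exp_weight x)\<^sup>2) 1"
proof -
  have sq: "(exp_weight x)\<^sup>2 = exp \<bar>x\<bar>" for x
    by (simp add: exp_weight_def power2_eq_square exp_add[symmetric])
  show ?thesis unfolding weight_def sq exp_add[symmetric] mult_1
    by (auto simp: exp_add[symmetric])
qed

lemma weight_pow:
  assumes \<alpha>: "\<alpha> > 1" shows "\<exists>C. weight (\<lambda>x. (pow_weight \<alpha> x)\<^sup>2) C"
proof -
  have sq: "(pow_weight \<alpha> x)\<^sup>2 = (1 + \<bar>x\<bar>) powr \<alpha>" for x
    by (simp add: pow_weight_def power2_eq_square powr_add[symmetric])
  \<comment> \<open>(1 + d)^\<alpha> e^{-d} is largest at 1 + d = \<alpha>, with value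
    \<alpha>^\<alpha> e^{1-\<alpha>}. The comparison for the weight then follows from 1 + |x| <= (1
    + |y|)(1 + |x - y|).\<close>
  define C where "C = max 1 (exp (1 - \<alpha> + \<alpha> * ln \<alpha>))"
  have C: "1 \<le> C" "exp (1 - \<alpha> + \<alpha> * ln \<alpha>) \<le> C" by (auto simp: C_def)
  have d: "(1 + d) powr \<alpha> \<le> C * exp d" if "0 \<le> d" for d
  proof -
    have "ln ((1 + d) / \<alpha>) \<le> (1 + d) / \<alpha> - 1" using that \<alpha> by (intro ln_le_minus_one) auto
    then have "\<alpha> * (ln (1 + d) - ln \<alpha>) \<le> \<alpha> * ((1 + d) / \<alpha> - 1)"
      using that \<alpha> by (intro mult_left_mono) (auto simp: ln_div)
    also have "\<alpha> * ((1 + d) / \<alpha> - 1) = 1 + d - \<alpha>" using \<alpha> by (simp add: field_simps)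
    finally have "\<alpha> * ln (1 + d) \<le> (1 - \<alpha> + \<alpha> * ln \<alpha>) + d" by (simp add: right_diff_distrib)
    then have "(1 + d) powr \<alpha> \<le> exp (1 - \<alpha> + \<alpha> * ln \<alpha>) * exp d"
      using that by (simp add: powr_def exp_add[symmetric])
    also have "\<dots> \<le> C * exp d" using C by (intro mult_right_mono) auto
    finally show ?thesis .
  qed
  have "(1 + \<bar>x\<bar>) powr \<alpha> \<le> C * (1 + \<bar>y\<bar>) powr \<alpha> * exp \<bar>x - y\<bar>" for x y
  proof -
    have "0 \<le> \<bar>y\<bar> * \<bar>x - y\<bar>" by simp
    moreover have "(1 + \<bar>y\<bar>) * (1 + \<bar>x - y\<bar>) = 1 + \<bar>y\<bar> + \<bar>x - y\<bar> + \<bar>y\<bar> * \<bar>x - y\<bar>"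
      by (simp add: distrib_left distrib_right)
    moreover have "\<bar>x\<bar> \<le> \<bar>y\<bar> + \<bar>x - y\<bar>" by linarith
    ultimately have "1 + \<bar>x\<bar> \<le> (1 + \<bar>y\<bar>) * (1 + \<bar>x - y\<bar>)" by linarith
    then have "(1 + \<bar>x\<bar>) powr \<alpha> \<le> ((1 + \<bar>y\<bar>) * (1 + \<bar>x - y\<bar>)) powr \<alpha>" using \<alpha> by (intro powr_mono2) auto
    also have "\<dots> = (1 + \<bar>y\<bar>) powr \<alpha> * (1 + \<bar>x - y\<bar>) powr \<alpha>" by (rule powr_mult)
    also have "\<dots> \<le> (1 + \<bar>y\<bar>) powr \<alpha> * (C * exp \<bar>x - y\<bar>)" by (intro mult_left_mono d) auto
    finally show ?thesis by (simp add: mult_ac)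
  qed
  moreover have "1 \<le> (1 + \<bar>x\<bar>) powr \<alpha>" for x using \<alpha> by (intro ge_one_powr_ge_zero) auto
  ultimately have "weight (\<lambda>x. (pow_weight \<alpha> x)\<^sup>2) C" unfolding weight_def sq using C by auto
  then show ?thesis ..
qed

text \<open>From e^{-|x-\<eta>|} <= e^{-|x|} e^{|\<eta>|} the convolution is at most W e^{-|x|}.
  Beyond R this is at most W e^{-R}, and \<integral>e^{-2|x|} over the tail equals e^{-2R}, so the
  L^2 norm has the same rate.\<close>

lemma tail_rate_exp: "tail_rate (\<lambda>x. (exp_weight x)\<^sup>2) (\<lambda>R. exp (- R))"
  unfolding tail_rate_def
proof (intro allI)
  fix E W :: real
  have sq: "(exp_weight x)\<^sup>2 = exp \<bar>x\<bar>" for x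
    by (simp add: exp_weight_def power2_eq_square exp_add[symmetric])
  show "\<exists>c\<ge>0. \<forall>h R. integrable lborel h \<longrightarrow> (AE x in lborel. 0 \<le> h x) \<longrightarrow>
     (LINT x|lborel. h x) \<le> E \<longrightarrow> integrable lborel (\<lambda>x. (exp_weight x)\<^sup>2 * h x) \<longrightarrow> (LINT x|lborel. (exp_weight x)\<^sup>2 * h x) \<le> W \<longrightarrow> 0 < R \<longrightarrow>
     L2_Linf_le (\<lambda>x. indicator (- {- R..<R}) x * conv exp_kernel h x) (c * exp (- R))"
    unfolding sq
  proof (intro exI[of _ "\<bar>W\<bar>"] conjI allI impI)
    fix h :: "real \<Rightarrow> real" and R :: real
    assume h: "integrable lborel h" "AE x in lborel. 0 \<le> h x" and \<Omega>h: "integrable lborel (\<lambda>x. exp \<bar>x\<bar> * h x)" "(LINT x|lborel. exp \<bar>x\<bar> * h x) \<le> W" and R: "0 < R"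
    let ?J = "conv exp_kernel h" and ?I = "indicator ({..- R} \<union> {R..}) :: real \<Rightarrow> real"
    have J0: "0 \<le> ?J x" for x by (rule conv_nonneg_AE[OF kernel_exp_kernel h(2)])
    have m: "(\<lambda>x. indicator (- {- R..<R}) x * ?J x) \<in> borel_measurable borel"
      using conv_L1(1)[OF kernel_exp_kernel h(1)] by measurable
    have J: "?J x \<le> exp (- \<bar>x\<bar>) * \<bar>W\<bar>" for x
    proof -
      have "?J x \<le> (LINT \<eta>|lborel. exp (- \<bar>x\<bar>) * (exp \<bar>\<eta>\<bar> * h \<eta>))"
        unfolding conv_def
      proof (rule integral_mono_AE[OF conv_integrable_L1[OF kernel_exp_kernel h(1)]])
        show "integrable lborel (\<lambda>\<eta>. exp (- \<bar>x\<bar>) * (exp \<bar>\<eta>\<bar> * h \<eta>))" using \<Omega>h by simp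
        show "AE \<eta> in lborel. exp_kernel (x - \<eta>) * h \<eta> \<le> exp (- \<bar>x\<bar>) * (exp \<bar>\<eta>\<bar> * h \<eta>)"
          using h(2)
        proof eventually_elim
          case (elim \<eta>)
          have "exp_kernel (x - \<eta>) \<le> exp (- \<bar>x\<bar>) * exp \<bar>\<eta>\<bar>" unfolding exp_kernel_def exp_add[symmetric] by simp
          from mult_right_mono[OF this elim] show ?case by (simp add: mult.assoc)
        qed
      qed
      also have "\<dots> \<le> exp (- \<bar>x\<bar>) * \<bar>W\<bar>" using \<Omega>h by (simp add: abs_if)
      finally show ?thesis .
    qed
    have "L2_le (\<lambda>x. \<bar>W\<bar> * (exp (- \<bar>x\<bar>) * ?I x)) (\<bar>\<bar>W\<bar>\<bar> * exp (- R))"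
    proof (rule L2_le_cmult)
      have sqe: "(exp (- \<bar>x\<bar>) * ?I x)\<^sup>2 = exp (- (2 * \<bar>x\<bar>)) * ?I x" for x
        by (simp add: power2_eq_square indicator_def exp_add[symmetric])
      have "2 * exp (- (2 * R)) / 2 = (exp (- R))\<^sup>2" by (simp add: power2_eq_square exp_add[symmetric])
      then show "L2_le (\<lambda>x. exp (- \<bar>x\<bar>) * ?I x) (exp (- R))"
        unfolding L2_le_iff sqe using exp_abs_tail[of 2 R] R by simp
    qed
    then have "L2_le (\<lambda>x. indicator (- {- R..<R}) x * ?J x) (\<bar>\<bar>W\<bar>\<bar> * exp (- R))"
    proof (rule L2_le_mono[OF _ m], intro AE_I2)
      fix x
      show "\<bar>indicator (- {- R..<R}) x * ?J x\<bar> \<le> \<bar>\<bar>W\<bar> * (exp (- \<bar>x\<bar>) * ?I x)\<bar>"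
        using J[of x] J0[of x] by (auto simp: indicator_def abs_mult mult.commute)
    qed
    moreover have "Linf_le (\<lambda>x. indicator (- {- R..<R}) x * ?J x) (\<bar>W\<bar> * exp (- R))"
    proof (rule Linf_leI[OF m])
      fix x
      show "\<bar>indicator (- {- R..<R}) x * ?J x\<bar> \<le> \<bar>W\<bar> * exp (- R)"
      proof (cases "x \<in> {- R..<R}")
        case False
        then have "exp (- \<bar>x\<bar>) * \<bar>W\<bar> \<le> exp (- R) * \<bar>W\<bar>" using R by (intro mult_right_mono) auto
        then show ?thesis using False J[of x] J0[of x] by (simp add: mult.commute)
      qed simp
    qed
    ultimately show "L2_Linf_le (\<lambda>x. indicator (- {- R..<R}) x * ?J x) (\<bar>W\<bar> * exp (- R))" by (simp add: L2_Linf_le_def)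
  qed simp
qed

text \<open>Here the weighted Cauchy--Schwarz inequality is used: \<Omega> J^2 <= C E JV with JV
  both bounded and integrable. Since \<Omega> >= R^\<alpha> on the tail, J^2 is O(R^{-\<alpha>})
  there, uniformly and in the mean; the square root gives the exponent \<alpha>/2.\<close>

lemma tail_rate_pow:
  assumes \<alpha>: "\<alpha> > 1"
  shows "tail_rate (\<lambda>x. (pow_weight \<alpha> x)\<^sup>2) (\<lambda>R. 1 / R powr (\<alpha> / 2))"
  unfolding tail_rate_def
proof (intro allI)
  fix E W :: real
  let ?\<Omega> = "\<lambda>x. (pow_weight \<alpha> x)\<^sup>2"
  have sq: "?\<Omega> x = (1 + \<bar>x\<bar>) powr \<alpha>" for x
    by (simp add: pow_weight_def power2_eq_square powr_add[symmetric])
  obtain C where w: "weight ?\<Omega> C" using weight_pow[OF \<alpha>] by blast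
  have exp_mass: "0 \<le> exp_mass" by (rule kernelD(6)[OF kernel_exp_kernel])
  let ?c = "sqrt \<bar>C * E * (exp_mass * W)\<bar> + sqrt \<bar>C * E * W\<bar>"
  show "\<exists>c\<ge>0. \<forall>h R. integrable lborel h \<longrightarrow> (AE x in lborel. 0 \<le> h x) \<longrightarrow>
     (LINT x|lborel. h x) \<le> E \<longrightarrow> integrable lborel (\<lambda>x. ?\<Omega> x * h x) \<longrightarrow> (LINT x|lborel. ?\<Omega> x * h x) \<le> W \<longrightarrow> 0 < R \<longrightarrow>
     L2_Linf_le (\<lambda>x. indicator (- {- R..<R}) x * conv exp_kernel h x) (c * (1 / R powr (\<alpha> / 2)))"
  proof (intro exI[of _ ?c] conjI allI impI)
    fix h :: "real \<Rightarrow> real" and R :: real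
    assume h: "integrable lborel h" "AE x in lborel. 0 \<le> h x" "(LINT x|lborel. h x) \<le> E"
      and \<Omega>h: "integrable lborel (\<lambda>x. ?\<Omega> x * h x)" "(LINT x|lborel. ?\<Omega> x * h x) \<le> W" and R: "0 < R"
    define J where "J = conv exp_kernel h"
    define JV where "JV = conv exp_kernel (\<lambda>x. ?\<Omega> x * h x)"
    have J0: "0 \<le> J x" for x unfolding J_def by (rule conv_nonneg_AE[OF kernel_exp_kernel h(2)])
    have \<Omega>h0: "AE x in lborel. 0 \<le> ?\<Omega> x * h x" using h(2) by (auto elim!: eventually_mono)
    have JV0: "0 \<le> JV x" for x unfolding JV_def by (rule conv_nonneg_AE[OF kernel_exp_kernel \<Omega>h0])
    have abs_eq: "(LINT x|lborel. \<bar>?\<Omega> x * h x\<bar>) = (LINT x|lborel. ?\<Omega> x * h x)"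
      using \<Omega>h(1) \<Omega>h0 by (intro integral_cong_AE) (auto elim!: eventually_mono)
    have JVW: "JV x \<le> W" for x
      using conv_bound_L1[OF kernel_exp_kernel \<Omega>h(1), of x] abs_eq \<Omega>h(2) by (simp add: JV_def)
    have W0: "0 \<le> W" using JV0 JVW order_trans by blast
    have E0: "0 \<le> E" using h(3) integral_nonneg_AE[OF h(2)] by linarith
    have C1: "1 \<le> C" using w by (simp add: weight_def)
    note JVi = conv_L1[OF kernel_exp_kernel \<Omega>h(1), folded JV_def]
    have m: "(\<lambda>x. indicator (- {- R..<R}) x * J x) \<in> borel_measurable borel"
      unfolding J_def using conv_L1(1)[OF kernel_exp_kernel h(1)] by measurable
    define r where "r = R powr \<alpha>"
    have r: "0 < r" using R by (simp add: r_def)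
    have key: "(indicator (- {- R..<R}) x * J x)\<^sup>2 \<le> C * E * JV x / r" for x
    proof (cases "x \<in> {- R..<R}")
      case False
      then have "R \<le> 1 + \<bar>x\<bar>" by auto
      then have "r \<le> ?\<Omega> x" unfolding sq r_def using R \<alpha> by (intro powr_mono2) auto
      then have "r * (J x)\<^sup>2 \<le> ?\<Omega> x * (J x)\<^sup>2" by (intro mult_right_mono) auto
      also have "\<dots> \<le> C * E * JV x"
        unfolding J_def JV_def using w by (intro weighted_conv_exp_kernel[OF h]) (auto simp: weight_def \<Omega>h(1))
      finally show ?thesis using False r by (simp add: pos_le_divide_eq mult.commute)
    qed (use C1 E0 JV0 r in auto)
    have sqr: "sqrt r = R powr (\<alpha> / 2)" using R by (simp add: r_def powr_half_sqrt[symmetric] powr_powr)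
    have i: "integrable lborel (\<lambda>x. C * E * JV x / r)" using JVi(1) by simp
    have i2: "integrable lborel (\<lambda>x. (indicator (- {- R..<R}) x * J x)\<^sup>2)"
    proof (rule Bochner_Integration.integrable_bound[OF i])
      show "(\<lambda>x. (indicator (- {- R..<R}) x * J x)\<^sup>2) \<in> borel_measurable lborel" using m by measurable
      show "AE x in lborel. norm ((indicator (- {- R..<R}) x * J x)\<^sup>2) \<le> norm (C * E * JV x / r)"
      proof (rule AE_I2)
        fix x show "norm ((indicator (- {- R..<R}) x * J x)\<^sup>2) \<le> norm (C * E * JV x / r)"
          using order_trans[OF key[of x] abs_ge_self] by simp
      qed
    qed
    have "(LINT x|lborel. (indicator (- {- R..<R}) x * J x)\<^sup>2) \<le> (LINT x|lborel. C * E * JV x / r)"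
      by (intro integral_mono i2 i key)
    also have "\<dots> = C * E * (exp_mass * (LINT x|lborel. ?\<Omega> x * h x)) / r" using JVi(2) by simp
    also have "\<dots> \<le> C * E * (exp_mass * W) / r"
      using \<Omega>h(2) exp_mass C1 E0 r by (intro divide_right_mono mult_left_mono) auto
    also have "\<dots> = (sqrt \<bar>C * E * (exp_mass * W)\<bar> * (1 / R powr (\<alpha> / 2)))\<^sup>2"
      unfolding sqr[symmetric] using C1 E0 exp_mass W0 r by (simp add: power_mult_distrib power_divide)
    finally have "L2_le (\<lambda>x. indicator (- {- R..<R}) x * J x) (sqrt \<bar>C * E * (exp_mass * W)\<bar> * (1 / R powr (\<alpha> / 2)))"
      using m i2 by (simp add: L2_le_iff)
    moreover have "Linf_le (\<lambda>x. indicator (- {- R..<R}) x * J x) (sqrt \<bar>C * E * W\<bar> * (1 / R powr (\<alpha> / 2)))"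
    proof (rule Linf_leI[OF m])
      fix x
      have "(indicator (- {- R..<R}) x * J x)\<^sup>2 \<le> C * E * W / r"
        using key[of x] mult_left_mono[OF JVW[of x], of "C * E"] C1 E0 r
        by (elim order_trans) (intro divide_right_mono, auto)
      also have "\<dots> = (sqrt \<bar>C * E * W\<bar> * (1 / R powr (\<alpha> / 2)))\<^sup>2"
        unfolding sqr[symmetric] using C1 E0 W0 r by (simp add: power_mult_distrib power_divide)
      finally have "\<bar>indicator (- {- R..<R}) x * J x\<bar> \<le> \<bar>sqrt \<bar>C * E * W\<bar> * (1 / R powr (\<alpha> / 2))\<bar>"
        by (simp only: abs_le_square_iff)
      then show "\<bar>indicator (- {- R..<R}) x * J x\<bar> \<le> sqrt \<bar>C * E * W\<bar> * (1 / R powr (\<alpha> / 2))" by simp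
    qed
    ultimately show "L2_Linf_le (\<lambda>x. indicator (- {- R..<R}) x * conv exp_kernel h x) (?c * (1 / R powr (\<alpha> / 2)))"
      unfolding J_def L2_Linf_le_def distrib_right
      by (intro conjI; elim L2_le_weaken Linf_le_weaken) auto
  qed simp
qed

section \<open>Initial data\<close>

text \<open>On [-n, n] the measures with densities the positive and the negative part of g are
  finite and agree on all half-lines, hence coincide; uniqueness of densities makes both parts
  equal, and so 0. This turns identities between integrated quantities into identities between the
  derivatives.\<close>

lemma has_wderiv_zero_AE:
  assumes g: "has_wderiv (\<lambda>x. 0) g" and m[measurable]: "g \<in> borel_measurable borel"
  shows "AE x in lborel. g x = 0"
proof -
  have "AE x in lborel. indicator {- real n..real n} x * g x = 0" for n :: nat
  proof -
    let ?g = "\<lambda>x. indicator {- real n..real n} x * g x"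
    let ?p = "\<lambda>x. ennreal (?g x)" and ?m = "\<lambda>x. ennreal (- ?g x)"
    have gi: "integrable lborel ?g" by (rule has_wderivD(1)[OF g]) simp
    have eq: "emeasure (density lborel ?p) {x<..} = emeasure (density lborel ?m) {x<..}"
      and fin: "emeasure (density lborel ?p) {x<..} < \<infinity>" for x
    proof -
      let ?h = "\<lambda>y. ?g y * indicator {x<..} y"
      have hi: "integrable lborel ?h"
        using integrable_real_mult_indicator[OF _ gi, of "{x<..}"] by simp
      have int0: "(LINT y|lborel. ?h y) = 0"
      proof (cases "max x (- real n) \<le> real n")
        case True
        have "(LINT y|lborel. ?h y) = (LINT y|lborel. indicator {max x (- real n)..real n} y * g y)"
        proof (rule integral_cong_AE)
          show "AE y in lborel. ?h y = indicator {max x (- real n)..real n} y * g y"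
            using AE_lborel_singleton[of x] by eventually_elim (auto simp: indicator_def)
        qed measurable
        also have "\<dots> = 0" using has_wderivD(2)[OF g True] by simp
        finally show ?thesis .
      next
        case False
        then have z: "?h y = 0" for y by (auto simp: indicator_def)
        show ?thesis unfolding z by simp
      qed
      have P: "emeasure (density lborel ?p) {x<..} = (\<integral>\<^sup>+y. ennreal (?h y) \<partial>lborel)"
        by (subst emeasure_density) (auto intro!: nn_integral_cong split: split_indicator)
      have M: "emeasure (density lborel ?m) {x<..} = (\<integral>\<^sup>+y. ennreal (- ?h y) \<partial>lborel)"
        by (subst emeasure_density) (auto intro!: nn_integral_cong split: split_indicator)
      have f: "(\<integral>\<^sup>+y. ennreal (?h y) \<partial>lborel) < \<infinity>" "(\<integral>\<^sup>+y. ennreal (- ?h y) \<partial>lborel) < \<infinity>"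
        using hi by (auto simp: real_integrable_def less_top)
      show "emeasure (density lborel ?p) {x<..} < \<infinity>" unfolding P by (rule f)
      have eq: "enn2real (\<integral>\<^sup>+y. ennreal (?h y) \<partial>lborel) = enn2real (\<integral>\<^sup>+y. ennreal (- ?h y) \<partial>lborel)"
        using int0 real_lebesgue_integral_def[OF hi] by simp
      show "emeasure (density lborel ?p) {x<..} = emeasure (density lborel ?m) {x<..}"
        unfolding P M
        using arg_cong[OF eq, of ennreal, unfolded ennreal_enn2real[OF f(1)[unfolded infinity_ennreal_def]]
            ennreal_enn2real[OF f(2)[unfolded infinity_ennreal_def]]] .
    qed
    have "density lborel ?p = density lborel ?m"
      by (rule measure_eqI_lessThan[OF _ _ fin eq]) auto
    then have "AE x in lborel. ?p x = ?m x"
      by (subst (asm) sigma_finite_measure.density_unique_iff[OF sigma_finite_lborel]) auto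
    then show ?thesis
    proof eventually_elim
      case (elim x)
      then show ?case by (cases "0 \<le> ?g x") (auto simp: ennreal_neg ennreal_eq_0_iff dest: sym)
    qed
  qed
  then have "AE x in lborel. \<forall>n::nat. indicator {- real n..real n} x * g x = 0" unfolding AE_all_countable by blast
  then show ?thesis
  proof eventually_elim
    case (elim x)
    obtain n :: nat where "\<bar>x\<bar> \<le> real n" using real_arch_simple by blast
    then show ?case using elim[rule_format, of n] by (auto simp: indicator_def abs_le_iff)
  qed
qed

lemma has_wderiv_ident: "has_wderiv (\<lambda>x. x) (\<lambda>x. 1)"
  by (rule has_wderivI) auto

locale initial =
  fixes \<omega> :: "real \<Rightarrow> real" and C :: real and u\<^sub>0 :: "real \<Rightarrow> real" and Y :: lag
  assumes w: "weight (\<lambda>x. (\<omega> x)\<^sup>2) C" and \<omega>m: "\<omega> \<in> borel_measurable borel"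
    and u0: "u\<^sub>0 \<in> H1w \<omega>" and lag: "lagrangian_of u\<^sub>0 Y" and GG: "Y \<in> GG"
begin

sublocale GG_elem by standard (rule GG)

definition "\<Omega> x = (\<omega> x)\<^sup>2"
definition "\<rho> x = (u\<^sub>0 x)\<^sup>2 + (wderiv u\<^sub>0 x)\<^sup>2"
definition "\<nu> = H1w_norm \<omega> u\<^sub>0"

lemma \<Omega>: "\<Omega> \<in> borel_measurable borel" "1 \<le> C" "1 \<le> \<Omega> x" "\<Omega> x \<le> C * \<Omega> y * exp \<bar>x - y\<bar>" "0 \<le> \<Omega> x"
proof -
  have W: "weight \<Omega> C" using w unfolding \<Omega>_def[abs_def] .
  then show "\<Omega> \<in> borel_measurable borel" "1 \<le> C" "1 \<le> \<Omega> x" "\<Omega> x \<le> C * \<Omega> y * exp \<bar>x - y\<bar>"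
    unfolding weight_def by blast+
  then show "0 \<le> \<Omega> x" by linarith
qed

lemma \<rho>0: "0 \<le> \<rho> x" by (simp add: \<rho>_def)

lemma \<rho>: "integrable lborel \<rho>" "integrable lborel (\<lambda>x. \<Omega> x * \<rho> x)"
  "(LINT x|lborel. \<Omega> x * \<rho> x) = \<nu>\<^sup>2" "(LINT x|lborel. \<rho> x) \<le> \<nu>\<^sup>2"
proof -
  have i: "integrable lborel (\<lambda>x. (u\<^sub>0 x)\<^sup>2)" "integrable lborel (\<lambda>x. (wderiv u\<^sub>0 x)\<^sup>2)"
    "integrable lborel (\<lambda>x. (\<omega> x * u\<^sub>0 x)\<^sup>2)" "integrable lborel (\<lambda>x. (\<omega> x * wderiv u\<^sub>0 x)\<^sup>2)"
    using u0 by (auto simp: H1w_def H1_def L2_def)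
  show r: "integrable lborel \<rho>" unfolding \<rho>_def[abs_def] using i by simp
  have eq: "\<Omega> x * \<rho> x = (\<omega> x * u\<^sub>0 x)\<^sup>2 + (\<omega> x * wderiv u\<^sub>0 x)\<^sup>2" for x
    by (simp add: \<Omega>_def \<rho>_def power_mult_distrib distrib_left)
  show Wr: "integrable lborel (\<lambda>x. \<Omega> x * \<rho> x)" unfolding eq using i by simp
  show nu: "(LINT x|lborel. \<Omega> x * \<rho> x) = \<nu>\<^sup>2"
    unfolding eq \<nu>_def H1w_norm_def L2_norm_power2 using i by (simp add: integral_nonneg_AE)
  have "(LINT x|lborel. \<rho> x) \<le> (LINT x|lborel. \<Omega> x * \<rho> x)"
    using mult_right_mono[OF \<Omega>(3) \<rho>0] by (intro integral_mono r Wr) simp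
  then show "(LINT x|lborel. \<rho> x) \<le> \<nu>\<^sup>2" using nu by simp
qed

lemma i\<rho>: "integrable lborel (\<lambda>x. indicator A x * \<rho> x)" "integrable lborel (\<lambda>x. indicator A x * (\<Omega> x * \<rho> x))"
  if "A \<in> sets borel" for A
  using integrable_real_mult_indicator[OF _ \<rho>(1), of A] integrable_real_mult_indicator[OF _ \<rho>(2), of A] that
  by (simp_all add: mult.commute)

lemma H_eq: "l_H Y \<xi> = (LINT x|lborel. indicator {..l_y Y \<xi>} x * \<rho> x)"
  and y_eq: "l_y Y \<xi> = \<xi> - l_H Y \<xi>"
proof -
  have "l_y Y \<xi> + (LINT x|lborel. indicator {..l_y Y \<xi>} x * \<rho> x) = \<xi>" "l_H Y \<xi> = \<xi> - l_y Y \<xi>"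
    using lag unfolding lagrangian_of_def set_lebesgue_integral_def \<rho>_def real_scaleR_def by blast+
  then show "l_H Y \<xi> = (LINT x|lborel. indicator {..l_y Y \<xi>} x * \<rho> x)" "l_y Y \<xi> = \<xi> - l_H Y \<xi>" by linarith+
qed

lemma H_bounds: "0 \<le> l_H Y \<xi>" "l_H Y \<xi> \<le> \<nu>\<^sup>2"
proof -
  show "0 \<le> l_H Y \<xi>" unfolding H_eq using \<rho>0 by (intro integral_nonneg_AE) auto
  have "l_H Y \<xi> \<le> (LINT x|lborel. \<rho> x)"
    unfolding H_eq using \<rho>0 by (intro integral_mono i\<rho> \<rho>(1)) (auto simp: indicator_def)
  with \<rho>(4) show "l_H Y \<xi> \<le> \<nu>\<^sup>2" by linarith
qed

lemma energy: "energy_le Y (\<nu>\<^sup>2)"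
  unfolding energy_le_def
proof (intro allI impI)
  fix a b :: real
  show "l_H Y b - l_H Y a \<le> \<nu>\<^sup>2" using H_bounds(2)[of b] H_bounds(1)[of a] by linarith
qed

text \<open>The Lagrangian parametrisation is normalised by y + H = id; differentiating gives the
  claim. With q, h >= 0 it bounds both by 1.\<close>

lemma qh: "AE x in lborel. l_q Y x + l_h Y x = 1"
proof -
  have "has_wderiv (\<lambda>x. 1 * (1 * l_y Y x + 1 * l_H Y x) + (- 1) * x) (\<lambda>x. 1 * (1 * l_q Y x + 1 * l_h Y x) + (- 1) * 1)"
    by (intro has_wderiv_lincomb dy dH has_wderiv_ident)
  moreover have "(\<lambda>x. 1 * (1 * l_y Y x + 1 * l_H Y x) + (- 1) * x) = (\<lambda>x. 0)" using y_eq by (simp add: fun_eq_iff)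
  ultimately have "AE x in lborel. 1 * (1 * l_q Y x + 1 * l_h Y x) + (- 1) * 1 = 0"
    using meas(6) q_meas by (intro has_wderiv_zero_AE) auto
  then show ?thesis by eventually_elim simp
qed

lemma L2_le_of_h:
  assumes "f \<in> borel_measurable borel" "AE x in lborel. (f x)\<^sup>2 \<le> c * l_h Y x" "0 \<le> c"
  shows "L2_le f (sqrt (c * \<nu>\<^sup>2))"
proof -
  note hi = h_integrable[OF energy]
  have ci: "integrable lborel (\<lambda>x. c * l_h Y x)" using hi by simp
  have i: "integrable lborel (\<lambda>x. (f x)\<^sup>2)"
  proof (rule Bochner_Integration.integrable_bound[OF ci])
    show "(\<lambda>x. (f x)\<^sup>2) \<in> borel_measurable lborel" using assms(1) by measurable
    show "AE x in lborel. norm ((f x)\<^sup>2) \<le> norm (c * l_h Y x)"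
      using assms(2) by eventually_elim (auto intro: order_trans[OF _ abs_ge_self])
  qed
  have "(LINT x|lborel. (f x)\<^sup>2) \<le> (LINT x|lborel. c * l_h Y x)" by (rule integral_mono_AE[OF i ci assms(2)])
  also have "\<dots> \<le> c * \<nu>\<^sup>2" using hi assms(3) by (auto intro: mult_left_mono)
  finally show ?thesis using i assms(1,3) by (simp add: L2_le_iff)
qed

text \<open>Everything reduces to \<integral>h <= \<nu>^2. The normalisation gives zeta = -H and v =
  -h, and 0 <= q, h <= 1 gives h^2 <= h and w^2 <= qh <= h. For U, which has no factor q to help,
  U^2 = U^2 q + U^2 h <= (1 + a^2) h with a = \<open>U_bd\<close> of \<nu>^2.\<close>

lemma F_bound: "F_norm Y \<le> 7 * (\<nu>\<^sup>2 + U_bd (\<nu>\<^sup>2) + sqrt ((1 + (U_bd (\<nu>\<^sup>2))\<^sup>2) * \<nu>\<^sup>2))"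
proof -
  let ?a = "U_bd (\<nu>\<^sup>2)"
  let ?s = "sqrt ((1 + ?a\<^sup>2) * \<nu>\<^sup>2)"
  let ?B = "\<nu>\<^sup>2 + ?a + ?s"
  have Ul: "Linf_le (l_U Y) ?a" by (rule U_Linf[OF energy])
  have a: "0 \<le> ?a" by (rule Linf_le_nonneg[OF Ul])
  have s: "0 \<le> ?s" by simp
  have U: "\<bar>l_U Y x\<bar> \<le> ?a" for x unfolding U_bd_def by (rule U_bound[OF energy])
  have U2: "(l_U Y x)\<^sup>2 \<le> ?a\<^sup>2" for x using power_mono[OF U[of x], of 2] by simp
  have AE_all: "AE x in lborel. (l_U Y x)\<^sup>2 \<le> (1 + ?a\<^sup>2) * l_h Y x \<and> (l_v Y x)\<^sup>2 \<le> (1 + ?a\<^sup>2) * l_h Y x \<and>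
      (l_w Y x)\<^sup>2 \<le> (1 + ?a\<^sup>2) * l_h Y x \<and> (l_h Y x)\<^sup>2 \<le> (1 + ?a\<^sup>2) * l_h Y x"
    using AE_cons qh
  proof eventually_elim
    case (elim x)
    then have q: "0 \<le> l_q Y x" "0 \<le> l_h Y x" "l_h Y x \<le> 1" "l_q Y x \<le> 1" "(l_U Y x)\<^sup>2 * l_q Y x \<le> l_h Y x"
      "(l_w Y x)\<^sup>2 \<le> l_q Y x * l_h Y x" by auto
    have le: "l_h Y x \<le> (1 + ?a\<^sup>2) * l_h Y x" using q mult_right_mono[of 1 "1 + ?a\<^sup>2" "l_h Y x"] by simp
    have "(l_U Y x)\<^sup>2 = (l_U Y x)\<^sup>2 * l_q Y x + (l_U Y x)\<^sup>2 * l_h Y x"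
      using elim by (simp add: distrib_left[symmetric])
    also have "\<dots> \<le> l_h Y x + ?a\<^sup>2 * l_h Y x" using q U2 by (intro add_mono mult_right_mono) auto
    finally have 1: "(l_U Y x)\<^sup>2 \<le> (1 + ?a\<^sup>2) * l_h Y x" by (simp add: distrib_right)
    have h2: "(l_h Y x)\<^sup>2 \<le> l_h Y x" using q by (simp add: power2_eq_square mult_left_le)
    have "l_v Y x = - l_h Y x" using elim by (simp add: l_q_def)
    then have "(l_v Y x)\<^sup>2 = (l_h Y x)\<^sup>2" by simp
    moreover have "l_q Y x * l_h Y x \<le> l_h Y x" using q by (simp add: mult_left_le_one_le)
    ultimately show ?case using 1 h2 le q by linarith
  qed
  have L: "L2_le (l_U Y) ?s" "L2_le (l_v Y) ?s" "L2_le (l_w Y) ?s" "L2_le (l_h Y) ?s"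
    by (rule L2_le_of_h; use meas AE_all in \<open>auto elim!: eventually_mono\<close>)+
  have z: "l_zeta Y x = - l_H Y x" for x using y_eq[of x] by (simp add: l_y_def)
  have Hb: "\<bar>l_H Y x\<bar> \<le> ?B" for x using H_bounds[of x] a s by linarith
  have "comps_le Y ?B"
    unfolding comps_le_def L2_Linf_le_def
  proof (intro conjI)
    show "Linf_le (l_zeta Y) ?B" by (intro Linf_leI meas) (simp only: z abs_minus_cancel Hb)
    show "Linf_le (l_H Y) ?B" by (intro Linf_leI meas Hb)
    show "Linf_le (l_U Y) ?B" using Ul a s by (elim Linf_le_weaken) auto
  qed (use L a in \<open>auto elim!: L2_le_weaken\<close>)
  from comps_le_imp(2)[OF this] show ?thesis .
qed

section \<open>Transfer of the weighted energy to Lagrangian coordinates\<close>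

definition "m\<Omega> x = (LINT z|lborel. indicator {..x} z * (\<Omega> z * \<rho> z))"

text \<open>This replaces the change of variables x = y(\<xi>). On a unit interval \<Omega> is at
  most C e times its value at c, and the mass of h there is the mass of \<rho> between y(c) and
  y(c+1). Moving the weight from c to such a point costs the second factor C e^{\<nu>^2+1}. The
  bound is an increment of \<open>m\<Omega>\<close>, so it telescopes over neighbouring
  cells.\<close>

lemma cell_weight:
  shows "integrable lborel (\<lambda>x. indicator {c..c + 1} x * (\<Omega> x * l_h Y x))"
    "(LINT x|lborel. indicator {c..c + 1} x * (\<Omega> x * l_h Y x)) \<le>
      C * exp 1 * (C * exp (\<nu>\<^sup>2 + 1)) * (m\<Omega> (l_y Y (c + 1)) - m\<Omega> (l_y Y c))"
proof -
  let ?y = "l_y Y c" and ?z = "l_y Y (c + 1)"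
  have yz: "?y \<le> ?z" by (rule y_mono) simp
  note hD = has_wderivD[OF dH, of c "c + 1", simplified]
  have bi: "integrable lborel (\<lambda>x. C * exp 1 * \<Omega> c * (indicator {c..c + 1} x * l_h Y x))" using hD(1) by simp
  have dom: "AE x in lborel. 0 \<le> indicator {c..c + 1} x * (\<Omega> x * l_h Y x) \<and>
      indicator {c..c + 1} x * (\<Omega> x * l_h Y x) \<le> C * exp 1 * \<Omega> c * (indicator {c..c + 1} x * l_h Y x)"
    using AE_h
  proof eventually_elim
    case (elim x)
    show ?case
    proof (cases "x \<in> {c..c + 1}")
      case True
      have "\<Omega> x \<le> C * \<Omega> c * exp \<bar>x - c\<bar>" by (rule \<Omega>(4))
      also have "\<dots> \<le> C * \<Omega> c * exp 1" using True \<Omega>(2,5) by (intro mult_left_mono) auto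
      finally have "\<Omega> x * l_h Y x \<le> (C * \<Omega> c * exp 1) * l_h Y x" using elim by (rule mult_right_mono)
      then show ?thesis using True elim \<Omega>(5) by (simp add: mult_ac)
    qed simp
  qed
  show i: "integrable lborel (\<lambda>x. indicator {c..c + 1} x * (\<Omega> x * l_h Y x))"
  proof (rule Bochner_Integration.integrable_bound[OF bi])
    show "(\<lambda>x. indicator {c..c + 1} x * (\<Omega> x * l_h Y x)) \<in> borel_measurable lborel"
      using \<Omega>(1) meas(6) by measurable
    show "AE x in lborel. norm (indicator {c..c + 1} x * (\<Omega> x * l_h Y x)) \<le> norm (C * exp 1 * \<Omega> c * (indicator {c..c + 1} x * l_h Y x))"
      using dom by eventually_elim auto
  qed
  have "(LINT x|lborel. indicator {c..c + 1} x * (\<Omega> x * l_h Y x)) \<le> (LINT x|lborel. C * exp 1 * \<Omega> c * (indicator {c..c + 1} x * l_h Y x))"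
    using dom by (intro integral_mono_AE i bi) (auto elim!: eventually_mono)
  also have "\<dots> = C * exp 1 * (\<Omega> c * (l_H Y (c + 1) - l_H Y c))" using hD(2) by simp
  also have "\<Omega> c * (l_H Y (c + 1) - l_H Y c) = (LINT x|lborel. \<Omega> c * (indicator {..?z} x * \<rho> x - indicator {..?y} x * \<rho> x))"
    unfolding H_eq using i\<rho>(1) by simp
  also have "\<dots> \<le> (LINT x|lborel. C * exp (\<nu>\<^sup>2 + 1) * (indicator {..?z} x * (\<Omega> x * \<rho> x) - indicator {..?y} x * (\<Omega> x * \<rho> x)))"
  proof (rule integral_mono)
    fix x
    show "\<Omega> c * (indicator {..?z} x * \<rho> x - indicator {..?y} x * \<rho> x) \<le>
       C * exp (\<nu>\<^sup>2 + 1) * (indicator {..?z} x * (\<Omega> x * \<rho> x) - indicator {..?y} x * (\<Omega> x * \<rho> x))"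
    proof (cases "?y < x \<and> x \<le> ?z")
      case True
      \<comment> \<open>Since y = id - H with 0 <= H <= \<nu>^2, the point x lies between c -
        \<nu>^2 and c + 1.\<close>
      have "\<bar>c - x\<bar> \<le> \<nu>\<^sup>2 + 1"
        using True y_eq[of c] y_eq[of "c + 1"] H_bounds[of c] H_bounds[of "c + 1"] by linarith
      then have "\<Omega> c \<le> C * \<Omega> x * exp (\<nu>\<^sup>2 + 1)"
        using \<Omega>(4)[of c x] \<Omega>(2) \<Omega>(5)[of x] by (elim order_trans) (intro mult_left_mono, auto)
      from mult_right_mono[OF this \<rho>0[of x]] True show ?thesis by (simp add: mult_ac)
    qed (use yz in \<open>auto simp: indicator_def\<close>)
  qed (use i\<rho> in auto)
  also have "\<dots> = C * exp (\<nu>\<^sup>2 + 1) * (m\<Omega> ?z - m\<Omega> ?y)" unfolding m\<Omega>_def using i\<rho>(2) by simp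
  finally show "(LINT x|lborel. indicator {c..c + 1} x * (\<Omega> x * l_h Y x)) \<le>
      C * exp 1 * (C * exp (\<nu>\<^sup>2 + 1)) * (m\<Omega> ?z - m\<Omega> ?y)"
    using \<Omega>(2) by (simp add: mult.assoc)
qed

lemma cells_weight:
  "integrable lborel (\<lambda>x. indicator {a..a + real k} x * (\<Omega> x * l_h Y x)) \<and>
    (LINT x|lborel. indicator {a..a + real k} x * (\<Omega> x * l_h Y x)) \<le>
      C * exp 1 * (C * exp (\<nu>\<^sup>2 + 1)) * (m\<Omega> (l_y Y (a + real k)) - m\<Omega> (l_y Y a))"
proof (induction k)
  case 0
  have ae: "AE x in lborel. indicator {a..a} x * (\<Omega> x * l_h Y x) = 0"
    using AE_lborel_singleton[of a] by eventually_elim (auto simp: indicator_def)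
  have m: "(\<lambda>x. indicator {a..a} x * (\<Omega> x * l_h Y x)) \<in> borel_measurable lborel"
    using \<Omega>(1) meas(6) by measurable
  have "integrable lborel (\<lambda>x. indicator {a..a} x * (\<Omega> x * l_h Y x))"
    using integrable_cong_AE[OF m _ ae] by simp
  moreover have "(LINT x|lborel. indicator {a..a} x * (\<Omega> x * l_h Y x)) = 0"
    using integral_cong_AE[OF m _ ae] by simp
  ultimately show ?case by simp
next
  case (Suc k)
  let ?b = "a + real k"
  have b: "a + real (Suc k) = ?b + 1" by simp
  note c = cell_weight[of ?b]
  have si: "integrable lborel (\<lambda>x. indicator {a..?b} x * (\<Omega> x * l_h Y x) + indicator {?b..?b + 1} x * (\<Omega> x * l_h Y x))"
    using Suc.IH c(1) by simp
  have dom: "AE x in lborel. 0 \<le> indicator {a..?b + 1} x * (\<Omega> x * l_h Y x) \<and>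
     indicator {a..?b + 1} x * (\<Omega> x * l_h Y x) \<le> indicator {a..?b} x * (\<Omega> x * l_h Y x) + indicator {?b..?b + 1} x * (\<Omega> x * l_h Y x)"
    using AE_h by eventually_elim (use \<Omega>(5) in \<open>auto simp: indicator_def\<close>)
  have i: "integrable lborel (\<lambda>x. indicator {a..?b + 1} x * (\<Omega> x * l_h Y x))"
  proof (rule Bochner_Integration.integrable_bound[OF si])
    show "(\<lambda>x. indicator {a..?b + 1} x * (\<Omega> x * l_h Y x)) \<in> borel_measurable lborel"
      using \<Omega>(1) meas(6) by measurable
    show "AE x in lborel. norm (indicator {a..?b + 1} x * (\<Omega> x * l_h Y x)) \<le> norm (indicator {a..?b} x * (\<Omega> x * l_h Y x) + indicator {?b..?b + 1} x * (\<Omega> x * l_h Y x))"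
      using dom by eventually_elim auto
  qed
  have "(LINT x|lborel. indicator {a..?b + 1} x * (\<Omega> x * l_h Y x)) \<le>
     (LINT x|lborel. indicator {a..?b} x * (\<Omega> x * l_h Y x) + indicator {?b..?b + 1} x * (\<Omega> x * l_h Y x))"
    using dom by (intro integral_mono_AE i si) (auto elim!: eventually_mono)
  also have "\<dots> = (LINT x|lborel. indicator {a..?b} x * (\<Omega> x * l_h Y x)) + (LINT x|lborel. indicator {?b..?b + 1} x * (\<Omega> x * l_h Y x))"
    using Suc.IH c(1) by simp
  finally have "(LINT x|lborel. indicator {a..?b + 1} x * (\<Omega> x * l_h Y x)) \<le>
      C * exp 1 * (C * exp (\<nu>\<^sup>2 + 1)) * (m\<Omega> (l_y Y ?b) - m\<Omega> (l_y Y a)) + C * exp 1 * (C * exp (\<nu>\<^sup>2 + 1)) * (m\<Omega> (l_y Y (?b + 1)) - m\<Omega> (l_y Y ?b))"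
    using Suc.IH c(2) by linarith
  then have "(LINT x|lborel. indicator {a..?b + 1} x * (\<Omega> x * l_h Y x)) \<le>
      C * exp 1 * (C * exp (\<nu>\<^sup>2 + 1)) * (m\<Omega> (l_y Y (?b + 1)) - m\<Omega> (l_y Y a))"
    by (simp add: algebra_simps)
  with i show ?case unfolding b by blast
qed

lemma weight_h:
  shows "integrable lborel (\<lambda>x. (\<omega> x)\<^sup>2 * l_h Y x)"
    "(LINT x|lborel. (\<omega> x)\<^sup>2 * l_h Y x) \<le> C * exp 1 * (C * exp (\<nu>\<^sup>2 + 1)) * \<nu>\<^sup>2"
proof -
  let ?K = "C * exp 1 * (C * exp (\<nu>\<^sup>2 + 1))"
  have K: "0 \<le> ?K" using \<Omega>(2) by simp
  have m0: "0 \<le> m\<Omega> x" for x unfolding m\<Omega>_def using \<Omega>(5) \<rho>0 by (intro integral_nonneg_AE) auto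
  have m1: "m\<Omega> x \<le> \<nu>\<^sup>2" for x
    unfolding m\<Omega>_def \<rho>(3)[symmetric] using \<Omega>(5) \<rho>0
    by (intro integral_mono i\<rho> \<rho>(2)) (auto simp: indicator_def)
  have *: "integrable lborel (\<lambda>x. indicator {- real n..real n} x * (\<Omega> x * l_h Y x))"
    "(LINT x|lborel. indicator {- real n..real n} x * (\<Omega> x * l_h Y x)) \<le> ?K * \<nu>\<^sup>2" for n :: nat
  proof -
    have e: "- real n + real (2 * n) = real n" by simp
    note c = cells_weight[of "- real n" "2 * n", unfolded e]
    from c show "integrable lborel (\<lambda>x. indicator {- real n..real n} x * (\<Omega> x * l_h Y x))" by blast
    have "(LINT x|lborel. indicator {- real n..real n} x * (\<Omega> x * l_h Y x)) \<le> ?K * (m\<Omega> (l_y Y (real n)) - m\<Omega> (l_y Y (- real n)))"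
      using c by blast
    also have "\<dots> \<le> ?K * \<nu>\<^sup>2" using m0[of "l_y Y (- real n)"] m1[of "l_y Y (real n)"] by (intro mult_left_mono K) linarith
    finally show "(LINT x|lborel. indicator {- real n..real n} x * (\<Omega> x * l_h Y x)) \<le> ?K * \<nu>\<^sup>2" .
  qed
  have m: "(\<lambda>x. \<Omega> x * l_h Y x) \<in> borel_measurable borel" using \<Omega>(1) meas(6) by measurable
  have n: "AE x in lborel. 0 \<le> \<Omega> x * l_h Y x" using AE_h \<Omega>(5) by (auto elim!: eventually_mono)
  from integrable_of_intervals[OF m n *]
  show "integrable lborel (\<lambda>x. (\<omega> x)\<^sup>2 * l_h Y x)"
    "(LINT x|lborel. (\<omega> x)\<^sup>2 * l_h Y x) \<le> ?K * \<nu>\<^sup>2" by (simp_all add: \<Omega>_def)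
qed

end

section \<open>Consistency\<close>

context GG_elem
begin

text \<open>Only v is known in L^2, so Cauchy--Schwarz on the interval yields the square root of its
  length; the contribution of the 1 in q is linear in the length.\<close>

lemma y_cell_oscillation:
  assumes M: "F_norm Y \<le> M" and d: "a \<le> b" "b \<le> a + \<delta>" "\<delta> \<le> 1"
  shows "\<bar>l_y Y b - l_y Y a\<bar> \<le> sqrt \<delta> * (1 + M)"
proof -
  have \<delta>0: "0 \<le> \<delta>" using d by simp
  have v: "L2_le (l_v Y) M" using comps_le_of_F_norm[OF FF M] by (simp add: comps_le_def)
  have M0: "0 \<le> M" by (rule L2_le_nonneg[OF v])
  let ?I = "indicator {a..b} :: real \<Rightarrow> real"
  have I: "L2_le ?I (sqrt (b - a))"
    using d by (auto simp: L2_le_iff power2_eq_square indicator_inter_arith[symmetric])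
  have "l_y Y b - l_y Y a = (LINT x|lborel. ?I x * l_q Y x)" using has_wderivD(2)[OF dy d(1)] by simp
  also have "\<dots> = (LINT x|lborel. ?I x + ?I x * l_v Y x)" by (simp add: l_q_def distrib_left)
  also have "\<dots> = (b - a) + (LINT x|lborel. ?I x * l_v Y x)"
    using L2_le_mult_integrable[OF I v] d by simp
  finally have "l_y Y b - l_y Y a = (b - a) + (LINT x|lborel. ?I x * l_v Y x)" .
  moreover have "\<bar>LINT x|lborel. ?I x * l_v Y x\<bar> \<le> sqrt (b - a) * M"
    by (rule order_trans[OF integral_abs_bound L2_le_Cauchy_Schwarz[OF I v]])
  moreover have "sqrt (b - a) * M \<le> sqrt \<delta> * M" using d M0 by (intro mult_right_mono) auto
  moreover have "b - a \<le> sqrt \<delta>"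
  proof -
    \<comment> \<open>Here \<delta> <= 1 absorbs the linear contribution into sqrt \<delta>.\<close>
    have "\<delta>\<^sup>2 \<le> \<delta>" using \<delta>0 d(3) by (simp add: power2_eq_square mult_left_le)
    then have "\<delta> \<le> sqrt \<delta>" by (rule real_le_rsqrt)
    then show ?thesis using d by linarith
  qed
  ultimately have "\<bar>l_y Y b - l_y Y a\<bar> \<le> sqrt \<delta> + sqrt \<delta> * M" using d(1) by linarith
  then show ?thesis by (simp add: distrib_left)
qed

text \<open>Inside [-R, R) the error is the oscillation within a cell; outside, the sample is 0 and
  the error is the nonlocal term itself, bounded by the tail of the convolution of h.\<close>

lemma sample_nonloc_error:
  assumes s: "sgn_or_one s" and E: "energy_le Y E" and M: "F_norm Y \<le> M"
    and \<delta>: "0 < \<delta>" "\<delta> \<le> 1" and R: "R = real N * \<delta>"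
    and tail: "L2_Linf_le (\<lambda>x. indicator (- {- R..<R}) x * conv exp_kernel (l_h Y) x) t"
  shows "L2_Linf_le (\<lambda>\<xi>. sample \<delta> N (nonloc s \<gamma> Y) \<xi> - nonloc s \<gamma> Y \<xi>)
    (exp (2 * M + 1) * (2 * (sqrt \<delta> * (1 + M)) * ((exp_mass + sqrt exp_mass) * (source_const \<gamma> M * M)) + 2 * (sqrt \<delta> * (source_const \<gamma> M * M)))
      + source_bd \<gamma> * exp (2 * M) * t)"
proof -
  interpret nonloc_setting s \<gamma> Y M by (rule FF_rc_nonloc_setting[OF FF_rc M s])
  let ?f = "\<lambda>\<eta>. \<bar>source \<gamma> Y \<eta>\<bar>" and ?b = "source_const \<gamma> M * M"
  have f: "L2_le ?f ?b" by (rule L2_le_abs[OF source_L2])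
  have b0: "0 \<le> ?b" by (rule L2_le_nonneg[OF f])
  have exp_mass: "0 \<le> exp_mass" by (rule kernelD(6)[OF kernel_exp_kernel])
  have fm: "?f \<in> borel_measurable borel" by (rule L2_le_measurable[OF f])
  let ?\<rho> = "sqrt \<delta> * (1 + M)"
  let ?J = "conv exp_kernel ?f" and ?I = "conv (indicator {0..\<delta>}) ?f" and ?T = "\<lambda>x. indicator (- {- R..<R}) x * conv exp_kernel (l_h Y) x"
  have \<rho>: "0 \<le> ?\<rho>" using M_nonneg \<delta> by simp
  have J0: "0 \<le> ?J x" for x by (rule conv_nonneg[OF kernel_exp_kernel]) simp
  have kI: "kernel (indicator {0..\<delta>}) \<delta>" using \<delta> by (intro kernel_indicator) simp
  have I0: "0 \<le> ?I x" for x by (rule conv_nonneg[OF kI]) simp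
  have H0: "0 \<le> conv exp_kernel (l_h Y) x" for x by (rule conv_nonneg_AE[OF kernel_exp_kernel AE_h])
  have "L2_le ?J (exp_mass * ?b)" by (rule conv_L2_le[OF kernel_exp_kernel f])
  moreover have "Linf_le ?J (sqrt exp_mass * ?b)"
    using conv_bound_L2[OF kernel_exp_kernel f] conv_measurable[OF exp_kernel_measurable fm] by (intro Linf_leI)
  ultimately have J: "L2_Linf_le ?J ((exp_mass + sqrt exp_mass) * ?b)"
    using exp_mass b0 unfolding L2_Linf_le_def distrib_right by (intro conjI; elim L2_le_weaken Linf_le_weaken) auto
  have \<delta>s: "\<delta> \<le> sqrt \<delta>" using \<delta> by (intro real_le_rsqrt) (simp add: power2_eq_square mult_left_le)
  \<comment> \<open>Convolution with the indicator of [0, \<delta>] has norm \<delta> from L^2 to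
    L^2 but sqrt \<delta> from L^2 to L^\<infinity>; the weaker rate is kept for both.\<close>
  have "L2_le ?I (\<delta> * ?b)" by (rule conv_L2_le[OF kI f])
  moreover have "Linf_le ?I (sqrt \<delta> * ?b)"
    using conv_bound_L2[OF kI f] conv_measurable[OF _ fm, of "indicator {0..\<delta>}"] by (intro Linf_leI) auto
  ultimately have I: "L2_Linf_le ?I (sqrt \<delta> * ?b)"
    using mult_right_mono[OF \<delta>s b0] unfolding L2_Linf_le_def by (auto elim: L2_le_weaken)
  have abs2: "\<bar>exp (2 * M + 1)\<bar> = exp (2 * M + 1)" "\<bar>2 * ?\<rho>\<bar> = 2 * ?\<rho>" "\<bar>2 :: real\<bar> = 2" "\<bar>source_bd \<gamma> * exp (2 * M)\<bar> = source_bd \<gamma> * exp (2 * M)"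
    by (rule abs_of_nonneg; use \<rho> source_bd_nonneg[of \<gamma>] in simp)+
  have bound: "L2_Linf_le (\<lambda>x. exp (2 * M + 1) * (2 * ?\<rho> * ?J x + 2 * ?I x) + source_bd \<gamma> * exp (2 * M) * ?T x)
    (exp (2 * M + 1) * (2 * ?\<rho> * ((exp_mass + sqrt exp_mass) * ?b) + 2 * (sqrt \<delta> * ?b)) + source_bd \<gamma> * exp (2 * M) * t)"
    using L2_Linf_le_add[OF L2_Linf_le_cmult[OF L2_Linf_le_add[OF L2_Linf_le_cmult[OF J, of "2 * ?\<rho>"] L2_Linf_le_cmult[OF I, of 2]], of "exp (2 * M + 1)"]
        L2_Linf_le_cmult[OF tail, of "source_bd \<gamma> * exp (2 * M)"]] unfolding abs2 .
  have le: "\<bar>sample \<delta> N (nonloc s \<gamma> Y) \<xi> - nonloc s \<gamma> Y \<xi>\<bar> \<le> exp (2 * M + 1) * (2 * ?\<rho> * ?J \<xi> + 2 * ?I \<xi>) + source_bd \<gamma> * exp (2 * M) * ?T \<xi>" for \<xi>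
  proof (cases "\<xi> \<in> {- R..<R}")
    case True
    let ?x = "grid \<delta> \<lfloor>\<xi> / \<delta>\<rfloor>"
    note g = grid_floor[OF \<delta>(1), of \<xi>]
    have osc: "\<bar>l_y Y a' - l_y Y ?x\<bar> \<le> ?\<rho>" "\<bar>l_y Y \<xi> - l_y Y a'\<bar> \<le> ?\<rho>" if "a' \<in> {?x..\<xi>}" for a'
      using that g by (auto intro!: y_cell_oscillation[OF M _ _ \<delta>(2)])
    have "\<bar>nonloc s \<gamma> Y \<xi> - nonloc s \<gamma> Y ?x\<bar> \<le> exp (2 * M + 1) * (2 * ?\<rho> * ?J \<xi> + 2 * ?I \<xi>)"
      by (rule nonloc_shift[OF FF_rc_nonloc_setting[OF FF_rc M s] g(1) less_imp_le[OF g(2)] \<delta>(2) osc])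
    moreover have "sample \<delta> N (nonloc s \<gamma> Y) \<xi> = nonloc s \<gamma> Y ?x"
      using True unfolding sample_eq[OF \<delta>(1)] R by simp
    ultimately show ?thesis using True by (simp add: abs_minus_commute)
  next
    case False
    then have "sample \<delta> N (nonloc s \<gamma> Y) \<xi> = 0" unfolding sample_eq[OF \<delta>(1)] R by auto
    moreover have "\<bar>nonloc s \<gamma> Y \<xi>\<bar> \<le> source_bd \<gamma> * exp (2 * M) * conv exp_kernel (l_h Y) \<xi>"
      by (rule nonloc_bound_conv[OF s E FF_rc_pointwise(1)[OF FF_rc M]])
    moreover have "0 \<le> exp (2 * M + 1) * (2 * ?\<rho> * ?J \<xi> + 2 * ?I \<xi>)"
      using \<rho> J0[of \<xi>] I0[of \<xi>] by simp
    ultimately show ?thesis using False by simp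
  qed
  have m: "(\<lambda>\<xi>. sample \<delta> N (nonloc s \<gamma> Y) \<xi> - nonloc s \<gamma> Y \<xi>) \<in> borel_measurable borel" by measurable
  have "AE \<xi> in lborel. \<bar>sample \<delta> N (nonloc s \<gamma> Y) \<xi> - nonloc s \<gamma> Y \<xi>\<bar> \<le> \<bar>exp (2 * M + 1) * (2 * ?\<rho> * ?J \<xi> + 2 * ?I \<xi>) + source_bd \<gamma> * exp (2 * M) * ?T \<xi>\<bar>"
    by (intro AE_I2 order_trans[OF le abs_ge_self])
  with bound m show ?thesis unfolding L2_Linf_le_def by (blast intro: L2_le_mono Linf_le_mono)
qed

end

definition sample_const :: "real \<Rightarrow> real \<Rightarrow> real \<Rightarrow> real" where
  "sample_const \<gamma> M c = exp (2 * M + 1) * (2 * (1 + M) * ((exp_mass + sqrt exp_mass) * (source_const \<gamma> M * M)) + 2 * (source_const \<gamma> M * M))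
      + source_bd \<gamma> * exp (2 * M) * c"

lemma sample_const_nonneg: "0 \<le> M \<Longrightarrow> 0 \<le> c \<Longrightarrow> 0 \<le> sample_const \<gamma> M c"
  using kernelD(6)[OF kernel_exp_kernel] source_bd_nonneg[of \<gamma>] source_const_nonneg[of M \<gamma>]
  by (simp add: sample_const_def)

lemma (in GG_elem) sample_PQ_error:
  assumes E: "energy_le Y E" and M: "F_norm Y \<le> M"
    and \<delta>: "0 < \<delta>" "\<delta> \<le> 1" and R: "R = real N * \<delta>" and c: "0 \<le> c" "0 \<le> t"
    and tail: "L2_Linf_le (\<lambda>x. indicator (- {- R..<R}) x * conv exp_kernel (l_h Y) x) (c * t)"
  shows "L2_Linf_le (\<lambda>\<xi>. sample \<delta> N (PP \<gamma> Y) \<xi> - PP \<gamma> Y \<xi>) (sample_const \<gamma> M c * (sqrt \<delta> + t))"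
    "L2_Linf_le (\<lambda>\<xi>. sample \<delta> N (QQ \<gamma> Y) \<xi> - QQ \<gamma> Y \<xi>) (sample_const \<gamma> M c * (sqrt \<delta> + t))"
proof -
  have M0: "0 \<le> M" using M F_norm_nonneg order_trans by blast
  define A where "A = exp (2 * M + 1) * (2 * (1 + M) * ((exp_mass + sqrt exp_mass) * (source_const \<gamma> M * M)) + 2 * (source_const \<gamma> M * M))"
  define B where "B = source_bd \<gamma> * exp (2 * M)"
  have A: "0 \<le> A" using kernelD(6)[OF kernel_exp_kernel] source_const_nonneg[OF M0, of \<gamma>] M0 by (simp add: A_def)
  have B: "0 \<le> B" using source_bd_nonneg by (simp add: B_def)
  have err: "L2_Linf_le (\<lambda>\<xi>. sample \<delta> N (nonloc s \<gamma> Y) \<xi> - nonloc s \<gamma> Y \<xi>) (sample_const \<gamma> M c * (sqrt \<delta> + t))" if "sgn_or_one s" for s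
  proof (rule L2_Linf_le_weaken[OF sample_nonloc_error[OF that E M \<delta> R tail]])
    have "exp (2 * M + 1) * (2 * (sqrt \<delta> * (1 + M)) * ((exp_mass + sqrt exp_mass) * (source_const \<gamma> M * M)) + 2 * (sqrt \<delta> * (source_const \<gamma> M * M)))
      + source_bd \<gamma> * exp (2 * M) * (c * t) = A * sqrt \<delta> + B * c * t"
      by (simp add: A_def B_def algebra_simps)
    also have "\<dots> \<le> (A + B * c) * (sqrt \<delta> + t)"
    proof -
      have "0 \<le> A * t" "0 \<le> B * c * sqrt \<delta>" using A B c \<delta> by auto
      then show ?thesis by (simp add: algebra_simps)
    qed
    also have "A + B * c = sample_const \<gamma> M c" by (simp add: A_def B_def sample_const_def)
    finally show "exp (2 * M + 1) * (2 * (sqrt \<delta> * (1 + M)) * ((exp_mass + sqrt exp_mass) * (source_const \<gamma> M * M)) + 2 * (sqrt \<delta> * (source_const \<gamma> M * M)))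
      + source_bd \<gamma> * exp (2 * M) * (c * t) \<le> sample_const \<gamma> M c * (sqrt \<delta> + t)" .
  qed
  have s: "sgn_or_one (\<lambda>_. 1)" "sgn_or_one sgn" by (auto simp: sgn_or_one_def)
  have n: "0 \<le> sample_const \<gamma> M c * (sqrt \<delta> + t)" using L2_Linf_le_nonneg[OF err[OF s(1)]] .
  have eq: "sample \<delta> N (PP \<gamma> Y) \<xi> - PP \<gamma> Y \<xi> = 1/2 * (sample \<delta> N (nonloc (\<lambda>_. 1) \<gamma> Y) \<xi> - nonloc (\<lambda>_. 1) \<gamma> Y \<xi>)"
    "sample \<delta> N (QQ \<gamma> Y) \<xi> - QQ \<gamma> Y \<xi> = - 1/2 * (sample \<delta> N (nonloc sgn \<gamma> Y) \<xi> - nonloc sgn \<gamma> Y \<xi>)" for \<xi>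
    using sample_cmult[of \<delta> N "1/2" "nonloc (\<lambda>_. 1) \<gamma> Y" \<xi>] sample_cmult[of \<delta> N "-1/2" "nonloc sgn \<gamma> Y" \<xi>]
    by (simp_all add: PP_nonloc[abs_def] QQ_nonloc[abs_def] right_diff_distrib)
  show "L2_Linf_le (\<lambda>\<xi>. sample \<delta> N (PP \<gamma> Y) \<xi> - PP \<gamma> Y \<xi>) (sample_const \<gamma> M c * (sqrt \<delta> + t))"
    unfolding eq using n by (intro L2_Linf_le_weaken[OF L2_Linf_le_cmult[OF err[OF s(1)]]]) linarith
  show "L2_Linf_le (\<lambda>\<xi>. sample \<delta> N (QQ \<gamma> Y) \<xi> - QQ \<gamma> Y \<xi>) (sample_const \<gamma> M c * (sqrt \<delta> + t))"
    unfolding eq using n by (intro L2_Linf_le_weaken[OF L2_Linf_le_cmult[OF err[OF s(2)]]]) linarith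
qed

text \<open>P and Q are compared through the sampled values at the exact state. The first difference
  is the Lipschitz estimate for a fixed sampling; the second is the sampling error, taken at the
  exact state because oscillation and tail bounds are available only there.\<close>

lemma consistency:
  fixes \<gamma> M :: real
  assumes GG: "Y \<in> GG" and E: "energy_le Y E" and Y: "F_norm Y \<le> M" and Z: "Z \<in> F_grid \<delta> N" "F_norm Z \<le> M"
    and \<delta>: "0 < \<delta>" "\<delta> \<le> 1" and R: "R = real N * \<delta>" and c: "0 \<le> c" "0 \<le> t"
    and tail: "L2_Linf_le (\<lambda>x. indicator (- {- R..<R}) x * conv exp_kernel (l_h Y) x) (c * t)"
  defines "K \<equiv> 7 * lag_field_const \<gamma> (M + PQ_const \<gamma> M)"
  shows "F_norm (sampled_field (sample \<delta> N) 1 1 \<gamma> Z - G_rhs \<gamma> Y) \<le>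
    K * (1 + nonloc_const \<gamma> M) * F_norm (Z - Y) + K * sample_const \<gamma> M c * (sqrt \<delta> + t)"
proof -
  interpret GG_elem Y by standard (rule GG)
  let ?S = "sample \<delta> N"
  have so: "samp_op ?S" by (rule samp_op_sample[OF \<delta>])
  have ZR: "Z \<in> FF_rc" by (rule F_grid_FF_rc[OF \<delta>(1) Z(1)])
  have M: "0 \<le> M" using Y F_norm_nonneg order_trans by blast
  define B where "B = M + PQ_const \<gamma> M"
  have B: "0 \<le> B" "M \<le> B" "PQ_const \<gamma> M \<le> B" using M PQ_const_nonneg[OF M, of \<gamma>] by (auto simp: B_def)
  let ?e = "nonloc_const \<gamma> M * F_norm (Z - Y) + sample_const \<gamma> M c * (sqrt \<delta> + t)"
  have e: "0 \<le> ?e" using nonloc_const_nonneg[OF M, of \<gamma>] sample_const_nonneg[OF M c(1), of \<gamma>] c \<delta> by simp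
  note d = PQ_diff_L2_Linf_le[OF ZR Z(2) FF_rc Y so, of \<gamma>]
  note sd = sample_PQ_error[OF E Y \<delta> R c tail, of \<gamma>]
  have P: "L2_Linf_le (\<lambda>x. ?S (PP \<gamma> Z) x - PP \<gamma> Y x) ?e"
    using L2_Linf_le_add[OF d(1) sd(1)] by (simp add: algebra_simps)
  have Q: "L2_Linf_le (\<lambda>x. ?S (QQ \<gamma> Z) x - QQ \<gamma> Y x) ?e"
    using L2_Linf_le_add[OF d(2) sd(2)] by (simp add: algebra_simps)
  have "F_norm (lag_field 1 1 \<gamma> Z (?S (PP \<gamma> Z)) (?S (QQ \<gamma> Z)) - lag_field 1 1 \<gamma> Y (PP \<gamma> Y) (QQ \<gamma> Y)) \<le> 7 * lag_field_const \<gamma> B * (F_norm (Z - Y) + ?e)"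
    using PQ_L2_Linf_le[OF ZR Z(2) so, of \<gamma>] PQ_L2_Linf_le[OF FF_rc Y samp_op_id, of \<gamma>] B Y Z
    by (intro lag_field_diff_F_norm(2) e P Q) (auto elim: L2_Linf_le_weaken intro: FF F_grid_FF)
  then show ?thesis
    unfolding sampled_field_def G_rhs_lag_field K_def B_def[symmetric] by (simp add: algebra_simps)
qed

text \<open>Two Gronwall estimates with zero rate: boundedness of the field gives Lipschitz
  continuity of the flow in time; then the field varies by at most L^2 \<tau> along the step, which
  is integrated once more.\<close>

lemma (in flow) local_error:
  assumes M: "\<And>s. s \<in> {0..T} \<Longrightarrow> F_norm (Y s) \<le> M" and t: "0 \<le> t" "0 \<le> \<tau>" "t + \<tau> \<le> T"
  shows "F_norm (Y (t + \<tau>) - Y t - \<tau> *\<^sub>R G_rhs \<gamma> (Y t)) \<le> (sampled_field_const \<gamma> M)\<^sup>2 * \<tau>\<^sup>2"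
proof -
  let ?L = "sampled_field_const \<gamma> M"
  have sT: "s \<in> {0..T}" if "t \<le> s" "s \<le> t + \<tau>" for s using that t by auto
  have L: "0 \<le> ?L" using order_trans[OF F_norm_nonneg M[of t]] t by (intro sampled_field_const_nonneg) auto
  have lip: "F_norm (Y s - Y t) \<le> ?L * \<tau>" if s: "t \<le> s" "s \<le> t + \<tau>" for s
  proof -
    have "F_norm (Y s - Y t - s *\<^sub>R 0) \<le> (F_norm (Y t - Y t - t *\<^sub>R 0) + ?L * (s - t)) * exp (0 * (s - t))"
    proof (rule seminorm_gronwall[where K = 1 and b = "t + \<tau>"])
      fix r assume r: "t \<le> r" "r < t + \<tau>"
      then have "F_norm (G_rhs \<gamma> (Y r)) \<le> ?L"
        unfolding G_rhs_sampled_field using t by (intro sampled_field_bounded(2)[OF FF_rc M samp_op_id]) (auto intro: sT)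
      then show "F_norm (G_rhs \<gamma> (Y r) - 0) \<le> 0 * F_norm (Y r - Y t - r *\<^sub>R 0) + ?L" by simp
    qed (use FF_0 FF[OF t(1)] L s t F_norm_add(2) F_norm_scaleR(2) in auto)
    then have "F_norm (Y s - Y t) \<le> ?L * (s - t)" by simp
    also have "\<dots> \<le> ?L * \<tau>" using s L by (intro mult_left_mono) auto
    finally show ?thesis .
  qed
  let ?B = "G_rhs \<gamma> (Y t)"
  \<comment> \<open>The comparison curve is the tangent line at t, written as A + sB with A = Y t -
    tB.\<close>
  have eq: "Y s - (Y t - t *\<^sub>R ?B) - s *\<^sub>R ?B = Y s - Y t - (s - t) *\<^sub>R ?B" for s
    by (simp add: scaleR_diff_left)
  have "F_norm (Y (t + \<tau>) - (Y t - t *\<^sub>R ?B) - (t + \<tau>) *\<^sub>R ?B) \<le>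
      (F_norm (Y t - (Y t - t *\<^sub>R ?B) - t *\<^sub>R ?B) + ?L * (?L * \<tau>) * ((t + \<tau>) - t)) * exp (0 * ((t + \<tau>) - t))"
  proof (rule seminorm_gronwall[where K = 1 and b = "t + \<tau>"])
    show "Y t - t *\<^sub>R ?B \<in> FF" "?B \<in> FF" by (intro F_norm_diff(1) F_norm_scaleR(1) rhs_FF FF t)+
    fix r assume r: "t \<le> r" "r < t + \<tau>"
    have "F_norm (G_rhs \<gamma> (Y r) - ?B) \<le> ?L * F_norm (Y r - Y t)"
      unfolding G_rhs_sampled_field using r t by (intro sampled_field_lipschitz[OF FF_rc M FF_rc M samp_op_id]) (auto intro: sT)
    also have "\<dots> \<le> ?L * (?L * \<tau>)" using lip[of r] r L by (intro mult_left_mono) auto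
    finally show "F_norm (G_rhs \<gamma> (Y r) - ?B) \<le> 0 * F_norm (Y r - (Y t - t *\<^sub>R ?B) - r *\<^sub>R ?B) + ?L * (?L * \<tau>)" by simp
  qed (use L t F_norm_add(2) F_norm_scaleR(2) in auto)
  then show ?thesis unfolding eq by (simp add: power2_eq_square mult_ac)
qed

section \<open>Convergence\<close>

definition rate_const :: "real \<Rightarrow> real \<Rightarrow> real" where
  "rate_const \<gamma> M = 7 * lag_field_const \<gamma> (M + PQ_const \<gamma> M)"

text \<open>The constants hold for numerical states of norm at most M + 1, which the induction
  supplies itself: \<open>small\<close> keeps the error below 1 up to time T, so the next step
  starts in that ball. The radius M + 3 is M + 1 enlarged by the 2 of
  \<open>lie_trotter_step\<close>.\<close>

lemma (in flow) scheme_error: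
  fixes T E M c t \<delta> R \<tau> :: real and N N\<^sub>T :: nat and Z\<^sub>0 :: lag
  assumes E: "energy_le (Y 0) E" and M: "\<And>s. s \<in> {0..T} \<Longrightarrow> F_norm (Y s) \<le> M" and c: "0 \<le> c" "0 \<le> t"
    and tail: "\<And>s. s \<in> {0..T} \<Longrightarrow> L2_Linf_le (\<lambda>x. indicator (- {- R..<R}) x * conv exp_kernel (l_h (Y s)) x) (c * t)"
    and \<delta>: "0 < \<delta>" "\<delta> \<le> 1" and R: "R = real N * \<delta>" and \<tau>: "0 \<le> \<tau>" "real N\<^sub>T * \<tau> = T" and Z: "Z\<^sub>0 \<in> F_grid \<delta> N"
  defines "L \<equiv> sampled_field_const \<gamma> (M + 3)" and "a \<equiv> rate_const \<gamma> (M + 1) * (1 + nonloc_const \<gamma> (M + 1))"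
  defines "r \<equiv> rate_const \<gamma> (M + 1) * sample_const \<gamma> (M + 1) c * (sqrt \<delta> + t) + (3 * L\<^sup>2 + (sampled_field_const \<gamma> M)\<^sup>2) * \<tau>"
  assumes \<tau>L: "\<tau> * L \<le> 1" and small: "exp (a * T) * (F_norm (Z\<^sub>0 - Y 0) + T * r) \<le> 1" and j: "j \<le> N\<^sub>T"
  shows "(lie_trotter \<gamma> \<delta> N \<tau> ^^ j) Z\<^sub>0 \<in> F_grid \<delta> N \<and>
    F_norm ((lie_trotter \<gamma> \<delta> N \<tau> ^^ j) Z\<^sub>0 - Y (real j * \<tau>)) \<le> exp (a * (real j * \<tau>)) * (F_norm (Z\<^sub>0 - Y 0) + real j * \<tau> * r)"
  using j
proof (induction j)
  case 0
  then show ?case using Z by simp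
next
  case (Suc j)
  have T0: "0 \<le> T" using \<tau> by (metis mult_nonneg_nonneg of_nat_0_le_iff)
  have M0: "0 \<le> M" using order_trans[OF F_norm_nonneg M[of 0]] T0 by simp
  have K: "0 \<le> rate_const \<gamma> (M + 1)"
    using M0 PQ_const_nonneg[of "M + 1" \<gamma>] by (simp add: rate_const_def lag_field_const_nonneg)
  have a: "0 \<le> a" using K nonloc_const_nonneg[of "M + 1" \<gamma>] M0 by (simp add: a_def)
  have r: "0 \<le> r" using K sample_const_nonneg[of "M + 1" c \<gamma>] M0 c \<delta> \<tau> by (simp add: r_def)
  let ?\<Phi> = "lie_trotter \<gamma> \<delta> N \<tau>" and ?t = "real j * \<tau>" and ?e0 = "F_norm (Z\<^sub>0 - Y 0)"
  define X where "X = (?\<Phi> ^^ j) Z\<^sub>0"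
  define e where "e = F_norm (X - Y ?t)"
  have jt: "0 \<le> ?t" "?t + \<tau> \<le> T" "?t \<le> T"
  proof -
    show "0 \<le> ?t" using \<tau> by simp
    have "real (Suc j) * \<tau> \<le> real N\<^sub>T * \<tau>" using Suc.prems \<tau>(1) by (intro mult_right_mono) auto
    then show "?t + \<tau> \<le> T" using \<tau>(2) by (simp add: distrib_right)
    then show "?t \<le> T" using \<tau>(1) by simp
  qed
  then have tT: "?t \<in> {0..T}" by simp
  have IH: "X \<in> F_grid \<delta> N" "e \<le> exp (a * ?t) * (?e0 + ?t * r)"
    using Suc.IH Suc.prems by (auto simp: X_def e_def)
  have e0: "0 \<le> e" by (simp add: e_def)
  have "exp (a * ?t) * (?e0 + ?t * r) \<le> exp (a * T) * (?e0 + T * r)"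
    using jt a r by (intro mult_mono add_mono mult_right_mono) (auto intro: mult_left_mono)
  then have e1: "e \<le> 1" using IH(2) small by linarith
  have XF: "X \<in> FF" by (rule F_grid_FF[OF IH(1)])
  have YF: "Y ?t \<in> FF" by (rule FF[OF jt(1)])
  have Xn: "F_norm X \<le> M + 1" using F_norm_triangle_sub[OF XF YF] M[OF tT] e1 by (simp add: e_def)
  have M3: "M + 1 + 2 = M + 3" by simp
  note step = lie_trotter_step[OF \<delta> IH(1) Xn \<tau>(1), of \<gamma>, unfolded M3, folded L_def, OF \<tau>L]
  define X' where "X' = ?\<Phi> X"
  have X': "X' \<in> F_grid \<delta> N" using step(1) by (simp add: X'_def)
  let ?G = "sampled_field (sample \<delta> N) 1 1 \<gamma> X" and ?H = "G_rhs \<gamma> (Y ?t)"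
  have GF: "?G \<in> FF" using sampled_field_F_grid[OF \<delta> IH(1), of 1 1 \<gamma>] by (simp add: F_grid_FF)
  have HF: "?H \<in> FF" by (rule rhs_FF[OF jt(1)])
  have Y'F: "Y (?t + \<tau>) \<in> FF" using jt(1) \<tau>(1) by (intro FF) simp
  have X'F: "X' \<in> FF" by (rule F_grid_FF[OF X'])
  have 1: "F_norm (X' - X - \<tau> *\<^sub>R ?G) \<le> 3 * L\<^sup>2 * \<tau>\<^sup>2" using step(2) by (simp add: X'_def)
  have 2: "F_norm (Y (?t + \<tau>) - Y ?t - \<tau> *\<^sub>R ?H) \<le> (sampled_field_const \<gamma> M)\<^sup>2 * \<tau>\<^sup>2"
    by (rule local_error[OF M jt(1) \<tau>(1) jt(2)])
  have 3: "F_norm (?G - ?H) \<le> a * e + rate_const \<gamma> (M + 1) * sample_const \<gamma> (M + 1) c * (sqrt \<delta> + t)"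
    unfolding a_def e_def rate_const_def
    by (rule consistency[OF GG[OF jt(1)] energy_le[OF E jt(1)] _ IH(1) Xn \<delta> R c tail[OF tT]])
      (use M[OF tT] in simp)
  have mF: "X' - X - \<tau> *\<^sub>R ?G \<in> FF" "Y (?t + \<tau>) - Y ?t - \<tau> *\<^sub>R ?H \<in> FF" "X - Y ?t \<in> FF" "\<tau> *\<^sub>R (?G - ?H) \<in> FF" "?G - ?H \<in> FF"
    by (intro F_norm_diff(1) F_norm_scaleR(1) XF YF X'F Y'F GF HF)+
  \<comment> \<open>The step error of the scheme minus that of the exact flow, plus the old error
    advanced by the difference of the two fields.\<close>
  have split: "X' - Y (?t + \<tau>) = ((X' - X - \<tau> *\<^sub>R ?G) - (Y (?t + \<tau>) - Y ?t - \<tau> *\<^sub>R ?H)) + ((X - Y ?t) + \<tau> *\<^sub>R (?G - ?H))"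
    by (simp add: scaleR_diff_right)
  have "F_norm (X' - Y (?t + \<tau>)) \<le> (F_norm (X' - X - \<tau> *\<^sub>R ?G) + F_norm (Y (?t + \<tau>) - Y ?t - \<tau> *\<^sub>R ?H)) + (e + F_norm (\<tau> *\<^sub>R (?G - ?H)))"
    unfolding split e_def
    by (intro order_trans[OF F_norm_add(2)] add_mono F_norm_diff(2) F_norm_add(2) F_norm_diff(1) F_norm_add(1) mF)
  also have "\<dots> \<le> (3 * L\<^sup>2 * \<tau>\<^sup>2 + (sampled_field_const \<gamma> M)\<^sup>2 * \<tau>\<^sup>2) + (e + \<tau> * (a * e + rate_const \<gamma> (M + 1) * sample_const \<gamma> (M + 1) c * (sqrt \<delta> + t)))"
  proof (intro add_mono 1 2 order_refl)
    have "F_norm (\<tau> *\<^sub>R (?G - ?H)) \<le> \<tau> * F_norm (?G - ?H)" using F_norm_scaleR(2)[OF mF(5), of \<tau>] \<tau>(1) by simp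
    also have "\<dots> \<le> \<tau> * (a * e + rate_const \<gamma> (M + 1) * sample_const \<gamma> (M + 1) c * (sqrt \<delta> + t))"
      using 3 \<tau>(1) by (rule mult_left_mono)
    finally show "F_norm (\<tau> *\<^sub>R (?G - ?H)) \<le> \<tau> * (a * e + rate_const \<gamma> (M + 1) * sample_const \<gamma> (M + 1) c * (sqrt \<delta> + t))" .
  qed
  \<comment> \<open>The discrete Gronwall recursion: 1 + a\<tau> <= e^{a\<tau>} multiplies the old
    error, and the factor exp >= 1 on \<tau> r brings the new contribution into the same closed
    form.\<close>
  also have "\<dots> = (1 + a * \<tau>) * e + \<tau> * r" by (simp add: r_def algebra_simps power2_eq_square)
  also have "\<dots> \<le> exp (a * \<tau>) * (exp (a * ?t) * (?e0 + ?t * r)) + exp (a * \<tau>) * exp (a * ?t) * (\<tau> * r)"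
  proof (rule add_mono)
    show "(1 + a * \<tau>) * e \<le> exp (a * \<tau>) * (exp (a * ?t) * (?e0 + ?t * r))"
      by (intro mult_mono IH(2) exp_ge_add_one_self) (use e0 in auto)
    have "1 * 1 \<le> exp (a * \<tau>) * exp (a * ?t)" using a \<tau>(1) jt(1) by (intro mult_mono) auto
    then have "1 * (\<tau> * r) \<le> exp (a * \<tau>) * exp (a * ?t) * (\<tau> * r)" using \<tau>(1) r by (intro mult_right_mono) auto
    then show "\<tau> * r \<le> exp (a * \<tau>) * exp (a * ?t) * (\<tau> * r)" by simp
  qed
  also have "\<dots> = exp (a * (real (Suc j) * \<tau>)) * (?e0 + real (Suc j) * \<tau> * r)"
    by (simp add: exp_add[symmetric] mult_exp_exp algebra_simps)
  finally have "F_norm (X' - Y (?t + \<tau>)) \<le> exp (a * (real (Suc j) * \<tau>)) * (?e0 + real (Suc j) * \<tau> * r)" .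
  moreover have "?t + \<tau> = real (Suc j) * \<tau>" by (simp add: distrib_right)
  ultimately show ?case using X' by (simp add: X'_def X_def)
qed

text \<open>The factor 2 adds the errors of y and U, each bounded by \<open>F_norm\<close>. Right
  continuity of the difference is what makes the bound valid at the grid points themselves.\<close>

lemma graph_error_le:
  assumes \<delta>: "0 < \<delta>" and N: "1 \<le> N" and Y: "\<And>s. 0 \<le> s \<Longrightarrow> Y s \<in> FF_rc" and \<tau>: "0 \<le> \<tau>"
    and err: "\<And>j. j \<le> N\<^sub>T \<Longrightarrow> (lie_trotter \<gamma> \<delta> N \<tau> ^^ j) Z \<in> F_grid \<delta> N \<and>
      F_norm ((lie_trotter \<gamma> \<delta> N \<tau> ^^ j) Z - Y (real j * \<tau>)) \<le> b"
  shows "graph_error \<gamma> \<delta> N N\<^sub>T \<tau> Z Y \<le> 2 * b"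
proof -
  define f where "f = (\<lambda>(i, j). norm ((l_y ((lie_trotter \<gamma> \<delta> N \<tau> ^^ j) Z) (grid \<delta> i), l_U ((lie_trotter \<gamma> \<delta> N \<tau> ^^ j) Z) (grid \<delta> i))
      - (l_y (Y (real j * \<tau>)) (grid \<delta> i), l_U (Y (real j * \<tau>)) (grid \<delta> i))))"
  let ?A = "{- int N..int N - 1} \<times> {0..N\<^sub>T}"
  have "Max (f ` ?A) \<le> 2 * b"
  proof (rule Max.boundedI)
    show "finite (f ` ?A)" by simp
    show "f ` ?A \<noteq> {}" using N by simp
    fix x assume "x \<in> f ` ?A"
    then obtain i j where j: "j \<le> N\<^sub>T" and x: "x = f (i, j)" by auto
  let ?X = "(lie_trotter \<gamma> \<delta> N \<tau> ^^ j) Z" and ?Y = "Y (real j * \<tau>)" and ?\<xi> = "grid \<delta> i"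
    have "?Y \<in> FF_rc" using \<tau> by (intro Y) simp
    then have D: "?X - ?Y \<in> FF_rc" using F_grid_FF_rc[OF \<delta> conjunct1[OF err[OF j]]] by (intro FF_rc_diff)
    have "x = norm (l_zeta (?X - ?Y) ?\<xi>, l_U (?X - ?Y) ?\<xi>)" unfolding x f_def by (simp add: l_y_def)
    also have "\<dots> \<le> norm (l_zeta (?X - ?Y) ?\<xi>) + norm (l_U (?X - ?Y) ?\<xi>)" by (rule norm_Pair_le)
    also have "\<dots> \<le> b + b"
      unfolding real_norm_def using err[OF j] by (intro add_mono FF_rc_pointwise[OF D]) auto
    finally show "x \<le> 2 * b" by simp
  qed
  then show ?thesis unfolding graph_error_def f_def Let_def .
qed

text \<open>Surjectivity of y at time t supplies the points over every x; the rest is the definition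
  of the solution.\<close>

lemma graph_eq:
  assumes Y: "\<And>t. 0 \<le> t \<Longrightarrow> Y t \<in> GG" and u: "conservative_solution Y u" and t: "0 \<le> t"
  shows "{(x, u t x) |x. True} = {(l_y (Y t) \<xi>, l_U (Y t) \<xi>) |\<xi>. True}"
proof -
  interpret GG_elem "Y t" by standard (rule Y[OF t])
  have eq: "u t (l_y (Y t) \<xi>) = l_U (Y t) \<xi>" for \<xi> using u t by (simp add: conservative_solution_def)
  have "\<exists>\<xi>. (x, u t x) = (l_y (Y t) \<xi>, l_U (Y t) \<xi>)" for x
  proof -
    obtain \<xi> where \<xi>: "l_y (Y t) \<xi> = x" by (rule exE[OF y_surj])
    show ?thesis by (rule exI[of _ \<xi>]) (simp add: \<xi>[symmetric] eq)
  qed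
  moreover have "\<exists>x. (l_y (Y t) \<xi>, l_U (Y t) \<xi>) = (x, u t x)" for \<xi>
    by (rule exI[of _ "l_y (Y t) \<xi>"]) (simp add: eq)
  ultimately show ?thesis by blast
qed

text \<open>The three summands of 1/n are nonnegative, so each is at most 1/n: the mesh and the time
  step tend to 0, and R >= n tends to infinity.\<close>

lemma discretisation_limits:
  assumes d: "discretisation \<omega> T C\<^sub>0 Y\<^sub>0 \<delta> N N\<^sub>T Z" and T: "T > 0" and \<theta>: "(\<theta> \<longlongrightarrow> 0) at_top"
  shows "(\<lambda>n. F_norm (Z n - Y\<^sub>0) + sqrt (\<delta> n) + \<theta> (real (N n) * \<delta> n) + T / real (N\<^sub>T n)) \<longlonglongrightarrow> 0"
    "(\<lambda>n. T / real (N\<^sub>T n)) \<longlonglongrightarrow> 0"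
proof -
  have b: "0 < \<delta> n" "\<delta> n \<le> 1 / real n" "real n \<le> real (N n) * \<delta> n" "0 \<le> T / real (N\<^sub>T n)" "T / real (N\<^sub>T n) \<le> 1 / real n" if n: "1 \<le> n" for n
  proof -
    have 1: "0 < \<delta> n" "1 \<le> N n" "1 \<le> N\<^sub>T n" and eq: "1 / real n = \<delta> n + 1 / (real (N n) * \<delta> n) + T / real (N\<^sub>T n)"
      using d n by (auto simp: discretisation_def)
    have R: "0 < real (N n) * \<delta> n" using 1 by simp
    have p: "0 < 1 / (real (N n) * \<delta> n)" "0 \<le> T / real (N\<^sub>T n)" using R T by simp_all
    show "0 < \<delta> n" "\<delta> n \<le> 1 / real n" "0 \<le> T / real (N\<^sub>T n)" "T / real (N\<^sub>T n) \<le> 1 / real n" using 1 p eq by linarith+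
    have "1 / (real (N n) * \<delta> n) \<le> 1 / real n" using 1 p eq by linarith
    then show "real n \<le> real (N n) * \<delta> n" using R n by (simp add: field_simps)
  qed
  have inv: "(\<lambda>n. 1 / real n) \<longlonglongrightarrow> 0" by (rule lim_1_over_n)
  have ev: "\<forall>\<^sub>F n in sequentially. 1 \<le> n" by (rule eventually_ge_at_top)
  have \<delta>0: "\<delta> \<longlonglongrightarrow> 0"
    by (rule tendsto_sandwich[OF _ _ tendsto_const inv]; rule eventually_mono[OF ev]) (use b in \<open>auto intro: less_imp_le\<close>)
  show \<tau>0: "(\<lambda>n. T / real (N\<^sub>T n)) \<longlonglongrightarrow> 0"
    by (rule tendsto_sandwich[OF _ _ tendsto_const inv]; rule eventually_mono[OF ev]) (use b in auto)
  have "filterlim (\<lambda>n. real (N n) * \<delta> n) at_top sequentially"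
    by (rule filterlim_at_top_mono[OF filterlim_real_sequentially eventually_mono[OF ev]]) (use b in auto)
  then have \<theta>0: "(\<lambda>n. \<theta> (real (N n) * \<delta> n)) \<longlonglongrightarrow> 0" by (rule filterlim_compose[OF \<theta>])
  have F0: "(\<lambda>n. F_norm (Z n - Y\<^sub>0)) \<longlonglongrightarrow> 0" using d by (simp add: discretisation_def)
  have s0: "(\<lambda>n. sqrt (\<delta> n)) \<longlonglongrightarrow> sqrt 0" by (intro tendsto_real_sqrt \<delta>0)
  show "(\<lambda>n. F_norm (Z n - Y\<^sub>0) + sqrt (\<delta> n) + \<theta> (real (N n) * \<delta> n) + T / real (N\<^sub>T n)) \<longlonglongrightarrow> 0"
    using tendsto_add[OF tendsto_add[OF tendsto_add[OF F0 s0] \<theta>0] \<tau>0] by simp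
qed

lemma exp_growth_mono:
  fixes a e r s t :: real
  assumes "0 \<le> a" "0 \<le> e" "0 \<le> r" "0 \<le> s" "s \<le> t"
  shows "exp (a * s) * (e + s * r) \<le> exp (a * t) * (e + t * r)"
  using assms by (intro mult_mono add_mono mult_right_mono) (auto intro: mult_left_mono)

lemma sum_mult_le:
  fixes a b s t :: real
  assumes "0 \<le> a" "0 \<le> b" "0 \<le> s" "0 \<le> t"
  shows "a * s + b * t \<le> (a + b) * (s + t)"
  using assms by (simp add: algebra_simps)

text \<open>Common form of the two cases. The weight enters through its comparison constant and its
  tail rate \<theta>, which becomes the third term of the error.\<close>

theorem weighted_convergence:
  fixes \<gamma> T C\<^sub>0 C :: real and \<omega> \<theta> :: "real \<Rightarrow> real"
  assumes T: "T > 0" and w: "weight (\<lambda>x. (\<omega> x)\<^sup>2) C" and \<omega>: "\<omega> \<in> borel_measurable borel"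
    and tail: "tail_rate (\<lambda>x. (\<omega> x)\<^sup>2) \<theta>" and \<theta>: "\<And>R. 0 \<le> \<theta> R" "(\<theta> \<longlongrightarrow> 0) at_top"
  shows "\<exists>K :: real \<Rightarrow> real. \<forall>u\<^sub>0 Y\<^sub>0 Y u \<delta> N N\<^sub>T Y\<^sub>0\<^sub>n.
        u\<^sub>0 \<in> H1w \<omega> \<longrightarrow> lagrangian_of u\<^sub>0 Y\<^sub>0 \<longrightarrow> is_flow \<gamma> Y\<^sub>0 Y \<longrightarrow>
        conservative_solution Y u \<longrightarrow>
        discretisation \<omega> T C\<^sub>0 Y\<^sub>0 \<delta> N N\<^sub>T Y\<^sub>0\<^sub>n \<longrightarrow>
        (\<forall>t\<ge>0. {(x, u t x) |x. True} = {(l_y (Y t) \<xi>, l_U (Y t) \<xi>) |\<xi>. True}) \<and>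
        (\<forall>\<^sub>F n in sequentially.
           graph_error \<gamma> (\<delta> n) (N n) (N\<^sub>T n) (T / real (N\<^sub>T n)) (Y\<^sub>0\<^sub>n n) Y
             \<le> K (H1w_norm \<omega> u\<^sub>0) *
               (F_norm (Y\<^sub>0 - Y\<^sub>0\<^sub>n n) + sqrt (\<delta> n) + \<theta> (real (N n) * \<delta> n)
                + T / real (N\<^sub>T n)))"
proof -
  \<comment> \<open>Fixing only the value \<nu> of the norm and quantifying over all data with this
    norm expresses that the constant depends on nothing else of u_0; \<open>choice\<close> then
    assembles the constants into a function of the norm.\<close>
  define bounds where "bounds \<nu> K \<longleftrightarrow> (\<forall>u\<^sub>0 Y\<^sub>0 Y \<delta> N N\<^sub>T Z. H1w_norm \<omega> u\<^sub>0 = \<nu> \<longrightarrow>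
          u\<^sub>0 \<in> H1w \<omega> \<longrightarrow> lagrangian_of u\<^sub>0 Y\<^sub>0 \<longrightarrow> is_flow \<gamma> Y\<^sub>0 Y \<longrightarrow>
          discretisation \<omega> T C\<^sub>0 Y\<^sub>0 \<delta> N N\<^sub>T Z \<longrightarrow>
          (\<forall>\<^sub>F n in sequentially.
             graph_error \<gamma> (\<delta> n) (N n) (N\<^sub>T n) (T / real (N\<^sub>T n)) (Z n) Y
               \<le> K * (F_norm (Y\<^sub>0 - Z n) + sqrt (\<delta> n) + \<theta> (real (N n) * \<delta> n) + T / real (N\<^sub>T n))))" for \<nu> K
  have ex: "\<exists>K. bounds \<nu> K" for \<nu>
  proof -
    define E where "E = \<nu>\<^sup>2"
    \<comment> \<open>This is the bound of \<open>F_bound\<close> for the initial state, with E =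
      \<nu>^2 as the energy bound.\<close>
    define F where "F = 7 * (E + U_bd E + sqrt ((1 + (U_bd E)\<^sup>2) * E))"
    obtain M where M: "0 \<le> M" "\<And>Y\<^sub>0 Y t. is_flow \<gamma> Y\<^sub>0 Y \<Longrightarrow> energy_le (Y 0) E \<Longrightarrow> F_norm (Y 0) \<le> F \<Longrightarrow> t \<in> {0..T} \<Longrightarrow> F_norm (Y t) \<le> M"
      using flow_F_bound[of T \<gamma> E F] T by auto
    define \<alpha> where "\<alpha> = 2 + 3 * U_bd E + 2 * (source_bd \<gamma> * exp (2 * M))\<^sup>2 * (C * E) * (2 * exp_mass + M\<^sup>2)"
    \<comment> \<open>The initial weighted energy as bounded by \<open>weight_h\<close>, times its
      growth over [0, T] from \<open>weight_bound\<close>.\<close>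
    define W where "W = C * exp 1 * (C * exp (E + 1)) * E * exp (\<alpha> * T)"
    obtain c where c: "0 \<le> c" "\<And>h R. integrable lborel h \<Longrightarrow> (AE x in lborel. 0 \<le> h x) \<Longrightarrow>
       (LINT x|lborel. h x) \<le> E \<Longrightarrow> integrable lborel (\<lambda>x. (\<omega> x)\<^sup>2 * h x) \<Longrightarrow> (LINT x|lborel. (\<omega> x)\<^sup>2 * h x) \<le> W \<Longrightarrow> 0 < R \<Longrightarrow>
       L2_Linf_le (\<lambda>x. indicator (- {- R..<R}) x * conv exp_kernel h x) (c * \<theta> R)"
      using tail[unfolded tail_rate_def, rule_format, of E W] by blast
    define L where "L = sampled_field_const \<gamma> (M + 3)"
    define a where "a = rate_const \<gamma> (M + 1) * (1 + nonloc_const \<gamma> (M + 1))"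
    define k where "k = rate_const \<gamma> (M + 1) * sample_const \<gamma> (M + 1) c + (3 * L\<^sup>2 + (sampled_field_const \<gamma> M)\<^sup>2)"
    define K where "K = exp (a * T) * (1 + T * k)"
    have rc: "0 \<le> rate_const \<gamma> (M + 1)"
      using M(1) PQ_const_nonneg[of "M + 1" \<gamma>] by (simp add: rate_const_def lag_field_const_nonneg)
    have a0: "0 \<le> a" using rc nonloc_const_nonneg[of "M + 1" \<gamma>] M(1) by (simp add: a_def)
    have rs: "0 \<le> rate_const \<gamma> (M + 1) * sample_const \<gamma> (M + 1) c" using rc sample_const_nonneg[of "M + 1" c \<gamma>] M(1) c(1) by simp
    have k0: "0 \<le> k" using rs by (simp add: k_def)
    show ?thesis
      unfolding bounds_def
    proof (intro exI[of _ "2 * K"] allI impI)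
      fix u\<^sub>0 Y\<^sub>0 Y \<delta> N N\<^sub>T Z
      assume \<nu>: "H1w_norm \<omega> u\<^sub>0 = \<nu>" and u0: "u\<^sub>0 \<in> H1w \<omega>" and lag: "lagrangian_of u\<^sub>0 Y\<^sub>0" and fl: "is_flow \<gamma> Y\<^sub>0 Y"
        and disc: "discretisation \<omega> T C\<^sub>0 Y\<^sub>0 \<delta> N N\<^sub>T Z"
      interpret flow \<gamma> Y\<^sub>0 Y by standard (rule fl)
      interpret I: initial \<omega> C u\<^sub>0 "Y 0"
        by standard (use w \<omega> u0 lag GG[of 0] Y0 in auto)
      have I\<nu>: "I.\<nu> = \<nu>" by (simp add: I.\<nu>_def \<nu>)
      have E: "energy_le (Y 0) E" using I.energy by (simp add: I\<nu> E_def)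
      have "F_norm (Y 0) \<le> F" using I.F_bound by (simp add: I\<nu> E_def F_def)
      then have YM: "F_norm (Y t) \<le> M" if "t \<in> {0..T}" for t using M(2)[OF fl E _ that] by blast
      have W0: "integrable lborel (\<lambda>x. (\<omega> x)\<^sup>2 * l_h (Y 0) x)" "(LINT x|lborel. (\<omega> x)\<^sup>2 * l_h (Y 0) x) \<le> C * exp 1 * (C * exp (E + 1)) * E"
        using I.weight_h by (simp_all add: I\<nu> E_def)
      have tl: "L2_Linf_le (\<lambda>x. indicator (- {- R..<R}) x * conv exp_kernel (l_h (Y s)) x) (c * \<theta> R)" if s: "s \<in> {0..T}" and R: "0 < R" for s R
      proof -
        have s0: "0 \<le> s" using s by simp
        interpret Ys: GG_elem "Y s" by (rule elem[OF s0])
        have wb: "integrable lborel (\<lambda>x. (\<omega> x)\<^sup>2 * l_h (Y s) x)" "(LINT x|lborel. (\<omega> x)\<^sup>2 * l_h (Y s) x) \<le> W"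
          unfolding W_def \<alpha>_def by (rule weight_bound(1)[OF E YM w W0 s], assumption, rule weight_bound(2)[OF E YM w W0 s])
        note hi = Ys.h_integrable[OF energy_le[OF E s0]]
        show ?thesis by (rule c(2)[OF hi(1) Ys.AE_h hi(2) wb R])
      qed
      let ?\<tau> = "\<lambda>n. T / real (N\<^sub>T n)" and ?R = "\<lambda>n. real (N n) * \<delta> n"
      let ?q = "\<lambda>n. F_norm (Z n - Y\<^sub>0) + sqrt (\<delta> n) + \<theta> (?R n) + ?\<tau> n"
      note lim = discretisation_limits[OF disc T \<theta>(2)]
      have "(\<lambda>n. K * ?q n) \<longlonglongrightarrow> K * 0" by (intro tendsto_mult tendsto_const lim(1))
      \<comment> \<open>Convergence of the total error provides the smallness assumption of
        \<open>scheme_error\<close>; \<open>ev2\<close> provides the step size restriction of the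
        midpoint rule.\<close>
      then have ev1: "\<forall>\<^sub>F n in sequentially. K * ?q n < 1" by (rule order_tendstoD(2)) simp
      have "(\<lambda>n. ?\<tau> n * L) \<longlonglongrightarrow> 0 * L" by (intro tendsto_mult tendsto_const lim(2))
      then have ev2: "\<forall>\<^sub>F n in sequentially. ?\<tau> n * L < 1" by (rule order_tendstoD(2)) simp
      show "\<forall>\<^sub>F n in sequentially. graph_error \<gamma> (\<delta> n) (N n) (N\<^sub>T n) (T / real (N\<^sub>T n)) (Z n) Y
             \<le> 2 * K * (F_norm (Y\<^sub>0 - Z n) + sqrt (\<delta> n) + \<theta> (real (N n) * \<delta> n) + T / real (N\<^sub>T n))"
        using ev1 ev2 eventually_ge_at_top[of 1]
      proof eventually_elim
        case (elim n)
        have d: "0 < \<delta> n" "1 \<le> N n" "1 \<le> N\<^sub>T n" "Z n \<in> F_grid (\<delta> n) (N n)"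
          and eq: "1 / real n = \<delta> n + 1 / (real (N n) * \<delta> n) + T / real (N\<^sub>T n)"
          using disc elim(3) by (auto simp: discretisation_def)
        have \<tau>0: "0 \<le> ?\<tau> n" using T by simp
        have R0: "0 < ?R n" using d by simp
        have "0 < 1 / ?R n" using R0 by simp
        moreover have "1 / real n \<le> 1" using elim(3) by simp
        ultimately have \<delta>1: "\<delta> n \<le> 1" using eq \<tau>0 by linarith
        let ?r = "rate_const \<gamma> (M + 1) * sample_const \<gamma> (M + 1) c * (sqrt (\<delta> n) + \<theta> (?R n)) + (3 * L\<^sup>2 + (sampled_field_const \<gamma> M)\<^sup>2) * ?\<tau> n"
        have e0: "F_norm (Z n - Y 0) = F_norm (Z n - Y\<^sub>0)" by (simp add: Y0)
        have st: "0 \<le> sqrt (\<delta> n) + \<theta> (?R n)" using d \<theta>(1)[of "?R n"] by simp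
        have L0: "0 \<le> 3 * L\<^sup>2 + (sampled_field_const \<gamma> M)\<^sup>2" by simp
        have r0: "0 \<le> ?r"
          by (rule add_nonneg_nonneg[OF mult_nonneg_nonneg[OF rs st] mult_nonneg_nonneg[OF L0 \<tau>0]])
        have rk: "?r \<le> k * (sqrt (\<delta> n) + \<theta> (?R n) + ?\<tau> n)"
          unfolding k_def by (rule sum_mult_le[OF rs L0 st \<tau>0])
        have bound: "exp (a * T) * (F_norm (Z n - Y 0) + T * ?r) \<le> K * ?q n"
        proof -
          have "F_norm (Z n - Y 0) + T * ?r \<le> F_norm (Z n - Y\<^sub>0) + T * (k * (sqrt (\<delta> n) + \<theta> (?R n) + ?\<tau> n))"
            unfolding e0 using T by (intro add_left_mono mult_left_mono rk) auto
          also have "\<dots> \<le> (1 + T * k) * ?q n"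
            using sum_mult_le[of 1 "T * k" "F_norm (Z n - Y\<^sub>0)" "sqrt (\<delta> n) + \<theta> (?R n) + ?\<tau> n"] T k0 st \<tau>0
            by (simp only: mult_1 add.assoc mult.assoc) simp
          finally show ?thesis unfolding K_def mult.assoc by (intro mult_left_mono) auto
        qed
        have NT: "real (N\<^sub>T n) * ?\<tau> n = T" using d by simp
        have err: "(lie_trotter \<gamma> (\<delta> n) (N n) (?\<tau> n) ^^ j) (Z n) \<in> F_grid (\<delta> n) (N n) \<and>
          F_norm ((lie_trotter \<gamma> (\<delta> n) (N n) (?\<tau> n) ^^ j) (Z n) - Y (real j * ?\<tau> n)) \<le> K * ?q n" if j: "j \<le> N\<^sub>T n" for j
        proof -
          have jT: "real j * ?\<tau> n \<le> T" using j \<tau>0 NT mult_right_mono[of "real j" "real (N\<^sub>T n)" "?\<tau> n"] by simp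
          have s1: "exp (a * T) * (F_norm (Z n - Y 0) + T * ?r) \<le> 1" using bound elim(1) by linarith
          have s: "(lie_trotter \<gamma> (\<delta> n) (N n) (?\<tau> n) ^^ j) (Z n) \<in> F_grid (\<delta> n) (N n) \<and>
            F_norm ((lie_trotter \<gamma> (\<delta> n) (N n) (?\<tau> n) ^^ j) (Z n) - Y (real j * ?\<tau> n)) \<le> exp (a * (real j * ?\<tau> n)) * (F_norm (Z n - Y 0) + real j * ?\<tau> n * ?r)"
            unfolding a_def L_def
          proof (rule scheme_error[OF E _ c(1) \<theta>(1) _ d(1) \<delta>1 refl \<tau>0 NT d(4) _ _ j])
            show "\<And>s. s \<in> {0..T} \<Longrightarrow> F_norm (Y s) \<le> M" by (rule YM)
            show "\<And>s. s \<in> {0..T} \<Longrightarrow> L2_Linf_le (\<lambda>x. indicator (- {- ?R n..<?R n}) x * conv exp_kernel (l_h (Y s)) x) (c * \<theta> (?R n))"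
              by (rule tl[OF _ R0])
            show "?\<tau> n * sampled_field_const \<gamma> (M + 3) \<le> 1" using elim(2) by (simp add: L_def)
          qed (use s1 in \<open>simp only: a_def L_def\<close>)
          have "exp (a * (real j * ?\<tau> n)) * (F_norm (Z n - Y 0) + real j * ?\<tau> n * ?r) \<le> exp (a * T) * (F_norm (Z n - Y 0) + T * ?r)"
            by (rule exp_growth_mono[OF a0 F_norm_nonneg r0 mult_nonneg_nonneg[OF of_nat_0_le_iff \<tau>0] jT])
          with s s1 bound show ?thesis by (meson order_trans)
        qed
        have "graph_error \<gamma> (\<delta> n) (N n) (N\<^sub>T n) (?\<tau> n) (Z n) Y \<le> 2 * (K * ?q n)"
          by (rule graph_error_le[OF d(1,2) FF_rc \<tau>0 err])
        then show ?case by (simp add: F_norm_commute[of Y\<^sub>0] mult.assoc)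
      qed
    qed
  qed
  obtain K where K: "\<forall>\<nu>. bounds \<nu> (K \<nu>)" using choice[of bounds] ex by blast
  show ?thesis
  proof (intro exI[of _ K] allI impI conjI)
    fix u\<^sub>0 Y\<^sub>0 Y and u :: "real \<Rightarrow> real \<Rightarrow> real" and \<delta> N N\<^sub>T Z and t :: real
    assume fl: "is_flow \<gamma> Y\<^sub>0 Y" and cs: "conservative_solution Y u" and t: "0 \<le> t"
    show "{(x, u t x) |x. True} = {(l_y (Y t) \<xi>, l_U (Y t) \<xi>) |\<xi>. True}"
      by (rule graph_eq[OF _ cs t]) (use fl in \<open>auto simp: is_flow_def\<close>)
  qed (rule K[unfolded bounds_def, rule_format, OF refl])
qed

theorem theorem8p3:
  fixes \<gamma> T C\<^sub>0 :: real
  assumes "T > 0"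
  shows
    "(\<exists>C :: real \<Rightarrow> real. \<forall>u\<^sub>0 Y\<^sub>0 Y u \<delta> N N\<^sub>T Y\<^sub>0\<^sub>n.
        u\<^sub>0 \<in> H1w exp_weight \<longrightarrow> lagrangian_of u\<^sub>0 Y\<^sub>0 \<longrightarrow> is_flow \<gamma> Y\<^sub>0 Y \<longrightarrow>
        conservative_solution Y u \<longrightarrow>
        discretisation exp_weight T C\<^sub>0 Y\<^sub>0 \<delta> N N\<^sub>T Y\<^sub>0\<^sub>n \<longrightarrow>
        (\<forall>t\<ge>0. {(x, u t x) |x. True} = {(l_y (Y t) \<xi>, l_U (Y t) \<xi>) |\<xi>. True}) \<and>
        (\<forall>\<^sub>F n in sequentially.
           graph_error \<gamma> (\<delta> n) (N n) (N\<^sub>T n) (T / real (N\<^sub>T n)) (Y\<^sub>0\<^sub>n n) Y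
             \<le> C (H1w_norm exp_weight u\<^sub>0) *
               (F_norm (Y\<^sub>0 - Y\<^sub>0\<^sub>n n) + sqrt (\<delta> n) + exp (- (real (N n) * \<delta> n))
                + T / real (N\<^sub>T n))))
     \<and>
     (\<forall>\<alpha>>1. \<exists>C :: real \<Rightarrow> real. \<forall>u\<^sub>0 Y\<^sub>0 Y u \<delta> N N\<^sub>T Y\<^sub>0\<^sub>n.
        u\<^sub>0 \<in> H1w (pow_weight \<alpha>) \<longrightarrow> lagrangian_of u\<^sub>0 Y\<^sub>0 \<longrightarrow> is_flow \<gamma> Y\<^sub>0 Y \<longrightarrow>
        conservative_solution Y u \<longrightarrow>
        discretisation (pow_weight \<alpha>) T C\<^sub>0 Y\<^sub>0 \<delta> N N\<^sub>T Y\<^sub>0\<^sub>n \<longrightarrow>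
        (\<forall>t\<ge>0. {(x, u t x) |x. True} = {(l_y (Y t) \<xi>, l_U (Y t) \<xi>) |\<xi>. True}) \<and>
        (\<forall>\<^sub>F n in sequentially.
           graph_error \<gamma> (\<delta> n) (N n) (N\<^sub>T n) (T / real (N\<^sub>T n)) (Y\<^sub>0\<^sub>n n) Y
             \<le> C (H1w_norm (pow_weight \<alpha>) u\<^sub>0) *
               (F_norm (Y\<^sub>0 - Y\<^sub>0\<^sub>n n) + sqrt (\<delta> n) + 1 / (real (N n) * \<delta> n) powr (\<alpha> / 2)
                + T / real (N\<^sub>T n))))"
proof (intro conjI allI impI)
  show "\<exists>C :: real \<Rightarrow> real. \<forall>u\<^sub>0 Y\<^sub>0 Y u \<delta> N N\<^sub>T Y\<^sub>0\<^sub>n.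
        u\<^sub>0 \<in> H1w exp_weight \<longrightarrow> lagrangian_of u\<^sub>0 Y\<^sub>0 \<longrightarrow> is_flow \<gamma> Y\<^sub>0 Y \<longrightarrow>
        conservative_solution Y u \<longrightarrow>
        discretisation exp_weight T C\<^sub>0 Y\<^sub>0 \<delta> N N\<^sub>T Y\<^sub>0\<^sub>n \<longrightarrow>
        (\<forall>t\<ge>0. {(x, u t x) |x. True} = {(l_y (Y t) \<xi>, l_U (Y t) \<xi>) |\<xi>. True}) \<and>
        (\<forall>\<^sub>F n in sequentially.
           graph_error \<gamma> (\<delta> n) (N n) (N\<^sub>T n) (T / real (N\<^sub>T n)) (Y\<^sub>0\<^sub>n n) Y
             \<le> C (H1w_norm exp_weight u\<^sub>0) *
               (F_norm (Y\<^sub>0 - Y\<^sub>0\<^sub>n n) + sqrt (\<delta> n) + exp (- (real (N n) * \<delta> n))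
                + T / real (N\<^sub>T n)))"
  proof (rule weighted_convergence[OF assms weight_exp _ tail_rate_exp])
    show "exp_weight \<in> borel_measurable borel" unfolding exp_weight_def[abs_def] by measurable
    show "((\<lambda>R. exp (- R)) \<longlongrightarrow> (0 :: real)) at_top"
      by (rule filterlim_compose[OF exp_at_bot filterlim_uminus_at_bot_at_top])
  qed simp
next
  fix \<alpha> :: real assume \<alpha>: "1 < \<alpha>"
  obtain C where C: "weight (\<lambda>x. (pow_weight \<alpha> x)\<^sup>2) C" using weight_pow[OF \<alpha>] by blast
  show "\<exists>C :: real \<Rightarrow> real. \<forall>u\<^sub>0 Y\<^sub>0 Y u \<delta> N N\<^sub>T Y\<^sub>0\<^sub>n.
        u\<^sub>0 \<in> H1w (pow_weight \<alpha>) \<longrightarrow> lagrangian_of u\<^sub>0 Y\<^sub>0 \<longrightarrow> is_flow \<gamma> Y\<^sub>0 Y \<longrightarrow>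
        conservative_solution Y u \<longrightarrow>
        discretisation (pow_weight \<alpha>) T C\<^sub>0 Y\<^sub>0 \<delta> N N\<^sub>T Y\<^sub>0\<^sub>n \<longrightarrow>
        (\<forall>t\<ge>0. {(x, u t x) |x. True} = {(l_y (Y t) \<xi>, l_U (Y t) \<xi>) |\<xi>. True}) \<and>
        (\<forall>\<^sub>F n in sequentially.
           graph_error \<gamma> (\<delta> n) (N n) (N\<^sub>T n) (T / real (N\<^sub>T n)) (Y\<^sub>0\<^sub>n n) Y
             \<le> C (H1w_norm (pow_weight \<alpha>) u\<^sub>0) *
               (F_norm (Y\<^sub>0 - Y\<^sub>0\<^sub>n n) + sqrt (\<delta> n) + 1 / (real (N n) * \<delta> n) powr (\<alpha> / 2)
                + T / real (N\<^sub>T n)))"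
  proof (rule weighted_convergence[OF assms C _ tail_rate_pow[OF \<alpha>]])
    show "pow_weight \<alpha> \<in> borel_measurable borel" unfolding pow_weight_def[abs_def] by measurable
    have "((\<lambda>R. R powr (- (\<alpha> / 2))) \<longlongrightarrow> 0) at_top"
      using \<alpha> by (intro tendsto_neg_powr filterlim_ident) simp
    then show "((\<lambda>R. 1 / R powr (\<alpha> / 2)) \<longlongrightarrow> 0) at_top" by (simp add: powr_minus_divide)
  qed simp
qed

end
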